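(* Let $K$ be a finite field extension of $\mathbb{Q}$, let $E/K$ be a (finite) Galois extension of fields with group $G$, and let $(H,\cdot)$ be a Hopf-Galois structure on $E/K$ corresponding to a regular subgroup $N\le\mathrm{Perm}(G)$ normalized by $\lambda(G)$. Let $F=\mathrm{Aut}(N)$, let $$W=\{g\in\lambda(G):\ {}^g\eta=\eta\ \text{for all } \eta\in N\},$$ and let $L=E^W$. If $\lambda(G)/W\cong F$, then $\Theta(L)=H$, i.e. $(L[N])^F\cong H$ as $K$-Hopf algebras. Moreover, $L$ is the smallest extension of $K$ for which $L\otimes_K H\cong L[N]$; that is, $L\otimes_K H\cong L[N]$ as $L$-Hopf algebras, and for every field extension $L'$ of $K$ such that $L'\otimes_K H\cong L'[N]$ as $L'$-Hopf algebras, there is a $K$-embedding of $L$ into $L'$.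
   Context: $\mathrm{Perm}(G)$ is the group of permutations of the set $G$; $\lambda:G\to\mathrm{Perm}(G)$, $\lambda(g)(h)=gh$, is the left regular representation. A subgroup $N\le\mathrm{Perm}(G)$ is regular if $|N|=|G|$ and $\eta(g)\neq g$ for all $\eta\in N$, $\eta\neq 1_N$, $g\in G$. It is normalized by $\lambda(G)$ if $\lambda(G)$ lies in the normalizer of $N$ in $\mathrm{Perm}(G)$. For $g\in\lambda(G)$ (or $g \in G$, identified with $\lambda(g)\in\lambda(G)$) and $\eta\in N$, ${}^g\eta$ denotes the conjugate of $\eta$ by $g$ (resp. by $\lambda(g)$) in $\mathrm{Perm}(G)$. A Hopf-Galois structure on $E/K$ is a finite dimensional cocommutative $K$-Hopf algebra $H$ with a $K$-linear action $\cdot$ of $H$ on $E$ such that $h\cdot(xy)=\sum_{(h)}(h_{(1)}\cdot x)(h_{(2)}\cdot y)$, $h\cdot 1=\varepsilon(h)1$, and the map $E\otimes_K H\to\mathrm{End}_K(E)$, $x\otimes h\mapsto (y\mapsto x(h\cdot y))$, is bijective. By Greither and Pareigis, isomorphism classes of Hopf-Galois structures on $E/K$ correspond bijectively to regular subgroups $N$ of $\mathrm{Perm}(G)$ normalized by $\lambda(G)$; the Hopf algebra corresponding to $N$ is the fixed ring $H=(E[N])^G$, where $g\in G$ acts on $E[N]$ by $g(x\eta)=g(x)\,{}^g\eta$, $x\in E$, $\eta\in N$, and $\big(\sum_{\eta\in N} r_\eta\eta\big)\cdot x=\sum_{\eta\in N}r_\eta\,\eta^{-1}(1_G)(x)$.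 The subgroup $W$ is normal in $\lambda(G)$, and via $\lambda(G)\cong G$ it is regarded as a subgroup of $G$; $E^W$ is its fixed field. Conjugation induces an injective homomorphism $\lambda(G)/W\to\mathrm{Aut}(N)=F$; when $\lambda(G)/W\cong F$ it is an isomorphism (the groups are finite) and is used to let $F$ act on $L=E^W$ as $\mathrm{Gal}(L/K)\cong\lambda(G)/W$. For a finite group $F$, an $F$-Galois extension of $K$ is a commutative $K$-algebra $L$ such that $F\le\mathrm{Aut}_K(L)$, $L$ is a finitely generated projective $K$-module, and $F\subseteq\mathrm{End}_K(L)$ is a free generating system over $K$ (the elements of $F$ form a basis of $\mathrm{End}_K(L)$ as a left $L$-module). For a finite group $N$ with $F=\mathrm{Aut}(N)$, $\Theta$ sends an $F$-Galois extension $L$ of $K$ to the $K$-Hopf algebra $\Theta(L)=(L[N])^F$ (fixed ring, with $F$ acting on $L$ by the Galois action and on $N$ as $\mathrm{Aut}(N)$, Hopf structure inherited from $L[N]$); it is a bijection, up to isomorphism, onto the Hopf forms of $K[N]$, i.e. the $K$-Hopf algebras $H$ with $S\otimes_KH\cong S[N]$ as $S$-Hopf algebras for some faithfully flat commutative $K$-algebra $S$. *)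

theory Defs
  imports "HOL-Algebra.Algebra" "HOL-Algebra.Algebraic_Closure_Type"
begin

section \<open>Linear maps and algebras\<close>

definition lin_maps ::
  "('r, 'm) ring_scheme \<Rightarrow> ('r, 'a, 'n) module_scheme \<Rightarrow> ('r, 'b, 'p) module_scheme \<Rightarrow> ('a \<Rightarrow> 'b) set"
  where "lin_maps R M N = {f \<in> carrier M \<rightarrow> carrier N.
    (\<forall>x\<in>carrier M. \<forall>y\<in>carrier M. f (x \<oplus>\<^bsub>M\<^esub> y) = f x \<oplus>\<^bsub>N\<^esub> f y) \<and>
    (\<forall>r\<in>carrier R. \<forall>x\<in>carrier M. f (r \<odot>\<^bsub>M\<^esub> x) = r \<odot>\<^bsub>N\<^esub> f x)}"

text \<open>
  The locale \<^locale>\<open>algebra\<close> of the library is restricted to commutative algebras.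
\<close>

locale assoc_algebra = module + ring M +
  assumes smult_mult_left:
    "\<lbrakk>a \<in> carrier R; x \<in> carrier M; y \<in> carrier M\<rbrakk>
      \<Longrightarrow> (a \<odot>\<^bsub>M\<^esub> x) \<otimes>\<^bsub>M\<^esub> y = a \<odot>\<^bsub>M\<^esub> (x \<otimes>\<^bsub>M\<^esub> y)"
  and smult_mult_right:
    "\<lbrakk>a \<in> carrier R; x \<in> carrier M; y \<in> carrier M\<rbrakk>
      \<Longrightarrow> x \<otimes>\<^bsub>M\<^esub> (a \<odot>\<^bsub>M\<^esub> y) = a \<odot>\<^bsub>M\<^esub> (x \<otimes>\<^bsub>M\<^esub> y)"

definition alg_hom ::
  "('r, 'm) ring_scheme \<Rightarrow> ('r, 'a, 'n) module_scheme \<Rightarrow> ('r, 'b, 'p) module_scheme \<Rightarrow> ('a \<Rightarrow> 'b) set"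
  where "alg_hom R A B = ring_hom A B \<inter> lin_maps R A B"

text \<open>A ring \<open>S\<close> as an algebra over the domain of a ring homomorphism \<open>\<phi>\<close> into \<open>S\<close>.\<close>

definition algebra_via :: "('r \<Rightarrow> 's) \<Rightarrow> ('s, 'm) ring_scheme \<Rightarrow> ('r, 's) module"
  where "algebra_via \<phi> S = \<lparr>carrier = carrier S, monoid.mult = monoid.mult S, one = one S,
    ring.zero = ring.zero S, ring.add = ring.add S, module.smult = (\<lambda>r x. \<phi> r \<otimes>\<^bsub>S\<^esub> x)\<rparr>"

definition restrict_scalars :: "('r \<Rightarrow> 's) \<Rightarrow> ('s, 'a, 'm) module_scheme \<Rightarrow> ('r, 'a) module"
  where "restrict_scalars \<phi> M = \<lparr>carrier = carrier M, monoid.mult = monoid.mult M, one = one M,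
    ring.zero = ring.zero M, ring.add = ring.add M, module.smult = (\<lambda>r x. \<phi> r \<odot>\<^bsub>M\<^esub> x)\<rparr>"

definition fin_gen :: "('r, 'm) ring_scheme \<Rightarrow> ('r, 'a, 'n) module_scheme \<Rightarrow> bool"
  where "fin_gen R M \<longleftrightarrow> (\<exists>B. finite B \<and> B \<subseteq> carrier M \<and>
    (\<forall>x\<in>carrier M. \<exists>c\<in>B \<rightarrow> carrier R. x = (\<Oplus>\<^bsub>M\<^esub>b\<in>B. c b \<odot>\<^bsub>M\<^esub> b)))"


section \<open>Tensor products\<close>

text \<open>
  \<open>M \<otimes>\<^sub>R N\<close> is the free module on \<open>carrier M \<times> carrier N\<close> modulo the submodule generated by the
  bilinearity relations; its elements are the cosets of that submodule.
\<close>

definition free_module :: "('r, 'm) ring_scheme \<Rightarrow> 'x set \<Rightarrow> ('r, 'x \<Rightarrow> 'r) module"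
  where "free_module R S = \<lparr>
    carrier = {c. (\<forall>p. c p \<in> carrier R) \<and> (\<forall>p. p \<notin> S \<longrightarrow> c p = \<zero>\<^bsub>R\<^esub>) \<and> finite {p. c p \<noteq> \<zero>\<^bsub>R\<^esub>}},
    monoid.mult = undefined, one = undefined,
    ring.zero = (\<lambda>p. \<zero>\<^bsub>R\<^esub>), ring.add = (\<lambda>c d p. c p \<oplus>\<^bsub>R\<^esub> d p), module.smult = (\<lambda>r c p. r \<otimes>\<^bsub>R\<^esub> c p)\<rparr>"

definition free_gen :: "('r, 'm) ring_scheme \<Rightarrow> 'x \<Rightarrow> 'x \<Rightarrow> 'r"
  where "free_gen R p = (\<lambda>q. if q = p then \<one>\<^bsub>R\<^esub> else \<zero>\<^bsub>R\<^esub>)"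

type_synonym ('r, 'a, 'b) tensor = "('a \<times> 'b \<Rightarrow> 'r) set"

context
  fixes R :: "('r, 'm) ring_scheme"
    and M :: "('r, 'a, 'n) module_scheme"
    and N :: "('r, 'b, 'p) module_scheme"
begin

definition tensor_free :: "('r, 'a \<times> 'b \<Rightarrow> 'r) module"
  where "tensor_free = free_module R (carrier M \<times> carrier N)"

definition tensor_rels :: "('a \<times> 'b \<Rightarrow> 'r) set"
  where "tensor_rels =
    {free_gen R (a \<oplus>\<^bsub>M\<^esub> a', b) \<ominus>\<^bsub>tensor_free\<^esub> (free_gen R (a, b) \<oplus>\<^bsub>tensor_free\<^esub> free_gen R (a', b))
      | a a' b. a \<in> carrier M \<and> a' \<in> carrier M \<and> b \<in> carrier N} \<union>
    {free_gen R (a, b \<oplus>\<^bsub>N\<^esub> b') \<ominus>\<^bsub>tensor_free\<^esub> (free_gen R (a, b) \<oplus>\<^bsub>tensor_free\<^esub> free_gen R (a, b'))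
      | a b b'. a \<in> carrier M \<and> b \<in> carrier N \<and> b' \<in> carrier N} \<union>
    {free_gen R (r \<odot>\<^bsub>M\<^esub> a, b) \<ominus>\<^bsub>tensor_free\<^esub> r \<odot>\<^bsub>tensor_free\<^esub> free_gen R (a, b)
      | r a b. r \<in> carrier R \<and> a \<in> carrier M \<and> b \<in> carrier N} \<union>
    {free_gen R (a, r \<odot>\<^bsub>N\<^esub> b) \<ominus>\<^bsub>tensor_free\<^esub> r \<odot>\<^bsub>tensor_free\<^esub> free_gen R (a, b)
      | r a b. r \<in> carrier R \<and> a \<in> carrier M \<and> b \<in> carrier N}"

definition tensor_null :: "('r, 'a, 'b) tensor"
  where "tensor_null = \<Inter>{S. submodule S R tensor_free \<and> tensor_rels \<subseteq> S}"

definition tensor_module :: "('r, ('r, 'a, 'b) tensor) module"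
  where "tensor_module = \<lparr>
    carrier = a_rcosets\<^bsub>tensor_free\<^esub> tensor_null,
    monoid.mult = undefined, one = undefined,
    ring.zero = tensor_null, ring.add = (\<lambda>U V. U <+>\<^bsub>tensor_free\<^esub> V),
    module.smult = (\<lambda>r U. \<Union>c\<in>U. tensor_null +>\<^bsub>tensor_free\<^esub> (r \<odot>\<^bsub>tensor_free\<^esub> c))\<rparr>"

definition pure_tensor :: "'a \<Rightarrow> 'b \<Rightarrow> ('r, 'a, 'b) tensor"
  where "pure_tensor a b = tensor_null +>\<^bsub>tensor_free\<^esub> free_gen R (a, b)"

text \<open>
  For \<open>R\<close>-bilinear \<open>\<beta>\<close>, the linear map on \<open>M \<otimes>\<^sub>R N\<close> with \<open>a \<otimes> b \<mapsto> \<beta> a b\<close>. The result then does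
  not depend on the representative chosen; only such \<open>\<beta>\<close> are used below.
\<close>

definition tensor_lift ::
  "('r, 'c, 'q) module_scheme \<Rightarrow> ('a \<Rightarrow> 'b \<Rightarrow> 'c) \<Rightarrow> ('r, 'a, 'b) tensor \<Rightarrow> 'c"
  where "tensor_lift P \<beta> U = (let c = (SOME c. c \<in> U) in
    \<Oplus>\<^bsub>P\<^esub>p\<in>{p \<in> carrier M \<times> carrier N. c p \<noteq> \<zero>\<^bsub>R\<^esub>}. c p \<odot>\<^bsub>P\<^esub> \<beta> (fst p) (snd p))"

definition tensor_algebra :: "('r, ('r, 'a, 'b) tensor) module"
  where "tensor_algebra = tensor_module\<lparr>
    monoid.mult := (\<lambda>U V. tensor_lift tensor_module (\<lambda>a b. tensor_lift tensor_module
      (\<lambda>a' b'. pure_tensor (a \<otimes>\<^bsub>M\<^esub> a') (b \<otimes>\<^bsub>N\<^esub> b')) V) U),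
    one := pure_tensor \<one>\<^bsub>M\<^esub> \<one>\<^bsub>N\<^esub>\<rparr>"

end

definition tensor_map ::
  "('r, 'm) ring_scheme \<Rightarrow> ('r, 'a, 'n) module_scheme \<Rightarrow> ('r, 'b, 'p) module_scheme
    \<Rightarrow> ('r, 'c, 'q) module_scheme \<Rightarrow> ('r, 'd, 's) module_scheme
    \<Rightarrow> ('a \<Rightarrow> 'c) \<Rightarrow> ('b \<Rightarrow> 'd) \<Rightarrow> ('r, 'a, 'b) tensor \<Rightarrow> ('r, 'c, 'd) tensor"
  where "tensor_map R M N M' N' f g =
    tensor_lift R M N (tensor_module R M' N') (\<lambda>a b. pure_tensor R M' N' (f a) (g b))"

definition tensor_assoc ::
  "('r, 'm) ring_scheme \<Rightarrow> ('r, 'a, 'n) module_scheme \<Rightarrow> ('r, 'b, 'p) module_scheme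
    \<Rightarrow> ('r, 'c, 'q) module_scheme
    \<Rightarrow> ('r, ('r, 'a, 'b) tensor, 'c) tensor \<Rightarrow> ('r, 'a, ('r, 'b, 'c) tensor) tensor"
  where "tensor_assoc R M N P = (let T = tensor_module R M (tensor_module R N P) in
    tensor_lift R (tensor_module R M N) P T (\<lambda>U c. tensor_lift R M N T
      (\<lambda>a b. pure_tensor R M (tensor_module R N P) a (pure_tensor R N P b c)) U))"


section \<open>Hopf algebras\<close>

record ('r, 'h) hopf = "('r, 'h) module" +
  comul :: "'h \<Rightarrow> ('r, 'h, 'h) tensor"
  counit :: "'h \<Rightarrow> 'r"
  antipode :: "'h \<Rightarrow> 'h"

locale hopf_algebra = assoc_algebra R H
  for R :: "('r, 'm) ring_scheme" and H :: "('r, 'h, 'n) hopf_scheme" +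
  assumes comul_hom: "comul H \<in> alg_hom R H (tensor_algebra R H H)"
    and counit_hom: "counit H \<in> alg_hom R H (algebra_via (\<lambda>r. r) R)"
    and antipode_lin: "antipode H \<in> lin_maps R H H"
    and coassoc: "h \<in> carrier H \<Longrightarrow>
      tensor_assoc R H H H (tensor_map R H H (tensor_module R H H) H (comul H) (\<lambda>x. x) (comul H h))
      = tensor_map R H H H (tensor_module R H H) (\<lambda>x. x) (comul H) (comul H h)"
    and counit_left: "h \<in> carrier H \<Longrightarrow>
      tensor_lift R H H H (\<lambda>a b. counit H a \<odot>\<^bsub>H\<^esub> b) (comul H h) = h"
    and counit_right: "h \<in> carrier H \<Longrightarrow>
      tensor_lift R H H H (\<lambda>a b. counit H b \<odot>\<^bsub>H\<^esub> a) (comul H h) = h"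
    and antipode_left: "h \<in> carrier H \<Longrightarrow>
      tensor_lift R H H H (\<lambda>a b. antipode H a \<otimes>\<^bsub>H\<^esub> b) (comul H h) = counit H h \<odot>\<^bsub>H\<^esub> \<one>\<^bsub>H\<^esub>"
    and antipode_right: "h \<in> carrier H \<Longrightarrow>
      tensor_lift R H H H (\<lambda>a b. a \<otimes>\<^bsub>H\<^esub> antipode H b) (comul H h) = counit H h \<odot>\<^bsub>H\<^esub> \<one>\<^bsub>H\<^esub>"

definition cocommutative :: "('r, 'm) ring_scheme \<Rightarrow> ('r, 'h, 'n) hopf_scheme \<Rightarrow> bool"
  where "cocommutative R H \<longleftrightarrow> (\<forall>h\<in>carrier H.
    tensor_lift R H H (tensor_module R H H) (\<lambda>a b. pure_tensor R H H b a) (comul H h) = comul H h)"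

definition hopf_iso ::
  "('r, 'm) ring_scheme \<Rightarrow> ('r, 'a, 'n) hopf_scheme \<Rightarrow> ('r, 'b, 'p) hopf_scheme \<Rightarrow> ('a \<Rightarrow> 'b) set"
  where "hopf_iso R A B = {f \<in> alg_hom R A B. bij_betw f (carrier A) (carrier B) \<and>
    (\<forall>x\<in>carrier A. comul B (f x) = tensor_map R A A B B f f (comul A x)) \<and>
    (\<forall>x\<in>carrier A. counit B (f x) = counit A x) \<and>
    (\<forall>x\<in>carrier A. antipode B (f x) = f (antipode A x))}"

definition hopf_isomorphic ::
  "('r, 'm) ring_scheme \<Rightarrow> ('r, 'a, 'n) hopf_scheme \<Rightarrow> ('r, 'b, 'p) hopf_scheme \<Rightarrow> bool"
  where "hopf_isomorphic R A B \<longleftrightarrow> hopf_iso R A B \<noteq> {}"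

text \<open>
  The \<open>S\<close>-Hopf algebra \<open>S \<otimes>\<^sub>R H\<close>, where \<open>S\<close> is an \<open>R\<close>-algebra via \<open>\<phi>\<close>. The comultiplication is
  \<open>s \<otimes> h \<mapsto> \<Sum> s ((1 \<otimes> h\<^sub>1) \<otimes>\<^sub>S (1 \<otimes> h\<^sub>2))\<close>.
\<close>

definition base_change_module ::
  "('r, 'm) ring_scheme \<Rightarrow> ('s, 'n) ring_scheme \<Rightarrow> ('r \<Rightarrow> 's) \<Rightarrow> ('r, 'h, 'p) module_scheme
    \<Rightarrow> ('s, ('r, 's, 'h) tensor) module"
  where "base_change_module R S \<phi> H =
    (let A = algebra_via \<phi> S; T = tensor_algebra R A H in
      \<lparr>carrier = carrier T, monoid.mult = monoid.mult T, one = one T, ring.zero = ring.zero T, ring.add = ring.add T,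
       module.smult = (\<lambda>s. tensor_lift R A H T (\<lambda>s' h. pure_tensor R A H (s \<otimes>\<^bsub>S\<^esub> s') h))\<rparr>)"

definition base_change ::
  "('r, 'm) ring_scheme \<Rightarrow> ('s, 'n) ring_scheme \<Rightarrow> ('r \<Rightarrow> 's) \<Rightarrow> ('r, 'h, 'p) hopf_scheme
    \<Rightarrow> ('s, ('r, 's, 'h) tensor) hopf"
  where "base_change R S \<phi> H =
    (let A = algebra_via \<phi> S; V = base_change_module R S \<phi> H;
         VV = tensor_module S V V; VV\<^sub>R = restrict_scalars \<phi> VV;
         \<iota> = pure_tensor R A H \<one>\<^bsub>S\<^esub>
     in module.extend V
       \<lparr>comul = tensor_lift R A H VV\<^sub>R (\<lambda>s h. s \<odot>\<^bsub>VV\<^esub>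
          tensor_lift R H H VV\<^sub>R (\<lambda>a b. pure_tensor S V V (\<iota> a) (\<iota> b)) (comul H h)),
        counit = tensor_lift R A H A (\<lambda>s h. s \<otimes>\<^bsub>S\<^esub> \<phi> (counit H h)),
        antipode = tensor_map R A H A H (\<lambda>s. s) (antipode H)\<rparr>)"


section \<open>Group algebras and their fixed rings\<close>

text \<open>The group algebra \<open>R[N]\<close>; \<open>N\<close> is assumed to be finite.\<close>

definition group_algebra :: "('r, 'm) ring_scheme \<Rightarrow> ('n, 'k) monoid_scheme \<Rightarrow> ('r, 'n \<Rightarrow> 'r) module"
  where "group_algebra R N = \<lparr>
    carrier = carrier N \<rightarrow>\<^sub>E carrier R,
    monoid.mult = (\<lambda>f g. \<lambda>n\<in>carrier N. \<Oplus>\<^bsub>R\<^esub>m\<in>carrier N. f m \<otimes>\<^bsub>R\<^esub> g (inv\<^bsub>N\<^esub> m \<otimes>\<^bsub>N\<^esub> n)),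
    one = (\<lambda>n\<in>carrier N. if n = \<one>\<^bsub>N\<^esub> then \<one>\<^bsub>R\<^esub> else \<zero>\<^bsub>R\<^esub>),
    ring.zero = (\<lambda>n\<in>carrier N. \<zero>\<^bsub>R\<^esub>),
    ring.add = (\<lambda>f g. \<lambda>n\<in>carrier N. f n \<oplus>\<^bsub>R\<^esub> g n),
    module.smult = (\<lambda>r f. \<lambda>n\<in>carrier N. r \<otimes>\<^bsub>R\<^esub> f n)\<rparr>"

definition group_elt :: "('r, 'm) ring_scheme \<Rightarrow> ('n, 'k) monoid_scheme \<Rightarrow> 'n \<Rightarrow> 'n \<Rightarrow> 'r"
  where "group_elt R N n = (\<lambda>m\<in>carrier N. if m = n then \<one>\<^bsub>R\<^esub> else \<zero>\<^bsub>R\<^esub>)"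

definition group_hopf :: "('r, 'm) ring_scheme \<Rightarrow> ('n, 'k) monoid_scheme \<Rightarrow> ('r, 'n \<Rightarrow> 'r) hopf"
  where "group_hopf R N =
    (let A = group_algebra R N; T = tensor_module R A A in module.extend A
      \<lparr>comul = (\<lambda>f. \<Oplus>\<^bsub>T\<^esub>n\<in>carrier N.
         f n \<odot>\<^bsub>T\<^esub> pure_tensor R A A (group_elt R N n) (group_elt R N n)),
       counit = (\<lambda>f. \<Oplus>\<^bsub>R\<^esub>n\<in>carrier N. f n),
       antipode = (\<lambda>f. \<lambda>n\<in>carrier N. f (inv\<^bsub>N\<^esub> n))\<rparr>)"

text \<open>\<open>\<Sum> r\<^sub>\<eta> \<eta> \<mapsto> \<Sum> \<rho>(r\<^sub>\<eta>) \<alpha>(\<eta>)\<close>\<close>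

definition semilinear_map ::
  "('r, 'm) ring_scheme \<Rightarrow> ('n, 'k) monoid_scheme \<Rightarrow> ('r \<Rightarrow> 'r) \<Rightarrow> ('n \<Rightarrow> 'n) \<Rightarrow> ('n \<Rightarrow> 'r) \<Rightarrow> ('n \<Rightarrow> 'r)"
  where "semilinear_map R N \<rho> \<alpha> f = (let A = group_algebra R N in
    \<Oplus>\<^bsub>A\<^esub>\<eta>\<in>carrier N. \<rho> (f \<eta>) \<odot>\<^bsub>A\<^esub> group_elt R N (\<alpha> \<eta>))"

text \<open>
  The \<open>K\<close>-Hopf algebra \<open>B = (L[N])\<^sup>\<Gamma>\<close>, where \<open>\<Gamma>\<close> acts on the field \<open>L\<close> through \<open>\<rho>\<close>, with fixed
  field \<open>K\<close>, and on the group \<open>N\<close> through \<open>\<alpha>\<close>. The comultiplication inherited from \<open>L[N]\<close> is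
  determined by commutation with the canonical map \<open>B \<otimes>\<^sub>K B \<rightarrow> L[N] \<otimes>\<^sub>L L[N]\<close>, which is injective by
  Galois descent.
\<close>

definition fixed_hopf ::
  "'r set \<Rightarrow> ('r, 'm) ring_scheme \<Rightarrow> ('n, 'k) monoid_scheme \<Rightarrow> 'g set
    \<Rightarrow> ('g \<Rightarrow> 'r \<Rightarrow> 'r) \<Rightarrow> ('g \<Rightarrow> 'n \<Rightarrow> 'n) \<Rightarrow> ('r, 'n \<Rightarrow> 'r) hopf"
  where "fixed_hopf K L N \<Gamma> \<rho> \<alpha> =
    (let A = group_hopf L N; K' = L\<lparr>carrier := K\<rparr>;
         B = A\<lparr>carrier := {f \<in> carrier A. \<forall>g\<in>\<Gamma>. semilinear_map L N (\<rho> g) (\<alpha> g) f = f}\<rparr>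
     in B\<lparr>comul := (\<lambda>f. THE U. U \<in> carrier (tensor_module K' B B) \<and>
       tensor_lift K' B B (tensor_module L A A) (pure_tensor L A A) U = comul A f)\<rparr>)"

text \<open>
  \<open>\<Theta>(L) = (L[N])\<^sup>F\<close> for an \<open>F\<close>-Galois extension \<open>L\<close> of \<open>K\<close>, \<open>F = Aut(N)\<close>; the embedding of \<open>F\<close>
  into \<open>Aut\<^sub>K(L)\<close> is the argument \<open>\<rho>\<close>.
\<close>

definition Theta ::
  "'r set \<Rightarrow> ('r, 'm) ring_scheme \<Rightarrow> ('n, 'k) monoid_scheme \<Rightarrow> (('n \<Rightarrow> 'n) \<Rightarrow> 'r \<Rightarrow> 'r)
    \<Rightarrow> ('r, 'n \<Rightarrow> 'r) hopf"
  where "Theta K L N \<rho> = fixed_hopf K L N (carrier (AutoGroup N)) \<rho> (\<lambda>f. f)"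


section \<open>Galois extensions and Hopf-Galois structures\<close>

definition number_field :: "('r, 'm) ring_scheme \<Rightarrow> bool"
  where "number_field K \<longleftrightarrow> field K \<and>
    (\<exists>\<phi> \<in> ring_hom (ring_of_type_algebra :: rat ring) K. ring.finite_dimension K (range \<phi>) (carrier K))"

text \<open>
  Field automorphisms are extensional functions, as in \<^const>\<open>BijGroup\<close> and \<^const>\<open>AutoGroup\<close>.
\<close>

definition galois_group :: "('e, 'm) ring_scheme \<Rightarrow> 'e set \<Rightarrow> ('e \<Rightarrow> 'e) monoid"
  where "galois_group E K = BijGroup (carrier E)
    \<lparr>carrier := {\<sigma> \<in> Bij (carrier E). \<sigma> \<in> ring_hom E E \<and> (\<forall>x\<in>K. \<sigma> x = x)}\<rparr>"

definition fixed_field :: "('e, 'm) ring_scheme \<Rightarrow> ('e \<Rightarrow> 'e) set \<Rightarrow> 'e set"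
  where "fixed_field E \<Gamma> = {x \<in> carrier E. \<forall>\<sigma>\<in>\<Gamma>. \<sigma> x = x}"

definition finite_galois :: "('e, 'm) ring_scheme \<Rightarrow> 'e set \<Rightarrow> bool"
  where "finite_galois E K \<longleftrightarrow> field E \<and> subfield K E \<and>
    ring.finite_dimension E K (carrier E) \<and> fixed_field E (carrier (galois_group E K)) = K"

definition hopf_galois_structure ::
  "('e, 'm) ring_scheme \<Rightarrow> 'e set \<Rightarrow> ('e, 'h, 'n) hopf_scheme \<Rightarrow> ('h \<Rightarrow> 'e \<Rightarrow> 'e) \<Rightarrow> bool"
  where "hopf_galois_structure E K H act \<longleftrightarrow>
    (let K' = E\<lparr>carrier := K\<rparr>; E\<^sub>K = algebra_via (\<lambda>x. x) E in
      hopf_algebra K' H \<and> fin_gen K' H \<and> cocommutative K' H \<and>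
      (\<forall>h\<in>carrier H. act h \<in> lin_maps K' E\<^sub>K E\<^sub>K) \<and>
      (\<forall>x\<in>carrier E. (\<lambda>h. act h x) \<in> lin_maps K' H E\<^sub>K) \<and>
      (\<forall>h\<in>carrier H. \<forall>h'\<in>carrier H. \<forall>x\<in>carrier E. act (h \<otimes>\<^bsub>H\<^esub> h') x = act h (act h' x)) \<and>
      (\<forall>x\<in>carrier E. act \<one>\<^bsub>H\<^esub> x = x) \<and>
      (\<forall>h\<in>carrier H. \<forall>x\<in>carrier E. \<forall>y\<in>carrier E. act h (x \<otimes>\<^bsub>E\<^esub> y) =
        tensor_lift K' H H E\<^sub>K (\<lambda>a b. act a x \<otimes>\<^bsub>E\<^esub> act b y) (comul H h)) \<and>
      (\<forall>h\<in>carrier H. act h \<one>\<^bsub>E\<^esub> = counit H h \<odot>\<^bsub>E\<^sub>K\<^esub> \<one>\<^bsub>E\<^esub>) \<and>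
      bij_betw (\<lambda>U. \<lambda>y\<in>carrier E. tensor_lift K' E\<^sub>K H E\<^sub>K (\<lambda>x h. x \<otimes>\<^bsub>E\<^esub> act h y) U)
        (carrier (tensor_module K' E\<^sub>K H)) (lin_maps K' E\<^sub>K E\<^sub>K \<inter> extensional (carrier E)))"


section \<open>Regular subgroups and the Greither--Pareigis correspondence\<close>

abbreviation Perm :: "('g, 'm) monoid_scheme \<Rightarrow> ('g \<Rightarrow> 'g) monoid"
  where "Perm G \<equiv> BijGroup (carrier G)"

definition left_reg :: "('g, 'm) monoid_scheme \<Rightarrow> 'g \<Rightarrow> 'g \<Rightarrow> 'g"
  where "left_reg G g = (\<lambda>h\<in>carrier G. g \<otimes>\<^bsub>G\<^esub> h)"

definition regular_subgroup :: "('g, 'm) monoid_scheme \<Rightarrow> ('g \<Rightarrow> 'g) set \<Rightarrow> bool"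
  where "regular_subgroup G N \<longleftrightarrow> subgroup N (Perm G) \<and> card N = card (carrier G) \<and>
    (\<forall>\<eta>\<in>N. \<eta> \<noteq> \<one>\<^bsub>Perm G\<^esub> \<longrightarrow> (\<forall>g\<in>carrier G. \<eta> g \<noteq> g))"

definition conj_by :: "('a, 'm) monoid_scheme \<Rightarrow> 'a \<Rightarrow> 'a \<Rightarrow> 'a"
  where "conj_by P g x = g \<otimes>\<^bsub>P\<^esub> x \<otimes>\<^bsub>P\<^esub> inv\<^bsub>P\<^esub> g"

abbreviation perm_subgroup :: "('g, 'm) monoid_scheme \<Rightarrow> ('g \<Rightarrow> 'g) set \<Rightarrow> ('g \<Rightarrow> 'g) monoid"
  where "perm_subgroup G N \<equiv> (Perm G)\<lparr>carrier := N\<rparr>"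

text \<open>The Hopf algebra \<open>(E[N])\<^sup>G\<close> of a regular subgroup \<open>N\<close> and its action on \<open>E\<close>.\<close>

definition GP_hopf ::
  "('e, 'm) ring_scheme \<Rightarrow> 'e set \<Rightarrow> (('e \<Rightarrow> 'e) \<Rightarrow> 'e \<Rightarrow> 'e) set
    \<Rightarrow> ('e, (('e \<Rightarrow> 'e) \<Rightarrow> 'e \<Rightarrow> 'e) \<Rightarrow> 'e) hopf"
  where "GP_hopf E K N = (let G = galois_group E K in
    fixed_hopf K E (perm_subgroup G N) (carrier G) (\<lambda>g. g) (\<lambda>g. conj_by (Perm G) (left_reg G g)))"

definition GP_action ::
  "('e, 'm) ring_scheme \<Rightarrow> 'e set \<Rightarrow> (('e \<Rightarrow> 'e) \<Rightarrow> 'e \<Rightarrow> 'e) set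
    \<Rightarrow> ((('e \<Rightarrow> 'e) \<Rightarrow> 'e \<Rightarrow> 'e) \<Rightarrow> 'e) \<Rightarrow> 'e \<Rightarrow> 'e"
  where "GP_action E K N r x = (let G = galois_group E K in
    \<Oplus>\<^bsub>E\<^esub>\<eta>\<in>N. r \<eta> \<otimes>\<^bsub>E\<^esub> (inv\<^bsub>Perm G\<^esub> \<eta>) \<one>\<^bsub>G\<^esub> x)"

definition corresponds_to ::
  "('e, 'm) ring_scheme \<Rightarrow> 'e set \<Rightarrow> ('e, 'h, 'n) hopf_scheme \<Rightarrow> ('h \<Rightarrow> 'e \<Rightarrow> 'e)
    \<Rightarrow> (('e \<Rightarrow> 'e) \<Rightarrow> 'e \<Rightarrow> 'e) set \<Rightarrow> bool"
  where "corresponds_to E K H act N \<longleftrightarrow>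
    (\<exists>\<theta> \<in> hopf_iso (E\<lparr>carrier := K\<rparr>) H (GP_hopf E K N).
      \<forall>h\<in>carrier H. \<forall>x\<in>carrier E. act h x = GP_action E K N (\<theta> h) x)"

definition conj_kernel :: "('g, 'm) monoid_scheme \<Rightarrow> ('g \<Rightarrow> 'g) set \<Rightarrow> ('g \<Rightarrow> 'g) set"
  where "conj_kernel G N =
    {p \<in> left_reg G ` carrier G. \<forall>\<eta>\<in>N. conj_by (Perm G) p \<eta> = \<eta>}"

text \<open>
  The action on \<open>E\<^sup>W\<close>, \<open>W\<close> the kernel above, of an automorphism \<open>f\<close> of \<open>N\<close> that is induced by conjugation
  with \<open>\<lambda>(g)\<close> for some \<open>g \<in> G\<close>. Two such \<open>g\<close> differ by an element of \<open>W\<close>, so on \<open>E\<^sup>W\<close> the choice is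
  immaterial.
\<close>

definition conj_galois_action ::
  "('e \<Rightarrow> 'e) monoid \<Rightarrow> (('e \<Rightarrow> 'e) \<Rightarrow> 'e \<Rightarrow> 'e) set
    \<Rightarrow> ((('e \<Rightarrow> 'e) \<Rightarrow> 'e \<Rightarrow> 'e) \<Rightarrow> ('e \<Rightarrow> 'e) \<Rightarrow> 'e \<Rightarrow> 'e) \<Rightarrow> 'e \<Rightarrow> 'e"
  where "conj_galois_action G N f =
    (SOME g. g \<in> carrier G \<and> (\<forall>\<eta>\<in>N. conj_by (Perm G) (left_reg G g) \<eta> = f \<eta>))"

end

theory Submission imports Defs begin

text \<open>
  Put \<open>\<Gamma> = Aut(N)\<close> and \<open>B = (L[N])\<^sup>\<Gamma>\<close>. An isomorphism of \<open>\<lambda>(G)/W\<close> with \<open>\<Gamma>\<close> forces conjugation to map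
  \<open>\<lambda>(G)\<close> onto \<open>\<Gamma>\<close>, because both groups are finite (\<open>cja_surj\<close>). So \<open>\<Gamma>\<close> acts on \<open>L = E\<^sup>W\<close>; the action is
  faithful (\<open>moves_F\<close>), and its fixed field is \<open>K\<close>.

  The fixed rings \<open>(E[N])\<^sup>G\<close> and \<open>B\<close> consist of the same functions on \<open>N\<close>: equivariance under \<open>W\<close>
  says that the values lie in \<open>L\<close>, and equivariance under the rest of \<open>G\<close> then depends on the induced
  automorphisms of \<open>N\<close> only (\<open>GP_carrier\<close>). The comultiplications agree, since in coordinates they
  are given by the same formula (\<open>GP_comul\<close>). This proves \<open>\<Theta>(L) \<cong> H\<close>.

  The splitting \<open>L \<otimes>\<^sub>K H \<cong> L[N]\<close> is Galois descent, made explicit by elements \<open>e k\<close> and \<open>u k\<close> of \<open>L\<close> with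
  \<open>\<Sum> e k * g (u k) = 1\<close> for \<open>g = 1\<close> and \<open>0\<close> for all other \<open>g \<in> \<Gamma>\<close> (\<open>exists_dual_family\<close>). They give
  \<open>f = \<Sum> e k * Tr (u k * f)\<close> for all \<open>f \<in> L[N]\<close>, where \<open>Tr\<close> is the trace from \<open>L[N]\<close> to \<open>B\<close>, and so an
  inverse of the canonical map \<open>L \<otimes>\<^sub>K B \<rightarrow> L[N]\<close> (\<open>split_hopf_iso\<close>). The same elements recover an
  element of \<open>B \<otimes>\<^sub>K B\<close> from its coordinates indexed by \<open>N \<times> N\<close>; hence the comultiplication of \<open>B\<close>
  exists and is unique (\<open>ex1_comul\<close>).

  For minimality, let \<open>\<Phi>\<close> be an isomorphism \<open>L' \<otimes>\<^sub>K H \<cong> L'[N]\<close>, and embed \<open>L\<close> and \<open>L'\<close> by \<open>\<sigma>\<close> and \<open>\<kappa>\<close> into a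
  field \<open>M\<close>, compatibly over \<open>K\<close> (\<open>exists_common_overfield\<close>). For \<open>\<zeta> \<in> N\<close>, the linear form
  \<open>b \<mapsto> \<sigma> (b \<zeta>)\<close> on \<open>B\<close> extends to \<open>L' \<otimes>\<^sub>K H\<close>. It turns comultiplication into multiplication, so via \<open>\<Phi>\<close> it
  sends every \<open>n \<in> N\<close> to an idempotent of \<open>M\<close>, which is \<open>0\<close> or \<open>1\<close>. Therefore \<open>\<sigma> (b \<zeta>) \<in> \<kappa> L'\<close> for all
  \<open>b \<in> B\<close> (\<open>coordinate_in_image\<close>). Every \<open>g \<noteq> 1\<close> in \<open>\<Gamma>\<close> moves some \<open>b \<zeta>\<close>, so the subfield of \<open>L\<close> that
  \<open>\<sigma>\<close> maps into \<open>\<kappa> L'\<close> again contains elements \<open>e k\<close> and \<open>u k\<close> as above. As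
  \<open>l = \<Sum> tr (u k * l) * e k\<close> with \<open>tr (u k * l) \<in> K\<close>, this subfield is \<open>L\<close> (\<open>image_subset\<close>), and
  \<open>\<kappa>\<inverse> \<circ> \<sigma>\<close> embeds \<open>L\<close> into \<open>L'\<close>.
\<close>

section \<open>Linear maps and bilinear maps\<close>

lemma lin_mapsI:
  assumes "\<And>x. x \<in> carrier M \<Longrightarrow> f x \<in> carrier N"
    and "\<And>x y. x \<in> carrier M \<Longrightarrow> y \<in> carrier M \<Longrightarrow> f (x \<oplus>\<^bsub>M\<^esub> y) = f x \<oplus>\<^bsub>N\<^esub> f y"
    and "\<And>r x. r \<in> carrier R \<Longrightarrow> x \<in> carrier M \<Longrightarrow> f (r \<odot>\<^bsub>M\<^esub> x) = r \<odot>\<^bsub>N\<^esub> f x"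
  shows "f \<in> lin_maps R M N"
  using assms by (simp add: lin_maps_def)

lemma lin_maps_closed: "f \<in> lin_maps R M N \<Longrightarrow> x \<in> carrier M \<Longrightarrow> f x \<in> carrier N"
  by (auto simp: lin_maps_def)

lemma lin_maps_add:
  "f \<in> lin_maps R M N \<Longrightarrow> x \<in> carrier M \<Longrightarrow> y \<in> carrier M \<Longrightarrow> f (x \<oplus>\<^bsub>M\<^esub> y) = f x \<oplus>\<^bsub>N\<^esub> f y"
  by (auto simp: lin_maps_def)

lemma lin_maps_smult:
  "f \<in> lin_maps R M N \<Longrightarrow> r \<in> carrier R \<Longrightarrow> x \<in> carrier M \<Longrightarrow> f (r \<odot>\<^bsub>M\<^esub> x) = r \<odot>\<^bsub>N\<^esub> f x"
  by (auto simp: lin_maps_def)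

lemmas lin_mapsD = lin_maps_closed lin_maps_add lin_maps_smult

lemma lin_maps_zero:
  assumes "module R M" "module R N" "f \<in> lin_maps R M N"
  shows "f \<zero>\<^bsub>M\<^esub> = \<zero>\<^bsub>N\<^esub>"
proof -
  interpret M: module R M by fact
  interpret N: module R N by fact
  have "f (\<zero>\<^bsub>R\<^esub> \<odot>\<^bsub>M\<^esub> \<zero>\<^bsub>M\<^esub>) = \<zero>\<^bsub>R\<^esub> \<odot>\<^bsub>N\<^esub> f \<zero>\<^bsub>M\<^esub>"
    using assms(3) by (intro lin_maps_smult) auto
  then show ?thesis using lin_maps_closed[OF assms(3)] by simp
qed

lemma lin_maps_finsum:
  assumes "module R M" "module R N" "f \<in> lin_maps R M N" "g \<in> I \<rightarrow> carrier M"
  shows "f (\<Oplus>\<^bsub>M\<^esub>i\<in>I. g i) = (\<Oplus>\<^bsub>N\<^esub>i\<in>I. f (g i))"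
proof -
  interpret M: module R M by fact
  interpret N: module R N by fact
  show ?thesis using assms(4)
  proof (induction I rule: infinite_finite_induct)
    case (infinite A)
    then show ?case using lin_maps_zero[OF assms(1-3)] by simp
  next
    case empty
    then show ?case using lin_maps_zero[OF assms(1-3)] by simp
  next
    case (insert x F)
    then show ?case
      by (simp add: Pi_def lin_mapsD[OF assms(3)])
  qed
qed

lemma lin_maps_comp:
  "f \<in> lin_maps R M N \<Longrightarrow> g \<in> lin_maps R N P \<Longrightarrow> (\<lambda>x. g (f x)) \<in> lin_maps R M P"
  by (auto simp: lin_maps_def Pi_def)

lemma lin_maps_id: "(\<lambda>x. x) \<in> lin_maps R M M"
  by (auto simp: lin_maps_def)

definition bilin ::
  "('r, 'm) ring_scheme \<Rightarrow> ('r, 'a, 'n) module_scheme \<Rightarrow> ('r, 'b, 'p) module_scheme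
    \<Rightarrow> ('r, 'c, 'q) module_scheme \<Rightarrow> ('a \<Rightarrow> 'b \<Rightarrow> 'c) \<Rightarrow> bool"
  where "bilin R M N P \<beta> \<longleftrightarrow> (\<forall>a\<in>carrier M. \<beta> a \<in> lin_maps R N P) \<and>
    (\<forall>b\<in>carrier N. (\<lambda>a. \<beta> a b) \<in> lin_maps R M P)"

lemma bilinI:
  assumes "\<And>a b. a \<in> carrier M \<Longrightarrow> b \<in> carrier N \<Longrightarrow> \<beta> a b \<in> carrier P"
    "\<And>a a' b. a \<in> carrier M \<Longrightarrow> a' \<in> carrier M \<Longrightarrow> b \<in> carrier N \<Longrightarrow>
      \<beta> (a \<oplus>\<^bsub>M\<^esub> a') b = \<beta> a b \<oplus>\<^bsub>P\<^esub> \<beta> a' b"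
    "\<And>a b b'. a \<in> carrier M \<Longrightarrow> b \<in> carrier N \<Longrightarrow> b' \<in> carrier N \<Longrightarrow>
      \<beta> a (b \<oplus>\<^bsub>N\<^esub> b') = \<beta> a b \<oplus>\<^bsub>P\<^esub> \<beta> a b'"
    "\<And>r a b. r \<in> carrier R \<Longrightarrow> a \<in> carrier M \<Longrightarrow> b \<in> carrier N \<Longrightarrow>
      \<beta> (r \<odot>\<^bsub>M\<^esub> a) b = r \<odot>\<^bsub>P\<^esub> \<beta> a b"
    "\<And>r a b. r \<in> carrier R \<Longrightarrow> a \<in> carrier M \<Longrightarrow> b \<in> carrier N \<Longrightarrow>
      \<beta> a (r \<odot>\<^bsub>N\<^esub> b) = r \<odot>\<^bsub>P\<^esub> \<beta> a b"
  shows "bilin R M N P \<beta>"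
  using assms by (auto simp: bilin_def intro!: lin_mapsI)

lemma bilin_left: "bilin R M N P \<beta> \<Longrightarrow> b \<in> carrier N \<Longrightarrow> (\<lambda>a. \<beta> a b) \<in> lin_maps R M P"
  by (simp add: bilin_def)

lemma bilin_right: "bilin R M N P \<beta> \<Longrightarrow> a \<in> carrier M \<Longrightarrow> \<beta> a \<in> lin_maps R N P"
  by (simp add: bilin_def)

lemma bilin_closed: "bilin R M N P \<beta> \<Longrightarrow> a \<in> carrier M \<Longrightarrow> b \<in> carrier N \<Longrightarrow> \<beta> a b \<in> carrier P"
  by (auto simp: bilin_def dest: lin_maps_closed)

lemma bilin_comp:
  assumes "bilin R M' N' P \<beta>" "f \<in> lin_maps R M M'" "g \<in> lin_maps R N N'"
  shows "bilin R M N P (\<lambda>a b. \<beta> (f a) (g b))"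
  using assms
  by (auto simp: bilin_def lin_maps_closed
      intro: lin_maps_comp[of f R M M'] lin_maps_comp[of g R N N'])

lemma bilin_post:
  assumes "bilin R M N P \<beta>" "h \<in> lin_maps R P Q"
  shows "bilin R M N Q (\<lambda>a b. h (\<beta> a b))"
  using assms by (auto simp: bilin_def intro: lin_maps_comp)


section \<open>Tensor products of modules\<close>

lemma free_module_simps [simp]:
  "carrier (free_module R S) =
     {c. (\<forall>p. c p \<in> carrier R) \<and> (\<forall>p. p \<notin> S \<longrightarrow> c p = \<zero>\<^bsub>R\<^esub>) \<and> finite {p. c p \<noteq> \<zero>\<^bsub>R\<^esub>}}"
  "\<zero>\<^bsub>free_module R S\<^esub> = (\<lambda>p. \<zero>\<^bsub>R\<^esub>)"
  "c \<oplus>\<^bsub>free_module R S\<^esub> d = (\<lambda>p. c p \<oplus>\<^bsub>R\<^esub> d p)"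
  "r \<odot>\<^bsub>free_module R S\<^esub> c = (\<lambda>p. r \<otimes>\<^bsub>R\<^esub> c p)"
  by (simp_all add: free_module_def)

lemma (in cring) module_free_module: "module R (free_module R S)"
proof (rule moduleI)
  show "abelian_group (free_module R S)"
  proof (rule abelian_groupI, goal_cases)
    case (1 x y)
    then show ?case
      by (auto intro: finite_subset[of _ "{p. x p \<noteq> \<zero>} \<union> {p. y p \<noteq> \<zero>}"])
  next
    case (6 x)
    then have "(\<lambda>p. \<ominus> x p) \<in> carrier (free_module R S)"
      by (auto intro: finite_subset[of _ "{p. x p \<noteq> \<zero>}"])
    with 6 show ?case by (intro bexI[of _ "\<lambda>p. \<ominus> x p"]) (auto simp: l_neg)
  qed (auto simp: a_ac fun_eq_iff)
next
  fix a x assume "a \<in> carrier R" "x \<in> carrier (free_module R S)"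
  then show "a \<odot>\<^bsub>free_module R S\<^esub> x \<in> carrier (free_module R S)"
    by (auto intro: finite_subset[of _ "{p. x p \<noteq> \<zero>}"])
qed (auto simp: is_cring l_distr r_distr m_assoc)

locale tensor_product =
  fixes R :: "('r, 'm) ring_scheme"
    and M :: "('r, 'a, 'n) module_scheme"
    and N :: "('r, 'b, 'p) module_scheme"
  assumes module_left: "module R M" and module_right: "module R N"
begin

sublocale left: module R M by (rule module_left)
sublocale right: module R N by (rule module_right)

abbreviation "F \<equiv> tensor_free R M N"
abbreviation "T \<equiv> tensor_module R M N"
abbreviation "pure \<equiv> pure_tensor R M N"

lemma module_F: "module R F"
  unfolding tensor_free_def by (rule left.R.module_free_module)

sublocale F: module R F by (rule module_F)

lemma free_gen_closed: "a \<in> carrier M \<Longrightarrow> b \<in> carrier N \<Longrightarrow> free_gen R (a, b) \<in> carrier F"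
  by (auto simp: tensor_free_def free_gen_def)

lemma tensor_rels_subset: "tensor_rels R M N \<subseteq> carrier F"
  unfolding tensor_rels_def
  by (auto intro!: F.M.minus_closed F.M.a_closed F.smult_closed free_gen_closed)

lemma submodule_null: "submodule (tensor_null R M N) R F"
proof -
  let ?A = "{S. submodule S R F \<and> tensor_rels R M N \<subseteq> S}"
  have top: "carrier F \<in> ?A" using F.carrier_is_submodule tensor_rels_subset by simp
  show ?thesis unfolding tensor_null_def
  proof (rule F.submoduleI)
    show "\<Inter> ?A \<subseteq> carrier F" using top by blast
    show "\<zero>\<^bsub>F\<^esub> \<in> \<Inter> ?A"
      using subgroup.one_closed[OF submodule.axioms(1)] by force
  qed (auto dest: F.submoduleE)
qed

lemma rels_null: "tensor_rels R M N \<subseteq> tensor_null R M N"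
  unfolding tensor_null_def by blast

sublocale null: abelian_subgroup "tensor_null R M N" F
  by (rule abelian_subgroupI3)
    (use submodule_null in \<open>auto simp: additive_subgroup_def dest: submodule.axioms intro: F.M.abelian_group_axioms\<close>)

abbreviation quot :: "('a \<times> 'b \<Rightarrow> 'r) \<Rightarrow> ('r, 'a, 'b) tensor"
  where "quot c \<equiv> tensor_null R M N +>\<^bsub>F\<^esub> c"

lemma T_simps:
  "carrier T = a_rcosets\<^bsub>F\<^esub> (tensor_null R M N)"
  "\<zero>\<^bsub>T\<^esub> = tensor_null R M N" "U \<oplus>\<^bsub>T\<^esub> V = U <+>\<^bsub>F\<^esub> V"
  "r \<odot>\<^bsub>T\<^esub> U = (\<Union>c\<in>U. quot (r \<odot>\<^bsub>F\<^esub> c))"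
  by (simp_all add: tensor_module_def)

lemma carrier_T: "carrier T = quot ` carrier F"
  unfolding T_simps by (auto simp: A_RCOSETS_def RCOSETS_def a_r_coset_def)

lemma quot_closed: "c \<in> carrier F \<Longrightarrow> quot c \<in> carrier T"
  by (auto simp: carrier_T)

lemma quot_eqI:
  assumes "c \<in> carrier F" "d \<in> carrier F" "c \<ominus>\<^bsub>F\<^esub> d \<in> tensor_null R M N"
  shows "quot c = quot d"
  using F.M.a_coset_add_inv1[of "tensor_null R M N" c d]
    F.M.a_coset_join2[of "c \<oplus>\<^bsub>F\<^esub> \<ominus>\<^bsub>F\<^esub> d" "tensor_null R M N"] assms null.a_subset null.a_subgroup
  by (simp add: a_minus_def)

lemma quot_mem: "c \<in> carrier F \<Longrightarrow> c' \<in> quot c \<Longrightarrow> \<exists>n\<in>tensor_null R M N. c' = n \<oplus>\<^bsub>F\<^esub> c"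
  by (auto simp: a_r_coset_def r_coset_def)

lemma quot_add: "c \<in> carrier F \<Longrightarrow> d \<in> carrier F \<Longrightarrow> quot c \<oplus>\<^bsub>T\<^esub> quot d = quot (c \<oplus>\<^bsub>F\<^esub> d)"
  by (simp add: T_simps null.a_rcos_sum)

lemma quot_zero: "quot \<zero>\<^bsub>F\<^esub> = \<zero>\<^bsub>T\<^esub>"
  using null.a_subset by (simp add: T_simps)

lemma quot_smult:
  assumes "r \<in> carrier R" "c \<in> carrier F"
  shows "r \<odot>\<^bsub>T\<^esub> quot c = quot (r \<odot>\<^bsub>F\<^esub> c)"
proof -
  have "quot (r \<odot>\<^bsub>F\<^esub> c') = quot (r \<odot>\<^bsub>F\<^esub> c)" if c': "c' \<in> quot c" for c'
  proof -
    obtain n where n: "n \<in> tensor_null R M N" "c' = n \<oplus>\<^bsub>F\<^esub> c"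
      using quot_mem[OF assms(2) c'] by blast
    then have nF: "n \<in> carrier F" using subsetD[OF null.a_subset] by simp
    have rn: "r \<odot>\<^bsub>F\<^esub> n \<in> tensor_null R M N"
      using submodule.smult_closed[OF submodule_null assms(1) n(1)] .
    show ?thesis
      by (rule quot_eqI) (use n nF rn assms in
          \<open>simp_all add: F.smult_r_distr a_minus_def F.M.a_assoc F.M.r_neg\<close>)
  qed
  moreover have "c \<in> quot c" by (rule null.a_rcos_self[OF assms(2)])
  ultimately show ?thesis unfolding T_simps by fast
qed

lemma module_T: "module R T"
proof (rule moduleI)
  show "cring R" by (rule left.R.is_cring)
  show "abelian_group T"
  proof (rule abelian_groupI, goal_cases)
    case (6 x)
    then obtain c where c: "c \<in> carrier F" "x = quot c" by (auto simp: carrier_T)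
    show ?case
      by (rule bexI[of _ "quot (\<ominus>\<^bsub>F\<^esub> c)"])
        (use c in \<open>auto simp: quot_add F.M.l_neg quot_zero simp del: free_module_simps intro: quot_closed\<close>)
  qed (auto simp: carrier_T quot_add F.M.a_ac quot_zero[symmetric] simp del: free_module_simps)
qed (auto simp: carrier_T quot_add quot_smult F.smult_l_distr F.smult_r_distr F.smult_assoc1)

sublocale T: module R T by (rule module_T)

lemma pure_closed [simp, intro]:
  "a \<in> carrier M \<Longrightarrow> b \<in> carrier N \<Longrightarrow> pure a b \<in> carrier T"
  by (simp add: pure_tensor_def quot_closed free_gen_closed)

lemma quot_eq_of_rel:
  assumes "c \<ominus>\<^bsub>F\<^esub> d \<in> tensor_rels R M N" "c \<in> carrier F" "d \<in> carrier F"
  shows "quot c = quot d"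
  using assms by (intro quot_eqI subsetD[OF rels_null])

lemma bilin_pure: "bilin R M N T pure"
proof (rule bilinI, goal_cases)
  case (2 a a' b)
  then have "free_gen R (a \<oplus>\<^bsub>M\<^esub> a', b) \<ominus>\<^bsub>F\<^esub> (free_gen R (a, b) \<oplus>\<^bsub>F\<^esub> free_gen R (a', b))
      \<in> tensor_rels R M N"
    unfolding tensor_rels_def by blast
  from quot_eq_of_rel[OF this] 2 show ?case
    by (simp add: pure_tensor_def quot_add free_gen_closed)
next
  case (3 a b b')
  then have "free_gen R (a, b \<oplus>\<^bsub>N\<^esub> b') \<ominus>\<^bsub>F\<^esub> (free_gen R (a, b) \<oplus>\<^bsub>F\<^esub> free_gen R (a, b'))
      \<in> tensor_rels R M N"
    unfolding tensor_rels_def by blast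
  from quot_eq_of_rel[OF this] 3 show ?case
    by (simp add: pure_tensor_def quot_add free_gen_closed)
next
  case (4 r a b)
  then have "free_gen R (r \<odot>\<^bsub>M\<^esub> a, b) \<ominus>\<^bsub>F\<^esub> r \<odot>\<^bsub>F\<^esub> free_gen R (a, b) \<in> tensor_rels R M N"
    unfolding tensor_rels_def by blast
  from quot_eq_of_rel[OF this] 4 show ?case
    by (simp add: pure_tensor_def quot_smult free_gen_closed)
next
  case (5 r a b)
  then have "free_gen R (a, r \<odot>\<^bsub>N\<^esub> b) \<ominus>\<^bsub>F\<^esub> r \<odot>\<^bsub>F\<^esub> free_gen R (a, b) \<in> tensor_rels R M N"
    unfolding tensor_rels_def by blast
  from quot_eq_of_rel[OF this] 5 show ?case
    by (simp add: pure_tensor_def quot_smult free_gen_closed)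
qed (rule pure_closed)

lemmas pure_add_left = lin_maps_add[OF bilin_left[OF bilin_pure]]
lemmas pure_add_right = lin_maps_add[OF bilin_right[OF bilin_pure]]
lemmas pure_smult_left = lin_maps_smult[OF bilin_left[OF bilin_pure]]
lemmas pure_smult_right = lin_maps_smult[OF bilin_right[OF bilin_pure]]

lemma free_decompose:
  assumes "c \<in> carrier F" "c (a, b) \<noteq> \<zero>\<^bsub>R\<^esub>"
  shows "a \<in> carrier M" "b \<in> carrier N" "c((a, b) := \<zero>\<^bsub>R\<^esub>) \<in> carrier F"
    "c = c((a, b) := \<zero>\<^bsub>R\<^esub>) \<oplus>\<^bsub>F\<^esub> c (a, b) \<odot>\<^bsub>F\<^esub> free_gen R (a, b)"
proof -
  have c: "\<And>p. c p \<in> carrier R" "\<And>p. p \<notin> carrier M \<times> carrier N \<Longrightarrow> c p = \<zero>\<^bsub>R\<^esub>"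
    "finite {p. c p \<noteq> \<zero>\<^bsub>R\<^esub>}"
    using assms(1) unfolding tensor_free_def free_module_simps by blast+
  show "a \<in> carrier M" "b \<in> carrier N" using c(2)[of "(a, b)"] assms(2) by auto
  have "finite {p. (c((a, b) := \<zero>\<^bsub>R\<^esub>)) p \<noteq> \<zero>\<^bsub>R\<^esub>}"
    by (rule finite_subset[OF _ c(3)]) auto
  then show "c((a, b) := \<zero>\<^bsub>R\<^esub>) \<in> carrier F"
    using c(1,2) by (simp add: tensor_free_def)
  show "c = c((a, b) := \<zero>\<^bsub>R\<^esub>) \<oplus>\<^bsub>F\<^esub> c (a, b) \<odot>\<^bsub>F\<^esub> free_gen R (a, b)"
    using c(1) by (simp add: tensor_free_def free_gen_def fun_eq_iff)
qed

lemma free_induct [consumes 1, case_names zero gen]: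
  assumes "c \<in> carrier F" "Q \<zero>\<^bsub>F\<^esub>"
    "\<And>c r a b. c \<in> carrier F \<Longrightarrow> Q c \<Longrightarrow> r \<in> carrier R \<Longrightarrow> a \<in> carrier M \<Longrightarrow> b \<in> carrier N \<Longrightarrow>
      Q (c \<oplus>\<^bsub>F\<^esub> r \<odot>\<^bsub>F\<^esub> free_gen R (a, b))"
  shows "Q c"
  using assms(1)
proof (induction "card {p. c p \<noteq> \<zero>\<^bsub>R\<^esub>}" arbitrary: c)
  case 0
  have "finite {p. c p \<noteq> \<zero>\<^bsub>R\<^esub>}" using 0(2) by (simp add: tensor_free_def)
  then have "{p. c p \<noteq> \<zero>\<^bsub>R\<^esub>} = {}" using 0(1) by simp
  then have "c = \<zero>\<^bsub>F\<^esub>" by (simp add: tensor_free_def fun_eq_iff)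
  then show ?case using assms(2) by simp
next
  case (Suc n)
  then have "{p. c p \<noteq> \<zero>\<^bsub>R\<^esub>} \<noteq> {}" by (metis card.empty nat.distinct(1))
  then obtain a b where ab: "c (a, b) \<noteq> \<zero>\<^bsub>R\<^esub>" by auto
  let ?c = "c((a, b) := \<zero>\<^bsub>R\<^esub>)"
  note d = free_decompose[OF Suc.prems ab]
  have "{p. ?c p \<noteq> \<zero>\<^bsub>R\<^esub>} = {p. c p \<noteq> \<zero>\<^bsub>R\<^esub>} - {(a, b)}" by auto
  then have "card {p. ?c p \<noteq> \<zero>\<^bsub>R\<^esub>} = n" using Suc.hyps(2) ab by simp
  then have "Q ?c" using Suc.hyps(1) d by simp
  moreover have "c (a, b) \<in> carrier R" using Suc.prems by (simp add: tensor_free_def)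
  ultimately show ?case using assms(3)[OF d(3) _ _ d(1,2)] d(4) by metis
qed

text \<open>No multiples of pure tensors are needed: a scalar is absorbed into the left factor.\<close>

lemma tensor_induct [consumes 1, case_names pure add]:
  assumes "U \<in> carrier T" "\<And>a b. a \<in> carrier M \<Longrightarrow> b \<in> carrier N \<Longrightarrow> Q (pure a b)"
    "\<And>U V. U \<in> carrier T \<Longrightarrow> V \<in> carrier T \<Longrightarrow> Q U \<Longrightarrow> Q V \<Longrightarrow> Q (U \<oplus>\<^bsub>T\<^esub> V)"
  shows "Q U"
proof -
  obtain c where c: "c \<in> carrier F" "U = quot c" using assms(1) by (auto simp: carrier_T)
  have "Q (quot c)" using c(1)
  proof (induction rule: free_induct)
    case zero
    have "pure \<zero>\<^bsub>M\<^esub> \<zero>\<^bsub>N\<^esub> = \<zero>\<^bsub>T\<^esub>"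
      using lin_maps_zero[OF module_left module_T bilin_left[OF bilin_pure]] by simp
    then show ?case using assms(2)[of "\<zero>\<^bsub>M\<^esub>" "\<zero>\<^bsub>N\<^esub>"] by (simp add: quot_zero)
  next
    case (gen c r a b)
    have "quot (r \<odot>\<^bsub>F\<^esub> free_gen R (a, b)) = pure (r \<odot>\<^bsub>M\<^esub> a) b"
      using gen by (simp add: pure_smult_left) (simp add: pure_tensor_def quot_smult free_gen_closed)
    then show ?case
      using gen assms(2)[of "r \<odot>\<^bsub>M\<^esub> a" b] assms(3)[of "quot c" "quot (r \<odot>\<^bsub>F\<^esub> free_gen R (a, b))"]
      by (simp add: quot_add[symmetric] free_gen_closed quot_closed)
  qed
  then show ?thesis using c by simp
qed

lemma lin_maps_eqI:
  assumes "f \<in> lin_maps R T P" "g \<in> lin_maps R T P" "U \<in> carrier T"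
    "\<And>a b. a \<in> carrier M \<Longrightarrow> b \<in> carrier N \<Longrightarrow> f (pure a b) = g (pure a b)"
  shows "f U = g U"
  using assms(3) by (induction rule: tensor_induct) (auto simp: assms lin_mapsD[OF assms(1)] lin_mapsD[OF assms(2)])

end

context tensor_product
begin

context
  fixes P :: "('r, 'c, 'q) module_scheme" and \<beta>
  assumes module_P: "module R P" and bilin: "bilin R M N P \<beta>"
begin

interpretation P: module R P by (rule module_P)

text \<open>
  The linear map on the free module that induces the lift on its quotient, summed over the same
  domain as in \<open>tensor_lift\<close>.
\<close>

definition lift_free :: "('a \<times> 'b \<Rightarrow> 'r) \<Rightarrow> 'c"
  where "lift_free c = (\<Oplus>\<^bsub>P\<^esub>p\<in>{p \<in> carrier M \<times> carrier N. c p \<noteq> \<zero>\<^bsub>R\<^esub>}. c p \<odot>\<^bsub>P\<^esub> \<beta> (fst p) (snd p))"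

lemma term_closed:
  "c \<in> carrier F \<Longrightarrow> p \<in> carrier M \<times> carrier N \<Longrightarrow> c p \<odot>\<^bsub>P\<^esub> \<beta> (fst p) (snd p) \<in> carrier P"
  using bilin_closed[OF bilin] by (auto simp: tensor_free_def)

lemma lift_free_superset:
  assumes "c \<in> carrier F" "finite D" "{p. c p \<noteq> \<zero>\<^bsub>R\<^esub>} \<subseteq> D" "D \<subseteq> carrier M \<times> carrier N"
  shows "lift_free c = (\<Oplus>\<^bsub>P\<^esub>p\<in>D. c p \<odot>\<^bsub>P\<^esub> \<beta> (fst p) (snd p))"
  unfolding lift_free_def
proof (rule P.M.add.finprod_mono_neutral_cong_left)
  show "finite D" "{p \<in> carrier M \<times> carrier N. c p \<noteq> \<zero>\<^bsub>R\<^esub>} \<subseteq> D" using assms by auto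
  show "(\<lambda>p. c p \<odot>\<^bsub>P\<^esub> \<beta> (fst p) (snd p)) \<in> D \<rightarrow> carrier P"
    using assms term_closed by blast
  fix p assume "p \<in> D - {p \<in> carrier M \<times> carrier N. c p \<noteq> \<zero>\<^bsub>R\<^esub>}"
  then show "c p \<odot>\<^bsub>P\<^esub> \<beta> (fst p) (snd p) = \<zero>\<^bsub>P\<^esub>"
    using assms bilin_closed[OF bilin] by auto
qed auto

lemma lift_free_lin: "lift_free \<in> lin_maps R F P"
proof (rule lin_mapsI, goal_cases)
  case (1 c)
  then show ?case unfolding lift_free_def using term_closed by (intro P.M.finsum_closed) auto
next
  case (2 c d)
  let ?D = "{p. c p \<noteq> \<zero>\<^bsub>R\<^esub>} \<union> {p. d p \<noteq> \<zero>\<^bsub>R\<^esub>}"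
  have D: "finite ?D" "?D \<subseteq> carrier M \<times> carrier N"
    using 2 by (auto simp: tensor_free_def)
  have "lift_free (c \<oplus>\<^bsub>F\<^esub> d) = (\<Oplus>\<^bsub>P\<^esub>p\<in>?D. (c \<oplus>\<^bsub>F\<^esub> d) p \<odot>\<^bsub>P\<^esub> \<beta> (fst p) (snd p))"
  proof (rule lift_free_superset)
    show "{p. (c \<oplus>\<^bsub>F\<^esub> d) p \<noteq> \<zero>\<^bsub>R\<^esub>} \<subseteq> ?D" using 2 by (auto simp: tensor_free_def)
  qed (use 2 D in auto)
  also have "\<dots> = (\<Oplus>\<^bsub>P\<^esub>p\<in>?D. c p \<odot>\<^bsub>P\<^esub> \<beta> (fst p) (snd p) \<oplus>\<^bsub>P\<^esub> d p \<odot>\<^bsub>P\<^esub> \<beta> (fst p) (snd p))"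
    using 2 D bilin_closed[OF bilin] term_closed
    by (intro P.M.finsum_cong') (auto simp: tensor_free_def P.smult_l_distr)
  also have "\<dots> = lift_free c \<oplus>\<^bsub>P\<^esub> lift_free d"
    using 2 D term_closed
    by (subst P.M.finsum_addf) (blast, blast, simp add: lift_free_superset[of _ ?D])
  finally show ?case .
next
  case (3 r c)
  let ?D = "{p. c p \<noteq> \<zero>\<^bsub>R\<^esub>}"
  have D: "finite ?D" "?D \<subseteq> carrier M \<times> carrier N"
    using 3 by (auto simp: tensor_free_def)
  have "lift_free (r \<odot>\<^bsub>F\<^esub> c) = (\<Oplus>\<^bsub>P\<^esub>p\<in>?D. (r \<odot>\<^bsub>F\<^esub> c) p \<odot>\<^bsub>P\<^esub> \<beta> (fst p) (snd p))"
  proof (rule lift_free_superset)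
    show "{p. (r \<odot>\<^bsub>F\<^esub> c) p \<noteq> \<zero>\<^bsub>R\<^esub>} \<subseteq> ?D" using 3 by (auto simp: tensor_free_def)
  qed (use 3 D in auto)
  also have "\<dots> = (\<Oplus>\<^bsub>P\<^esub>p\<in>?D. r \<odot>\<^bsub>P\<^esub> (c p \<odot>\<^bsub>P\<^esub> \<beta> (fst p) (snd p)))"
    using 3 D bilin_closed[OF bilin] term_closed
    by (intro P.M.finsum_cong') (auto simp: tensor_free_def P.smult_assoc1)
  also have "\<dots> = r \<odot>\<^bsub>P\<^esub> lift_free c"
    using 3 D term_closed
    by (subst P.finsum_smult_ldistr[symmetric]) (auto simp: lift_free_superset[of _ ?D])
  finally show ?case .
qed

lemma lift_free_gen: "a \<in> carrier M \<Longrightarrow> b \<in> carrier N \<Longrightarrow> lift_free (free_gen R (a, b)) = \<beta> a b"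
proof -
  assume ab: "a \<in> carrier M" "b \<in> carrier N"
  have "lift_free (free_gen R (a, b)) =
      (\<Oplus>\<^bsub>P\<^esub>p\<in>{(a, b)}. free_gen R (a, b) p \<odot>\<^bsub>P\<^esub> \<beta> (fst p) (snd p))"
    using ab by (intro lift_free_superset free_gen_closed) (auto simp: free_gen_def)
  also have "\<dots> = \<beta> a b"
    using bilin_closed[OF bilin ab] by (simp add: free_gen_def)
  finally show ?thesis .
qed

lemma lift_free_minus:
  assumes "c \<in> carrier F" "d \<in> carrier F" "lift_free c = lift_free d"
  shows "lift_free (c \<ominus>\<^bsub>F\<^esub> d) = \<zero>\<^bsub>P\<^esub>"
proof -
  note l = lin_mapsD[OF lift_free_lin]
  have "lift_free ((c \<ominus>\<^bsub>F\<^esub> d) \<oplus>\<^bsub>F\<^esub> d) = lift_free (c \<ominus>\<^bsub>F\<^esub> d) \<oplus>\<^bsub>P\<^esub> lift_free d"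
    using assms by (intro l) auto
  moreover have "(c \<ominus>\<^bsub>F\<^esub> d) \<oplus>\<^bsub>F\<^esub> d = c"
    using assms by (simp add: a_minus_def F.M.a_assoc F.M.l_neg)
  ultimately show ?thesis using assms l(1) by (simp add: P.M.add.r_cancel_one')
qed

text \<open>
  The kernel of \<open>lift_free\<close> is a submodule that contains the bilinearity relations. Therefore
  \<open>tensor_lift\<close> does not depend on the representative that it chooses.
\<close>

lemma lift_free_null: "n \<in> tensor_null R M N \<Longrightarrow> lift_free n = \<zero>\<^bsub>P\<^esub>"
proof -
  note l = lin_mapsD[OF lift_free_lin]
  let ?S = "{c \<in> carrier F. lift_free c = \<zero>\<^bsub>P\<^esub>}"
  have "submodule ?S R F"
  proof (rule F.submoduleI)
    show "\<zero>\<^bsub>F\<^esub> \<in> ?S" using lin_maps_zero[OF module_F P.module_axioms lift_free_lin] by simp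
    fix c assume c: "c \<in> ?S"
    have "lift_free (\<zero>\<^bsub>F\<^esub> \<ominus>\<^bsub>F\<^esub> c) = \<zero>\<^bsub>P\<^esub>"
      using lin_maps_zero[OF module_F P.module_axioms lift_free_lin] c
      by (intro lift_free_minus) auto
    then show "\<ominus>\<^bsub>F\<^esub> c \<in> ?S" using c by (simp add: a_minus_def)
  qed (auto simp: l)
  moreover have "tensor_rels R M N \<subseteq> ?S"
  proof -
    note fg = free_gen_closed
    note lg = lift_free_gen bilin_closed[OF bilin] lin_maps_add[OF bilin_left[OF bilin]]
      lin_maps_add[OF bilin_right[OF bilin]] lin_maps_smult[OF bilin_left[OF bilin]]
      lin_maps_smult[OF bilin_right[OF bilin]]
    show ?thesis unfolding tensor_rels_def
      by (auto simp: fg l lg intro!: lift_free_minus)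
  qed
  ultimately have "tensor_null R M N \<subseteq> ?S" unfolding tensor_null_def by blast
  then show "n \<in> tensor_null R M N \<Longrightarrow> lift_free n = \<zero>\<^bsub>P\<^esub>" by blast
qed

lemma tensor_lift_quot:
  assumes "c \<in> carrier F"
  shows "tensor_lift R M N P \<beta> (quot c) = lift_free c"
proof -
  have "c \<in> quot c" by (rule null.a_rcos_self[OF assms])
  then have "(SOME c'. c' \<in> quot c) \<in> quot c" by (rule someI[where P = "\<lambda>c'. c' \<in> quot c"])
  then obtain n where n: "n \<in> tensor_null R M N" "(SOME c'. c' \<in> quot c) = n \<oplus>\<^bsub>F\<^esub> c"
    using quot_mem[OF assms] by blast
  have "lift_free (n \<oplus>\<^bsub>F\<^esub> c) = lift_free n \<oplus>\<^bsub>P\<^esub> lift_free c"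
    using n null.a_subset assms by (intro lin_maps_add[OF lift_free_lin]) auto
  also have "\<dots> = lift_free c"
    using n lift_free_null lin_maps_closed[OF lift_free_lin] assms by simp
  finally show ?thesis by (simp add: tensor_lift_def Let_def n(2) lift_free_def)
qed

lemma lift_lin: "tensor_lift R M N P \<beta> \<in> lin_maps R T P"
  by (rule lin_mapsI)
    (auto simp: carrier_T quot_add quot_smult tensor_lift_quot lin_mapsD[OF lift_free_lin])

lemma lift_pure:
  "a \<in> carrier M \<Longrightarrow> b \<in> carrier N \<Longrightarrow> tensor_lift R M N P \<beta> (pure a b) = \<beta> a b"
  by (simp add: pure_tensor_def tensor_lift_quot free_gen_closed lift_free_gen)

end

lemma lift_unique:
  assumes "module R P" "f \<in> lin_maps R T P" "U \<in> carrier T"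
    "\<And>a b. a \<in> carrier M \<Longrightarrow> b \<in> carrier N \<Longrightarrow> f (pure a b) = \<beta> a b"
    "bilin R M N P \<beta>"
  shows "tensor_lift R M N P \<beta> U = f U"
  by (rule lin_maps_eqI[OF lift_lin[OF assms(1,5)] assms(2,3)])
    (simp add: lift_pure[OF assms(1,5)] assms(4))

lemma tensor_lift_cong:
  assumes "U \<in> carrier T" "module R P"
    "\<And>a b. a \<in> carrier M \<Longrightarrow> b \<in> carrier N \<Longrightarrow> \<beta> a b = \<beta>' a b" "bilin R M N P \<beta>'"
  shows "tensor_lift R M N P \<beta> U = tensor_lift R M N P \<beta>' U"
proof -
  have b: "bilin R M N P \<beta>"
    by (rule bilinI) (simp_all add: assms(3) bilin_closed[OF assms(4)]
      lin_mapsD[OF bilin_left[OF assms(4)]] lin_mapsD[OF bilin_right[OF assms(4)]])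
  show ?thesis
    by (rule lin_maps_eqI[OF lift_lin[OF assms(2) b] lift_lin[OF assms(2,4)] assms(1)])
      (simp add: lift_pure[OF assms(2) b] lift_pure[OF assms(2,4)] assms(3))
qed

text \<open>By this rule, coordinate functions and homomorphisms are moved through a comultiplication.\<close>

lemma lift_post:
  assumes "module R P" "bilin R M N P \<beta>" "module R Q" "h \<in> lin_maps R P Q" "U \<in> carrier T"
  shows "h (tensor_lift R M N P \<beta> U) = tensor_lift R M N Q (\<lambda>a b. h (\<beta> a b)) U"
  by (rule lift_unique[OF assms(3) lin_maps_comp[OF lift_lin[OF assms(1,2)] assms(4)] assms(5) _
        bilin_post[OF assms(2,4)], symmetric])
    (simp add: lift_pure[OF assms(1,2)])

end

lemma tensor_map_props:
  assumes "tensor_product R M N" "tensor_product R M' N'"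
    "f \<in> lin_maps R M M'" "g \<in> lin_maps R N N'"
  shows tensor_map_lin: "tensor_map R M N M' N' f g \<in> lin_maps R (tensor_module R M N) (tensor_module R M' N')"
    and tensor_map_pure: "a \<in> carrier M \<Longrightarrow> b \<in> carrier N \<Longrightarrow>
      tensor_map R M N M' N' f g (pure_tensor R M N a b) = pure_tensor R M' N' (f a) (g b)"
proof -
  interpret A: tensor_product R M N by fact
  interpret B: tensor_product R M' N' by fact
  have "bilin R M N B.T (\<lambda>a b. B.pure (f a) (g b))"
    by (rule bilin_comp[OF B.bilin_pure]) fact+
  from A.lift_lin[OF B.module_T this] A.lift_pure[OF B.module_T this]
  show "tensor_map R M N M' N' f g \<in> lin_maps R (tensor_module R M N) (tensor_module R M' N')"
    "a \<in> carrier M \<Longrightarrow> b \<in> carrier N \<Longrightarrow>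
      tensor_map R M N M' N' f g (pure_tensor R M N a b) = pure_tensor R M' N' (f a) (g b)"
    by (simp_all add: tensor_map_def)
qed

lemma tensor_lift_map:
  assumes "tensor_product R M N" "tensor_product R M' N'" "module R P"
    "f \<in> lin_maps R M M'" "g \<in> lin_maps R N N'" "bilin R M' N' P \<beta>"
    "U \<in> carrier (tensor_module R M N)"
  shows "tensor_lift R M' N' P \<beta> (tensor_map R M N M' N' f g U) =
    tensor_lift R M N P (\<lambda>a b. \<beta> (f a) (g b)) U"
proof -
  interpret A: tensor_product R M N by fact
  interpret B: tensor_product R M' N' by fact
  note t = tensor_map_props[OF assms(1,2,4,5)]
  show ?thesis
    by (rule A.lift_unique[OF assms(3) lin_maps_comp[OF t(1) B.lift_lin[OF assms(3,6)]] assms(7) _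
        bilin_comp[OF assms(6,4,5)], symmetric])
      (simp add: t(2) B.lift_pure[OF assms(3,6)] lin_maps_closed[OF assms(4)] lin_maps_closed[OF assms(5)])
qed



section \<open>Dependence of tensor products on the module structure only\<close>

text \<open>
  Hopf algebras are extended records, so that several records have the same underlying module; their
  tensor products are equal because only carrier, addition and scalars enter the construction.
\<close>

lemma tensor_cong:
  assumes "carrier M = carrier M'" "add M = add M'" "module.smult M = module.smult M'"
    "carrier N = carrier N'" "add N = add N'" "module.smult N = module.smult N'"
  shows "tensor_module R M N = tensor_module R M' N'"
    and "pure_tensor R M N = pure_tensor R M' N'"
    and "tensor_lift R M N P \<beta> = tensor_lift R M' N' P \<beta>"
proof -
  have f: "tensor_free R M N = tensor_free R M' N'" by (simp add: tensor_free_def assms)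
  have "tensor_rels R M N = tensor_rels R M' N'" by (simp add: tensor_rels_def f assms)
  with f have n: "tensor_null R M N = tensor_null R M' N'" by (simp add: tensor_null_def)
  show "tensor_module R M N = tensor_module R M' N'" by (simp add: tensor_module_def f n)
  show "pure_tensor R M N = pure_tensor R M' N'" by (simp add: pure_tensor_def fun_eq_iff f n)
  show "tensor_lift R M N P \<beta> = tensor_lift R M' N' P \<beta>"
    by (simp add: tensor_lift_def fun_eq_iff assms)
qed

lemma module_cong:
  assumes "module R M" "carrier M' = carrier M" "add M' = add M" "ring.zero M' = ring.zero M"
    "module.smult M' = module.smult M"
  shows "module R M'"
proof -
  interpret M: module R M by fact
  show ?thesis
  proof (rule moduleI)
    show "abelian_group M'"
    proof (rule abelian_groupI, goal_cases)
      case (6 x)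
      then show ?case using assms by (intro bexI[of _ "\<ominus>\<^bsub>M\<^esub> x"]) (auto simp: M.M.l_neg)
    qed (simp_all add: assms M.M.a_assoc, simp add: M.M.a_comm)
  qed (simp_all add: assms M.R.is_cring M.smult_l_distr M.smult_r_distr M.smult_assoc1)
qed

lemma lin_maps_addf:
  assumes "module R N" "f \<in> lin_maps R M N" "g \<in> lin_maps R M N"
  shows "(\<lambda>x. f x \<oplus>\<^bsub>N\<^esub> g x) \<in> lin_maps R M N"
proof -
  interpret N: module R N by fact
  show ?thesis
    by (rule lin_mapsI)
      (simp_all add: lin_mapsD[OF assms(2)] lin_mapsD[OF assms(3)] N.M.a_ac N.smult_r_distr)
qed

lemma lin_maps_smultf:
  assumes "module R N" "f \<in> lin_maps R M N" "r \<in> carrier R"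
  shows "(\<lambda>x. r \<odot>\<^bsub>N\<^esub> f x) \<in> lin_maps R M N"
proof -
  interpret N: module R N by fact
  show ?thesis
    by (rule lin_mapsI)
      (use assms(3) in \<open>simp_all add: lin_mapsD[OF assms(2)] N.smult_r_distr N.smult_assoc1[symmetric] N.R.m_comm\<close>)
qed


section \<open>Tensor products of algebras\<close>

lemma tensor_algebra_simps [simp]:
  "carrier (tensor_algebra R M N) = carrier (tensor_module R M N)"
  "add (tensor_algebra R M N) = add (tensor_module R M N)"
  "ring.zero (tensor_algebra R M N) = ring.zero (tensor_module R M N)"
  "module.smult (tensor_algebra R M N) = module.smult (tensor_module R M N)"
  "one (tensor_algebra R M N) = pure_tensor R M N \<one>\<^bsub>M\<^esub> \<one>\<^bsub>N\<^esub>"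
  by (simp_all add: tensor_algebra_def)

text \<open>
  Only bilinearity of the two products is assumed, so that a noncommutative Hopf algebra
  is allowed as a factor.
\<close>

locale tensor_product_mult = tensor_product R M N
  for R :: "('r, 'm) ring_scheme" and M :: "('r, 'a, 'n) module_scheme"
    and N :: "('r, 'b, 'p) module_scheme" +
  assumes mult_left: "bilin R M M M (monoid.mult M)"
    and mult_right: "bilin R N N N (monoid.mult N)"
begin

abbreviation "TA \<equiv> tensor_algebra R M N"

lemma module_TA: "module R TA"
  by (rule module_cong[OF module_T]) simp_all

text \<open>Left multiplication by \<open>a \<otimes> b\<close>: the inner lift in the definition of the product.\<close>

definition mult_by :: "'a \<Rightarrow> 'b \<Rightarrow> ('r, 'a, 'b) tensor \<Rightarrow> ('r, 'a, 'b) tensor"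
  where "mult_by a b = tensor_lift R M N T (\<lambda>a' b'. pure (a \<otimes>\<^bsub>M\<^esub> a') (b \<otimes>\<^bsub>N\<^esub> b'))"

lemma bilin_mult_by: "a \<in> carrier M \<Longrightarrow> b \<in> carrier N \<Longrightarrow>
  bilin R M N T (\<lambda>a' b'. pure (a \<otimes>\<^bsub>M\<^esub> a') (b \<otimes>\<^bsub>N\<^esub> b'))"
  by (rule bilin_comp[OF bilin_pure bilin_right[OF mult_left] bilin_right[OF mult_right]])

lemma mult_by_lin: "a \<in> carrier M \<Longrightarrow> b \<in> carrier N \<Longrightarrow> mult_by a b \<in> lin_maps R T T"
  unfolding mult_by_def by (rule lift_lin[OF module_T bilin_mult_by])

lemma mult_by_pure:
  "\<lbrakk>a \<in> carrier M; b \<in> carrier N; a' \<in> carrier M; b' \<in> carrier N\<rbrakk> \<Longrightarrow>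
    mult_by a b (pure a' b') = pure (a \<otimes>\<^bsub>M\<^esub> a') (b \<otimes>\<^bsub>N\<^esub> b')"
  unfolding mult_by_def by (rule lift_pure[OF module_T bilin_mult_by])

lemmas mult_simps =
  lin_maps_add[OF bilin_left[OF mult_left]] lin_maps_add[OF bilin_left[OF mult_right]]
  lin_maps_smult[OF bilin_left[OF mult_left]] lin_maps_smult[OF bilin_left[OF mult_right]]
  bilin_closed[OF mult_left] bilin_closed[OF mult_right]

lemma bilin_mult_by_left: "V \<in> carrier T \<Longrightarrow> bilin R M N T (\<lambda>a b. mult_by a b V)"
proof (rule bilinI, goal_cases)
  case (1 a b)
  then show ?case by (simp add: lin_maps_closed[OF mult_by_lin])
next
  case (2 a a' b)
  show ?case
    by (rule lin_maps_eqI[OF mult_by_lin lin_maps_addf[OF module_T mult_by_lin mult_by_lin]])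
      (use 2 in \<open>simp_all add: mult_by_pure mult_simps pure_add_left\<close>)
next
  case (3 a b b')
  show ?case
    by (rule lin_maps_eqI[OF mult_by_lin lin_maps_addf[OF module_T mult_by_lin mult_by_lin]])
      (use 3 in \<open>simp_all add: mult_by_pure mult_simps pure_add_right\<close>)
next
  case (4 r a b)
  show ?case
    by (rule lin_maps_eqI[OF mult_by_lin lin_maps_smultf[OF module_T mult_by_lin]])
      (use 4 in \<open>simp_all add: mult_by_pure mult_simps pure_smult_left\<close>)
next
  case (5 r a b)
  show ?case
    by (rule lin_maps_eqI[OF mult_by_lin lin_maps_smultf[OF module_T mult_by_lin]])
      (use 5 in \<open>simp_all add: mult_by_pure mult_simps pure_smult_right\<close>)
qed

lemma TA_mult: "U \<otimes>\<^bsub>TA\<^esub> V = tensor_lift R M N T (\<lambda>a b. mult_by a b V) U"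
  by (simp add: tensor_algebra_def mult_by_def)

lemma TA_mult_left_lin: "V \<in> carrier T \<Longrightarrow> (\<lambda>U. U \<otimes>\<^bsub>TA\<^esub> V) \<in> lin_maps R T T"
  unfolding TA_mult by (rule lift_lin[OF module_T bilin_mult_by_left])

lemma TA_mult_pure_left:
  "\<lbrakk>a \<in> carrier M; b \<in> carrier N; V \<in> carrier T\<rbrakk> \<Longrightarrow> pure a b \<otimes>\<^bsub>TA\<^esub> V = mult_by a b V"
  unfolding TA_mult by (rule lift_pure[OF module_T bilin_mult_by_left])

lemma TA_mult_pure:
  "\<lbrakk>a \<in> carrier M; b \<in> carrier N; a' \<in> carrier M; b' \<in> carrier N\<rbrakk> \<Longrightarrow>
    pure a b \<otimes>\<^bsub>TA\<^esub> pure a' b' = pure (a \<otimes>\<^bsub>M\<^esub> a') (b \<otimes>\<^bsub>N\<^esub> b')"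
  by (simp add: TA_mult_pure_left mult_by_pure)

lemma TA_mult_right_lin: "U \<in> carrier T \<Longrightarrow> (\<lambda>V. U \<otimes>\<^bsub>TA\<^esub> V) \<in> lin_maps R T T"
proof (induction rule: tensor_induct)
  case (pure a b)
  then have "V \<in> carrier T \<Longrightarrow> pure a b \<otimes>\<^bsub>TA\<^esub> V = mult_by a b V" for V
    by (rule TA_mult_pure_left)
  then show ?case using mult_by_lin[OF pure] unfolding lin_maps_def by auto
next
  case (add U V)
  have "(U \<oplus>\<^bsub>T\<^esub> V) \<otimes>\<^bsub>TA\<^esub> W = U \<otimes>\<^bsub>TA\<^esub> W \<oplus>\<^bsub>T\<^esub> V \<otimes>\<^bsub>TA\<^esub> W" if "W \<in> carrier T" for W
    by (rule lin_maps_add[OF TA_mult_left_lin]) (use add that in auto)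
  with lin_maps_addf[OF module_T add(3,4)] show ?case unfolding lin_maps_def by auto
qed

lemma TA_mult_closed: "U \<in> carrier T \<Longrightarrow> V \<in> carrier T \<Longrightarrow> U \<otimes>\<^bsub>TA\<^esub> V \<in> carrier T"
  by (rule lin_maps_closed[OF TA_mult_left_lin])

lemmas TA_mult_add_left = lin_maps_add[OF TA_mult_left_lin]
lemmas TA_mult_add_right = lin_maps_add[OF TA_mult_right_lin]

end

lemma (in algebra) bilin_mult: "bilin R M M M (monoid.mult M)"
proof (rule bilinI, goal_cases)
  case (5 r a b)
  then show ?case using smult_assoc2[of r b a] by (simp add: m_comm)
qed (simp_all add: l_distr r_distr smult_assoc2)

lemma cring_tensor_algebra:
  assumes "algebra R M" "algebra R N"
  shows "cring (tensor_algebra R M N)"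
proof -
  interpret M: algebra R M by fact
  interpret N: algebra R N by fact
  interpret tensor_product_mult R M N
    by (intro tensor_product_mult.intro tensor_product.intro tensor_product_mult_axioms.intro
        M.module_axioms N.module_axioms M.bilin_mult N.bilin_mult)
  interpret TM: module R TA by (rule module_TA)
  have comm: "U \<otimes>\<^bsub>TA\<^esub> V = V \<otimes>\<^bsub>TA\<^esub> U" if U: "U \<in> carrier T" and V: "V \<in> carrier T" for U V
    using U
  proof (induction rule: tensor_induct)
    case (pure a b)
    show ?case using V
    proof (induction rule: tensor_induct)
      case (pure a' b')
      then show ?case using \<open>a \<in> carrier M\<close> \<open>b \<in> carrier N\<close>
        by (simp add: TA_mult_pure M.m_comm N.m_comm)
    qed (use pure in \<open>simp add: TA_mult_add_left TA_mult_add_right\<close>)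
  qed (use V in \<open>simp add: TA_mult_add_left TA_mult_add_right\<close>)
  have assoc: "(U \<otimes>\<^bsub>TA\<^esub> V) \<otimes>\<^bsub>TA\<^esub> W = U \<otimes>\<^bsub>TA\<^esub> (V \<otimes>\<^bsub>TA\<^esub> W)"
    if U: "U \<in> carrier T" and V: "V \<in> carrier T" and W: "W \<in> carrier T" for U V W
    using U
  proof (induction rule: tensor_induct)
    case ab: (pure a b)
    show ?case using V
    proof (induction rule: tensor_induct)
      case ab': (pure a' b')
      show ?case using W
      proof (induction rule: tensor_induct)
        case (pure a'' b'')
        then show ?case using ab ab'
          by (simp add: TA_mult_pure M.m_assoc N.m_assoc)
      qed (use ab ab' in \<open>simp add: TA_mult_add_left TA_mult_add_right TA_mult_closed\<close>)
    qed (use ab W in \<open>simp add: TA_mult_add_left TA_mult_add_right TA_mult_closed\<close>)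
  qed (use V W in \<open>simp add: TA_mult_add_left TA_mult_add_right TA_mult_closed\<close>)
  have one: "pure \<one>\<^bsub>M\<^esub> \<one>\<^bsub>N\<^esub> \<otimes>\<^bsub>TA\<^esub> U = U" if "U \<in> carrier T" for U
    using that
  proof (induction rule: tensor_induct)
    case (pure a b)
    then show ?case by (simp add: TA_mult_pure)
  qed (simp add: TA_mult_add_right)
  show ?thesis
  proof (rule cringI)
    show "abelian_group TA" by (rule TM.M.abelian_group_axioms)
    show "comm_monoid TA"
      by (rule comm_monoidI) (simp_all add: TA_mult_closed assoc one, rule comm)
  qed (simp add: TA_mult_add_left)
qed


section \<open>Change of scalars\<close>

lemma algebra_via_simps [simp]:
  "carrier (algebra_via \<phi> S) = carrier S" "monoid.mult (algebra_via \<phi> S) = monoid.mult S"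
  "one (algebra_via \<phi> S) = one S" "ring.zero (algebra_via \<phi> S) = ring.zero S" "add (algebra_via \<phi> S) = add S"
  "r \<odot>\<^bsub>algebra_via \<phi> S\<^esub> x = \<phi> r \<otimes>\<^bsub>S\<^esub> x"
  by (simp_all add: algebra_via_def)

lemma restrict_scalars_simps [simp]:
  "carrier (restrict_scalars \<phi> P) = carrier P" "ring.zero (restrict_scalars \<phi> P) = ring.zero P"
  "add (restrict_scalars \<phi> P) = add P" "r \<odot>\<^bsub>restrict_scalars \<phi> P\<^esub> x = \<phi> r \<odot>\<^bsub>P\<^esub> x"
  by (simp_all add: restrict_scalars_def)

lemma restrict_scalars_algebra_via: "restrict_scalars \<phi> (algebra_via (\<lambda>x. x) S) = algebra_via \<phi> S"
  by (simp add: restrict_scalars_def algebra_via_def)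

lemma algebra_algebra_via:
  assumes "cring R" "cring S" "\<phi> \<in> ring_hom R S"
  shows "algebra R (algebra_via \<phi> S)"
proof -
  interpret R: cring R by fact
  interpret S: cring S by fact
  note [simp] = ring_hom_memE[OF assms(3)]
  have ab: "abelian_group (algebra_via \<phi> S)"
  proof (rule abelian_groupI, goal_cases)
    case (6 x)
    then show ?case by (intro bexI[of _ "\<ominus>\<^bsub>S\<^esub> x"]) (auto simp: S.l_neg)
  qed (simp_all add: S.a_assoc, simp add: S.a_comm)
  have "comm_monoid (algebra_via \<phi> S)"
    by (rule comm_monoidI) (simp_all add: S.m_assoc, simp add: S.m_comm)
  with ab have "cring (algebra_via \<phi> S)"
    by (rule cringI) (simp add: S.l_distr)
  then show ?thesis
    by (rule algebraI[OF R.is_cring]) (simp_all add: S.l_distr S.r_distr S.m_assoc)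
qed

lemma module_algebra_via:
  "cring R \<Longrightarrow> cring S \<Longrightarrow> \<phi> \<in> ring_hom R S \<Longrightarrow> module R (algebra_via \<phi> S)"
  by (rule algebra.axioms(1)[OF algebra_algebra_via])

lemma module_restrict_scalars:
  assumes "cring R" "module S P" "\<phi> \<in> ring_hom R S"
  shows "module R (restrict_scalars \<phi> P)"
proof -
  interpret P: module S P by fact
  note [simp] = ring_hom_memE[OF assms(3)]
  show ?thesis
  proof (rule moduleI)
    show "abelian_group (restrict_scalars \<phi> P)"
    proof (rule abelian_groupI, goal_cases)
      case (6 x)
      then show ?case by (intro bexI[of _ "\<ominus>\<^bsub>P\<^esub> x"]) (auto simp: P.M.l_neg)
    qed (simp_all add: P.M.a_assoc, simp add: P.M.a_comm)
  qed (simp_all add: assms(1) P.smult_l_distr P.smult_r_distr P.smult_assoc1)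
qed

lemma lin_maps_restrict_scalars:
  assumes "f \<in> lin_maps S M P" "\<phi> \<in> ring_hom R S"
  shows "f \<in> lin_maps R (restrict_scalars \<phi> M) (restrict_scalars \<phi> P)"
  by (rule lin_mapsI) (simp_all add: lin_mapsD[OF assms(1)] ring_hom_memE[OF assms(2)])

locale base_changed_module =
  fixes R :: "('r, 'm) ring_scheme" and S :: "('s, 'n) ring_scheme" and \<phi> :: "'r \<Rightarrow> 's"
    and H :: "('r, 'h, 'p) module_scheme"
  assumes cring_S: "cring S" and hom: "\<phi> \<in> ring_hom R S" and module_H: "module R H"
begin

sublocale S: cring S by (rule cring_S)
sublocale H: module R H by (rule module_H)

abbreviation "A \<equiv> algebra_via \<phi> S"
abbreviation "V \<equiv> base_change_module R S \<phi> H"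

sublocale tp: tensor_product R A H
  by (rule tensor_product.intro[OF module_algebra_via[OF H.R.is_cring cring_S hom] module_H])

abbreviation "pt \<equiv> pure_tensor R A H"

lemma V_simps [simp]:
  "carrier V = carrier tp.T" "ring.zero V = ring.zero tp.T" "add V = add tp.T"
  "monoid.mult V = monoid.mult (tensor_algebra R A H)" "one V = pt \<one>\<^bsub>S\<^esub> \<one>\<^bsub>H\<^esub>"
  by (simp_all add: base_change_module_def Let_def)

lemma module_TA: "module R (tensor_algebra R A H)"
  by (rule module_cong[OF tp.module_T]) simp_all

lemma bilin_smult: "s \<in> carrier S \<Longrightarrow> bilin R A H (tensor_algebra R A H) (\<lambda>s' h. pt (s \<otimes>\<^bsub>S\<^esub> s') h)"
proof -
  assume s: "s \<in> carrier S"
  note [simp] = ring_hom_memE[OF hom]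
  have "(\<lambda>s'. s \<otimes>\<^bsub>S\<^esub> s') \<in> lin_maps R A A"
    by (rule lin_mapsI) (use s in \<open>simp_all add: S.r_distr S.m_lcomm\<close>)
  from bilin_comp[OF tp.bilin_pure this lin_maps_id]
  show ?thesis by (simp add: bilin_def lin_maps_def)
qed

lemma V_smult: "module.smult V s = tensor_lift R A H (tensor_algebra R A H) (\<lambda>s' h. pt (s \<otimes>\<^bsub>S\<^esub> s') h)"
  by (simp add: base_change_module_def Let_def)

lemma V_smult_lin: "s \<in> carrier S \<Longrightarrow> module.smult V s \<in> lin_maps R tp.T tp.T"
  using tp.lift_lin[OF module_TA bilin_smult] by (simp add: V_smult lin_maps_def)

lemma V_smult_pure: "\<lbrakk>s \<in> carrier S; s' \<in> carrier S; h \<in> carrier H\<rbrakk> \<Longrightarrow>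
    s \<odot>\<^bsub>V\<^esub> pt s' h = pt (s \<otimes>\<^bsub>S\<^esub> s') h"
  using tp.lift_pure[OF module_TA bilin_smult] by (simp add: V_smult)

lemma pure_closed: "s \<in> carrier S \<Longrightarrow> h \<in> carrier H \<Longrightarrow> pt s h \<in> carrier V"
  by simp

lemma V_induct [consumes 1, case_names pure add]:
  assumes "U \<in> carrier V" "\<And>s h. s \<in> carrier S \<Longrightarrow> h \<in> carrier H \<Longrightarrow> Q (pt s h)"
    "\<And>U W. U \<in> carrier V \<Longrightarrow> W \<in> carrier V \<Longrightarrow> Q U \<Longrightarrow> Q W \<Longrightarrow> Q (U \<oplus>\<^bsub>V\<^esub> W)"
  shows "Q U"
  using assms tp.tensor_induct[of U Q] by simp

lemma module_V: "module S V"
proof -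
  have ag: "abelian_group V"
  proof (rule abelian_groupI, goal_cases)
    case (6 x)
    then show ?case by (intro bexI[of _ "\<ominus>\<^bsub>tp.T\<^esub> x"]) (auto simp: tp.T.M.l_neg)
  qed (simp_all add: tp.T.M.a_assoc, simp add: tp.T.M.a_comm)
  interpret V: abelian_group V by (rule ag)
  note sc = lin_maps_closed[OF V_smult_lin]
  note sa = lin_maps_add[OF V_smult_lin]
  show ?thesis
  proof (rule moduleI)
    fix a b x assume *: "a \<in> carrier S" "b \<in> carrier S" "x \<in> carrier V"
    show "(a \<oplus>\<^bsub>S\<^esub> b) \<odot>\<^bsub>V\<^esub> x = a \<odot>\<^bsub>V\<^esub> x \<oplus>\<^bsub>V\<^esub> b \<odot>\<^bsub>V\<^esub> x"
      using *(3)
    proof (induction rule: V_induct)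
      case (pure s h)
      then show ?case using * by (simp add: V_smult_pure S.l_distr tp.pure_add_left[simplified])
    next
      case (add U W)
      then show ?case using * by (simp add: sa sc tp.T.M.a_ac)
    qed
    show "(a \<otimes>\<^bsub>S\<^esub> b) \<odot>\<^bsub>V\<^esub> x = a \<odot>\<^bsub>V\<^esub> (b \<odot>\<^bsub>V\<^esub> x)"
      using *(3)
    proof (induction rule: V_induct)
      case (pure s h)
      then show ?case using * by (simp add: V_smult_pure S.m_assoc)
    next
      case (add U W)
      then show ?case using * by (simp add: sa sc)
    qed
  next
    fix x assume "x \<in> carrier V"
    then show "\<one>\<^bsub>S\<^esub> \<odot>\<^bsub>V\<^esub> x = x"
    proof (induction rule: V_induct)
      case (pure s h)
      then show ?case by (simp add: V_smult_pure)
    next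
      case (add U W)
      then show ?case by (simp add: sa sc)
    qed
  qed (simp_all add: cring_S ag sa sc)
qed

sublocale V: module S V by (rule module_V)

lemma pure_as_smult: "s \<in> carrier S \<Longrightarrow> h \<in> carrier H \<Longrightarrow> pt s h = s \<odot>\<^bsub>V\<^esub> pt \<one>\<^bsub>S\<^esub> h"
  by (simp add: V_smult_pure)

lemma V_scalar: "r \<in> carrier R \<Longrightarrow> U \<in> carrier V \<Longrightarrow> \<phi> r \<odot>\<^bsub>V\<^esub> U = r \<odot>\<^bsub>tp.T\<^esub> U"
proof -
  assume r: "r \<in> carrier R" and "U \<in> carrier V"
  have \<phi>: "\<phi> r \<in> carrier S" using ring_hom_memE(1)[OF hom r] .
  show ?thesis using \<open>U \<in> carrier V\<close>
  proof (induction rule: V_induct)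
    case (pure s h)
    then show ?case using tp.pure_smult_left[of h r s] r \<phi> by (simp add: V_smult_pure)
  next
    case (add U W)
    then show ?case using r \<phi> lin_maps_add[OF V_smult_lin[OF \<phi>], of U W]
      by (simp add: tp.T.smult_r_distr)
  qed
qed

lemma one_tensor_lin: "(\<lambda>h. pt \<one>\<^bsub>S\<^esub> h) \<in> lin_maps R H (restrict_scalars \<phi> V)"
  by (rule lin_mapsI) (simp_all add: tp.pure_add_right tp.pure_smult_right V_scalar[simplified])

lemma lin_maps_V_eqI:
  assumes "f \<in> lin_maps S V P" "g \<in> lin_maps S V P" "U \<in> carrier V"
    "\<And>h. h \<in> carrier H \<Longrightarrow> f (pt \<one>\<^bsub>S\<^esub> h) = g (pt \<one>\<^bsub>S\<^esub> h)"
  shows "f U = g U"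
  using assms(3)
proof (induction rule: V_induct)
  case (pure s h)
  then show ?case unfolding pure_as_smult[OF pure]
    by (simp add: lin_maps_smult[OF assms(1)] lin_maps_smult[OF assms(2)] assms(4) del: V_simps add: pure_closed)
next
  case (add U W)
  then show ?case by (simp add: lin_maps_add[OF assms(1)] lin_maps_add[OF assms(2)] del: V_simps)
qed

text \<open>A linear map from \<open>H\<close> to an \<open>S\<close>-module extends to \<open>S \<otimes>\<^sub>R H\<close>; by \<open>lin_maps_V_eqI\<close> in exactly one way.\<close>

context
  fixes P :: "('s, 'c, 'q) module_scheme" and g
  assumes module_P: "module S P" and g: "g \<in> lin_maps R H (restrict_scalars \<phi> P)"
begin

interpretation P: module S P by (rule module_P)

lemma module_restrict_P: "module R (restrict_scalars \<phi> P)"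
  by (rule module_restrict_scalars[OF H.R.is_cring module_P hom])

lemma bilin_extend: "bilin R A H (restrict_scalars \<phi> P) (\<lambda>s h. s \<odot>\<^bsub>P\<^esub> g h)"
proof -
  note [simp] = ring_hom_memE[OF hom]
  note [simp] = lin_mapsD[OF g, simplified]
  show ?thesis
    by (rule bilinI)
      (simp_all add: P.smult_l_distr P.smult_r_distr P.smult_assoc1[symmetric] S.m_comm)
qed

lemma extend_pure: "s \<in> carrier S \<Longrightarrow> h \<in> carrier H \<Longrightarrow>
    tensor_lift R A H (restrict_scalars \<phi> P) (\<lambda>s h. s \<odot>\<^bsub>P\<^esub> g h) (pt s h) = s \<odot>\<^bsub>P\<^esub> g h"
  using tp.lift_pure[OF module_restrict_P bilin_extend] by simp

lemma extend_lin: "tensor_lift R A H (restrict_scalars \<phi> P) (\<lambda>s h. s \<odot>\<^bsub>P\<^esub> g h) \<in> lin_maps S V P"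
  (is "?f \<in> _")
proof -
  have f: "?f \<in> lin_maps R tp.T (restrict_scalars \<phi> P)"
    by (rule tp.lift_lin[OF module_restrict_P bilin_extend])
  note [simp] = lin_mapsD[OF f, simplified]
  note [simp] = lin_mapsD[OF g, simplified]
  show ?thesis
  proof (rule lin_mapsI)
    fix s U assume s: "s \<in> carrier S" and "U \<in> carrier V"
    show "?f (s \<odot>\<^bsub>V\<^esub> U) = s \<odot>\<^bsub>P\<^esub> ?f U" using \<open>U \<in> carrier V\<close>
    proof (induction rule: V_induct)
      case (pure s' h)
      then show ?case using s
        by (simp add: V_smult_pure extend_pure P.smult_assoc1)
    next
      case (add U W)
      have "s \<odot>\<^bsub>V\<^esub> U \<in> carrier V" "s \<odot>\<^bsub>V\<^esub> W \<in> carrier V" using V.smult_closed[OF s] add(1,2) by blast+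
      then show ?case using add s V.smult_r_distr[OF s add(1,2)] by (simp add: P.smult_r_distr)
    qed
  qed simp_all
qed

end

end



section \<open>Finite sums\<close>

lemma finsum_structure_cong:
  assumes "carrier P = carrier Q" "add P = add Q" "ring.zero P = ring.zero Q"
  shows "finsum P f I = finsum Q f I"
  using assms by (simp add: finsum_def finprod_def)

lemma finsum_algebra_via: "finsum (algebra_via \<phi> S) f I = finsum S f I"
  by (rule finsum_structure_cong) simp_all

lemma (in abelian_monoid) finsum_swap:
  assumes "finite A" "finite B" "\<And>a b. a \<in> A \<Longrightarrow> b \<in> B \<Longrightarrow> f a b \<in> carrier G"
  shows "(\<Oplus>a\<in>A. \<Oplus>b\<in>B. f a b) = (\<Oplus>b\<in>B. \<Oplus>a\<in>A. f a b)"
  using assms(1,3)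
proof (induction A rule: finite_induct)
  case empty
  then show ?case by (simp add: finsum_zero)
next
  case (insert x F)
  have "(\<Oplus>a\<in>insert x F. \<Oplus>b\<in>B. f a b) = (\<Oplus>b\<in>B. f x b) \<oplus> (\<Oplus>a\<in>F. \<Oplus>b\<in>B. f a b)"
    using insert by (intro finsum_insert) (auto intro!: finsum_closed)
  also have "\<dots> = (\<Oplus>b\<in>B. f x b) \<oplus> (\<Oplus>b\<in>B. \<Oplus>a\<in>F. f a b)"
    using insert by simp
  also have "\<dots> = (\<Oplus>b\<in>B. f x b \<oplus> (\<Oplus>a\<in>F. f a b))"
    using insert by (intro finsum_addf[symmetric]) (auto intro!: finsum_closed)
  also have "\<dots> = (\<Oplus>b\<in>B. \<Oplus>a\<in>insert x F. f a b)"
    using insert by (intro finsum_cong') (auto intro!: finsum_closed simp: finsum_insert Pi_def)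
  finally show ?case .
qed

lemma (in abelian_monoid) finsum_lessThan_add:
  fixes n m :: nat
  assumes "\<And>k. k < n + m \<Longrightarrow> f k \<in> carrier G"
  shows "(\<Oplus>k\<in>{..<n + m}. f k) = (\<Oplus>k\<in>{..<n}. f k) \<oplus> (\<Oplus>k\<in>{..<m}. f (n + k))"
  using assms
proof (induction m)
  case 0
  then show ?case by (simp add: Pi_def)
next
  case (Suc m)
  then show ?case
    by (simp add: lessThan_Suc Pi_def a_ac)
qed

lemma (in abelian_monoid) finsum_delta:
  assumes "finite A" "i \<in> A" "f i \<in> carrier G"
  shows "(\<Oplus>j\<in>A. if j = i then f j else \<zero>) = f i"
proof -
  have "(\<Oplus>j\<in>A. if j = i then f j else \<zero>) = (\<Oplus>j\<in>A. if j = i then f i else \<zero>)"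
    using assms by (intro finsum_cong') auto
  also have "\<dots> = f i"
    using add.finprod_singleton_swap[of i A "\<lambda>_. f i"] assms by simp
  finally show ?thesis .
qed

lemma lin_maps_finsumf:
  assumes "module R M" "module R N" "\<And>i. i \<in> I \<Longrightarrow> f i \<in> lin_maps R M N"
  shows "(\<lambda>x. \<Oplus>\<^bsub>N\<^esub>i\<in>I. f i x) \<in> lin_maps R M N"
proof -
  interpret M: module R M by fact
  interpret N: module R N by fact
  show ?thesis
    using assms(3)
  proof (induction I rule: infinite_finite_induct)
    case (insert i F)
    have "(\<lambda>x. f i x \<oplus>\<^bsub>N\<^esub> (\<Oplus>\<^bsub>N\<^esub>i\<in>F. f i x)) \<in> lin_maps R M N"
      using insert by (intro lin_maps_addf[OF assms(2)]) auto
    moreover have "(\<Oplus>\<^bsub>N\<^esub>i\<in>insert i F. f i x) = f i x \<oplus>\<^bsub>N\<^esub> (\<Oplus>\<^bsub>N\<^esub>i\<in>F. f i x)"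
      if "x \<in> carrier M" for x
      using insert that by (intro N.M.finsum_insert) (auto intro: lin_maps_closed)
    ultimately show ?case by (auto simp: lin_maps_def)
  qed (auto intro!: lin_mapsI)
qed


section \<open>Dual bases from separation\<close>

text \<open>
  The family takes the place of a basis of \<open>L\<close> over the fixed field together with its dual basis for
  the trace form. One automorphism \<open>\<psi>\<close> at a time, the element \<open>\<Sum> e k \<otimes> u k\<close> of \<open>S \<otimes> S\<close> is multiplied by
  one that \<open>y \<otimes> z \<mapsto> y * z\<close> sends to \<open>1\<close> and \<open>y \<otimes> z \<mapsto> y * \<psi> z\<close> to \<open>0\<close>.
  With \<open>S = L\<close> the result gives descent from \<open>L\<close>; with a smaller \<open>S\<close> it will show that \<open>S\<close> is all of \<open>L\<close>.
\<close>

lemma exists_dual_family: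
  assumes "field L" "subfield S L" "finite Y" "Y \<subseteq> ring_hom L L"
    and "\<And>\<psi>. \<psi> \<in> Y \<Longrightarrow> \<exists>x\<in>S. \<psi> x \<in> S \<and> \<psi> x \<noteq> x"
  shows "\<exists>(n::nat) e u. e \<in> {..<n} \<rightarrow> S \<and> u \<in> {..<n} \<rightarrow> S \<and>
    (\<Oplus>\<^bsub>L\<^esub>k\<in>{..<n}. e k \<otimes>\<^bsub>L\<^esub> u k) = \<one>\<^bsub>L\<^esub> \<and>
    (\<forall>\<psi>\<in>Y. (\<Oplus>\<^bsub>L\<^esub>k\<in>{..<n}. e k \<otimes>\<^bsub>L\<^esub> \<psi> (u k)) = \<zero>\<^bsub>L\<^esub>)"
  using assms(3-5)
proof (induction Y rule: finite_induct)
  case empty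
  interpret L: field L by fact
  have "\<one>\<^bsub>L\<^esub> \<in> S" by (rule subringE(3)[OF subfieldE(1)[OF assms(2)]])
  then show ?case
    by (intro exI[of _ "1::nat"] exI[of _ "\<lambda>_. \<one>\<^bsub>L\<^esub>"]) (auto simp: lessThan_Suc)
next
  case (insert \<psi> Y)
  interpret L: field L by fact
  note S = subringE[OF subfieldE(1)[OF assms(2)]]
  obtain n :: nat and e u where
    eu: "e \<in> {..<n} \<rightarrow> S" "u \<in> {..<n} \<rightarrow> S"
      "(\<Oplus>\<^bsub>L\<^esub>k\<in>{..<n}. e k \<otimes>\<^bsub>L\<^esub> u k) = \<one>\<^bsub>L\<^esub>"
      "\<And>\<chi>. \<chi> \<in> Y \<Longrightarrow> (\<Oplus>\<^bsub>L\<^esub>k\<in>{..<n}. e k \<otimes>\<^bsub>L\<^esub> \<chi> (u k)) = \<zero>\<^bsub>L\<^esub>"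
    using insert by auto
  obtain x where x: "x \<in> S" "\<psi> x \<in> S" "\<psi> x \<noteq> x" using insert by blast
  note SL = subsetD[OF S(1)]
  let ?d = "x \<ominus>\<^bsub>L\<^esub> \<psi> x"
  have xL: "x \<in> carrier L" "\<psi> x \<in> carrier L" using x SL by auto
  have d0: "?d \<noteq> \<zero>\<^bsub>L\<^esub>" using x(3) xL by (simp add: L.r_right_minus_eq)
  have dS: "?d \<in> S" unfolding a_minus_def using x S by auto
  define c where "c = inv\<^bsub>L\<^esub> ?d"
  have c: "c \<in> S" "?d \<otimes>\<^bsub>L\<^esub> c = \<one>\<^bsub>L\<^esub>"
    using L.subfield_m_inv[OF assms(2), of ?d] d0 dS by (auto simp: c_def)
  have cL: "c \<in> carrier L" using c SL by auto
  define c' where "c' = \<ominus>\<^bsub>L\<^esub> (c \<otimes>\<^bsub>L\<^esub> \<psi> x)"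
  have c'S: "c' \<in> S" unfolding c'_def using S c x by auto
  have c'L: "c' \<in> carrier L" using c'S SL by auto
  \<comment> \<open>The new factor is \<open>c \<otimes> x + c' \<otimes> 1\<close>. A homomorphism \<open>\<chi>\<close> turns it into \<open>(\<chi> x - \<psi> x) / (x - \<psi> x)\<close>,
    which is \<open>1\<close> for the identity and \<open>0\<close> for \<open>\<psi>\<close>.\<close>
  define e' where "e' k = (if k < n then e k \<otimes>\<^bsub>L\<^esub> c else e (k - n) \<otimes>\<^bsub>L\<^esub> c')" for k
  define u' where "u' k = (if k < n then u k \<otimes>\<^bsub>L\<^esub> x else u (k - n))" for k
  have eL: "\<And>k. k < n \<Longrightarrow> e k \<in> carrier L" "\<And>k. k < n \<Longrightarrow> u k \<in> carrier L"
    using eu(1,2) SL by (auto simp: Pi_def)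
  have sum: "(\<Oplus>\<^bsub>L\<^esub>k\<in>{..<n + n}. e' k \<otimes>\<^bsub>L\<^esub> \<chi> (u' k)) =
      (\<Oplus>\<^bsub>L\<^esub>k\<in>{..<n}. e k \<otimes>\<^bsub>L\<^esub> \<chi> (u k)) \<otimes>\<^bsub>L\<^esub> (c \<otimes>\<^bsub>L\<^esub> \<chi> x \<oplus>\<^bsub>L\<^esub> c')"
    if \<chi>: "\<chi> \<in> ring_hom L L" for \<chi>
  proof -
    note h = ring_hom_memE[OF \<chi>]
    have cl: "\<And>k. k < n \<Longrightarrow> e k \<otimes>\<^bsub>L\<^esub> \<chi> (u k) \<in> carrier L" using eL h by auto
    have "(\<Oplus>\<^bsub>L\<^esub>k\<in>{..<n + n}. e' k \<otimes>\<^bsub>L\<^esub> \<chi> (u' k)) =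
      (\<Oplus>\<^bsub>L\<^esub>k\<in>{..<n}. e' k \<otimes>\<^bsub>L\<^esub> \<chi> (u' k)) \<oplus>\<^bsub>L\<^esub> (\<Oplus>\<^bsub>L\<^esub>k\<in>{..<n}. e' (n + k) \<otimes>\<^bsub>L\<^esub> \<chi> (u' (n + k)))"
      by (rule L.finsum_lessThan_add)
        (use eL h cL c'L xL in \<open>auto simp: e'_def u'_def\<close>)
    also have "(\<Oplus>\<^bsub>L\<^esub>k\<in>{..<n}. e' k \<otimes>\<^bsub>L\<^esub> \<chi> (u' k)) =
        (\<Oplus>\<^bsub>L\<^esub>k\<in>{..<n}. (e k \<otimes>\<^bsub>L\<^esub> \<chi> (u k)) \<otimes>\<^bsub>L\<^esub> (c \<otimes>\<^bsub>L\<^esub> \<chi> x))"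
      using eL h cL xL by (intro L.finsum_cong') (auto simp: e'_def u'_def L.m_ac)
    also have "(\<Oplus>\<^bsub>L\<^esub>k\<in>{..<n}. e' (n + k) \<otimes>\<^bsub>L\<^esub> \<chi> (u' (n + k))) =
        (\<Oplus>\<^bsub>L\<^esub>k\<in>{..<n}. (e k \<otimes>\<^bsub>L\<^esub> \<chi> (u k)) \<otimes>\<^bsub>L\<^esub> c')"
      using eL h c'L by (intro L.finsum_cong') (auto simp: e'_def u'_def L.m_ac)
    finally show ?thesis
      using cl cL c'L h xL L.finsum_closed[of "\<lambda>k. e k \<otimes>\<^bsub>L\<^esub> \<chi> (u k)" "{..<n}"]
      by (simp add: L.finsum_ldistr[symmetric] Pi_def L.r_distr)
  qed
  have "e' \<in> {..<n + n} \<rightarrow> S" "u' \<in> {..<n + n} \<rightarrow> S"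
    using eu(1,2) S c c'S x by (auto simp: e'_def u'_def Pi_def)
  moreover have "(\<Oplus>\<^bsub>L\<^esub>k\<in>{..<n + n}. e' k \<otimes>\<^bsub>L\<^esub> u' k) = \<one>\<^bsub>L\<^esub>"
  proof -
    have "(\<lambda>y. y) \<in> ring_hom L L" by (auto simp: ring_hom_def)
    from sum[OF this] have "(\<Oplus>\<^bsub>L\<^esub>k\<in>{..<n + n}. e' k \<otimes>\<^bsub>L\<^esub> u' k) = c \<otimes>\<^bsub>L\<^esub> x \<oplus>\<^bsub>L\<^esub> c'"
      using eu(3) cL c'L xL by simp
    also have "\<dots> = ?d \<otimes>\<^bsub>L\<^esub> c"
      using cL xL by (simp add: c'_def a_minus_def L.r_distr L.m_comm[of _ c] L.r_minus)
    finally show ?thesis using c by simp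
  qed
  moreover have "(\<Oplus>\<^bsub>L\<^esub>k\<in>{..<n + n}. e' k \<otimes>\<^bsub>L\<^esub> \<chi> (u' k)) = \<zero>\<^bsub>L\<^esub>" if "\<chi> \<in> insert \<psi> Y" for \<chi>
  proof -
    have \<chi>: "\<chi> \<in> ring_hom L L" using that insert by auto
    note h = ring_hom_memE[OF \<chi>]
    have cl: "(\<Oplus>\<^bsub>L\<^esub>k\<in>{..<n}. e k \<otimes>\<^bsub>L\<^esub> \<chi> (u k)) \<in> carrier L"
      using eL h by (intro L.finsum_closed) auto
    show ?thesis
    proof (cases "\<chi> = \<psi>")
      case True
      then show ?thesis unfolding sum[OF \<chi>] using cl cL xL by (simp add: c'_def L.r_neg)
    next
      case False
      then show ?thesis unfolding sum[OF \<chi>] using eu(4) that cL c'L h xL by simp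
    qed
  qed
  ultimately show ?case by blast
qed


section \<open>Group algebras\<close>

lemma group_algebra_simps [simp]:
  "carrier (group_algebra L N) = carrier N \<rightarrow>\<^sub>E carrier L"
  "ring.zero (group_algebra L N) = (\<lambda>n\<in>carrier N. \<zero>\<^bsub>L\<^esub>)"
  "f \<oplus>\<^bsub>group_algebra L N\<^esub> g = (\<lambda>n\<in>carrier N. f n \<oplus>\<^bsub>L\<^esub> g n)"
  "r \<odot>\<^bsub>group_algebra L N\<^esub> f = (\<lambda>n\<in>carrier N. r \<otimes>\<^bsub>L\<^esub> f n)"
  "one (group_algebra L N) = (\<lambda>n\<in>carrier N. if n = \<one>\<^bsub>N\<^esub> then \<one>\<^bsub>L\<^esub> else \<zero>\<^bsub>L\<^esub>)"
  "f \<otimes>\<^bsub>group_algebra L N\<^esub> g =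
    (\<lambda>n\<in>carrier N. \<Oplus>\<^bsub>L\<^esub>m\<in>carrier N. f m \<otimes>\<^bsub>L\<^esub> g (inv\<^bsub>N\<^esub> m \<otimes>\<^bsub>N\<^esub> n))"
  by (simp_all add: group_algebra_def)

lemma group_hopf_fields:
  "carrier (group_hopf L N) = carrier (group_algebra L N)"
  "monoid.mult (group_hopf L N) = monoid.mult (group_algebra L N)"
  "one (group_hopf L N) = one (group_algebra L N)"
  "ring.zero (group_hopf L N) = ring.zero (group_algebra L N)"
  "add (group_hopf L N) = add (group_algebra L N)"
  "module.smult (group_hopf L N) = module.smult (group_algebra L N)"
  "counit (group_hopf L N) f = (\<Oplus>\<^bsub>L\<^esub>n\<in>carrier N. f n)"
  "antipode (group_hopf L N) f = (\<lambda>n\<in>carrier N. f (inv\<^bsub>N\<^esub> n))"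
  "comul (group_hopf L N) f = (\<Oplus>\<^bsub>tensor_module L (group_algebra L N) (group_algebra L N)\<^esub>n\<in>carrier N.
     f n \<odot>\<^bsub>tensor_module L (group_algebra L N) (group_algebra L N)\<^esub>
     pure_tensor L (group_algebra L N) (group_algebra L N) (group_elt L N n) (group_elt L N n))"
  by (simp_all add: group_hopf_def Let_def module.defs)

locale finite_group_algebra =
  fixes L :: "('r, 'm) ring_scheme" and N :: "('n, 'k) monoid_scheme"
  assumes cring_L: "cring L" and group_N: "group N" and finite_N: "finite (carrier N)"
begin

sublocale L: cring L by (rule cring_L)
sublocale N: group N by (rule group_N)

abbreviation "GA \<equiv> group_algebra L N"
abbreviation "el \<equiv> group_elt L N"
abbreviation "L1 \<equiv> algebra_via (\<lambda>x. x) L"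

lemma GA_mem: "f \<in> carrier GA \<Longrightarrow> n \<in> carrier N \<Longrightarrow> f n \<in> carrier L"
  by (auto simp: PiE_mem)

lemma GA_eqI: "\<lbrakk>f \<in> carrier GA; g \<in> carrier GA; \<And>n. n \<in> carrier N \<Longrightarrow> f n = g n\<rbrakk> \<Longrightarrow> f = g"
  by (auto intro: PiE_ext)

lemma module_GA: "module L GA"
proof -
  have ag: "abelian_group GA"
  proof (rule abelian_groupI, goal_cases)
    case (1 x y)
    note [simp] = GA_mem[OF 1(1)] GA_mem[OF 1(2)]
    show ?case by simp
  next
    case (3 x y z)
    note [simp] = GA_mem[OF 3(1)] GA_mem[OF 3(2)] GA_mem[OF 3(3)]
    show ?case by (auto simp: L.a_assoc)
  next
    case (4 x y)
    note [simp] = GA_mem[OF 4(1)] GA_mem[OF 4(2)]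
    show ?case by (auto simp: L.a_comm)
  next
    case (5 x)
    note [simp] = GA_mem[OF 5]
    show ?case by (rule GA_eqI[OF _ 5]) simp_all
  next
    case (6 x)
    note [simp] = GA_mem[OF 6]
    show ?case by (rule bexI[of _ "\<lambda>n\<in>carrier N. \<ominus>\<^bsub>L\<^esub> x n"]) (auto simp: L.l_neg)
  qed simp
  show ?thesis
  proof (rule moduleI[OF cring_L ag], goal_cases)
    case (1 a x)
    note [simp] = 1(1) GA_mem[OF 1(2)]
    show ?case by simp
  next
    case (2 a b x)
    note [simp] = 2(1,2) GA_mem[OF 2(3)]
    show ?case by (auto simp: L.l_distr)
  next
    case (3 a x y)
    note [simp] = 3(1) GA_mem[OF 3(2)] GA_mem[OF 3(3)]
    show ?case by (auto simp: L.r_distr)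
  next
    case (4 a b x)
    note [simp] = 4(1,2) GA_mem[OF 4(3)]
    show ?case by (auto simp: L.m_assoc)
  next
    case (5 x)
    note [simp] = GA_mem[OF 5]
    show ?case by (rule GA_eqI[OF _ 5]) simp_all
  qed
qed

sublocale GA: module L GA by (rule module_GA)

lemma module_L1: "module L L1"
  by (rule module_algebra_via[OF cring_L cring_L]) (auto simp: ring_hom_def)

lemma eval_lin: "n \<in> carrier N \<Longrightarrow> (\<lambda>f. f n) \<in> lin_maps L GA L1"
  by (rule lin_mapsI) (auto simp: PiE_mem)

lemma GA_finsum_eval:
  assumes "F \<in> I \<rightarrow> carrier GA" "n \<in> carrier N"
  shows "(\<Oplus>\<^bsub>GA\<^esub>i\<in>I. F i) n = (\<Oplus>\<^bsub>L\<^esub>i\<in>I. F i n)"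
  using lin_maps_finsum[OF module_GA module_L1 eval_lin[OF assms(2)] assms(1)]
  by (simp add: finsum_algebra_via)

lemma el_closed [simp]: "el n \<in> carrier GA"
  by (simp add: group_elt_def)

lemma el_apply: "m \<in> carrier N \<Longrightarrow> el n m = (if m = n then \<one>\<^bsub>L\<^esub> else \<zero>\<^bsub>L\<^esub>)"
  by (simp add: group_elt_def)

lemma L_sum_delta:
  assumes "n \<in> carrier N" "f n \<in> carrier L"
  shows "(\<Oplus>\<^bsub>L\<^esub>m\<in>carrier N. if m = n then f m else \<zero>\<^bsub>L\<^esub>) = f n"
  using L.finsum_delta[OF finite_N, of n f] assms by simp

lemma GA_expand:
  assumes "f \<in> carrier GA"
  shows "f = (\<Oplus>\<^bsub>GA\<^esub>n\<in>carrier N. f n \<odot>\<^bsub>GA\<^esub> el n)"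
proof (rule GA_eqI[OF assms])
  have cl: "(\<lambda>n. f n \<odot>\<^bsub>GA\<^esub> el n) \<in> carrier N \<rightarrow> carrier GA"
    using GA_mem[OF assms] GA.smult_closed[OF _ el_closed] by blast
  show "(\<Oplus>\<^bsub>GA\<^esub>n\<in>carrier N. f n \<odot>\<^bsub>GA\<^esub> el n) \<in> carrier GA"
    by (rule GA.M.finsum_closed[OF cl])
  fix m assume m: "m \<in> carrier N"
  have "(\<Oplus>\<^bsub>GA\<^esub>n\<in>carrier N. f n \<odot>\<^bsub>GA\<^esub> el n) m = (\<Oplus>\<^bsub>L\<^esub>n\<in>carrier N. (f n \<odot>\<^bsub>GA\<^esub> el n) m)"
    by (rule GA_finsum_eval[OF cl m])
  also have "\<dots> = (\<Oplus>\<^bsub>L\<^esub>n\<in>carrier N. if n = m then f n else \<zero>\<^bsub>L\<^esub>)"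
    using m GA_mem[OF assms] by (intro L.finsum_cong') (auto simp: el_apply)
  also have "\<dots> = f m" using m GA_mem[OF assms] by (intro L_sum_delta) auto
  finally show "f m = (\<Oplus>\<^bsub>GA\<^esub>n\<in>carrier N. f n \<odot>\<^bsub>GA\<^esub> el n) m" by simp
qed

lemma bilin_GA_mult: "bilin L GA GA GA (monoid.mult GA)"
proof (rule bilinI, goal_cases)
  case (1 a b)
  note [simp] = GA_mem[OF 1(1)] GA_mem[OF 1(2)]
  then show ?case by (auto intro!: L.finsum_closed)
next
  case (2 a a' b)
  note [simp] = GA_mem[OF 2(1)] GA_mem[OF 2(2)] GA_mem[OF 2(3)]
  have "(\<Oplus>\<^bsub>L\<^esub>m\<in>carrier N. (a m \<oplus>\<^bsub>L\<^esub> a' m) \<otimes>\<^bsub>L\<^esub> b (inv\<^bsub>N\<^esub> m \<otimes>\<^bsub>N\<^esub> n)) =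
      (\<Oplus>\<^bsub>L\<^esub>m\<in>carrier N. a m \<otimes>\<^bsub>L\<^esub> b (inv\<^bsub>N\<^esub> m \<otimes>\<^bsub>N\<^esub> n)) \<oplus>\<^bsub>L\<^esub>
      (\<Oplus>\<^bsub>L\<^esub>m\<in>carrier N. a' m \<otimes>\<^bsub>L\<^esub> b (inv\<^bsub>N\<^esub> m \<otimes>\<^bsub>N\<^esub> n))" if "n \<in> carrier N" for n
  proof -
    have "(\<Oplus>\<^bsub>L\<^esub>m\<in>carrier N. (a m \<oplus>\<^bsub>L\<^esub> a' m) \<otimes>\<^bsub>L\<^esub> b (inv\<^bsub>N\<^esub> m \<otimes>\<^bsub>N\<^esub> n)) =
      (\<Oplus>\<^bsub>L\<^esub>m\<in>carrier N. a m \<otimes>\<^bsub>L\<^esub> b (inv\<^bsub>N\<^esub> m \<otimes>\<^bsub>N\<^esub> n) \<oplus>\<^bsub>L\<^esub> a' m \<otimes>\<^bsub>L\<^esub> b (inv\<^bsub>N\<^esub> m \<otimes>\<^bsub>N\<^esub> n))"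
      using that by (intro L.finsum_cong') (auto simp: L.l_distr)
    also have "\<dots> = (\<Oplus>\<^bsub>L\<^esub>m\<in>carrier N. a m \<otimes>\<^bsub>L\<^esub> b (inv\<^bsub>N\<^esub> m \<otimes>\<^bsub>N\<^esub> n)) \<oplus>\<^bsub>L\<^esub>
      (\<Oplus>\<^bsub>L\<^esub>m\<in>carrier N. a' m \<otimes>\<^bsub>L\<^esub> b (inv\<^bsub>N\<^esub> m \<otimes>\<^bsub>N\<^esub> n))"
      using that by (intro L.finsum_addf) auto
    finally show ?thesis .
  qed
  moreover have "(\<Oplus>\<^bsub>L\<^esub>m\<in>carrier N. (a \<oplus>\<^bsub>GA\<^esub> a') m \<otimes>\<^bsub>L\<^esub> b (inv\<^bsub>N\<^esub> m \<otimes>\<^bsub>N\<^esub> n)) =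
    (\<Oplus>\<^bsub>L\<^esub>m\<in>carrier N. (a m \<oplus>\<^bsub>L\<^esub> a' m) \<otimes>\<^bsub>L\<^esub> b (inv\<^bsub>N\<^esub> m \<otimes>\<^bsub>N\<^esub> n))" if "n \<in> carrier N" for n
    using 2 that by (intro L.finsum_cong') auto
  ultimately show ?case by (auto simp: fun_eq_iff)
next
  case (3 a b b')
  note [simp] = GA_mem[OF 3(1)] GA_mem[OF 3(2)] GA_mem[OF 3(3)]
  have "(\<Oplus>\<^bsub>L\<^esub>m\<in>carrier N. a m \<otimes>\<^bsub>L\<^esub> (b (inv\<^bsub>N\<^esub> m \<otimes>\<^bsub>N\<^esub> n) \<oplus>\<^bsub>L\<^esub> b' (inv\<^bsub>N\<^esub> m \<otimes>\<^bsub>N\<^esub> n))) =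
      (\<Oplus>\<^bsub>L\<^esub>m\<in>carrier N. a m \<otimes>\<^bsub>L\<^esub> b (inv\<^bsub>N\<^esub> m \<otimes>\<^bsub>N\<^esub> n)) \<oplus>\<^bsub>L\<^esub>
      (\<Oplus>\<^bsub>L\<^esub>m\<in>carrier N. a m \<otimes>\<^bsub>L\<^esub> b' (inv\<^bsub>N\<^esub> m \<otimes>\<^bsub>N\<^esub> n))" if "n \<in> carrier N" for n
  proof -
    have "(\<Oplus>\<^bsub>L\<^esub>m\<in>carrier N. a m \<otimes>\<^bsub>L\<^esub> (b (inv\<^bsub>N\<^esub> m \<otimes>\<^bsub>N\<^esub> n) \<oplus>\<^bsub>L\<^esub> b' (inv\<^bsub>N\<^esub> m \<otimes>\<^bsub>N\<^esub> n))) =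
      (\<Oplus>\<^bsub>L\<^esub>m\<in>carrier N. a m \<otimes>\<^bsub>L\<^esub> b (inv\<^bsub>N\<^esub> m \<otimes>\<^bsub>N\<^esub> n) \<oplus>\<^bsub>L\<^esub> a m \<otimes>\<^bsub>L\<^esub> b' (inv\<^bsub>N\<^esub> m \<otimes>\<^bsub>N\<^esub> n))"
      using that by (intro L.finsum_cong') (auto simp: L.r_distr)
    also have "\<dots> = (\<Oplus>\<^bsub>L\<^esub>m\<in>carrier N. a m \<otimes>\<^bsub>L\<^esub> b (inv\<^bsub>N\<^esub> m \<otimes>\<^bsub>N\<^esub> n)) \<oplus>\<^bsub>L\<^esub>
      (\<Oplus>\<^bsub>L\<^esub>m\<in>carrier N. a m \<otimes>\<^bsub>L\<^esub> b' (inv\<^bsub>N\<^esub> m \<otimes>\<^bsub>N\<^esub> n))"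
      using that by (intro L.finsum_addf) auto
    finally show ?thesis .
  qed
  moreover have "(\<Oplus>\<^bsub>L\<^esub>m\<in>carrier N. a m \<otimes>\<^bsub>L\<^esub> (b \<oplus>\<^bsub>GA\<^esub> b') (inv\<^bsub>N\<^esub> m \<otimes>\<^bsub>N\<^esub> n)) =
    (\<Oplus>\<^bsub>L\<^esub>m\<in>carrier N. a m \<otimes>\<^bsub>L\<^esub> (b (inv\<^bsub>N\<^esub> m \<otimes>\<^bsub>N\<^esub> n) \<oplus>\<^bsub>L\<^esub> b' (inv\<^bsub>N\<^esub> m \<otimes>\<^bsub>N\<^esub> n)))" if "n \<in> carrier N" for n
    using 3 that by (intro L.finsum_cong') auto
  ultimately show ?case by (auto simp: fun_eq_iff)
next
  case (4 r a b)
  note [simp] = GA_mem[OF 4(2)] GA_mem[OF 4(3)]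
  have "(\<Oplus>\<^bsub>L\<^esub>m\<in>carrier N. (r \<odot>\<^bsub>GA\<^esub> a) m \<otimes>\<^bsub>L\<^esub> b (inv\<^bsub>N\<^esub> m \<otimes>\<^bsub>N\<^esub> n)) =
      r \<otimes>\<^bsub>L\<^esub> (\<Oplus>\<^bsub>L\<^esub>m\<in>carrier N. a m \<otimes>\<^bsub>L\<^esub> b (inv\<^bsub>N\<^esub> m \<otimes>\<^bsub>N\<^esub> n))" if "n \<in> carrier N" for n
    using 4 that
    by (subst L.finsum_rdistr[OF finite_N]) (auto simp: L.m_assoc intro!: L.finsum_cong')
  then show ?case by (auto simp: fun_eq_iff)
next
  case (5 r a b)
  note [simp] = GA_mem[OF 5(2)] GA_mem[OF 5(3)]
  have "(\<Oplus>\<^bsub>L\<^esub>m\<in>carrier N. a m \<otimes>\<^bsub>L\<^esub> (r \<odot>\<^bsub>GA\<^esub> b) (inv\<^bsub>N\<^esub> m \<otimes>\<^bsub>N\<^esub> n)) =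
      r \<otimes>\<^bsub>L\<^esub> (\<Oplus>\<^bsub>L\<^esub>m\<in>carrier N. a m \<otimes>\<^bsub>L\<^esub> b (inv\<^bsub>N\<^esub> m \<otimes>\<^bsub>N\<^esub> n))" if "n \<in> carrier N" for n
    using 5 that
    by (subst L.finsum_rdistr[OF finite_N]) (auto simp: L.m_lcomm intro!: L.finsum_cong')
  then show ?case by (auto simp: fun_eq_iff)
qed

lemma semilinear_map_apply:
  assumes "f \<in> carrier GA" "\<rho> \<in> carrier L \<rightarrow> carrier L" "bij_betw \<alpha> (carrier N) (carrier N)" "n \<in> carrier N"
  shows "semilinear_map L N \<rho> \<alpha> f (\<alpha> n) = \<rho> (f n)"
proof -
  have a: "\<And>m. m \<in> carrier N \<Longrightarrow> \<alpha> m \<in> carrier N" using assms(3) by (auto simp: bij_betw_def)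
  have inj: "\<And>m. m \<in> carrier N \<Longrightarrow> \<alpha> m = \<alpha> n \<longleftrightarrow> m = n"
    using assms(3,4) by (auto simp: bij_betw_def inj_on_def)
  have inj': "\<And>m. m \<in> carrier N \<Longrightarrow> \<alpha> n = \<alpha> m \<longleftrightarrow> m = n" using inj by metis
  have r: "\<And>m. m \<in> carrier N \<Longrightarrow> \<rho> (f m) \<in> carrier L" using assms GA_mem by blast
  have cl: "(\<lambda>\<eta>. \<rho> (f \<eta>) \<odot>\<^bsub>GA\<^esub> el (\<alpha> \<eta>)) \<in> carrier N \<rightarrow> carrier GA"
    using r GA.smult_closed[OF _ el_closed] by blast
  have "semilinear_map L N \<rho> \<alpha> f (\<alpha> n) =
      (\<Oplus>\<^bsub>L\<^esub>m\<in>carrier N. (\<rho> (f m) \<odot>\<^bsub>GA\<^esub> el (\<alpha> m)) (\<alpha> n))"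
    unfolding semilinear_map_def Let_def by (rule GA_finsum_eval[OF cl a[OF assms(4)]])
  also have "\<dots> = (\<Oplus>\<^bsub>L\<^esub>m\<in>carrier N. if m = n then \<rho> (f m) else \<zero>\<^bsub>L\<^esub>)"
    using a assms(4) r by (intro L.finsum_cong') (auto simp: el_apply inj inj')
  also have "\<dots> = \<rho> (f n)" using assms(4) r by (intro L_sum_delta) auto
  finally show ?thesis .
qed

lemma semilinear_map_closed:
  assumes "f \<in> carrier GA" "\<rho> \<in> carrier L \<rightarrow> carrier L"
  shows "semilinear_map L N \<rho> \<alpha> f \<in> carrier GA"
  unfolding semilinear_map_def Let_def
proof (rule GA.M.finsum_closed)
  show "(\<lambda>\<eta>. \<rho> (f \<eta>) \<odot>\<^bsub>GA\<^esub> el (\<alpha> \<eta>)) \<in> carrier N \<rightarrow> carrier GA"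
    using GA.smult_closed[OF _ el_closed] GA_mem[OF assms(1)] assms(2) by blast
qed

lemma semilinear_map_fixed_iff:
  assumes "f \<in> carrier GA" "\<rho> \<in> carrier L \<rightarrow> carrier L" "bij_betw \<alpha> (carrier N) (carrier N)"
  shows "semilinear_map L N \<rho> \<alpha> f = f \<longleftrightarrow> (\<forall>n\<in>carrier N. f (\<alpha> n) = \<rho> (f n))"
proof
  assume "semilinear_map L N \<rho> \<alpha> f = f"
  then show "\<forall>n\<in>carrier N. f (\<alpha> n) = \<rho> (f n)"
    using semilinear_map_apply[OF assms] by simp
next
  assume *: "\<forall>n\<in>carrier N. f (\<alpha> n) = \<rho> (f n)"
  show "semilinear_map L N \<rho> \<alpha> f = f"
  proof (rule GA_eqI[OF semilinear_map_closed[OF assms(1,2)] assms(1)])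
    fix m assume "m \<in> carrier N"
    then obtain n where "n \<in> carrier N" "m = \<alpha> n" using assms(3) by (auto simp: bij_betw_def)
    then show "semilinear_map L N \<rho> \<alpha> f m = f m"
      using semilinear_map_apply[OF assms] * by simp
  qed
qed

sublocale AA: tensor_product L GA GA
  by (rule tensor_product.intro[OF module_GA module_GA])

text \<open>
  The coefficient at \<open>m \<otimes> n\<close>. Elements of \<open>L[N] \<otimes>\<^sub>L L[N]\<close> are compared through these coefficients
  (\<open>coord_eqI\<close>).
\<close>

definition coord :: "'n \<Rightarrow> 'n \<Rightarrow> ('r, 'n \<Rightarrow> 'r, 'n \<Rightarrow> 'r) tensor \<Rightarrow> 'r"
  where "coord m n = tensor_lift L GA GA L1 (\<lambda>a b. a m \<otimes>\<^bsub>L\<^esub> b n)"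

lemma bilin_coord:
  assumes m: "m \<in> carrier N" and n: "n \<in> carrier N"
  shows "bilin L GA GA L1 (\<lambda>a b. a m \<otimes>\<^bsub>L\<^esub> b n)"
  by (rule bilinI)
    (use m n in \<open>simp_all add: GA_mem[OF _ m] GA_mem[OF _ n] L.l_distr L.r_distr L.m_ac del: group_algebra_simps(1)\<close>)

lemma coord_lin: "m \<in> carrier N \<Longrightarrow> n \<in> carrier N \<Longrightarrow> coord m n \<in> lin_maps L AA.T L1"
  unfolding coord_def by (rule AA.lift_lin[OF module_L1 bilin_coord])

lemma coord_pure:
  "\<lbrakk>m \<in> carrier N; n \<in> carrier N; a \<in> carrier GA; b \<in> carrier GA\<rbrakk> \<Longrightarrow>
    coord m n (AA.pure a b) = a m \<otimes>\<^bsub>L\<^esub> b n"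
  unfolding coord_def by (rule AA.lift_pure[OF module_L1 bilin_coord])

lemma coord_closed: "\<lbrakk>m \<in> carrier N; n \<in> carrier N; U \<in> carrier AA.T\<rbrakk> \<Longrightarrow> coord m n U \<in> carrier L"
  using lin_maps_closed[OF coord_lin] by simp

lemma coord_expand:
  assumes "U \<in> carrier AA.T"
  shows "U = (\<Oplus>\<^bsub>AA.T\<^esub>m\<in>carrier N. \<Oplus>\<^bsub>AA.T\<^esub>n\<in>carrier N. coord m n U \<odot>\<^bsub>AA.T\<^esub> AA.pure (el m) (el n))"
proof (rule AA.lin_maps_eqI[of "\<lambda>U. U"])
  show "(\<lambda>U. U) \<in> lin_maps L AA.T AA.T" by (rule lin_maps_id)
  have "(\<lambda>U. coord m n U \<odot>\<^bsub>AA.T\<^esub> AA.pure (el m) (el n)) \<in> lin_maps L AA.T AA.T"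
    if "m \<in> carrier N" "n \<in> carrier N" for m n
    by (rule lin_mapsI)
      (use that in \<open>simp_all add: coord_closed AA.T.smult_l_distr AA.T.smult_assoc1
        lin_maps_add[OF coord_lin, simplified] lin_maps_smult[OF coord_lin, simplified] del: group_algebra_simps\<close>)
  then show "(\<lambda>U. \<Oplus>\<^bsub>AA.T\<^esub>m\<in>carrier N. \<Oplus>\<^bsub>AA.T\<^esub>n\<in>carrier N.
      coord m n U \<odot>\<^bsub>AA.T\<^esub> AA.pure (el m) (el n)) \<in> lin_maps L AA.T AA.T"
    by (intro lin_maps_finsumf[OF AA.module_T AA.module_T])
  fix a b assume a: "a \<in> carrier GA" and b: "b \<in> carrier GA"
  note p = AA.bilin_pure
  have as: "\<And>m. m \<in> carrier N \<Longrightarrow> a m \<odot>\<^bsub>GA\<^esub> el m \<in> carrier GA"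
    "\<And>m. m \<in> carrier N \<Longrightarrow> b m \<odot>\<^bsub>GA\<^esub> el m \<in> carrier GA"
    using GA.smult_closed[OF GA_mem el_closed] a b by blast+
  have "AA.pure a b = AA.pure (\<Oplus>\<^bsub>GA\<^esub>m\<in>carrier N. a m \<odot>\<^bsub>GA\<^esub> el m) b"
    using GA_expand[OF a] by simp
  also have "\<dots> = (\<Oplus>\<^bsub>AA.T\<^esub>m\<in>carrier N. AA.pure (a m \<odot>\<^bsub>GA\<^esub> el m) b)"
    by (rule lin_maps_finsum[OF module_GA AA.module_T bilin_left[OF p b]]) (use as in blast)
  also have "\<dots> = (\<Oplus>\<^bsub>AA.T\<^esub>m\<in>carrier N. \<Oplus>\<^bsub>AA.T\<^esub>n\<in>carrier N.
      coord m n (AA.pure a b) \<odot>\<^bsub>AA.T\<^esub> AA.pure (el m) (el n))"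
  proof (rule AA.T.M.finsum_cong', rule refl)
    show "(\<lambda>m. \<Oplus>\<^bsub>AA.T\<^esub>n\<in>carrier N. coord m n (AA.pure a b) \<odot>\<^bsub>AA.T\<^esub> AA.pure (el m) (el n))
        \<in> carrier N \<rightarrow> carrier AA.T"
      using a b by (intro Pi_I AA.T.M.finsum_closed AA.T.smult_closed coord_closed AA.pure_closed el_closed)
    fix m assume m: "m \<in> carrier N"
    have "AA.pure (a m \<odot>\<^bsub>GA\<^esub> el m) b =
        AA.pure (a m \<odot>\<^bsub>GA\<^esub> el m) (\<Oplus>\<^bsub>GA\<^esub>n\<in>carrier N. b n \<odot>\<^bsub>GA\<^esub> el n)"
      using GA_expand[OF b] by simp
    also have "\<dots> = (\<Oplus>\<^bsub>AA.T\<^esub>n\<in>carrier N. AA.pure (a m \<odot>\<^bsub>GA\<^esub> el m) (b n \<odot>\<^bsub>GA\<^esub> el n))"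
      by (rule lin_maps_finsum[OF module_GA AA.module_T bilin_right[OF p as(1)[OF m]]]) (use as in blast)
    also have "\<dots> = (\<Oplus>\<^bsub>AA.T\<^esub>n\<in>carrier N. coord m n (AA.pure a b) \<odot>\<^bsub>AA.T\<^esub> AA.pure (el m) (el n))"
    proof (rule AA.T.M.finsum_cong', rule refl)
      show "(\<lambda>n. coord m n (AA.pure a b) \<odot>\<^bsub>AA.T\<^esub> AA.pure (el m) (el n)) \<in> carrier N \<rightarrow> carrier AA.T"
        using a b m by (intro Pi_I AA.T.smult_closed coord_closed AA.pure_closed el_closed)
      fix n assume n: "n \<in> carrier N"
      have am: "a m \<in> carrier L" "b n \<in> carrier L" using GA_mem a b m n by auto
      have "AA.pure (a m \<odot>\<^bsub>GA\<^esub> el m) (b n \<odot>\<^bsub>GA\<^esub> el n) = a m \<odot>\<^bsub>AA.T\<^esub> AA.pure (el m) (b n \<odot>\<^bsub>GA\<^esub> el n)"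
        by (rule AA.pure_smult_left[OF as(2)[OF n] am(1) el_closed])
      also have "\<dots> = a m \<odot>\<^bsub>AA.T\<^esub> (b n \<odot>\<^bsub>AA.T\<^esub> AA.pure (el m) (el n))"
        by (subst AA.pure_smult_right[OF el_closed am(2) el_closed]) (rule refl)
      also have "\<dots> = (a m \<otimes>\<^bsub>L\<^esub> b n) \<odot>\<^bsub>AA.T\<^esub> AA.pure (el m) (el n)"
        by (rule AA.T.smult_assoc1[symmetric, OF am AA.pure_closed[OF el_closed el_closed]])
      finally show "AA.pure (a m \<odot>\<^bsub>GA\<^esub> el m) (b n \<odot>\<^bsub>GA\<^esub> el n) =
          coord m n (AA.pure a b) \<odot>\<^bsub>AA.T\<^esub> AA.pure (el m) (el n)"
        by (simp only: coord_pure[OF m n a b])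
    qed
    finally show "AA.pure (a m \<odot>\<^bsub>GA\<^esub> el m) b =
      (\<Oplus>\<^bsub>AA.T\<^esub>n\<in>carrier N. coord m n (AA.pure a b) \<odot>\<^bsub>AA.T\<^esub> AA.pure (el m) (el n))" .
  qed
  finally show "AA.pure a b = (\<Oplus>\<^bsub>AA.T\<^esub>m\<in>carrier N. \<Oplus>\<^bsub>AA.T\<^esub>n\<in>carrier N.
      coord m n (AA.pure a b) \<odot>\<^bsub>AA.T\<^esub> AA.pure (el m) (el n))" .
qed (rule assms)

lemma coord_eqI:
  assumes "U \<in> carrier AA.T" "V \<in> carrier AA.T"
    "\<And>m n. m \<in> carrier N \<Longrightarrow> n \<in> carrier N \<Longrightarrow> coord m n U = coord m n V"
  shows "U = V"
proof -
  have "U = (\<Oplus>\<^bsub>AA.T\<^esub>m\<in>carrier N. \<Oplus>\<^bsub>AA.T\<^esub>n\<in>carrier N. coord m n U \<odot>\<^bsub>AA.T\<^esub> AA.pure (el m) (el n))"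
    by (rule coord_expand[OF assms(1)])
  also have "\<dots> = (\<Oplus>\<^bsub>AA.T\<^esub>m\<in>carrier N. \<Oplus>\<^bsub>AA.T\<^esub>n\<in>carrier N. coord m n V \<odot>\<^bsub>AA.T\<^esub> AA.pure (el m) (el n))"
    using assms(2)
    by (intro AA.T.M.finsum_cong' refl Pi_I AA.T.M.finsum_closed AA.T.smult_closed coord_closed AA.pure_closed el_closed)
      (simp_all only: assms(3))
  also have "\<dots> = V" by (rule coord_expand[OF assms(2), symmetric])
  finally show ?thesis .
qed

lemma comul_closed: "f \<in> carrier GA \<Longrightarrow> comul (group_hopf L N) f \<in> carrier AA.T"
  unfolding group_hopf_fields
  by (intro AA.T.M.finsum_closed Pi_I AA.T.smult_closed AA.pure_closed el_closed GA_mem)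

lemma coord_comul:
  assumes "f \<in> carrier GA" "m \<in> carrier N" "n \<in> carrier N"
  shows "coord m n (comul (group_hopf L N) f) = (if m = n then f m else \<zero>\<^bsub>L\<^esub>)"
proof -
  have "coord m n (comul (group_hopf L N) f) =
      (\<Oplus>\<^bsub>L1\<^esub>k\<in>carrier N. coord m n (f k \<odot>\<^bsub>AA.T\<^esub> AA.pure (el k) (el k)))"
    unfolding group_hopf_fields using assms
    by (intro lin_maps_finsum[OF AA.module_T module_L1 coord_lin] Pi_I AA.T.smult_closed
        AA.pure_closed el_closed GA_mem)
  also have "\<dots> = (\<Oplus>\<^bsub>L\<^esub>k\<in>carrier N. coord m n (f k \<odot>\<^bsub>AA.T\<^esub> AA.pure (el k) (el k)))"
    by (rule finsum_algebra_via)
  also have "\<dots> = (\<Oplus>\<^bsub>L\<^esub>k\<in>carrier N. if k = m then (if m = n then f k else \<zero>\<^bsub>L\<^esub>) else \<zero>\<^bsub>L\<^esub>)"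
  proof (rule L.finsum_cong', rule refl)
    show "(\<lambda>k. if k = m then (if m = n then f k else \<zero>\<^bsub>L\<^esub>) else \<zero>\<^bsub>L\<^esub>) \<in> carrier N \<rightarrow> carrier L"
      using GA_mem[OF assms(1)] by auto
    fix k assume k: "k \<in> carrier N"
    have "coord m n (f k \<odot>\<^bsub>AA.T\<^esub> AA.pure (el k) (el k)) = f k \<otimes>\<^bsub>L\<^esub> (el k m \<otimes>\<^bsub>L\<^esub> el k n)"
      using lin_maps_smult[OF coord_lin[OF assms(2,3)] GA_mem[OF assms(1) k] AA.pure_closed[OF el_closed[of k] el_closed[of k]]]
      by (simp add: coord_pure[OF assms(2,3) el_closed el_closed] del: group_algebra_simps)
    then show "coord m n (f k \<odot>\<^bsub>AA.T\<^esub> AA.pure (el k) (el k)) =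
      (if k = m then (if m = n then f k else \<zero>\<^bsub>L\<^esub>) else \<zero>\<^bsub>L\<^esub>)"
      using GA_mem[OF assms(1) k] assms(2,3) by (auto simp: el_apply)
  qed
  also have "\<dots> = (if m = n then f m else \<zero>\<^bsub>L\<^esub>)"
    using L.finsum_delta[OF finite_N assms(2), of "\<lambda>k. if m = n then f k else \<zero>\<^bsub>L\<^esub>"] GA_mem[OF assms(1,2)]
    by (cases "m = n") simp_all
  finally show ?thesis .
qed

end



section \<open>Rational subspaces of a group algebra\<close>

lemma module_subring:
  assumes "module R M" "cring (R\<lparr>carrier := K\<rparr>)" "K \<subseteq> carrier R"
  shows "module (R\<lparr>carrier := K\<rparr>) M"
proof -
  interpret M: module R M by fact
  note [simp] = subsetD[OF assms(3)]
  show ?thesis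
    by (intro moduleI assms(2) M.M.abelian_group_axioms)
      (auto simp: M.smult_l_distr M.smult_r_distr M.smult_assoc1)
qed

lemma lin_maps_subring: "f \<in> lin_maps R M P \<Longrightarrow> K \<subseteq> carrier R \<Longrightarrow> f \<in> lin_maps (R\<lparr>carrier := K\<rparr>) M P"
  by (auto simp: lin_maps_def)

lemma bilin_subring: "bilin R M M' P \<beta> \<Longrightarrow> K \<subseteq> carrier R \<Longrightarrow> bilin (R\<lparr>carrier := K\<rparr>) M M' P \<beta>"
  by (auto simp: bilin_def intro: lin_maps_subring)

text \<open>
  A \<open>K\<close>-subspace \<open>B\<close> of \<open>L[N]\<close>, for a subring \<open>K\<close> of \<open>L\<close>. Fixed rings are of this form over either of
  the fields \<open>E\<close> and \<open>L\<close>; the coordinates \<open>coordB\<close> on \<open>B \<otimes>\<^sub>K B\<close> make the two cases comparable.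
\<close>

locale rational_form = finite_group_algebra L N
  for L :: "('r, 'm) ring_scheme" and N :: "('n, 'k) monoid_scheme" +
  fixes K :: "'r set" and B :: "('r, 'n \<Rightarrow> 'r, 'z) module_scheme"
  assumes cring_K: "cring (L\<lparr>carrier := K\<rparr>)" and K_subset: "K \<subseteq> carrier L"
    and B_subset: "carrier B \<subseteq> carrier (group_algebra L N)"
    and B_add: "add B = add (group_algebra L N)"
    and B_smult: "module.smult B = module.smult (group_algebra L N)"
    and module_B: "module (L\<lparr>carrier := K\<rparr>) B"
begin

abbreviation "K' \<equiv> L\<lparr>carrier := K\<rparr>"

sublocale K: cring K' by (rule cring_K)
sublocale B: module K' B by (rule module_B)
sublocale BB: tensor_product K' B B by (rule tensor_product.intro[OF module_B module_B])

lemma K_mem: "k \<in> K \<Longrightarrow> k \<in> carrier L" using K_subset by blast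

lemma B_mem: "f \<in> carrier B \<Longrightarrow> f \<in> carrier GA" using B_subset by blast

lemma module_K_GA: "module K' GA" by (rule module_subring[OF module_GA cring_K K_subset])
lemma module_K_L1: "module K' L1" by (rule module_subring[OF module_L1 cring_K K_subset])
lemma module_K_AA: "module K' AA.T" by (rule module_subring[OF AA.module_T cring_K K_subset])

lemma B_incl_lin: "(\<lambda>f. f) \<in> lin_maps K' B GA"
  by (rule lin_mapsI) (use B_subset in \<open>auto simp: B_add B_smult simp del: group_algebra_simps\<close>)

definition coordB :: "'n \<Rightarrow> 'n \<Rightarrow> ('r, 'n \<Rightarrow> 'r, 'n \<Rightarrow> 'r) tensor \<Rightarrow> 'r"
  where "coordB m n = tensor_lift K' B B L1 (\<lambda>a b. a m \<otimes>\<^bsub>L\<^esub> b n)"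

lemma bilin_coordB: "m \<in> carrier N \<Longrightarrow> n \<in> carrier N \<Longrightarrow> bilin K' B B L1 (\<lambda>a b. a m \<otimes>\<^bsub>L\<^esub> b n)"
  by (rule bilin_comp[OF bilin_subring[OF bilin_coord K_subset] B_incl_lin B_incl_lin])

lemma coordB_lin: "m \<in> carrier N \<Longrightarrow> n \<in> carrier N \<Longrightarrow> coordB m n \<in> lin_maps K' BB.T L1"
  unfolding coordB_def by (rule BB.lift_lin[OF module_K_L1 bilin_coordB])

lemma coordB_pure:
  "\<lbrakk>m \<in> carrier N; n \<in> carrier N; a \<in> carrier B; b \<in> carrier B\<rbrakk> \<Longrightarrow>
    coordB m n (BB.pure a b) = a m \<otimes>\<^bsub>L\<^esub> b n"
  unfolding coordB_def by (rule BB.lift_pure[OF module_K_L1 bilin_coordB])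

lemma coordB_closed: "\<lbrakk>m \<in> carrier N; n \<in> carrier N; U \<in> carrier BB.T\<rbrakk> \<Longrightarrow> coordB m n U \<in> carrier L"
  using lin_maps_closed[OF coordB_lin] by simp

lemma coordB_add: "\<lbrakk>m \<in> carrier N; n \<in> carrier N; U \<in> carrier BB.T; V \<in> carrier BB.T\<rbrakk> \<Longrightarrow>
    coordB m n (U \<oplus>\<^bsub>BB.T\<^esub> V) = coordB m n U \<oplus>\<^bsub>L\<^esub> coordB m n V"
  using lin_maps_add[OF coordB_lin] by simp

lemma bilin_B_pure: "bilin K' B B AA.T AA.pure"
  by (rule bilin_comp[OF bilin_subring[OF AA.bilin_pure K_subset] B_incl_lin B_incl_lin])

lemma coord_canonical:
  assumes "m \<in> carrier N" "n \<in> carrier N" "U \<in> carrier BB.T"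
  shows "coord m n (tensor_lift K' B B AA.T AA.pure U) = coordB m n U"
proof -
  have "coord m n (tensor_lift K' B B AA.T AA.pure U) =
      tensor_lift K' B B L1 (\<lambda>a b. coord m n (AA.pure a b)) U"
    by (rule BB.lift_post[OF module_K_AA bilin_B_pure module_K_L1 lin_maps_subring[OF coord_lin K_subset] assms(3)])
      (use assms in auto)
  also have "\<dots> = coordB m n U"
    unfolding coordB_def
    by (rule BB.tensor_lift_cong[OF assms(3) module_K_L1 _ bilin_coordB])
      (use assms coord_pure B_mem in auto)
  finally show ?thesis .
qed

text \<open>
  The condition that defines the comultiplication of a fixed ring, freed from the tensor product
  over \<open>L\<close>.
\<close>

lemma canonical_eq_comul_iff:
  assumes "U \<in> carrier BB.T" "f \<in> carrier GA"
  shows "tensor_lift K' B B AA.T AA.pure U = comul (group_hopf L N) f \<longleftrightarrow>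
    (\<forall>m\<in>carrier N. \<forall>n\<in>carrier N. coordB m n U = (if m = n then f m else \<zero>\<^bsub>L\<^esub>))"
    (is "?l = ?r \<longleftrightarrow> ?c")
proof
  assume "?l = ?r"
  then show ?c using coord_canonical[OF _ _ assms(1)] coord_comul[OF assms(2)] by metis
next
  assume c: ?c
  have "?l \<in> carrier AA.T"
    by (rule lin_maps_closed[OF BB.lift_lin[OF module_K_AA bilin_B_pure] assms(1)])
  then show "?l = ?r"
    by (rule coord_eqI[OF _ comul_closed[OF assms(2)]])
      (simp add: coord_canonical assms(1) coord_comul[OF assms(2)] c)
qed

end


section \<open>Galois descent for group algebras\<close>

lemma fixed_hopf_fields:
  "ring.zero (fixed_hopf K L N \<Gamma> \<rho> \<alpha>) = ring.zero (group_algebra L N)"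
  "add (fixed_hopf K L N \<Gamma> \<rho> \<alpha>) = add (group_algebra L N)"
  "monoid.mult (fixed_hopf K L N \<Gamma> \<rho> \<alpha>) = monoid.mult (group_algebra L N)"
  "one (fixed_hopf K L N \<Gamma> \<rho> \<alpha>) = one (group_algebra L N)"
  "module.smult (fixed_hopf K L N \<Gamma> \<rho> \<alpha>) = module.smult (group_algebra L N)"
  "counit (fixed_hopf K L N \<Gamma> \<rho> \<alpha>) f = (\<Oplus>\<^bsub>L\<^esub>n\<in>carrier N. f n)"
  "antipode (fixed_hopf K L N \<Gamma> \<rho> \<alpha>) f = (\<lambda>n\<in>carrier N. f (inv\<^bsub>N\<^esub> n))"
  "carrier (fixed_hopf K L N \<Gamma> \<rho> \<alpha>) =
     {f \<in> carrier (group_algebra L N). \<forall>g\<in>\<Gamma>. semilinear_map L N (\<rho> g) (\<alpha> g) f = f}"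
  by (simp_all add: fixed_hopf_def Let_def group_hopf_fields)

text \<open>
  The definition forms \<open>B \<otimes>\<^sub>K B\<close> for an intermediate record that still carries the comultiplication of
  the group algebra. By \<open>tensor_cong\<close> any \<open>B\<close> with the same underlying module can replace it.
\<close>

lemma fixed_hopf_comul:
  fixes L :: "('r, 'm) ring_scheme" and N :: "('n, 'k) monoid_scheme"
  defines "A \<equiv> group_algebra L N"
  assumes "carrier B = carrier (fixed_hopf K L N \<Gamma> \<rho> \<alpha>)" "add B = add A" "module.smult B = module.smult A"
  shows "comul (fixed_hopf K L N \<Gamma> \<rho> \<alpha>) f =
    (THE U. U \<in> carrier (tensor_module (L\<lparr>carrier := K\<rparr>) B B) \<and>
      tensor_lift (L\<lparr>carrier := K\<rparr>) B B (tensor_module L A A) (pure_tensor L A A) U =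
      comul (group_hopf L N) f)"
proof -
  let ?H = "group_hopf L N"
  let ?B = "?H\<lparr>carrier := {f \<in> carrier ?H. \<forall>g\<in>\<Gamma>. semilinear_map L N (\<rho> g) (\<alpha> g) f = f}\<rparr>"
  have A: "tensor_module L ?H ?H = tensor_module L A A" "pure_tensor L ?H ?H = pure_tensor L A A"
    by (rule tensor_cong; simp add: A_def group_hopf_fields)+
  have B: "tensor_module (L\<lparr>carrier := K\<rparr>) ?B ?B = tensor_module (L\<lparr>carrier := K\<rparr>) B B"
    "tensor_lift (L\<lparr>carrier := K\<rparr>) ?B ?B P \<beta> = tensor_lift (L\<lparr>carrier := K\<rparr>) B B P \<beta>"
    for P :: "('r, ('r, 'n \<Rightarrow> 'r, 'n \<Rightarrow> 'r) tensor) module" and \<beta>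
    by (rule tensor_cong; simp add: assms(2-4) A_def group_hopf_fields fixed_hopf_fields)+
  show ?thesis by (simp add: fixed_hopf_def Let_def A B)
qed

locale galois_descent = finite_group_algebra L N + \<Gamma>: group \<Gamma>
  for L :: "('r, 'm) ring_scheme" and N :: "('n, 'k) monoid_scheme" and \<Gamma> :: "('g, 'q) monoid_scheme" +
  fixes K :: "'r set" and \<rho> :: "'g \<Rightarrow> 'r \<Rightarrow> 'r" and \<alpha> :: "'g \<Rightarrow> 'n \<Rightarrow> 'n"
  assumes field_L: "field L" and field_K: "field (L\<lparr>carrier := K\<rparr>)"
    and finite_\<Gamma>: "finite (carrier \<Gamma>)"
    and rho_hom: "g \<in> carrier \<Gamma> \<Longrightarrow> \<rho> g \<in> ring_hom L L"
    and rho_comp: "\<lbrakk>g \<in> carrier \<Gamma>; h \<in> carrier \<Gamma>; x \<in> carrier L\<rbrakk> \<Longrightarrow> \<rho> (g \<otimes>\<^bsub>\<Gamma>\<^esub> h) x = \<rho> g (\<rho> h x)"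
    and rho_id: "x \<in> carrier L \<Longrightarrow> \<rho> \<one>\<^bsub>\<Gamma>\<^esub> x = x"
    and fixed: "K = {x \<in> carrier L. \<forall>g\<in>carrier \<Gamma>. \<rho> g x = x}"
    and faithful: "\<lbrakk>g \<in> carrier \<Gamma>; g \<noteq> \<one>\<^bsub>\<Gamma>\<^esub>\<rbrakk> \<Longrightarrow> \<exists>x\<in>carrier L. \<rho> g x \<noteq> x"
    and alpha_closed: "\<lbrakk>g \<in> carrier \<Gamma>; n \<in> carrier N\<rbrakk> \<Longrightarrow> \<alpha> g n \<in> carrier N"
    and alpha_comp: "\<lbrakk>g \<in> carrier \<Gamma>; h \<in> carrier \<Gamma>; n \<in> carrier N\<rbrakk> \<Longrightarrow> \<alpha> (g \<otimes>\<^bsub>\<Gamma>\<^esub> h) n = \<alpha> g (\<alpha> h n)"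
    and alpha_id: "n \<in> carrier N \<Longrightarrow> \<alpha> \<one>\<^bsub>\<Gamma>\<^esub> n = n"
begin

sublocale fL: field L by (rule field_L)

abbreviation "B \<equiv> fixed_hopf K L N (carrier \<Gamma>) \<rho> \<alpha>"

lemma rho_closed: "g \<in> carrier \<Gamma> \<Longrightarrow> x \<in> carrier L \<Longrightarrow> \<rho> g x \<in> carrier L"
  by (rule ring_hom_memE(1)[OF rho_hom])
lemma rho_mult: "\<lbrakk>g \<in> carrier \<Gamma>; x \<in> carrier L; y \<in> carrier L\<rbrakk> \<Longrightarrow> \<rho> g (x \<otimes>\<^bsub>L\<^esub> y) = \<rho> g x \<otimes>\<^bsub>L\<^esub> \<rho> g y"
  by (rule ring_hom_memE(2)[OF rho_hom])
lemma rho_add: "\<lbrakk>g \<in> carrier \<Gamma>; x \<in> carrier L; y \<in> carrier L\<rbrakk> \<Longrightarrow> \<rho> g (x \<oplus>\<^bsub>L\<^esub> y) = \<rho> g x \<oplus>\<^bsub>L\<^esub> \<rho> g y"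
  by (rule ring_hom_memE(3)[OF rho_hom])
lemma rho_zero: "g \<in> carrier \<Gamma> \<Longrightarrow> \<rho> g \<zero>\<^bsub>L\<^esub> = \<zero>\<^bsub>L\<^esub>"
  by (rule ring_hom_zero[OF rho_hom L.ring_axioms L.ring_axioms])

lemma rho_finsum: "g \<in> carrier \<Gamma> \<Longrightarrow> (\<And>i. i \<in> I \<Longrightarrow> F i \<in> carrier L) \<Longrightarrow>
    \<rho> g (\<Oplus>\<^bsub>L\<^esub>i\<in>I. F i) = (\<Oplus>\<^bsub>L\<^esub>i\<in>I. \<rho> g (F i))"
  by (induction I rule: infinite_finite_induct)
    (simp_all add: rho_zero rho_add rho_closed Pi_def L.finsum_closed)

lemma K_subset: "K \<subseteq> carrier L" using fixed by blast
lemma K_mem: "k \<in> K \<Longrightarrow> k \<in> carrier L" using K_subset by blast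
lemma rho_K: "g \<in> carrier \<Gamma> \<Longrightarrow> k \<in> K \<Longrightarrow> \<rho> g k = k" using fixed by blast

lemma alpha_cancel:
  assumes "g \<in> carrier \<Gamma>" "n \<in> carrier N"
  shows "\<alpha> g (\<alpha> (inv\<^bsub>\<Gamma>\<^esub> g) n) = n" "\<alpha> (inv\<^bsub>\<Gamma>\<^esub> g) (\<alpha> g n) = n"
  using alpha_comp[of g "inv\<^bsub>\<Gamma>\<^esub> g" n] alpha_comp[of "inv\<^bsub>\<Gamma>\<^esub> g" g n] alpha_id assms by simp_all

lemma alpha_bij: "g \<in> carrier \<Gamma> \<Longrightarrow> bij_betw (\<alpha> g) (carrier N) (carrier N)"
  by (rule bij_betw_byWitness[of _ "\<alpha> (inv\<^bsub>\<Gamma>\<^esub> g)"]) (auto simp: alpha_cancel alpha_closed)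

lemma B_carrier: "carrier B =
    {f \<in> carrier GA. \<forall>g\<in>carrier \<Gamma>. \<forall>n\<in>carrier N. f (\<alpha> g n) = \<rho> g (f n)}"
  unfolding fixed_hopf_fields
  using semilinear_map_fixed_iff[OF _ _ alpha_bij] rho_closed by blast

lemma BI: "\<lbrakk>f \<in> carrier GA; \<And>g n. g \<in> carrier \<Gamma> \<Longrightarrow> n \<in> carrier N \<Longrightarrow> f (\<alpha> g n) = \<rho> g (f n)\<rbrakk> \<Longrightarrow>
    f \<in> carrier B"
  by (simp add: B_carrier del: group_algebra_simps)

lemma B_GA: "f \<in> carrier B \<Longrightarrow> f \<in> carrier GA"
  by (simp add: B_carrier del: group_algebra_simps)

lemma B_equivariant: "\<lbrakk>f \<in> carrier B; g \<in> carrier \<Gamma>; n \<in> carrier N\<rbrakk> \<Longrightarrow> f (\<alpha> g n) = \<rho> g (f n)"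
  by (simp add: B_carrier del: group_algebra_simps)

lemma module_B: "module (L\<lparr>carrier := K\<rparr>) B"
proof -
  interpret KGA: module "L\<lparr>carrier := K\<rparr>" GA
    by (rule module_subring[OF module_GA domain.axioms(1)[OF field.axioms(1)[OF field_K]] K_subset])
  have "submodule (carrier B) (L\<lparr>carrier := K\<rparr>) GA"
  proof (rule KGA.submoduleI)
    show "carrier B \<subseteq> carrier GA" using B_GA by blast
    show "\<zero>\<^bsub>GA\<^esub> \<in> carrier B"
      by (rule BI) (simp_all add: rho_zero alpha_closed)
    fix a assume a: "a \<in> carrier B"
    note [simp] = GA_mem[OF B_GA[OF a]] B_equivariant[OF a]
    have s: "r \<odot>\<^bsub>GA\<^esub> a \<in> carrier B" if "r \<in> K" for r
      by (rule BI) (use that in \<open>simp_all add: K_mem rho_mult rho_K alpha_closed\<close>)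
    then show "\<And>r. r \<in> carrier (L\<lparr>carrier := K\<rparr>) \<Longrightarrow> r \<odot>\<^bsub>GA\<^esub> a \<in> carrier B" by simp
    have m: "\<ominus>\<^bsub>L\<lparr>carrier := K\<rparr>\<^esub> \<one>\<^bsub>L\<lparr>carrier := K\<rparr>\<^esub> \<in> K"
      using KGA.R.a_inv_closed[OF KGA.R.one_closed] by simp
    have "\<ominus>\<^bsub>GA\<^esub> a = (\<ominus>\<^bsub>L\<lparr>carrier := K\<rparr>\<^esub> \<one>\<^bsub>L\<lparr>carrier := K\<rparr>\<^esub>) \<odot>\<^bsub>GA\<^esub> a"
      using KGA.smult_l_minus[OF KGA.R.one_closed B_GA[OF a]] KGA.smult_one[OF B_GA[OF a]] by simp
    then show "\<ominus>\<^bsub>GA\<^esub> a \<in> carrier B" using s[OF m] by simp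
    fix b assume b: "b \<in> carrier B"
    note [simp] = GA_mem[OF B_GA[OF b]] B_equivariant[OF b]
    show "a \<oplus>\<^bsub>GA\<^esub> b \<in> carrier B"
      by (rule BI) (simp_all add: rho_add alpha_closed)
  qed
  from submodule.submodule_is_module[OF this KGA.module_axioms]
  show ?thesis by (rule module_cong) (simp_all add: fixed_hopf_fields(1-5) del: group_algebra_simps)
qed

sublocale rational_form L N K B
proof (rule rational_form.intro[OF finite_group_algebra_axioms], rule rational_form_axioms.intro)
  show "cring (L\<lparr>carrier := K\<rparr>)" by (rule domain.axioms(1)[OF field.axioms(1)[OF field_K]])
  show "module (L\<lparr>carrier := K\<rparr>) B" by (rule module_B)
  show "carrier B \<subseteq> carrier GA" using B_GA by blast
qed (simp_all add: K_subset fixed_hopf_fields(1-5) del: group_algebra_simps)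

lemma sum_shift:
  assumes "h \<in> carrier \<Gamma>" "\<And>g. g \<in> carrier \<Gamma> \<Longrightarrow> F g \<in> carrier L"
  shows "(\<Oplus>\<^bsub>L\<^esub>g\<in>carrier \<Gamma>. F (h \<otimes>\<^bsub>\<Gamma>\<^esub> g)) = (\<Oplus>\<^bsub>L\<^esub>g\<in>carrier \<Gamma>. F g)"
proof -
  have b: "bij_betw (\<lambda>g. h \<otimes>\<^bsub>\<Gamma>\<^esub> g) (carrier \<Gamma>) (carrier \<Gamma>)"
    by (rule bij_betw_byWitness[of _ "\<lambda>g. inv\<^bsub>\<Gamma>\<^esub> h \<otimes>\<^bsub>\<Gamma>\<^esub> g"])
      (use assms(1) in \<open>auto simp: \<Gamma>.m_assoc[symmetric]\<close>)
  have "(\<Oplus>\<^bsub>L\<^esub>g\<in>(\<lambda>g. h \<otimes>\<^bsub>\<Gamma>\<^esub> g) ` carrier \<Gamma>. F g) = (\<Oplus>\<^bsub>L\<^esub>g\<in>carrier \<Gamma>. F (h \<otimes>\<^bsub>\<Gamma>\<^esub> g))"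
    using b assms by (intro L.finsum_reindex) (auto simp: bij_betw_def)
  then show ?thesis using b by (simp add: bij_betw_def)
qed

text \<open>The trace of \<open>L\<close> over \<open>K\<close>.\<close>

definition tr :: "'r \<Rightarrow> 'r"
  where "tr x = (\<Oplus>\<^bsub>L\<^esub>g\<in>carrier \<Gamma>. \<rho> g x)"

text \<open>
  The sum of the conjugates of \<open>f\<close>, where \<open>g \<in> \<Gamma>\<close> takes \<open>f\<close> to \<open>\<rho> g \<circ> f \<circ> \<alpha> (inv g)\<close>: the trace from
  \<open>L[N]\<close> to \<open>B\<close>.
\<close>

definition Tr :: "('n \<Rightarrow> 'r) \<Rightarrow> ('n \<Rightarrow> 'r)"
  where "Tr f = (\<lambda>m\<in>carrier N. \<Oplus>\<^bsub>L\<^esub>g\<in>carrier \<Gamma>. \<rho> g (f (\<alpha> (inv\<^bsub>\<Gamma>\<^esub> g) m)))"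

lemma Tr_term_closed: "\<lbrakk>f \<in> carrier GA; g \<in> carrier \<Gamma>; m \<in> carrier N\<rbrakk> \<Longrightarrow>
    \<rho> g (f (\<alpha> (inv\<^bsub>\<Gamma>\<^esub> g) m)) \<in> carrier L"
  by (intro rho_closed GA_mem alpha_closed) auto

lemma Tr_GA: "f \<in> carrier GA \<Longrightarrow> Tr f \<in> carrier GA"
  using Tr_term_closed by (auto simp: Tr_def intro!: L.finsum_closed)

lemma Tr_apply: "m \<in> carrier N \<Longrightarrow> Tr f m = (\<Oplus>\<^bsub>L\<^esub>g\<in>carrier \<Gamma>. \<rho> g (f (\<alpha> (inv\<^bsub>\<Gamma>\<^esub> g) m)))"
  by (simp add: Tr_def)

lemma Tr_B: "f \<in> carrier GA \<Longrightarrow> Tr f \<in> carrier B"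
proof (rule BI[OF Tr_GA])
  fix h m assume f: "f \<in> carrier GA" and h: "h \<in> carrier \<Gamma>" and m: "m \<in> carrier N"
  have hm: "\<alpha> h m \<in> carrier N" using h m by (rule alpha_closed)
  have "Tr f (\<alpha> h m) = (\<Oplus>\<^bsub>L\<^esub>g\<in>carrier \<Gamma>. \<rho> (h \<otimes>\<^bsub>\<Gamma>\<^esub> g) (f (\<alpha> (inv\<^bsub>\<Gamma>\<^esub> (h \<otimes>\<^bsub>\<Gamma>\<^esub> g)) (\<alpha> h m))))"
    unfolding Tr_apply[OF hm]
    by (rule sum_shift[OF h, symmetric]) (rule Tr_term_closed[OF f _ hm])
  also have "\<dots> = (\<Oplus>\<^bsub>L\<^esub>g\<in>carrier \<Gamma>. \<rho> h (\<rho> g (f (\<alpha> (inv\<^bsub>\<Gamma>\<^esub> g) m))))"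
  proof (rule L.finsum_cong', rule refl)
    show "(\<lambda>g. \<rho> h (\<rho> g (f (\<alpha> (inv\<^bsub>\<Gamma>\<^esub> g) m)))) \<in> carrier \<Gamma> \<rightarrow> carrier L"
      using Tr_term_closed[OF f _ m] rho_closed[OF h] by blast
    fix g assume g: "g \<in> carrier \<Gamma>"
    have "\<alpha> (inv\<^bsub>\<Gamma>\<^esub> (h \<otimes>\<^bsub>\<Gamma>\<^esub> g)) (\<alpha> h m) = \<alpha> (inv\<^bsub>\<Gamma>\<^esub> g) m"
      using g h m by (simp add: \<Gamma>.inv_mult_group alpha_comp alpha_cancel alpha_closed)
    then show "\<rho> (h \<otimes>\<^bsub>\<Gamma>\<^esub> g) (f (\<alpha> (inv\<^bsub>\<Gamma>\<^esub> (h \<otimes>\<^bsub>\<Gamma>\<^esub> g)) (\<alpha> h m))) = \<rho> h (\<rho> g (f (\<alpha> (inv\<^bsub>\<Gamma>\<^esub> g) m)))"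
      using g h m by (simp add: rho_comp GA_mem[OF f] alpha_closed)
  qed
  also have "\<dots> = \<rho> h (Tr f m)"
    unfolding Tr_apply[OF m] by (rule rho_finsum[OF h, symmetric]) (rule Tr_term_closed[OF f _ m])
  finally show "Tr f (\<alpha> h m) = \<rho> h (Tr f m)" .
qed

lemma Tr_lin: "Tr \<in> lin_maps K' GA B"
proof (rule lin_mapsI)
  fix f assume f: "f \<in> carrier GA"
  then show "Tr f \<in> carrier B" by (rule Tr_B)
  {
    fix g assume g: "g \<in> carrier GA"
    show "Tr (f \<oplus>\<^bsub>GA\<^esub> g) = Tr f \<oplus>\<^bsub>B\<^esub> Tr g"
    proof (rule GA_eqI)
      show "Tr (f \<oplus>\<^bsub>GA\<^esub> g) \<in> carrier GA" by (rule Tr_GA[OF GA.M.a_closed[OF f g]])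
      show "Tr f \<oplus>\<^bsub>B\<^esub> Tr g \<in> carrier GA"
        using GA.M.a_closed[OF Tr_GA[OF f] Tr_GA[OF g]] by (simp add: B_add)
      fix m assume m: "m \<in> carrier N"
      have "Tr (f \<oplus>\<^bsub>GA\<^esub> g) m =
          (\<Oplus>\<^bsub>L\<^esub>x\<in>carrier \<Gamma>. \<rho> x (f (\<alpha> (inv\<^bsub>\<Gamma>\<^esub> x) m)) \<oplus>\<^bsub>L\<^esub> \<rho> x (g (\<alpha> (inv\<^bsub>\<Gamma>\<^esub> x) m)))"
        unfolding Tr_apply[OF m] using m
        by (intro L.finsum_cong')
          (simp_all add: alpha_closed rho_add GA_mem[OF f] GA_mem[OF g] rho_closed)
      also have "\<dots> = Tr f m \<oplus>\<^bsub>L\<^esub> Tr g m"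
        unfolding Tr_apply[OF m] using Tr_term_closed[OF f _ m] Tr_term_closed[OF g _ m]
        by (intro L.finsum_addf) auto
      finally show "Tr (f \<oplus>\<^bsub>GA\<^esub> g) m = (Tr f \<oplus>\<^bsub>B\<^esub> Tr g) m" using m by (simp add: B_add)
    qed
  }
  fix r assume "r \<in> carrier K'"
  then have r: "r \<in> K" "r \<in> carrier L" using K_mem by auto
  show "Tr (r \<odot>\<^bsub>GA\<^esub> f) = r \<odot>\<^bsub>B\<^esub> Tr f"
  proof (rule GA_eqI)
    show "Tr (r \<odot>\<^bsub>GA\<^esub> f) \<in> carrier GA" by (rule Tr_GA[OF GA.smult_closed[OF r(2) f]])
    show "r \<odot>\<^bsub>B\<^esub> Tr f \<in> carrier GA"
      using GA.smult_closed[OF r(2) Tr_GA[OF f]] by (simp add: B_smult)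
    fix m assume m: "m \<in> carrier N"
    have "Tr (r \<odot>\<^bsub>GA\<^esub> f) m = (\<Oplus>\<^bsub>L\<^esub>x\<in>carrier \<Gamma>. r \<otimes>\<^bsub>L\<^esub> \<rho> x (f (\<alpha> (inv\<^bsub>\<Gamma>\<^esub> x) m)))"
      unfolding Tr_apply[OF m] using m r
      by (intro L.finsum_cong')
        (simp_all add: alpha_closed rho_mult GA_mem[OF f] rho_closed rho_K)
    also have "\<dots> = r \<otimes>\<^bsub>L\<^esub> Tr f m"
      unfolding Tr_apply[OF m] using Tr_term_closed[OF f _ m] r
      by (intro L.finsum_rdistr[OF finite_\<Gamma>, symmetric]) auto
    finally show "Tr (r \<odot>\<^bsub>GA\<^esub> f) m = (r \<odot>\<^bsub>B\<^esub> Tr f) m" using m by (simp add: B_smult)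
  qed
qed

lemma tr_closed: "x \<in> carrier L \<Longrightarrow> tr x \<in> carrier L"
  unfolding tr_def by (intro L.finsum_closed) (auto simp: rho_closed)

lemma tr_K:
  assumes x: "x \<in> carrier L" shows "tr x \<in> K"
proof -
  have "\<rho> h (tr x) = tr x" if h: "h \<in> carrier \<Gamma>" for h
  proof -
    have "\<rho> h (tr x) = (\<Oplus>\<^bsub>L\<^esub>g\<in>carrier \<Gamma>. \<rho> h (\<rho> g x))"
      unfolding tr_def by (rule rho_finsum[OF h]) (rule rho_closed[OF _ x])
    also have "\<dots> = (\<Oplus>\<^bsub>L\<^esub>g\<in>carrier \<Gamma>. \<rho> (h \<otimes>\<^bsub>\<Gamma>\<^esub> g) x)"
      using h x by (intro L.finsum_cong') (auto simp: rho_comp rho_closed)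
    also have "\<dots> = tr x" unfolding tr_def by (rule sum_shift[OF h]) (rule rho_closed[OF _ x])
    finally show ?thesis .
  qed
  then show ?thesis using fixed tr_closed[OF x] by blast
qed

lemma Tr_smult_B:
  assumes x: "x \<in> carrier L" and b: "b \<in> carrier B"
  shows "Tr (x \<odot>\<^bsub>GA\<^esub> b) = tr x \<odot>\<^bsub>B\<^esub> b"
proof (rule GA_eqI)
  have bG: "b \<in> carrier GA" by (rule B_GA[OF b])
  show "Tr (x \<odot>\<^bsub>GA\<^esub> b) \<in> carrier GA" by (rule Tr_GA[OF GA.smult_closed[OF x bG]])
  show "tr x \<odot>\<^bsub>B\<^esub> b \<in> carrier GA"
    using GA.smult_closed[OF tr_closed[OF x] bG] by (simp add: B_smult)
  fix m assume m: "m \<in> carrier N"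
  have "Tr (x \<odot>\<^bsub>GA\<^esub> b) m = (\<Oplus>\<^bsub>L\<^esub>g\<in>carrier \<Gamma>. \<rho> g x \<otimes>\<^bsub>L\<^esub> b m)"
    unfolding Tr_apply[OF m]
  proof (rule L.finsum_cong', rule refl)
    show "(\<lambda>g. \<rho> g x \<otimes>\<^bsub>L\<^esub> b m) \<in> carrier \<Gamma> \<rightarrow> carrier L"
      using rho_closed x GA_mem[OF bG m] by auto
    fix g assume g: "g \<in> carrier \<Gamma>"
    have a: "\<alpha> (inv\<^bsub>\<Gamma>\<^esub> g) m \<in> carrier N" using g m by (simp add: alpha_closed)
    have "\<rho> g (b (\<alpha> (inv\<^bsub>\<Gamma>\<^esub> g) m)) = b m"
      using B_equivariant[OF b g a] g m by (simp add: alpha_cancel)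
    then show "\<rho> g ((x \<odot>\<^bsub>GA\<^esub> b) (\<alpha> (inv\<^bsub>\<Gamma>\<^esub> g) m)) = \<rho> g x \<otimes>\<^bsub>L\<^esub> b m"
      using a g x GA_mem[OF bG a] by (simp add: rho_mult)
  qed
  also have "\<dots> = tr x \<otimes>\<^bsub>L\<^esub> b m"
    unfolding tr_def using rho_closed x GA_mem[OF bG m]
    by (intro L.finsum_ldistr[OF finite_\<Gamma>, symmetric]) auto
  finally show "Tr (x \<odot>\<^bsub>GA\<^esub> b) m = (tr x \<odot>\<^bsub>B\<^esub> b) m" using m by (simp add: B_smult)
qed

lemma exists_dual:
  assumes S: "subfield S L"
    and sep: "\<And>g. \<lbrakk>g \<in> carrier \<Gamma>; g \<noteq> \<one>\<^bsub>\<Gamma>\<^esub>\<rbrakk> \<Longrightarrow> \<exists>x\<in>S. \<rho> g x \<in> S \<and> \<rho> g x \<noteq> x"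
  shows "\<exists>(n::nat) e u. e \<in> {..<n} \<rightarrow> S \<and> u \<in> {..<n} \<rightarrow> S \<and>
    (\<forall>g\<in>carrier \<Gamma>. (\<Oplus>\<^bsub>L\<^esub>k\<in>{..<n}. e k \<otimes>\<^bsub>L\<^esub> \<rho> g (u k)) = (if g = \<one>\<^bsub>\<Gamma>\<^esub> then \<one>\<^bsub>L\<^esub> else \<zero>\<^bsub>L\<^esub>))"
proof -
  let ?Y = "\<rho> ` (carrier \<Gamma> - {\<one>\<^bsub>\<Gamma>\<^esub>})"
  note SL = subfieldE(3)[OF S]
  have "\<exists>(n::nat) e u. e \<in> {..<n} \<rightarrow> S \<and> u \<in> {..<n} \<rightarrow> S \<and>
    (\<Oplus>\<^bsub>L\<^esub>k\<in>{..<n}. e k \<otimes>\<^bsub>L\<^esub> u k) = \<one>\<^bsub>L\<^esub> \<and>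
    (\<forall>\<psi>\<in>?Y. (\<Oplus>\<^bsub>L\<^esub>k\<in>{..<n}. e k \<otimes>\<^bsub>L\<^esub> \<psi> (u k)) = \<zero>\<^bsub>L\<^esub>)"
    by (rule exists_dual_family[OF field_L S])
      (use finite_\<Gamma> rho_hom in simp, use rho_hom in blast, use sep in blast)
  then obtain n :: nat and e u where *: "e \<in> {..<n} \<rightarrow> S" "u \<in> {..<n} \<rightarrow> S"
    "(\<Oplus>\<^bsub>L\<^esub>k\<in>{..<n}. e k \<otimes>\<^bsub>L\<^esub> u k) = \<one>\<^bsub>L\<^esub>"
    "\<And>\<psi>. \<psi> \<in> ?Y \<Longrightarrow> (\<Oplus>\<^bsub>L\<^esub>k\<in>{..<n}. e k \<otimes>\<^bsub>L\<^esub> \<psi> (u k)) = \<zero>\<^bsub>L\<^esub>" by blast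
  have "(\<Oplus>\<^bsub>L\<^esub>k\<in>{..<n}. e k \<otimes>\<^bsub>L\<^esub> \<rho> \<one>\<^bsub>\<Gamma>\<^esub> (u k)) = (\<Oplus>\<^bsub>L\<^esub>k\<in>{..<n}. e k \<otimes>\<^bsub>L\<^esub> u k)"
    using *(1,2) SL by (intro L.finsum_cong') (auto simp: rho_id Pi_def)
  with *(3,4) have "\<forall>g\<in>carrier \<Gamma>. (\<Oplus>\<^bsub>L\<^esub>k\<in>{..<n}. e k \<otimes>\<^bsub>L\<^esub> \<rho> g (u k)) =
      (if g = \<one>\<^bsub>\<Gamma>\<^esub> then \<one>\<^bsub>L\<^esub> else \<zero>\<^bsub>L\<^esub>)" by auto
  with *(1,2) show ?thesis by blast
qed

end



text \<open>
  The elements \<open>e k\<close> and \<open>u k\<close> behave like dual bases of \<open>L\<close> over \<open>K\<close>: by \<open>tr_dual_expand\<close>, the elements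
  \<open>tr (u k * s)\<close> of \<open>K\<close> are coordinates of \<open>s\<close> with respect to the \<open>e k\<close>.
\<close>

locale dual_family = galois_descent L N \<Gamma> K \<rho> \<alpha>
  for L :: "('r, 'm) ring_scheme" and N :: "('n, 'k) monoid_scheme" and \<Gamma> :: "('g, 'q) monoid_scheme"
    and K :: "'r set" and \<rho> :: "'g \<Rightarrow> 'r \<Rightarrow> 'r" and \<alpha> :: "'g \<Rightarrow> 'n \<Rightarrow> 'n" +
  fixes d :: nat and e u :: "nat \<Rightarrow> 'r"
  assumes e_closed: "k < d \<Longrightarrow> e k \<in> carrier L" and u_closed: "k < d \<Longrightarrow> u k \<in> carrier L"
    and dual: "g \<in> carrier \<Gamma> \<Longrightarrow>
      (\<Oplus>\<^bsub>L\<^esub>k\<in>{..<d}. e k \<otimes>\<^bsub>L\<^esub> \<rho> g (u k)) = (if g = \<one>\<^bsub>\<Gamma>\<^esub> then \<one>\<^bsub>L\<^esub> else \<zero>\<^bsub>L\<^esub>)"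
begin

lemma smult_GA: "x \<in> carrier L \<Longrightarrow> f \<in> carrier GA \<Longrightarrow> x \<odot>\<^bsub>GA\<^esub> f \<in> carrier GA"
  by (rule GA.smult_closed)

text \<open>
  After the sums over \<open>k\<close> and \<open>g\<close> are exchanged, the \<open>g\<close>-conjugate of \<open>f\<close> has the coefficient
  \<open>\<Sum> e k * g (u k)\<close>, which leaves the term for \<open>g = 1\<close>.
\<close>

lemma Tr_dual_expand:
  assumes f: "f \<in> carrier GA" and m: "m \<in> carrier N"
  shows "(\<Oplus>\<^bsub>L\<^esub>k\<in>{..<d}. e k \<otimes>\<^bsub>L\<^esub> Tr (u k \<odot>\<^bsub>GA\<^esub> f) m) = f m"
proof -
  have am: "\<alpha> (inv\<^bsub>\<Gamma>\<^esub> g) m \<in> carrier N" if "g \<in> carrier \<Gamma>" for g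
    using that m by (simp add: alpha_closed)
  let ?f = "\<lambda>g. \<rho> g (f (\<alpha> (inv\<^bsub>\<Gamma>\<^esub> g) m))"
  have fc: "?f g \<in> carrier L" if "g \<in> carrier \<Gamma>" for g
    by (rule Tr_term_closed[OF f that m])
  have c: "e k \<otimes>\<^bsub>L\<^esub> \<rho> g (u k) \<in> carrier L" if "k < d" "g \<in> carrier \<Gamma>" for k g
    using that e_closed u_closed rho_closed by simp
  have "(\<Oplus>\<^bsub>L\<^esub>k\<in>{..<d}. e k \<otimes>\<^bsub>L\<^esub> Tr (u k \<odot>\<^bsub>GA\<^esub> f) m) =
      (\<Oplus>\<^bsub>L\<^esub>k\<in>{..<d}. \<Oplus>\<^bsub>L\<^esub>g\<in>carrier \<Gamma>. (e k \<otimes>\<^bsub>L\<^esub> \<rho> g (u k)) \<otimes>\<^bsub>L\<^esub> ?f g)"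
  proof (rule L.finsum_cong', rule refl)
    show "(\<lambda>k. \<Oplus>\<^bsub>L\<^esub>g\<in>carrier \<Gamma>. (e k \<otimes>\<^bsub>L\<^esub> \<rho> g (u k)) \<otimes>\<^bsub>L\<^esub> ?f g) \<in> {..<d} \<rightarrow> carrier L"
      using c fc by (auto intro!: L.finsum_closed)
    fix k assume "k \<in> {..<d}"
    then have k: "k < d" by simp
    have "Tr (u k \<odot>\<^bsub>GA\<^esub> f) m = (\<Oplus>\<^bsub>L\<^esub>g\<in>carrier \<Gamma>. \<rho> g (u k) \<otimes>\<^bsub>L\<^esub> ?f g)"
      unfolding Tr_apply[OF m] using rho_closed u_closed[OF k] fc am GA_mem[OF f]
      by (intro L.finsum_cong') (auto simp: rho_mult)
    then have "e k \<otimes>\<^bsub>L\<^esub> Tr (u k \<odot>\<^bsub>GA\<^esub> f) m = (\<Oplus>\<^bsub>L\<^esub>g\<in>carrier \<Gamma>. e k \<otimes>\<^bsub>L\<^esub> (\<rho> g (u k) \<otimes>\<^bsub>L\<^esub> ?f g))"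
      using rho_closed u_closed[OF k] fc e_closed[OF k]
      by (simp add: L.finsum_rdistr[OF finite_\<Gamma>] Pi_def)
    also have "\<dots> = (\<Oplus>\<^bsub>L\<^esub>g\<in>carrier \<Gamma>. (e k \<otimes>\<^bsub>L\<^esub> \<rho> g (u k)) \<otimes>\<^bsub>L\<^esub> ?f g)"
      using rho_closed u_closed[OF k] fc e_closed[OF k]
      by (intro L.finsum_cong') (auto simp: L.m_assoc)
    finally show "e k \<otimes>\<^bsub>L\<^esub> Tr (u k \<odot>\<^bsub>GA\<^esub> f) m =
      (\<Oplus>\<^bsub>L\<^esub>g\<in>carrier \<Gamma>. (e k \<otimes>\<^bsub>L\<^esub> \<rho> g (u k)) \<otimes>\<^bsub>L\<^esub> ?f g)" .
  qed
  also have "\<dots> = (\<Oplus>\<^bsub>L\<^esub>g\<in>carrier \<Gamma>. \<Oplus>\<^bsub>L\<^esub>k\<in>{..<d}. (e k \<otimes>\<^bsub>L\<^esub> \<rho> g (u k)) \<otimes>\<^bsub>L\<^esub> ?f g)"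
    using c fc finite_\<Gamma> by (intro L.finsum_swap) auto
  also have "\<dots> = (\<Oplus>\<^bsub>L\<^esub>g\<in>carrier \<Gamma>. if g = \<one>\<^bsub>\<Gamma>\<^esub> then ?f g else \<zero>\<^bsub>L\<^esub>)"
  proof (rule L.finsum_cong', rule refl)
    show "(\<lambda>g. if g = \<one>\<^bsub>\<Gamma>\<^esub> then ?f g else \<zero>\<^bsub>L\<^esub>) \<in> carrier \<Gamma> \<rightarrow> carrier L"
      using fc by (intro Pi_I) (metis L.zero_closed)
    fix g assume g: "g \<in> carrier \<Gamma>"
    have "(\<Oplus>\<^bsub>L\<^esub>k\<in>{..<d}. (e k \<otimes>\<^bsub>L\<^esub> \<rho> g (u k)) \<otimes>\<^bsub>L\<^esub> ?f g) = (\<Oplus>\<^bsub>L\<^esub>k\<in>{..<d}. e k \<otimes>\<^bsub>L\<^esub> \<rho> g (u k)) \<otimes>\<^bsub>L\<^esub> ?f g"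
      using c fc g by (intro L.finsum_ldistr[symmetric]) auto
    also have "\<dots> = (if g = \<one>\<^bsub>\<Gamma>\<^esub> then ?f g else \<zero>\<^bsub>L\<^esub>)" unfolding dual[OF g] using fc[OF g] by (metis L.l_one L.l_null)
    finally show "(\<Oplus>\<^bsub>L\<^esub>k\<in>{..<d}. (e k \<otimes>\<^bsub>L\<^esub> \<rho> g (u k)) \<otimes>\<^bsub>L\<^esub> ?f g) = (if g = \<one>\<^bsub>\<Gamma>\<^esub> then ?f g else \<zero>\<^bsub>L\<^esub>)" .
  qed
  also have "\<dots> = ?f \<one>\<^bsub>\<Gamma>\<^esub>"
    by (rule L.finsum_delta[OF finite_\<Gamma> \<Gamma>.one_closed, where f = ?f]) (rule fc[OF \<Gamma>.one_closed])
  also have "\<dots> = f m" using m GA_mem[OF f m] by (simp add: alpha_id rho_id)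
  finally show ?thesis .
qed

text \<open>The case of a constant function in \<open>Tr_dual_expand\<close>: there \<open>\<Gamma>\<close> acts on the value only.\<close>

lemma tr_dual_expand:
  assumes s: "s \<in> carrier L"
  shows "(\<Oplus>\<^bsub>L\<^esub>k\<in>{..<d}. tr (u k \<otimes>\<^bsub>L\<^esub> s) \<otimes>\<^bsub>L\<^esub> e k) = s"
proof -
  let ?f = "\<lambda>n\<in>carrier N. s"
  have f: "?f \<in> carrier GA" using s by auto
  have "Tr (u k \<odot>\<^bsub>GA\<^esub> ?f) \<one>\<^bsub>N\<^esub> = tr (u k \<otimes>\<^bsub>L\<^esub> s)" if k: "k < d" for k
    unfolding Tr_apply[OF N.one_closed] tr_def using s u_closed[OF k]
    by (intro L.finsum_cong') (auto simp: alpha_closed rho_closed)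
  then have "(\<Oplus>\<^bsub>L\<^esub>k\<in>{..<d}. tr (u k \<otimes>\<^bsub>L\<^esub> s) \<otimes>\<^bsub>L\<^esub> e k) =
      (\<Oplus>\<^bsub>L\<^esub>k\<in>{..<d}. e k \<otimes>\<^bsub>L\<^esub> Tr (u k \<odot>\<^bsub>GA\<^esub> ?f) \<one>\<^bsub>N\<^esub>)"
    using s e_closed u_closed tr_closed by (intro L.finsum_cong') (auto simp: L.m_comm)
  then show ?thesis using Tr_dual_expand[OF f N.one_closed] by simp
qed

lemma tr_smult:
  assumes "k \<in> K" "x \<in> carrier L"
  shows "tr (k \<otimes>\<^bsub>L\<^esub> x) = k \<otimes>\<^bsub>L\<^esub> tr x"
proof -
  have "tr (k \<otimes>\<^bsub>L\<^esub> x) = (\<Oplus>\<^bsub>L\<^esub>g\<in>carrier \<Gamma>. k \<otimes>\<^bsub>L\<^esub> \<rho> g x)"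
    unfolding tr_def using assms rho_closed K_mem
    by (intro L.finsum_cong') (auto simp: rho_mult rho_K)
  also have "\<dots> = k \<otimes>\<^bsub>L\<^esub> tr x"
    unfolding tr_def using assms rho_closed K_mem
    by (intro L.finsum_rdistr[OF finite_\<Gamma>, symmetric]) auto
  finally show ?thesis .
qed

text \<open>If all traces were zero, so would be the expansion of \<open>1\<close> in the \<open>e k\<close>.\<close>

lemma exists_tr_one: "\<exists>w\<in>carrier L. tr w = \<one>\<^bsub>L\<^esub>"
proof -
  have "\<exists>x\<in>carrier L. tr x \<noteq> \<zero>\<^bsub>L\<^esub>"
  proof (rule ccontr)
    assume "\<not> ?thesis"
    then have z: "tr x = \<zero>\<^bsub>L\<^esub>" if "x \<in> carrier L" for x using that by blast
    have "\<one>\<^bsub>L\<^esub> = (\<Oplus>\<^bsub>L\<^esub>k\<in>{..<d}. tr (u k \<otimes>\<^bsub>L\<^esub> \<one>\<^bsub>L\<^esub>) \<otimes>\<^bsub>L\<^esub> e k)"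
      by (rule tr_dual_expand[symmetric]) simp
    also have "\<dots> = (\<Oplus>\<^bsub>L\<^esub>k\<in>{..<d}. \<zero>\<^bsub>L\<^esub>)"
      using z u_closed e_closed by (intro L.finsum_cong') auto
    also have "\<dots> = \<zero>\<^bsub>L\<^esub>" by (rule L.finsum_zero)
    finally show False using fL.one_not_zero by simp
  qed
  then obtain x where x: "x \<in> carrier L" "tr x \<noteq> \<zero>\<^bsub>L\<^esub>" by blast
  have Kf: "subfield K L" by (rule L.subfield_iff(1)[OF field_K K_subset])
  have i: "inv\<^bsub>L\<^esub> (tr x) \<in> K" "inv\<^bsub>L\<^esub> (tr x) \<otimes>\<^bsub>L\<^esub> tr x = \<one>\<^bsub>L\<^esub>"
    using L.subfield_m_inv[OF Kf, of "tr x"] tr_K x by auto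
  have "tr (inv\<^bsub>L\<^esub> (tr x) \<otimes>\<^bsub>L\<^esub> x) = \<one>\<^bsub>L\<^esub>" using tr_smult[OF i(1) x(1)] i by simp
  then show ?thesis using i(1) x(1) K_mem by (intro bexI[of _ "inv\<^bsub>L\<^esub> (tr x) \<otimes>\<^bsub>L\<^esub> x"]) auto
qed

text \<open>A weight that turns sums over \<open>\<Gamma>\<close> into averages, without division by the order of \<open>\<Gamma>\<close>.\<close>

definition w :: 'r where "w = (SOME w. w \<in> carrier L \<and> tr w = \<one>\<^bsub>L\<^esub>)"

lemma w_closed: "w \<in> carrier L" and tr_w: "tr w = \<one>\<^bsub>L\<^esub>"
  using someI_ex[of "\<lambda>w. w \<in> carrier L \<and> tr w = \<one>\<^bsub>L\<^esub>"] exists_tr_one unfolding w_def by blast+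

text \<open>
  A system of \<open>K\<close>-linear maps from \<open>L\<close> to \<open>B\<close> that recovers an element of \<open>B\<close> from its coefficients
  (\<open>sum_retr\<close>).
\<close>

definition retr :: "'n \<Rightarrow> 'r \<Rightarrow> ('n \<Rightarrow> 'r)"
  where "retr m x = Tr ((w \<otimes>\<^bsub>L\<^esub> x) \<odot>\<^bsub>GA\<^esub> el m)"

lemma retr_lin: "retr m \<in> lin_maps K' L1 B"
proof -
  have "(\<lambda>x. (w \<otimes>\<^bsub>L\<^esub> x) \<odot>\<^bsub>GA\<^esub> el m) \<in> lin_maps K' L1 GA"
  proof (rule lin_mapsI)
    fix x assume "x \<in> carrier L1"
    then have x: "x \<in> carrier L" by simp
    then show "(w \<otimes>\<^bsub>L\<^esub> x) \<odot>\<^bsub>GA\<^esub> el m \<in> carrier GA" using w_closed by (intro smult_GA el_closed) simp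
    show "(w \<otimes>\<^bsub>L\<^esub> (x \<oplus>\<^bsub>L1\<^esub> y)) \<odot>\<^bsub>GA\<^esub> el m = (w \<otimes>\<^bsub>L\<^esub> x) \<odot>\<^bsub>GA\<^esub> el m \<oplus>\<^bsub>GA\<^esub> (w \<otimes>\<^bsub>L\<^esub> y) \<odot>\<^bsub>GA\<^esub> el m"
      if "y \<in> carrier L1" for y
      using GA.smult_l_distr[of "w \<otimes>\<^bsub>L\<^esub> x" "w \<otimes>\<^bsub>L\<^esub> y" "el m"] that x w_closed
      by (simp add: L.r_distr del: group_algebra_simps)
    show "(w \<otimes>\<^bsub>L\<^esub> (r \<odot>\<^bsub>L1\<^esub> x)) \<odot>\<^bsub>GA\<^esub> el m = r \<odot>\<^bsub>GA\<^esub> ((w \<otimes>\<^bsub>L\<^esub> x) \<odot>\<^bsub>GA\<^esub> el m)"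
      if "r \<in> carrier K'" for r
      using GA.smult_assoc1[of r "w \<otimes>\<^bsub>L\<^esub> x" "el m"] that x w_closed K_mem
      by (simp add: L.m_lcomm del: group_algebra_simps)
  qed
  from lin_maps_comp[OF this Tr_lin] show ?thesis unfolding retr_def .
qed

lemma retr_B: "x \<in> carrier L \<Longrightarrow> retr m x \<in> carrier B"
  using lin_maps_closed[OF retr_lin] by simp

lemma sum_retr:
  assumes a: "a \<in> carrier B"
  shows "(\<Oplus>\<^bsub>B\<^esub>m\<in>carrier N. retr m (a m)) = a"
proof -
  have aG: "a \<in> carrier GA" by (rule B_mem[OF a])
  have ac: "\<And>m. m \<in> carrier N \<Longrightarrow> a m \<odot>\<^bsub>GA\<^esub> el m \<in> carrier GA"
    by (rule smult_GA[OF GA_mem[OF aG] el_closed])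
  have "(\<Oplus>\<^bsub>B\<^esub>m\<in>carrier N. retr m (a m)) = Tr (\<Oplus>\<^bsub>GA\<^esub>m\<in>carrier N. (w \<otimes>\<^bsub>L\<^esub> a m) \<odot>\<^bsub>GA\<^esub> el m)"
    unfolding retr_def
    by (rule lin_maps_finsum[OF module_K_GA module_B Tr_lin, symmetric])
      (use smult_GA el_closed GA_mem[OF aG] w_closed L.m_closed in blast)
  also have "(\<Oplus>\<^bsub>GA\<^esub>m\<in>carrier N. (w \<otimes>\<^bsub>L\<^esub> a m) \<odot>\<^bsub>GA\<^esub> el m) =
      (\<Oplus>\<^bsub>GA\<^esub>m\<in>carrier N. w \<odot>\<^bsub>GA\<^esub> (a m \<odot>\<^bsub>GA\<^esub> el m))"
  proof (rule GA.M.finsum_cong', rule refl)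
    show "(\<lambda>m. w \<odot>\<^bsub>GA\<^esub> (a m \<odot>\<^bsub>GA\<^esub> el m)) \<in> carrier N \<rightarrow> carrier GA"
      using smult_GA[OF w_closed ac] by blast
  qed (rule GA.smult_assoc1[OF w_closed GA_mem[OF aG] el_closed])
  also have "\<dots> = w \<odot>\<^bsub>GA\<^esub> (\<Oplus>\<^bsub>GA\<^esub>m\<in>carrier N. a m \<odot>\<^bsub>GA\<^esub> el m)"
    by (rule GA.finsum_smult_ldistr[OF finite_N w_closed, symmetric]) (use ac in blast)
  also have "\<dots> = w \<odot>\<^bsub>GA\<^esub> a" using GA_expand[OF aG] by simp
  also have "Tr (w \<odot>\<^bsub>GA\<^esub> a) = tr w \<odot>\<^bsub>B\<^esub> a" by (rule Tr_smult_B[OF w_closed a])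
  also have "\<dots> = a" unfolding tr_w using B.smult_one[OF a] by simp
  finally show ?thesis .
qed

text \<open>
  The element of \<open>B \<otimes>\<^sub>K B\<close> with the coordinates \<open>F\<close>, provided that there is one. The formula is found
  from \<open>F m q = a m * b q\<close>, where \<open>a \<otimes> b = \<Sum> retr m (a m) \<otimes> b\<close>: expand \<open>a m = \<Sum> tr (u k * a m) * e k\<close>, and move
  the coefficients, which are in \<open>K\<close>, to the right factor, where \<open>tr (u k * a m) * b = Tr (u k * F m)\<close>.
\<close>

definition Rec :: "('n \<Rightarrow> 'n \<Rightarrow> 'r) \<Rightarrow> ('r, 'n \<Rightarrow> 'r, 'n \<Rightarrow> 'r) tensor"
  where "Rec F = (\<Oplus>\<^bsub>BB.T\<^esub>m\<in>carrier N. \<Oplus>\<^bsub>BB.T\<^esub>k\<in>{..<d}.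
    BB.pure (retr m (e k)) (Tr (u k \<odot>\<^bsub>GA\<^esub> (\<lambda>q\<in>carrier N. F m q))))"

lemma Rec_term:
  assumes "\<And>m q. m \<in> carrier N \<Longrightarrow> q \<in> carrier N \<Longrightarrow> F m q \<in> carrier L" "m \<in> carrier N" "k < d"
  shows "(\<lambda>q\<in>carrier N. F m q) \<in> carrier GA" "Tr (u k \<odot>\<^bsub>GA\<^esub> (\<lambda>q\<in>carrier N. F m q)) \<in> carrier B"
    "BB.pure (retr m (e k)) (Tr (u k \<odot>\<^bsub>GA\<^esub> (\<lambda>q\<in>carrier N. F m q))) \<in> carrier BB.T"
proof -
  show f: "(\<lambda>q\<in>carrier N. F m q) \<in> carrier GA" using assms by simp
  show t: "Tr (u k \<odot>\<^bsub>GA\<^esub> (\<lambda>q\<in>carrier N. F m q)) \<in> carrier B"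
    by (rule Tr_B[OF smult_GA[OF u_closed[OF assms(3)] f]])
  show "BB.pure (retr m (e k)) (Tr (u k \<odot>\<^bsub>GA\<^esub> (\<lambda>q\<in>carrier N. F m q))) \<in> carrier BB.T"
    by (rule BB.pure_closed[OF retr_B[OF e_closed[OF assms(3)]] t])
qed

lemma Rec_closed:
  assumes "\<And>m q. m \<in> carrier N \<Longrightarrow> q \<in> carrier N \<Longrightarrow> F m q \<in> carrier L"
  shows "Rec F \<in> carrier BB.T"
  unfolding Rec_def
  by (intro BB.T.M.finsum_closed Pi_I) (use Rec_term(3)[OF assms] in auto)

lemma Rec_add:
  assumes F: "\<And>m q. m \<in> carrier N \<Longrightarrow> q \<in> carrier N \<Longrightarrow> F m q \<in> carrier L"
    and G: "\<And>m q. m \<in> carrier N \<Longrightarrow> q \<in> carrier N \<Longrightarrow> G m q \<in> carrier L"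
    and H: "\<And>m q. m \<in> carrier N \<Longrightarrow> q \<in> carrier N \<Longrightarrow> H m q = F m q \<oplus>\<^bsub>L\<^esub> G m q"
  shows "Rec H = Rec F \<oplus>\<^bsub>BB.T\<^esub> Rec G"
proof -
  let ?t = "\<lambda>F m k. BB.pure (retr m (e k)) (Tr (u k \<odot>\<^bsub>GA\<^esub> (\<lambda>q\<in>carrier N. F m q)))"
  have step: "?t H m k = ?t F m k \<oplus>\<^bsub>BB.T\<^esub> ?t G m k" if m: "m \<in> carrier N" and k: "k < d" for m k
  proof -
    have u: "u k \<in> carrier L" by (rule u_closed[OF k])
    note f = Rec_term(1)[of F, OF F m k] and g = Rec_term(1)[of G, OF G m k]
    have "(\<lambda>q\<in>carrier N. H m q) = (\<lambda>q\<in>carrier N. F m q) \<oplus>\<^bsub>GA\<^esub> (\<lambda>q\<in>carrier N. G m q)"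
      using H[OF m] by (auto simp: fun_eq_iff)
    then have "u k \<odot>\<^bsub>GA\<^esub> (\<lambda>q\<in>carrier N. H m q) =
        u k \<odot>\<^bsub>GA\<^esub> (\<lambda>q\<in>carrier N. F m q) \<oplus>\<^bsub>GA\<^esub> u k \<odot>\<^bsub>GA\<^esub> (\<lambda>q\<in>carrier N. G m q)"
      using GA.smult_r_distr[OF u f g] by (simp del: group_algebra_simps)
    then have "Tr (u k \<odot>\<^bsub>GA\<^esub> (\<lambda>q\<in>carrier N. H m q)) =
        Tr (u k \<odot>\<^bsub>GA\<^esub> (\<lambda>q\<in>carrier N. F m q)) \<oplus>\<^bsub>B\<^esub> Tr (u k \<odot>\<^bsub>GA\<^esub> (\<lambda>q\<in>carrier N. G m q))"
      using lin_maps_add[OF Tr_lin smult_GA[OF u f] smult_GA[OF u g]] by (simp del: group_algebra_simps)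
    then show ?thesis
      using BB.pure_add_right[OF retr_B[OF e_closed[OF k]] Rec_term(2)[of F, OF F m k] Rec_term(2)[of G, OF G m k]]
      by (simp del: group_algebra_simps)
  qed
  have Fc: "?t F m k \<in> carrier BB.T" if "m \<in> carrier N" "k < d" for m k
    using Rec_term(3)[of F, OF F that] .
  have Gc: "?t G m k \<in> carrier BB.T" if "m \<in> carrier N" "k < d" for m k
    using Rec_term(3)[of G, OF G that] .
  have "Rec H = (\<Oplus>\<^bsub>BB.T\<^esub>m\<in>carrier N. (\<Oplus>\<^bsub>BB.T\<^esub>k\<in>{..<d}. ?t F m k) \<oplus>\<^bsub>BB.T\<^esub> (\<Oplus>\<^bsub>BB.T\<^esub>k\<in>{..<d}. ?t G m k))"
    unfolding Rec_def
  proof (rule BB.T.M.finsum_cong', rule refl)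
    show "(\<lambda>m. (\<Oplus>\<^bsub>BB.T\<^esub>k\<in>{..<d}. ?t F m k) \<oplus>\<^bsub>BB.T\<^esub> (\<Oplus>\<^bsub>BB.T\<^esub>k\<in>{..<d}. ?t G m k)) \<in> carrier N \<rightarrow> carrier BB.T"
      using Fc Gc by (intro Pi_I BB.T.M.a_closed BB.T.M.finsum_closed) auto
    fix m assume m: "m \<in> carrier N"
    have "(\<Oplus>\<^bsub>BB.T\<^esub>k\<in>{..<d}. ?t H m k) = (\<Oplus>\<^bsub>BB.T\<^esub>k\<in>{..<d}. ?t F m k \<oplus>\<^bsub>BB.T\<^esub> ?t G m k)"
      by (rule BB.T.M.finsum_cong') (use Fc[OF m] Gc[OF m] step[OF m] in \<open>auto simp del: group_algebra_simps\<close>)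
    also have "\<dots> = (\<Oplus>\<^bsub>BB.T\<^esub>k\<in>{..<d}. ?t F m k) \<oplus>\<^bsub>BB.T\<^esub> (\<Oplus>\<^bsub>BB.T\<^esub>k\<in>{..<d}. ?t G m k)"
      by (rule BB.T.M.finsum_addf) (use Fc[OF m] Gc[OF m] in \<open>auto simp del: group_algebra_simps\<close>)
    finally show "(\<Oplus>\<^bsub>BB.T\<^esub>k\<in>{..<d}. ?t H m k) = (\<Oplus>\<^bsub>BB.T\<^esub>k\<in>{..<d}. ?t F m k) \<oplus>\<^bsub>BB.T\<^esub> (\<Oplus>\<^bsub>BB.T\<^esub>k\<in>{..<d}. ?t G m k)" .
  qed
  also have "\<dots> = Rec F \<oplus>\<^bsub>BB.T\<^esub> Rec G"
    unfolding Rec_def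
    by (rule BB.T.M.finsum_addf) (use Fc Gc in \<open>auto intro!: BB.T.M.finsum_closed simp del: group_algebra_simps\<close>)
  finally show ?thesis .
qed

lemma Rec_pure:
  assumes a: "a \<in> carrier B" and b: "b \<in> carrier B"
    and F: "\<And>m q. m \<in> carrier N \<Longrightarrow> q \<in> carrier N \<Longrightarrow> F m q = a m \<otimes>\<^bsub>L\<^esub> b q"
  shows "Rec F = BB.pure a b"
proof -
  have aG: "a \<in> carrier GA" and bG: "b \<in> carrier GA" using a b B_mem by auto
  note ra = retr_B[OF e_closed]
  have inner: "(\<Oplus>\<^bsub>BB.T\<^esub>k\<in>{..<d}. BB.pure (retr m (e k)) (Tr (u k \<odot>\<^bsub>GA\<^esub> (\<lambda>q\<in>carrier N. F m q)))) =
      BB.pure (retr m (a m)) b" if m: "m \<in> carrier N" for m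
  proof -
    have am: "a m \<in> carrier L" by (rule GA_mem[OF aG m])
    let ?c = "\<lambda>k. tr (u k \<otimes>\<^bsub>L\<^esub> a m)"
    have c: "?c k \<in> carrier K'" if "k < d" for k using tr_K[of "u k \<otimes>\<^bsub>L\<^esub> a m"] u_closed[OF that] am by simp
    have "(\<Oplus>\<^bsub>BB.T\<^esub>k\<in>{..<d}. BB.pure (retr m (e k)) (Tr (u k \<odot>\<^bsub>GA\<^esub> (\<lambda>q\<in>carrier N. F m q)))) =
        (\<Oplus>\<^bsub>BB.T\<^esub>k\<in>{..<d}. BB.pure (?c k \<odot>\<^bsub>B\<^esub> retr m (e k)) b)"
    proof (rule BB.T.M.finsum_cong', rule refl)
      show "(\<lambda>k. BB.pure (?c k \<odot>\<^bsub>B\<^esub> retr m (e k)) b) \<in> {..<d} \<rightarrow> carrier BB.T"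
        using BB.pure_closed[OF B.smult_closed[OF c ra] b] by auto
      fix k assume "k \<in> {..<d}"
      then have k: "k < d" by simp
      have "u k \<odot>\<^bsub>GA\<^esub> (\<lambda>q\<in>carrier N. F m q) = (u k \<otimes>\<^bsub>L\<^esub> a m) \<odot>\<^bsub>GA\<^esub> b"
        using F[OF m] u_closed[OF k] am GA_mem[OF bG] by (auto simp: fun_eq_iff L.m_assoc)
      then have t: "Tr (u k \<odot>\<^bsub>GA\<^esub> (\<lambda>q\<in>carrier N. F m q)) = ?c k \<odot>\<^bsub>B\<^esub> b"
        using Tr_smult_B[OF _ b, of "u k \<otimes>\<^bsub>L\<^esub> a m"] u_closed[OF k] am by (simp del: group_algebra_simps)
      show "BB.pure (retr m (e k)) (Tr (u k \<odot>\<^bsub>GA\<^esub> (\<lambda>q\<in>carrier N. F m q))) = BB.pure (?c k \<odot>\<^bsub>B\<^esub> retr m (e k)) b"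
        unfolding t using BB.pure_smult_left[OF b c[OF k] ra[OF k]] BB.pure_smult_right[OF ra[OF k] c[OF k] b] by simp
    qed
    also have "\<dots> = BB.pure (\<Oplus>\<^bsub>B\<^esub>k\<in>{..<d}. ?c k \<odot>\<^bsub>B\<^esub> retr m (e k)) b"
      by (rule lin_maps_finsum[OF module_B BB.module_T bilin_left[OF BB.bilin_pure b], symmetric])
        (use B.smult_closed[OF c ra] in auto)
    also have "(\<Oplus>\<^bsub>B\<^esub>k\<in>{..<d}. ?c k \<odot>\<^bsub>B\<^esub> retr m (e k)) = (\<Oplus>\<^bsub>B\<^esub>k\<in>{..<d}. retr m (?c k \<otimes>\<^bsub>L\<^esub> e k))"
    proof (rule B.M.finsum_cong', rule refl)
      show "(\<lambda>k. retr m (?c k \<otimes>\<^bsub>L\<^esub> e k)) \<in> {..<d} \<rightarrow> carrier B"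
        using c e_closed K_mem by (auto intro!: retr_B)
      fix k assume "k \<in> {..<d}"
      then have k: "k < d" by simp
      show "?c k \<odot>\<^bsub>B\<^esub> retr m (e k) = retr m (?c k \<otimes>\<^bsub>L\<^esub> e k)"
        using lin_maps_smult[OF retr_lin c[OF k], of "e k" m] e_closed[OF k] by simp
    qed
    also have "\<dots> = retr m (\<Oplus>\<^bsub>L1\<^esub>k\<in>{..<d}. ?c k \<otimes>\<^bsub>L\<^esub> e k)"
      by (rule lin_maps_finsum[OF module_K_L1 module_B retr_lin, symmetric])
        (use c e_closed K_mem in auto)
    also have "(\<Oplus>\<^bsub>L1\<^esub>k\<in>{..<d}. ?c k \<otimes>\<^bsub>L\<^esub> e k) = a m"
      unfolding finsum_algebra_via by (rule tr_dual_expand[OF am])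
    finally show ?thesis .
  qed
  have "Rec F = (\<Oplus>\<^bsub>BB.T\<^esub>m\<in>carrier N. BB.pure (retr m (a m)) b)"
    unfolding Rec_def
    by (rule BB.T.M.finsum_cong')
      (use inner BB.pure_closed[OF retr_B[OF GA_mem[OF aG]] b] in auto)
  also have "\<dots> = BB.pure (\<Oplus>\<^bsub>B\<^esub>m\<in>carrier N. retr m (a m)) b"
    by (rule lin_maps_finsum[OF module_B BB.module_T bilin_left[OF BB.bilin_pure b], symmetric])
      (use retr_B[OF GA_mem[OF aG]] in auto)
  also have "\<dots> = BB.pure a b" unfolding sum_retr[OF a] ..
  finally show ?thesis .
qed

text \<open>
  Elements of \<open>B \<otimes>\<^sub>K B\<close> with the same image in \<open>L[N] \<otimes>\<^sub>L L[N]\<close> have the same coordinates and are therefore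
  equal, so the canonical map is injective.
\<close>

lemma Rec_coordB: "U \<in> carrier BB.T \<Longrightarrow> Rec (\<lambda>m n. coordB m n U) = U"
proof (induction rule: BB.tensor_induct)
  case (pure a b)
  then show ?case by (intro Rec_pure) (simp_all add: coordB_pure)
next
  case (add U V)
  have "Rec (\<lambda>m n. coordB m n (U \<oplus>\<^bsub>BB.T\<^esub> V)) =
      Rec (\<lambda>m n. coordB m n U) \<oplus>\<^bsub>BB.T\<^esub> Rec (\<lambda>m n. coordB m n V)"
    by (rule Rec_add) (use add in \<open>simp_all add: coordB_closed coordB_add\<close>)
  then show ?case using add by simp
qed

text \<open>
  Every equivariant family is a family of coordinates. In the triple sum over \<open>m\<close>, \<open>k\<close> and \<open>g\<close>, only
  \<open>m = \<alpha> (inv g) p\<close> contributes; by \<open>Tr_dual_expand\<close> and equivariance, the sum over \<open>k\<close> is then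
  \<open>\<rho> g w * F p q\<close>, and the sum over \<open>g\<close> is \<open>tr w * F p q = F p q\<close>.
\<close>

lemma coordB_Rec:
  assumes F: "\<And>m n. m \<in> carrier N \<Longrightarrow> n \<in> carrier N \<Longrightarrow> F m n \<in> carrier L"
    and inv: "\<And>g m n. g \<in> carrier \<Gamma> \<Longrightarrow> m \<in> carrier N \<Longrightarrow> n \<in> carrier N \<Longrightarrow>
      F (\<alpha> g m) (\<alpha> g n) = \<rho> g (F m n)"
    and p: "p \<in> carrier N" and q: "q \<in> carrier N"
  shows "coordB p q (Rec F) = F p q"
proof -
  let ?G = "\<lambda>m. \<lambda>q\<in>carrier N. F m q"
  define T where "T m k = Tr (u k \<odot>\<^bsub>GA\<^esub> (\<lambda>q\<in>carrier N. F m q))" for m k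
  let ?a = "\<lambda>g. \<alpha> (inv\<^bsub>\<Gamma>\<^esub> g)"
  note RT = Rec_term[of F, OF F, folded T_def]
  have GG: "?G m \<in> carrier GA" if "m \<in> carrier N" for m using F that by simp
  have TB: "T m k \<in> carrier B" if "m \<in> carrier N" "k < d" for m k
    unfolding T_def by (rule Tr_B[OF smult_GA[OF u_closed[OF that(2)] GG[OF that(1)]]])
  have TL: "T m k n \<in> carrier L" if "m \<in> carrier N" "k < d" "n \<in> carrier N" for m k n
    by (rule GA_mem[OF B_mem[OF TB[OF that(1,2)]] that(3)])
  have ap: "?a g n \<in> carrier N" if "g \<in> carrier \<Gamma>" "n \<in> carrier N" for g n
    using that by (simp add: alpha_closed)
  have we: "\<rho> g (w \<otimes>\<^bsub>L\<^esub> e k) \<in> carrier L" if "g \<in> carrier \<Gamma>" "k < d" for g k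
    using that w_closed e_closed by (simp add: rho_closed)
  let ?D = "\<lambda>m k g. (if m = ?a g p then \<rho> g (w \<otimes>\<^bsub>L\<^esub> e k) \<otimes>\<^bsub>L\<^esub> T m k q else \<zero>\<^bsub>L\<^esub>)"
  have D: "?D m k g \<in> carrier L" if "m \<in> carrier N" "k < d" "g \<in> carrier \<Gamma>" for m k g
    using TL[OF that(1,2) q] we[OF that(3,2)] by (metis L.m_closed L.zero_closed)
  have "coordB p q (Rec F) = (\<Oplus>\<^bsub>L1\<^esub>m\<in>carrier N. coordB p q (\<Oplus>\<^bsub>BB.T\<^esub>k\<in>{..<d}.
    BB.pure (retr m (e k)) (T m k)))"
    unfolding Rec_def T_def[symmetric]
    by (rule lin_maps_finsum[OF BB.module_T module_K_L1 coordB_lin[OF p q]])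
      (intro Pi_I BB.T.M.finsum_closed, use RT(3) in auto)
  also have "\<dots> = (\<Oplus>\<^bsub>L\<^esub>m\<in>carrier N. coordB p q (\<Oplus>\<^bsub>BB.T\<^esub>k\<in>{..<d}. BB.pure (retr m (e k)) (T m k)))"
    by (rule finsum_algebra_via)
  also have "\<dots> = (\<Oplus>\<^bsub>L\<^esub>m\<in>carrier N. \<Oplus>\<^bsub>L\<^esub>k\<in>{..<d}. \<Oplus>\<^bsub>L\<^esub>g\<in>carrier \<Gamma>. ?D m k g)"
  proof (rule L.finsum_cong', rule refl)
    show "(\<lambda>m. \<Oplus>\<^bsub>L\<^esub>k\<in>{..<d}. \<Oplus>\<^bsub>L\<^esub>g\<in>carrier \<Gamma>. ?D m k g) \<in> carrier N \<rightarrow> carrier L"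
      using D by (intro Pi_I L.finsum_closed) auto
    fix m assume m: "m \<in> carrier N"
    have "coordB p q (\<Oplus>\<^bsub>BB.T\<^esub>k\<in>{..<d}. BB.pure (retr m (e k)) (T m k)) =
        (\<Oplus>\<^bsub>L1\<^esub>k\<in>{..<d}. coordB p q (BB.pure (retr m (e k)) (T m k)))"
      by (rule lin_maps_finsum[OF BB.module_T module_K_L1 coordB_lin[OF p q]]) (use RT(3) m in auto)
    also have "\<dots> = (\<Oplus>\<^bsub>L\<^esub>k\<in>{..<d}. coordB p q (BB.pure (retr m (e k)) (T m k)))"
      by (rule finsum_algebra_via)
    also have "\<dots> = (\<Oplus>\<^bsub>L\<^esub>k\<in>{..<d}. \<Oplus>\<^bsub>L\<^esub>g\<in>carrier \<Gamma>. ?D m k g)"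
    proof (rule L.finsum_cong', rule refl)
      show "(\<lambda>k. \<Oplus>\<^bsub>L\<^esub>g\<in>carrier \<Gamma>. ?D m k g) \<in> {..<d} \<rightarrow> carrier L"
        using D m by (intro Pi_I L.finsum_closed) auto
      fix k assume "k \<in> {..<d}"
      then have k: "k < d" by simp
      have wk: "w \<otimes>\<^bsub>L\<^esub> e k \<in> carrier L" using w_closed e_closed[OF k] by simp
      have "coordB p q (BB.pure (retr m (e k)) (T m k)) = retr m (e k) p \<otimes>\<^bsub>L\<^esub> T m k q"
        by (rule coordB_pure[OF p q retr_B[OF e_closed[OF k]] TB[OF m k]])
      also have "retr m (e k) p = (\<Oplus>\<^bsub>L\<^esub>g\<in>carrier \<Gamma>. if m = ?a g p then \<rho> g (w \<otimes>\<^bsub>L\<^esub> e k) else \<zero>\<^bsub>L\<^esub>)"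
        unfolding retr_def Tr_apply[OF p]
        by (rule L.finsum_cong')
          (use we[OF _ k] ap[OF _ p] wk in \<open>auto simp: el_apply rho_zero\<close>)
      also have "\<dots> \<otimes>\<^bsub>L\<^esub> T m k q = (\<Oplus>\<^bsub>L\<^esub>g\<in>carrier \<Gamma>. (if m = ?a g p then \<rho> g (w \<otimes>\<^bsub>L\<^esub> e k) else \<zero>\<^bsub>L\<^esub>) \<otimes>\<^bsub>L\<^esub> T m k q)"
        by (rule L.finsum_ldistr[OF finite_\<Gamma> TL[OF m k q]]) (use we[OF _ k] in auto)
      also have "\<dots> = (\<Oplus>\<^bsub>L\<^esub>g\<in>carrier \<Gamma>. ?D m k g)"
        by (rule L.finsum_cong') (use we[OF _ k] TL[OF m k q] in auto)
      finally show "coordB p q (BB.pure (retr m (e k)) (T m k)) = (\<Oplus>\<^bsub>L\<^esub>g\<in>carrier \<Gamma>. ?D m k g)" .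
    qed
    finally show "coordB p q (\<Oplus>\<^bsub>BB.T\<^esub>k\<in>{..<d}. BB.pure (retr m (e k)) (T m k)) =
      (\<Oplus>\<^bsub>L\<^esub>k\<in>{..<d}. \<Oplus>\<^bsub>L\<^esub>g\<in>carrier \<Gamma>. ?D m k g)" .
  qed
  also have "\<dots> = (\<Oplus>\<^bsub>L\<^esub>k\<in>{..<d}. \<Oplus>\<^bsub>L\<^esub>m\<in>carrier N. \<Oplus>\<^bsub>L\<^esub>g\<in>carrier \<Gamma>. ?D m k g)"
    by (rule L.finsum_swap[OF finite_N]) (use D in \<open>auto intro!: L.finsum_closed\<close>)
  also have "\<dots> = (\<Oplus>\<^bsub>L\<^esub>k\<in>{..<d}. \<Oplus>\<^bsub>L\<^esub>g\<in>carrier \<Gamma>. \<Oplus>\<^bsub>L\<^esub>m\<in>carrier N. ?D m k g)"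
    by (rule L.finsum_cong', rule refl)
      (use D in \<open>auto intro!: L.finsum_closed L.finsum_swap[OF finite_N finite_\<Gamma>]\<close>)
  also have "\<dots> = (\<Oplus>\<^bsub>L\<^esub>g\<in>carrier \<Gamma>. \<Oplus>\<^bsub>L\<^esub>k\<in>{..<d}. \<Oplus>\<^bsub>L\<^esub>m\<in>carrier N. ?D m k g)"
    by (rule L.finsum_swap[OF _ finite_\<Gamma>]) (use D in \<open>auto intro!: L.finsum_closed\<close>)
  also have "\<dots> = (\<Oplus>\<^bsub>L\<^esub>g\<in>carrier \<Gamma>. \<rho> g w \<otimes>\<^bsub>L\<^esub> F p q)"
  proof (rule L.finsum_cong', rule refl)
    show "(\<lambda>g. \<rho> g w \<otimes>\<^bsub>L\<^esub> F p q) \<in> carrier \<Gamma> \<rightarrow> carrier L"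
      using F[OF p q] w_closed rho_closed by auto
    fix g assume g: "g \<in> carrier \<Gamma>"
    let ?p = "?a g p" and ?q = "?a g q"
    have pN: "?p \<in> carrier N" and qN: "?q \<in> carrier N" using ap g p q by auto
    have "(\<Oplus>\<^bsub>L\<^esub>k\<in>{..<d}. \<Oplus>\<^bsub>L\<^esub>m\<in>carrier N. ?D m k g) =
        (\<Oplus>\<^bsub>L\<^esub>k\<in>{..<d}. \<rho> g (w \<otimes>\<^bsub>L\<^esub> (e k \<otimes>\<^bsub>L\<^esub> T ?p k ?q)))"
    proof (rule L.finsum_cong', rule refl)
      show "(\<lambda>k. \<rho> g (w \<otimes>\<^bsub>L\<^esub> (e k \<otimes>\<^bsub>L\<^esub> T ?p k ?q))) \<in> {..<d} \<rightarrow> carrier L"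
        using TL[OF pN _ qN] w_closed e_closed rho_closed[OF g] by auto
      fix k assume "k \<in> {..<d}"
      then have k: "k < d" by simp
      have "(\<Oplus>\<^bsub>L\<^esub>m\<in>carrier N. ?D m k g) = \<rho> g (w \<otimes>\<^bsub>L\<^esub> e k) \<otimes>\<^bsub>L\<^esub> T ?p k q"
        by (rule L.finsum_delta[OF finite_N pN, where f = "\<lambda>m. \<rho> g (w \<otimes>\<^bsub>L\<^esub> e k) \<otimes>\<^bsub>L\<^esub> T m k q"])
          (use we[OF g k] TL[OF pN k q] in simp)
      also have "T ?p k q = \<rho> g (T ?p k ?q)"
        using B_equivariant[OF TB[OF pN k] g qN] g q by (simp add: alpha_cancel)
      also have "\<rho> g (w \<otimes>\<^bsub>L\<^esub> e k) \<otimes>\<^bsub>L\<^esub> \<rho> g (T ?p k ?q) = \<rho> g (w \<otimes>\<^bsub>L\<^esub> (e k \<otimes>\<^bsub>L\<^esub> T ?p k ?q))"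
        using TL[OF pN k qN] w_closed e_closed[OF k] g by (simp add: rho_mult[symmetric] L.m_assoc)
      finally show "(\<Oplus>\<^bsub>L\<^esub>m\<in>carrier N. ?D m k g) = \<rho> g (w \<otimes>\<^bsub>L\<^esub> (e k \<otimes>\<^bsub>L\<^esub> T ?p k ?q))" .
    qed
    also have "\<dots> = \<rho> g (\<Oplus>\<^bsub>L\<^esub>k\<in>{..<d}. w \<otimes>\<^bsub>L\<^esub> (e k \<otimes>\<^bsub>L\<^esub> T ?p k ?q))"
      by (rule rho_finsum[OF g, symmetric]) (use TL[OF pN _ qN] w_closed e_closed in auto)
    also have "(\<Oplus>\<^bsub>L\<^esub>k\<in>{..<d}. w \<otimes>\<^bsub>L\<^esub> (e k \<otimes>\<^bsub>L\<^esub> T ?p k ?q)) = w \<otimes>\<^bsub>L\<^esub> (\<Oplus>\<^bsub>L\<^esub>k\<in>{..<d}. e k \<otimes>\<^bsub>L\<^esub> T ?p k ?q)"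
      by (rule L.finsum_rdistr[symmetric]) (use TL[OF pN _ qN] w_closed e_closed in auto)
    also have "(\<Oplus>\<^bsub>L\<^esub>k\<in>{..<d}. e k \<otimes>\<^bsub>L\<^esub> T ?p k ?q) = F ?p ?q"
      using Tr_dual_expand[OF GG[OF pN] qN, folded T_def] qN by simp
    also have "\<rho> g (w \<otimes>\<^bsub>L\<^esub> F ?p ?q) = \<rho> g w \<otimes>\<^bsub>L\<^esub> F p q"
      using inv[OF g pN qN] g p q F[OF pN qN] w_closed by (simp add: rho_mult alpha_cancel)
    finally show "(\<Oplus>\<^bsub>L\<^esub>k\<in>{..<d}. \<Oplus>\<^bsub>L\<^esub>m\<in>carrier N. ?D m k g) = \<rho> g w \<otimes>\<^bsub>L\<^esub> F p q" .
  qed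
  also have "\<dots> = tr w \<otimes>\<^bsub>L\<^esub> F p q"
    unfolding tr_def by (rule L.finsum_ldistr[OF finite_\<Gamma> F[OF p q], symmetric]) (use w_closed rho_closed in auto)
  also have "\<dots> = F p q" using F[OF p q] by (simp add: tr_w)
  finally show ?thesis .
qed

text \<open>
  The diagonal family of an element of \<open>B\<close> is equivariant, so the comultiplication of \<open>L[N]\<close> restricts
  to \<open>B\<close>.
\<close>

lemma ex1_comul:
  assumes f: "f \<in> carrier B"
  shows "\<exists>!U. U \<in> carrier BB.T \<and>
    (\<forall>m\<in>carrier N. \<forall>n\<in>carrier N. coordB m n U = (if m = n then f m else \<zero>\<^bsub>L\<^esub>))"
proof -
  let ?F = "\<lambda>m n. if m = n then f m else \<zero>\<^bsub>L\<^esub>"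
  have Fc: "?F m n \<in> carrier L" if "m \<in> carrier N" "n \<in> carrier N" for m n
    using GA_mem[OF B_mem[OF f]] that by simp
  have Fi: "?F (\<alpha> g m) (\<alpha> g n) = \<rho> g (?F m n)"
    if "g \<in> carrier \<Gamma>" "m \<in> carrier N" "n \<in> carrier N" for g m n
  proof -
    have "\<alpha> g m = \<alpha> g n \<longleftrightarrow> m = n" using alpha_cancel(2) that by metis
    then show ?thesis using that B_equivariant[OF f] rho_zero by simp
  qed
  show ?thesis
  proof (rule ex1I[of _ "Rec ?F"])
    show "Rec ?F \<in> carrier BB.T \<and> (\<forall>m\<in>carrier N. \<forall>n\<in>carrier N. coordB m n (Rec ?F) = ?F m n)"
      using Rec_closed[of ?F] Fc coordB_Rec[of ?F] Fi by blast
    fix U assume U: "U \<in> carrier BB.T \<and> (\<forall>m\<in>carrier N. \<forall>n\<in>carrier N. coordB m n U = ?F m n)"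
    then have "U = Rec (\<lambda>m n. coordB m n U)" by (simp add: Rec_coordB)
    \<comment> \<open>The two families agree on \<open>carrier N\<close> only. As sums with the zero family they satisfy the
      hypotheses of \<open>Rec_add\<close>, which are restricted to \<open>carrier N\<close>.\<close>
    also have "\<dots> = Rec ?F \<oplus>\<^bsub>BB.T\<^esub> Rec (\<lambda>m n. \<zero>\<^bsub>L\<^esub>)"
      by (rule Rec_add) (use U Fc in auto)
    also have "Rec (\<lambda>m n. \<zero>\<^bsub>L\<^esub>) = BB.pure \<zero>\<^bsub>B\<^esub> \<zero>\<^bsub>B\<^esub>"
      by (rule Rec_pure[OF B.M.zero_closed B.M.zero_closed]) (simp add: fixed_hopf_fields(1))
    also have "\<dots> = \<zero>\<^bsub>BB.T\<^esub>"
      using lin_maps_zero[OF module_B BB.module_T bilin_left[OF BB.bilin_pure]] by simp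
    finally show "U = Rec ?F" using Rec_closed[of ?F] Fc by simp
  qed
qed

end



section \<open>Isomorphisms of Hopf algebras\<close>

lemma tensor_lift_target_cong:
  assumes "carrier P = carrier P'" "add P = add P'" "ring.zero P = ring.zero P'"
    "module.smult P = module.smult P'"
  shows "tensor_lift R M N P \<beta> = tensor_lift R M N P' \<beta>"
  by (simp add: tensor_lift_def fun_eq_iff finsum_structure_cong[OF assms(1-3)] assms(4) Let_def)

lemma hopf_isoD:
  assumes "f \<in> hopf_iso R A B"
  shows "f \<in> ring_hom A B" "f \<in> lin_maps R A B" "bij_betw f (carrier A) (carrier B)"
    "\<And>x. x \<in> carrier A \<Longrightarrow> comul B (f x) = tensor_map R A A B B f f (comul A x)"
    "\<And>x. x \<in> carrier A \<Longrightarrow> counit B (f x) = counit A x"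
    "\<And>x. x \<in> carrier A \<Longrightarrow> antipode B (f x) = f (antipode A x)"
  using assms by (auto simp: hopf_iso_def alg_hom_def)

context hopf_algebra
begin

lemma module_H: "module R H" by (rule assoc_algebra.axioms(1)[OF assoc_algebra_axioms])

lemma comul_lin: "comul H \<in> lin_maps R H (tensor_module R H H)"
  using comul_hom by (simp add: alg_hom_def lin_maps_def)

lemma counit_lin: "counit H \<in> lin_maps R H (algebra_via (\<lambda>r. r) R)"
  using counit_hom by (simp add: alg_hom_def)

end

lemma lin_maps_inv_into:
  assumes "f \<in> lin_maps R A B" "bij_betw f (carrier A) (carrier B)" "module R A"
  shows "inv_into (carrier A) f \<in> lin_maps R B A"
proof -
  interpret A: module R A by fact
  let ?g = "inv_into (carrier A) f"
  have g: "\<And>y. y \<in> carrier B \<Longrightarrow> ?g y \<in> carrier A" "\<And>y. y \<in> carrier B \<Longrightarrow> f (?g y) = y"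
    "\<And>x. x \<in> carrier A \<Longrightarrow> ?g (f x) = x"
    using assms(2) by (auto simp: bij_betw_def inv_into_into f_inv_into_f)
  show ?thesis
  proof (rule lin_mapsI)
    fix x y assume "x \<in> carrier B" "y \<in> carrier B"
    then show "?g (x \<oplus>\<^bsub>B\<^esub> y) = ?g x \<oplus>\<^bsub>A\<^esub> ?g y"
      using g(3)[of "?g x \<oplus>\<^bsub>A\<^esub> ?g y"] g(1,2) lin_maps_add[OF assms(1), of "?g x" "?g y"] by simp
  next
    fix r x assume "r \<in> carrier R" "x \<in> carrier B"
    then show "?g (r \<odot>\<^bsub>B\<^esub> x) = r \<odot>\<^bsub>A\<^esub> ?g x"
      using g(3)[of "r \<odot>\<^bsub>A\<^esub> ?g x"] g(1,2) lin_maps_smult[OF assms(1), of r "?g x"] by simp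
  qed (rule g(1))
qed

lemma hopf_iso_inv_into:
  assumes "f \<in> hopf_iso R A B" "hopf_algebra R A" "module R B"
  shows "inv_into (carrier A) f \<in> hopf_iso R B A"
proof -
  interpret A: hopf_algebra R A by fact
  interpret B: module R B by fact
  let ?g = "inv_into (carrier A) f"
  note f = hopf_isoD[OF assms(1)]
  have g: "\<And>y. y \<in> carrier B \<Longrightarrow> ?g y \<in> carrier A" "\<And>y. y \<in> carrier B \<Longrightarrow> f (?g y) = y"
    "\<And>x. x \<in> carrier A \<Longrightarrow> ?g (f x) = x"
    using f(3) by (auto simp: bij_betw_def inv_into_into f_inv_into_f)
  have lin: "?g \<in> lin_maps R B A" by (rule lin_maps_inv_into[OF f(2,3) A.module_H])
  have "?g \<in> ring_hom B A"
  proof (rule ring_hom_memI)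
    show "\<And>x. x \<in> carrier B \<Longrightarrow> ?g x \<in> carrier A" by (rule g(1))
    show "?g \<one>\<^bsub>B\<^esub> = \<one>\<^bsub>A\<^esub>" using g(3)[of "\<one>\<^bsub>A\<^esub>"] ring_hom_one[OF f(1)] by simp
    fix x y assume xy: "x \<in> carrier B" "y \<in> carrier B"
    show "?g (x \<otimes>\<^bsub>B\<^esub> y) = ?g x \<otimes>\<^bsub>A\<^esub> ?g y"
      using xy g(3)[of "?g x \<otimes>\<^bsub>A\<^esub> ?g y"] g(1,2) ring_hom_mult[OF f(1), of "?g x" "?g y"] by simp
    show "?g (x \<oplus>\<^bsub>B\<^esub> y) = ?g x \<oplus>\<^bsub>A\<^esub> ?g y" using lin_maps_add[OF lin] xy by simp
  qed
  moreover have "bij_betw ?g (carrier B) (carrier A)" by (rule bij_betw_inv_into[OF f(3)])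
  moreover have "comul A (?g y) = tensor_map R B B A A ?g ?g (comul B y)" if y: "y \<in> carrier B" for y
  proof -
    have tA: "tensor_product R A A" and tB: "tensor_product R B B"
      by (auto intro: tensor_product.intro A.module_H assms(3))
    interpret AA: tensor_product R A A by (rule tA)
    let ?c = "comul A (?g y)"
    have c: "?c \<in> carrier AA.T" using lin_maps_closed[OF A.comul_lin] g y by simp
    have "tensor_map R B B A A ?g ?g (comul B y) = tensor_map R B B A A ?g ?g (tensor_map R A A B B f f ?c)"
      using f(4)[of "?g y"] g y by simp
    also have "\<dots> = ?c"
      by (rule AA.lin_maps_eqI[OF lin_maps_comp[OF tensor_map_lin[OF tA tB f(2) f(2)] tensor_map_lin[OF tB tA lin lin]] lin_maps_id c])
        (simp add: tensor_map_pure[OF tA tB f(2) f(2)] tensor_map_pure[OF tB tA lin lin] lin_maps_closed[OF f(2)] g)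
    finally show ?thesis by simp
  qed
  moreover have "counit A (?g y) = counit B y" "antipode A (?g y) = ?g (antipode B y)" if y: "y \<in> carrier B" for y
    using f(5,6)[of "?g y"] g y lin_maps_closed[OF A.antipode_lin] by simp_all
  ultimately show ?thesis using lin by (simp add: hopf_iso_def alg_hom_def)
qed


section \<open>Extension of scalars for Hopf algebras\<close>

lemma base_change_fields:
  "carrier (base_change R S \<phi> H) = carrier (base_change_module R S \<phi> H)"
  "monoid.mult (base_change R S \<phi> H) = monoid.mult (base_change_module R S \<phi> H)"
  "one (base_change R S \<phi> H) = one (base_change_module R S \<phi> H)"
  "ring.zero (base_change R S \<phi> H) = ring.zero (base_change_module R S \<phi> H)"
  "add (base_change R S \<phi> H) = add (base_change_module R S \<phi> H)"
  "module.smult (base_change R S \<phi> H) = module.smult (base_change_module R S \<phi> H)"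
  "counit (base_change R S \<phi> H) = tensor_lift R (algebra_via \<phi> S) H (algebra_via \<phi> S)
    (\<lambda>s h. s \<otimes>\<^bsub>S\<^esub> \<phi> (counit H h))"
  "antipode (base_change R S \<phi> H) = tensor_map R (algebra_via \<phi> S) H (algebra_via \<phi> S) H (\<lambda>s. s) (antipode H)"
  by (simp_all add: base_change_def Let_def module.defs)

lemma base_change_comul:
  fixes R :: "('r, 'm) ring_scheme" and S :: "('s, 'n) ring_scheme" and \<phi> :: "'r \<Rightarrow> 's"
    and H :: "('r, 'h, 'p) hopf_scheme"
  defines "V \<equiv> base_change_module R S \<phi> H" and "A \<equiv> algebra_via \<phi> S"
  shows "comul (base_change R S \<phi> H) = tensor_lift R A H (restrict_scalars \<phi> (tensor_module S V V))
      (\<lambda>s h. s \<odot>\<^bsub>tensor_module S V V\<^esub> tensor_lift R H H (restrict_scalars \<phi> (tensor_module S V V))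
        (\<lambda>a b. pure_tensor S V V (pure_tensor R A H \<one>\<^bsub>S\<^esub> a) (pure_tensor R A H \<one>\<^bsub>S\<^esub> b)) (comul H h))"
  by (simp add: base_change_def Let_def module.defs V_def A_def)

lemma bilin_restrict_scalars:
  assumes "bilin S M N P \<beta>" "\<phi> \<in> ring_hom R S"
  shows "bilin R (restrict_scalars \<phi> M) (restrict_scalars \<phi> N) (restrict_scalars \<phi> P) \<beta>"
  using assms by (auto simp: bilin_def intro: lin_maps_restrict_scalars)

locale base_changed_hopf = base_changed_module R S \<phi> H
  for R :: "('r, 'm) ring_scheme" and S :: "('s, 'n) ring_scheme" and \<phi> :: "'r \<Rightarrow> 's"
    and H :: "('r, 'h, 'p) hopf_scheme" +
  assumes comul_lin: "comul H \<in> lin_maps R H (tensor_module R H H)"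
    and counit_lin: "counit H \<in> lin_maps R H (algebra_via (\<lambda>r. r) R)"
    and antipode_lin: "antipode H \<in> lin_maps R H H"
begin

abbreviation "W \<equiv> base_change R S \<phi> H"

sublocale HH: tensor_product R H H by (rule tensor_product.intro[OF module_H module_H])
sublocale VV: tensor_product S V V by (rule tensor_product.intro[OF module_V module_V])

lemma tensor_W: "tensor_module S W W = VV.T" "pure_tensor S W W = VV.pure"
  "tensor_lift S W W P \<beta> = tensor_lift S V V P \<beta>"
  by (rule tensor_cong; simp only: base_change_fields)+

lemma module_VV_R: "module R (restrict_scalars \<phi> VV.T)"
  by (rule module_restrict_scalars[OF H.R.is_cring VV.module_T hom])

text \<open>The comultiplication of \<open>1 \<otimes> h\<close>, with values in \<open>(S \<otimes>\<^sub>R H) \<otimes>\<^sub>S (S \<otimes>\<^sub>R H)\<close>.\<close>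

definition comul_H :: "'h \<Rightarrow> ('s, ('r, 's, 'h) tensor, ('r, 's, 'h) tensor) tensor"
  where "comul_H h = tensor_lift R H H (restrict_scalars \<phi> VV.T)
    (\<lambda>a b. VV.pure (pt \<one>\<^bsub>S\<^esub> a) (pt \<one>\<^bsub>S\<^esub> b)) (comul H h)"

lemma bilin_ones:
  assumes "bilin S V V P \<beta>"
  shows "bilin R H H (restrict_scalars \<phi> P) (\<lambda>a b. \<beta> (pt \<one>\<^bsub>S\<^esub> a) (pt \<one>\<^bsub>S\<^esub> b))"
  by (rule bilin_comp[OF bilin_restrict_scalars[OF assms hom] one_tensor_lin one_tensor_lin])

lemma comul_H_lin: "comul_H \<in> lin_maps R H (restrict_scalars \<phi> VV.T)"
  using lin_maps_comp[OF comul_lin HH.lift_lin[OF module_VV_R bilin_ones[OF VV.bilin_pure]]]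
  unfolding comul_H_def .

lemma comul_W_lin: "comul W \<in> lin_maps S V VV.T"
  using extend_lin[OF VV.module_T comul_H_lin]
  unfolding base_change_comul comul_H_def .

lemma comul_W_pure: "s \<in> carrier S \<Longrightarrow> h \<in> carrier H \<Longrightarrow> comul W (pt s h) = s \<odot>\<^bsub>VV.T\<^esub> comul_H h"
  using extend_pure[OF VV.module_T comul_H_lin, of s h]
  unfolding base_change_comul comul_H_def .

text \<open>This reduces identities about the comultiplication of \<open>S \<otimes>\<^sub>R H\<close> to identities over \<open>R\<close>.\<close>

lemma lift_comul_H:
  assumes P: "module S P" and \<beta>: "bilin S V V P \<beta>" and h: "h \<in> carrier H"
  shows "tensor_lift S V V P \<beta> (comul_H h) =
    tensor_lift R H H (restrict_scalars \<phi> P) (\<lambda>a b. \<beta> (pt \<one>\<^bsub>S\<^esub> a) (pt \<one>\<^bsub>S\<^esub> b)) (comul H h)"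
proof -
  have PR: "module R (restrict_scalars \<phi> P)"
    by (rule module_restrict_scalars[OF H.R.is_cring P hom])
  have c: "comul H h \<in> carrier HH.T" by (rule lin_maps_closed[OF comul_lin h])
  have "tensor_lift S V V P \<beta> (comul_H h) = tensor_lift R H H (restrict_scalars \<phi> P)
      (\<lambda>a b. tensor_lift S V V P \<beta> (VV.pure (pt \<one>\<^bsub>S\<^esub> a) (pt \<one>\<^bsub>S\<^esub> b))) (comul H h)"
    unfolding comul_H_def
    by (rule HH.lift_post[OF module_VV_R bilin_ones[OF VV.bilin_pure] PR
        lin_maps_restrict_scalars[OF VV.lift_lin[OF P \<beta>] hom] c])
  also have "\<dots> = tensor_lift R H H (restrict_scalars \<phi> P) (\<lambda>a b. \<beta> (pt \<one>\<^bsub>S\<^esub> a) (pt \<one>\<^bsub>S\<^esub> b)) (comul H h)"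
    by (rule HH.tensor_lift_cong[OF c PR _ bilin_ones[OF \<beta>]])
      (simp add: VV.lift_pure[OF P \<beta>])
  finally show ?thesis .
qed

lemma counit_W_lin: "counit W \<in> lin_maps S V (algebra_via (\<lambda>x. x) S)"
  and counit_W_pure: "s \<in> carrier S \<Longrightarrow> h \<in> carrier H \<Longrightarrow> counit W (pt s h) = s \<otimes>\<^bsub>S\<^esub> \<phi> (counit H h)"
proof -
  let ?S1 = "algebra_via (\<lambda>x. x) S"
  have P: "module S ?S1" by (rule module_algebra_via[OF cring_S cring_S]) (auto simp: ring_hom_def)
  note [simp] = ring_hom_memE[OF hom] lin_mapsD[OF counit_lin, simplified]
  have g: "(\<lambda>h. \<phi> (counit H h)) \<in> lin_maps R H (restrict_scalars \<phi> ?S1)"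
    by (rule lin_mapsI) simp_all
  show "counit W \<in> lin_maps S V ?S1"
    using extend_lin[OF P g] by (simp add: base_change_fields restrict_scalars_algebra_via)
  show "s \<in> carrier S \<Longrightarrow> h \<in> carrier H \<Longrightarrow> counit W (pt s h) = s \<otimes>\<^bsub>S\<^esub> \<phi> (counit H h)"
    using extend_pure[OF P g, of s h] by (simp add: base_change_fields restrict_scalars_algebra_via)
qed

lemma antipode_W_lin: "antipode W \<in> lin_maps R tp.T tp.T"
  and antipode_W_pure: "s \<in> carrier S \<Longrightarrow> h \<in> carrier H \<Longrightarrow> antipode W (pt s h) = pt s (antipode H h)"
proof -
  have "tensor_product R A H" by (rule tp.tensor_product_axioms)
  note t = tensor_map_props[OF this this lin_maps_id antipode_lin]
  show "antipode W \<in> lin_maps R tp.T tp.T" using t(1) by (simp add: base_change_fields)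
  show "s \<in> carrier S \<Longrightarrow> h \<in> carrier H \<Longrightarrow> antipode W (pt s h) = pt s (antipode H h)"
    using t(2)[of s h] by (simp add: base_change_fields)
qed

end


section \<open>Splitting over the Galois extension\<close>

lemma (in finite_group_algebra) comul_lin: "comul (group_hopf L N) \<in> lin_maps L GA AA.T"
proof -
  have "(\<lambda>f. \<Oplus>\<^bsub>AA.T\<^esub>n\<in>carrier N. f n \<odot>\<^bsub>AA.T\<^esub> AA.pure (el n) (el n)) \<in> lin_maps L GA AA.T"
  proof (rule lin_maps_finsumf[OF module_GA AA.module_T])
    fix n assume n: "n \<in> carrier N"
    show "(\<lambda>f. f n \<odot>\<^bsub>AA.T\<^esub> AA.pure (el n) (el n)) \<in> lin_maps L GA AA.T"
    proof (rule lin_mapsI)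
      fix f assume f: "f \<in> carrier GA"
      note [simp] = GA_mem[OF f n] n
      show "f n \<odot>\<^bsub>AA.T\<^esub> AA.pure (el n) (el n) \<in> carrier AA.T"
        using AA.pure_closed[OF el_closed[of n] el_closed[of n]] by simp
      show "(r \<odot>\<^bsub>GA\<^esub> f) n \<odot>\<^bsub>AA.T\<^esub> AA.pure (el n) (el n) = r \<odot>\<^bsub>AA.T\<^esub> (f n \<odot>\<^bsub>AA.T\<^esub> AA.pure (el n) (el n))"
        if "r \<in> carrier L" for r
        using AA.pure_closed[OF el_closed[of n] el_closed[of n]] that by (simp add: AA.T.smult_assoc1)
      fix g assume g: "g \<in> carrier GA"
      show "(f \<oplus>\<^bsub>GA\<^esub> g) n \<odot>\<^bsub>AA.T\<^esub> AA.pure (el n) (el n) =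
        f n \<odot>\<^bsub>AA.T\<^esub> AA.pure (el n) (el n) \<oplus>\<^bsub>AA.T\<^esub> g n \<odot>\<^bsub>AA.T\<^esub> AA.pure (el n) (el n)"
        using AA.pure_closed[OF el_closed[of n] el_closed[of n]] GA_mem[OF g n] by (simp add: AA.T.smult_l_distr)
    qed
  qed
  moreover have "comul (group_hopf L N) =
      (\<lambda>f. \<Oplus>\<^bsub>AA.T\<^esub>n\<in>carrier N. f n \<odot>\<^bsub>AA.T\<^esub> AA.pure (el n) (el n))"
    by (rule ext) (rule group_hopf_fields(9))
  ultimately show ?thesis by (simp only:)
qed

locale descended_hopf = dual_family L N \<Gamma> K \<rho> \<alpha> d e u
  for L :: "('r, 'm) ring_scheme" and N :: "('n, 'k) monoid_scheme" and \<Gamma> :: "('g, 'q) monoid_scheme"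
    and K :: "'r set" and \<rho> \<alpha> d e u +
  fixes H :: "('r, 'h, 'p) hopf_scheme" and \<theta> :: "'h \<Rightarrow> 'n \<Rightarrow> 'r"
  assumes hopf_H: "hopf_algebra (L\<lparr>carrier := K\<rparr>) H"
    and theta: "\<theta> \<in> hopf_iso (L\<lparr>carrier := K\<rparr>) H (fixed_hopf K L N (carrier \<Gamma>) \<rho> \<alpha>)"
begin

sublocale H: hopf_algebra K' H by (rule hopf_H)

lemmas theta_hom = hopf_isoD(1)[OF theta]
lemmas theta_lin = hopf_isoD(2)[OF theta]
lemmas theta_bij = hopf_isoD(3)[OF theta]

lemma theta_B: "h \<in> carrier H \<Longrightarrow> \<theta> h \<in> carrier B" by (rule lin_maps_closed[OF theta_lin])
lemma theta_GA: "h \<in> carrier H \<Longrightarrow> \<theta> h \<in> carrier GA" by (rule B_mem[OF theta_B])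

text \<open>The comultiplication of \<open>B\<close> is given by a definite description, which \<open>ex1_comul\<close> justifies.\<close>

lemma comul_B:
  assumes "f \<in> carrier B"
  shows "comul B f \<in> carrier BB.T" "tensor_lift K' B B AA.T AA.pure (comul B f) = comul (group_hopf L N) f"
proof -
  have "comul B f = (THE U. U \<in> carrier BB.T \<and> tensor_lift K' B B AA.T AA.pure U = comul (group_hopf L N) f)"
    by (rule fixed_hopf_comul) (simp_all only: fixed_hopf_fields)
  moreover have "\<exists>!U. U \<in> carrier BB.T \<and> tensor_lift K' B B AA.T AA.pure U = comul (group_hopf L N) f"
    using ex1_comul[OF assms] canonical_eq_comul_iff[OF _ B_mem[OF assms]] by (metis (no_types, lifting))
  ultimately have "comul B f \<in> carrier BB.T \<and> tensor_lift K' B B AA.T AA.pure (comul B f) = comul (group_hopf L N) f"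
    using theI'[of "\<lambda>U. U \<in> carrier BB.T \<and> tensor_lift K' B B AA.T AA.pure U = comul (group_hopf L N) f"] by simp
  then show "comul B f \<in> carrier BB.T" "tensor_lift K' B B AA.T AA.pure (comul B f) = comul (group_hopf L N) f"
    by auto
qed

lemma comul_theta:
  assumes h: "h \<in> carrier H"
  shows "tensor_lift K' H H AA.T (\<lambda>a b. AA.pure (\<theta> a) (\<theta> b)) (comul H h) = comul (group_hopf L N) (\<theta> h)"
proof -
  have tH: "tensor_product K' H H" by (rule tensor_product.intro[OF H.module_H H.module_H])
  have "tensor_lift K' H H AA.T (\<lambda>a b. AA.pure (\<theta> a) (\<theta> b)) (comul H h) =
      tensor_lift K' B B AA.T AA.pure (tensor_map K' H H B B \<theta> \<theta> (comul H h))"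
    by (rule tensor_lift_map[OF tH BB.tensor_product_axioms module_K_AA theta_lin theta_lin bilin_B_pure
        lin_maps_closed[OF H.comul_lin h], symmetric])
  also have "\<dots> = comul (group_hopf L N) (\<theta> h)"
    using comul_B(2)[OF theta_B[OF h]] hopf_isoD(4)[OF theta h] by simp
  finally show ?thesis .
qed

sublocale bc: base_changed_hopf K' L "\<lambda>x. x" H
proof (intro base_changed_hopf.intro base_changed_module.intro base_changed_hopf_axioms.intro)
  show "(\<lambda>x. x) \<in> ring_hom K' L" using K_subset by (auto simp: ring_hom_def)
qed (rule cring_L H.module_H H.comul_lin H.counit_lin H.antipode_lin)+

lemma theta_lin_L: "\<theta> \<in> lin_maps K' H (restrict_scalars (\<lambda>x. x) GA)"
  by (rule lin_mapsI)
    (use theta_GA lin_mapsD[OF theta_lin] in \<open>simp_all add: B_add B_smult del: group_algebra_simps\<close>)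

definition split :: "('r, 'r, 'h) tensor \<Rightarrow> ('n \<Rightarrow> 'r)"
  where "split = tensor_lift K' L1 H (restrict_scalars (\<lambda>x. x) GA) (\<lambda>s h. s \<odot>\<^bsub>GA\<^esub> \<theta> h)"

lemma split_lin: "split \<in> lin_maps L bc.V GA"
  unfolding split_def by (rule bc.extend_lin[OF module_GA theta_lin_L])

lemma split_pure: "s \<in> carrier L \<Longrightarrow> h \<in> carrier H \<Longrightarrow> split (bc.pt s h) = s \<odot>\<^bsub>GA\<^esub> \<theta> h"
  unfolding split_def by (rule bc.extend_pure[OF module_GA theta_lin_L])

lemma split_one: "h \<in> carrier H \<Longrightarrow> split (bc.pt \<one>\<^bsub>L\<^esub> h) = \<theta> h"
  using split_pure[of "\<one>\<^bsub>L\<^esub>" h] GA.smult_one[OF theta_GA] by simp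

abbreviation "theta_inv \<equiv> inv_into (carrier H) \<theta>"

lemma theta_inv: "b \<in> carrier B \<Longrightarrow> theta_inv b \<in> carrier H" "b \<in> carrier B \<Longrightarrow> \<theta> (theta_inv b) = b"
  "h \<in> carrier H \<Longrightarrow> theta_inv (\<theta> h) = h"
  using theta_bij by (auto simp: bij_betw_def inv_into_into f_inv_into_f)

lemma theta_inv_lin: "theta_inv \<in> lin_maps K' B H"
  by (rule lin_maps_inv_into[OF theta_lin theta_bij H.module_H])

text \<open>The inverse of \<open>split\<close>, read off from \<open>f = \<Sum> e k * Tr (u k * f)\<close>.\<close>

definition unsplit :: "('n \<Rightarrow> 'r) \<Rightarrow> ('r, 'r, 'h) tensor"
  where "unsplit f = (\<Oplus>\<^bsub>bc.V\<^esub>k\<in>{..<d}. bc.pt (e k) (theta_inv (Tr (u k \<odot>\<^bsub>GA\<^esub> f))))"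

lemma unsplit_term:
  assumes "f \<in> carrier GA" "k < d"
  shows "theta_inv (Tr (u k \<odot>\<^bsub>GA\<^esub> f)) \<in> carrier H" "bc.pt (e k) (theta_inv (Tr (u k \<odot>\<^bsub>GA\<^esub> f))) \<in> carrier bc.V"
proof -
  show "theta_inv (Tr (u k \<odot>\<^bsub>GA\<^esub> f)) \<in> carrier H"
    by (rule theta_inv(1)[OF Tr_B[OF smult_GA[OF u_closed[OF assms(2)] assms(1)]]])
  then show "bc.pt (e k) (theta_inv (Tr (u k \<odot>\<^bsub>GA\<^esub> f))) \<in> carrier bc.V"
    by (rule bc.pure_closed[OF e_closed[OF assms(2)]])
qed

lemma unsplit_closed: "f \<in> carrier GA \<Longrightarrow> unsplit f \<in> carrier bc.V"
  unfolding unsplit_def using unsplit_term(2) by (intro bc.V.M.finsum_closed) (auto simp del: bc.V_simps group_algebra_simps)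

lemma split_unsplit:
  assumes f: "f \<in> carrier GA"
  shows "split (unsplit f) = f"
proof (rule GA_eqI[OF lin_maps_closed[OF split_lin unsplit_closed[OF f]] f])
  fix m assume m: "m \<in> carrier N"
  let ?b = "\<lambda>k. Tr (u k \<odot>\<^bsub>GA\<^esub> f)"
  have bB: "?b k \<in> carrier B" if "k < d" for k by (rule Tr_B[OF smult_GA[OF u_closed[OF that] f]])
  have "split (unsplit f) = (\<Oplus>\<^bsub>GA\<^esub>k\<in>{..<d}. split (bc.pt (e k) (theta_inv (?b k))))"
    unfolding unsplit_def
    by (rule lin_maps_finsum[OF bc.module_V module_GA split_lin]) (use unsplit_term(2)[OF f] in blast)
  also have "\<dots> = (\<Oplus>\<^bsub>GA\<^esub>k\<in>{..<d}. e k \<odot>\<^bsub>GA\<^esub> ?b k)"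
  proof (rule GA.M.finsum_cong', rule refl)
    show "(\<lambda>k. e k \<odot>\<^bsub>GA\<^esub> ?b k) \<in> {..<d} \<rightarrow> carrier GA"
      using smult_GA[OF e_closed B_mem[OF bB]] by blast
    fix k assume "k \<in> {..<d}"
    then have k: "k < d" by simp
    show "split (bc.pt (e k) (theta_inv (?b k))) = e k \<odot>\<^bsub>GA\<^esub> ?b k"
      using split_pure[OF e_closed[OF k] theta_inv(1)[OF bB[OF k]]] theta_inv(2)[OF bB[OF k]] by simp
  qed
  finally have "split (unsplit f) m = (\<Oplus>\<^bsub>GA\<^esub>k\<in>{..<d}. e k \<odot>\<^bsub>GA\<^esub> ?b k) m" by simp
  also have "\<dots> = (\<Oplus>\<^bsub>L\<^esub>k\<in>{..<d}. (e k \<odot>\<^bsub>GA\<^esub> ?b k) m)"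
    by (rule GA_finsum_eval[OF _ m]) (use smult_GA[OF e_closed B_mem[OF bB]] in blast)
  also have "\<dots> = (\<Oplus>\<^bsub>L\<^esub>k\<in>{..<d}. e k \<otimes>\<^bsub>L\<^esub> ?b k m)"
    by (rule L.finsum_cong') (use m e_closed GA_mem[OF B_mem[OF bB] m] in auto)
  also have "\<dots> = f m" by (rule Tr_dual_expand[OF f m])
  finally show "split (unsplit f) m = f m" .
qed

lemma unsplit_add:
  assumes f: "f \<in> carrier GA" and g: "g \<in> carrier GA"
  shows "unsplit (f \<oplus>\<^bsub>GA\<^esub> g) = unsplit f \<oplus>\<^bsub>bc.V\<^esub> unsplit g"
proof -
  let ?t = "\<lambda>f k. bc.pt (e k) (theta_inv (Tr (u k \<odot>\<^bsub>GA\<^esub> f)))"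
  have "unsplit (f \<oplus>\<^bsub>GA\<^esub> g) = (\<Oplus>\<^bsub>bc.V\<^esub>k\<in>{..<d}. ?t f k \<oplus>\<^bsub>bc.V\<^esub> ?t g k)"
    unfolding unsplit_def
  proof (rule bc.V.M.finsum_cong', rule refl)
    show "(\<lambda>k. ?t f k \<oplus>\<^bsub>bc.V\<^esub> ?t g k) \<in> {..<d} \<rightarrow> carrier bc.V"
      using bc.V.M.a_closed[OF unsplit_term(2)[OF f] unsplit_term(2)[OF g]] by blast
    fix k assume "k \<in> {..<d}"
    then have k: "k < d" by simp
    note uf = smult_GA[OF u_closed[OF k] f] and ug = smult_GA[OF u_closed[OF k] g]
    have "theta_inv (Tr (u k \<odot>\<^bsub>GA\<^esub> (f \<oplus>\<^bsub>GA\<^esub> g))) =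
        theta_inv (Tr (u k \<odot>\<^bsub>GA\<^esub> f)) \<oplus>\<^bsub>H\<^esub> theta_inv (Tr (u k \<odot>\<^bsub>GA\<^esub> g))"
      unfolding GA.smult_r_distr[OF u_closed[OF k] f g] lin_maps_add[OF Tr_lin uf ug]
      by (rule lin_maps_add[OF theta_inv_lin Tr_B[OF uf] Tr_B[OF ug]])
    then show "?t (f \<oplus>\<^bsub>GA\<^esub> g) k = ?t f k \<oplus>\<^bsub>bc.V\<^esub> ?t g k"
      using bc.tp.pure_add_right[OF _ unsplit_term(1)[OF f k] unsplit_term(1)[OF g k], of "e k"] e_closed[OF k]
      by (simp del: group_algebra_simps)
  qed
  also have "\<dots> = unsplit f \<oplus>\<^bsub>bc.V\<^esub> unsplit g"
    unfolding unsplit_def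
    by (rule bc.V.M.finsum_addf) (use unsplit_term(2)[OF f] unsplit_term(2)[OF g] in blast)+
  finally show ?thesis .
qed

text \<open>
  Since \<open>Tr (u k * s * \<theta> h) = tr (u k * s) * \<theta> h\<close>, the coefficients \<open>tr (u k * s)\<close> can be moved to the left
  factors \<open>e k\<close>, which then add up to \<open>s\<close>.
\<close>

lemma unsplit_pure:
  assumes s: "s \<in> carrier L" and h: "h \<in> carrier H"
  shows "unsplit (s \<odot>\<^bsub>GA\<^esub> \<theta> h) = bc.pt s h"
proof -
  let ?c = "\<lambda>k. tr (u k \<otimes>\<^bsub>L\<^esub> s)"
  have c: "?c k \<in> carrier K'" if "k < d" for k
    using tr_K[of "u k \<otimes>\<^bsub>L\<^esub> s"] u_closed[OF that] s by simp
  have cL: "?c k \<otimes>\<^bsub>L\<^esub> e k \<in> carrier L1" if "k < d" for k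
    using c[OF that] K_mem e_closed[OF that] by simp
  have "unsplit (s \<odot>\<^bsub>GA\<^esub> \<theta> h) = (\<Oplus>\<^bsub>bc.tp.T\<^esub>k\<in>{..<d}. bc.pt (?c k \<otimes>\<^bsub>L\<^esub> e k) h)"
    unfolding unsplit_def finsum_structure_cong[OF bc.V_simps(1,3,2)]
  proof (rule bc.tp.T.M.finsum_cong', rule refl)
    show "(\<lambda>k. bc.pt (?c k \<otimes>\<^bsub>L\<^esub> e k) h) \<in> {..<d} \<rightarrow> carrier bc.tp.T"
      using bc.tp.pure_closed[OF cL h] by blast
    fix k assume "k \<in> {..<d}"
    then have k: "k < d" by simp
    have "Tr (u k \<odot>\<^bsub>GA\<^esub> (s \<odot>\<^bsub>GA\<^esub> \<theta> h)) = ?c k \<odot>\<^bsub>B\<^esub> \<theta> h"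
      using Tr_smult_B[OF _ theta_B[OF h], of "u k \<otimes>\<^bsub>L\<^esub> s"] u_closed[OF k] s
        GA.smult_assoc1[OF u_closed[OF k] s theta_GA[OF h]] by (simp del: group_algebra_simps)
    then have "theta_inv (Tr (u k \<odot>\<^bsub>GA\<^esub> (s \<odot>\<^bsub>GA\<^esub> \<theta> h))) = ?c k \<odot>\<^bsub>H\<^esub> h"
      using lin_maps_smult[OF theta_inv_lin c[OF k] theta_B[OF h]] theta_inv(3)[OF h] by simp
    then show "bc.pt (e k) (theta_inv (Tr (u k \<odot>\<^bsub>GA\<^esub> (s \<odot>\<^bsub>GA\<^esub> \<theta> h)))) = bc.pt (?c k \<otimes>\<^bsub>L\<^esub> e k) h"
      using bc.tp.pure_smult_left[OF h c[OF k], of "e k"] bc.tp.pure_smult_right[OF _ c[OF k] h, of "e k"] e_closed[OF k]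
      by simp
  qed
  also have "\<dots> = bc.pt (\<Oplus>\<^bsub>L1\<^esub>k\<in>{..<d}. ?c k \<otimes>\<^bsub>L\<^esub> e k) h"
    by (rule lin_maps_finsum[OF module_K_L1 bc.tp.module_T bilin_left[OF bc.tp.bilin_pure h], symmetric])
      (use cL in blast)
  also have "(\<Oplus>\<^bsub>L1\<^esub>k\<in>{..<d}. ?c k \<otimes>\<^bsub>L\<^esub> e k) = s"
    unfolding finsum_algebra_via by (rule tr_dual_expand[OF s])
  finally show ?thesis .
qed

lemma unsplit_split: "U \<in> carrier bc.V \<Longrightarrow> unsplit (split U) = U"
proof (induction rule: bc.V_induct)
  case (pure s h)
  then show ?case by (simp only: split_pure unsplit_pure)
next
  case (add U W)
  then show ?case
    by (simp only: lin_maps_add[OF split_lin] unsplit_add lin_maps_closed[OF split_lin])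
qed

lemma split_bij: "bij_betw split (carrier bc.V) (carrier GA)"
  by (rule bij_betw_byWitness[of _ unsplit])
    (use unsplit_split split_unsplit unsplit_closed lin_maps_closed[OF split_lin] in blast)+

lemma B_mult: "monoid.mult B = monoid.mult GA" by (rule fixed_hopf_fields(3))

sublocale HA: tensor_product_mult K' L1 H
proof (intro tensor_product_mult.intro tensor_product_mult_axioms.intro)
  show "tensor_product K' L1 H" by (rule bc.tp.tensor_product_axioms)
  have "(\<lambda>x. x) \<in> ring_hom K' L" using K_subset by (auto simp: ring_hom_def)
  from algebra.bilin_mult[OF algebra_algebra_via[OF K.is_cring cring_L this]]
  show "bilin K' L1 L1 L1 (monoid.mult L1)" .
  show "bilin K' H H H (monoid.mult H)"
    by (rule bilinI)
      (simp_all add: H.l_distr H.r_distr H.smult_mult_left[simplified] H.smult_mult_right[simplified])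
qed

lemma split_mult:
  assumes "U \<in> carrier bc.V" "V \<in> carrier bc.V"
  shows "split (U \<otimes>\<^bsub>bc.V\<^esub> V) = split U \<otimes>\<^bsub>GA\<^esub> split V"
  using assms(1)
proof (induction rule: bc.V_induct)
  case sh: (pure s h)
  note Gm = lin_mapsD[OF bilin_left[OF bilin_GA_mult]] lin_mapsD[OF bilin_right[OF bilin_GA_mult]]
  show ?case using assms(2)
  proof (induction rule: bc.V_induct)
    case (pure s' h')
    have "bc.pt s h \<otimes>\<^bsub>bc.V\<^esub> bc.pt s' h' = bc.pt (s \<otimes>\<^bsub>L\<^esub> s') (h \<otimes>\<^bsub>H\<^esub> h')"
      using HA.TA_mult_pure[of s h s' h'] sh pure by simp
    then have "split (bc.pt s h \<otimes>\<^bsub>bc.V\<^esub> bc.pt s' h') = (s \<otimes>\<^bsub>L\<^esub> s') \<odot>\<^bsub>GA\<^esub> (\<theta> h \<otimes>\<^bsub>GA\<^esub> \<theta> h')"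
      using split_pure[of "s \<otimes>\<^bsub>L\<^esub> s'" "h \<otimes>\<^bsub>H\<^esub> h'"] sh pure ring_hom_mult[OF theta_hom sh(2) pure(2)]
      by (simp add: B_mult del: group_algebra_simps)
    also have "\<dots> = s \<odot>\<^bsub>GA\<^esub> (s' \<odot>\<^bsub>GA\<^esub> (\<theta> h \<otimes>\<^bsub>GA\<^esub> \<theta> h'))"
      by (rule GA.smult_assoc1[OF sh(1) pure(1) bilin_closed[OF bilin_GA_mult theta_GA[OF sh(2)] theta_GA[OF pure(2)]]])
    also have "\<dots> = s \<odot>\<^bsub>GA\<^esub> (\<theta> h \<otimes>\<^bsub>GA\<^esub> (s' \<odot>\<^bsub>GA\<^esub> \<theta> h'))"
      by (simp only: Gm(6)[OF theta_GA[OF sh(2)] pure(1) theta_GA[OF pure(2)]])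
    also have "\<dots> = (s \<odot>\<^bsub>GA\<^esub> \<theta> h) \<otimes>\<^bsub>GA\<^esub> (s' \<odot>\<^bsub>GA\<^esub> \<theta> h')"
      by (rule Gm(3)[OF smult_GA[OF pure(1) theta_GA[OF pure(2)]] sh(1) theta_GA[OF sh(2)], symmetric])
    finally show ?case unfolding split_pure[OF sh] split_pure[OF pure] .
  next
    case (add U W)
    have sU: "split U \<in> carrier GA" "split W \<in> carrier GA" using add lin_maps_closed[OF split_lin] by auto
    have st: "split (bc.pt s h) \<in> carrier GA"
      by (rule lin_maps_closed[OF split_lin bc.pure_closed[OF sh]])
    have cl: "bc.pt s h \<otimes>\<^bsub>bc.V\<^esub> U \<in> carrier bc.V" "bc.pt s h \<otimes>\<^bsub>bc.V\<^esub> W \<in> carrier bc.V"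
      using HA.TA_mult_closed[of "bc.pt s h"] sh add(1,2) by simp_all
    have "bc.pt s h \<otimes>\<^bsub>bc.V\<^esub> (U \<oplus>\<^bsub>bc.V\<^esub> W) = bc.pt s h \<otimes>\<^bsub>bc.V\<^esub> U \<oplus>\<^bsub>bc.V\<^esub> bc.pt s h \<otimes>\<^bsub>bc.V\<^esub> W"
      using HA.TA_mult_add_right[of "bc.pt s h" U W] sh add(1,2) by simp
    then have "split (bc.pt s h \<otimes>\<^bsub>bc.V\<^esub> (U \<oplus>\<^bsub>bc.V\<^esub> W)) =
        split (bc.pt s h) \<otimes>\<^bsub>GA\<^esub> split U \<oplus>\<^bsub>GA\<^esub> split (bc.pt s h) \<otimes>\<^bsub>GA\<^esub> split W"
      by (simp only: lin_maps_add[OF split_lin cl] add.IH)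
    also have "\<dots> = split (bc.pt s h) \<otimes>\<^bsub>GA\<^esub> (split U \<oplus>\<^bsub>GA\<^esub> split W)"
      by (rule Gm(5)[OF st sU, symmetric])
    finally show ?case by (simp only: lin_maps_add[OF split_lin add(1,2)])
  qed
next
  case (add U W)
  note Gm = lin_mapsD[OF bilin_left[OF bilin_GA_mult]] lin_mapsD[OF bilin_right[OF bilin_GA_mult]]
  have sU: "split U \<in> carrier GA" "split W \<in> carrier GA" using add lin_maps_closed[OF split_lin] by auto
  have st: "split V \<in> carrier GA" by (rule lin_maps_closed[OF split_lin assms(2)])
  have cl: "U \<otimes>\<^bsub>bc.V\<^esub> V \<in> carrier bc.V" "W \<otimes>\<^bsub>bc.V\<^esub> V \<in> carrier bc.V"
    using HA.TA_mult_closed[of _ V] assms(2) add(1,2) by simp_all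
  have "(U \<oplus>\<^bsub>bc.V\<^esub> W) \<otimes>\<^bsub>bc.V\<^esub> V = U \<otimes>\<^bsub>bc.V\<^esub> V \<oplus>\<^bsub>bc.V\<^esub> W \<otimes>\<^bsub>bc.V\<^esub> V"
    using HA.TA_mult_add_left[of V U W] assms(2) add(1,2) by simp
  then have "split ((U \<oplus>\<^bsub>bc.V\<^esub> W) \<otimes>\<^bsub>bc.V\<^esub> V) = split U \<otimes>\<^bsub>GA\<^esub> split V \<oplus>\<^bsub>GA\<^esub> split W \<otimes>\<^bsub>GA\<^esub> split V"
    by (simp only: lin_maps_add[OF split_lin cl] add.IH)
  also have "\<dots> = (split U \<oplus>\<^bsub>GA\<^esub> split W) \<otimes>\<^bsub>GA\<^esub> split V"
    by (rule Gm(2)[OF st sU, symmetric])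
  finally show ?case by (simp only: lin_maps_add[OF split_lin add(1,2)])
qed

lemma restrict_id_AA: "tensor_lift K' H H (restrict_scalars (\<lambda>x. x) AA.T) \<beta> = tensor_lift K' H H AA.T \<beta>"
  by (rule tensor_lift_target_cong) (simp_all add: fun_eq_iff)

text \<open>By linearity it suffices to compare both sides on \<open>1 \<otimes> h\<close>, where the identity is \<open>comul_theta\<close>.\<close>

lemma split_comul:
  assumes "U \<in> carrier bc.V"
  shows "comul (group_hopf L N) (split U) = tensor_lift L bc.V bc.V AA.T (\<lambda>a b. AA.pure (split a) (split b)) (comul bc.W U)"
proof -
  have b: "bilin L bc.V bc.V AA.T (\<lambda>a b. AA.pure (split a) (split b))"
    by (rule bilin_comp[OF AA.bilin_pure split_lin split_lin])
  show ?thesis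
  proof (rule bc.lin_maps_V_eqI[OF lin_maps_comp[OF split_lin comul_lin]
        lin_maps_comp[OF bc.comul_W_lin bc.VV.lift_lin[OF AA.module_T b]] assms])
    fix h assume h: "h \<in> carrier H"
    have tH: "tensor_product K' H H" by (rule tensor_product.intro[OF H.module_H H.module_H])
    have "bc.comul_H h \<in> carrier bc.VV.T" using lin_maps_closed[OF bc.comul_H_lin h] by simp
    then have "comul bc.W (bc.pt \<one>\<^bsub>L\<^esub> h) = bc.comul_H h"
      using bc.comul_W_pure[OF L.one_closed h] by (simp add: bc.VV.T.smult_one)
    then have "tensor_lift L bc.V bc.V AA.T (\<lambda>a b. AA.pure (split a) (split b)) (comul bc.W (bc.pt \<one>\<^bsub>L\<^esub> h)) =
      tensor_lift K' H H AA.T (\<lambda>a b. AA.pure (split (bc.pt \<one>\<^bsub>L\<^esub> a)) (split (bc.pt \<one>\<^bsub>L\<^esub> b))) (comul H h)"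
      using bc.lift_comul_H[OF AA.module_T b h] by (simp add: restrict_id_AA)
    also have "\<dots> = tensor_lift K' H H AA.T (\<lambda>a b. AA.pure (\<theta> a) (\<theta> b)) (comul H h)"
      by (rule tensor_product.tensor_lift_cong[OF tH lin_maps_closed[OF H.comul_lin h] module_K_AA])
        (simp_all add: split_one bilin_comp[OF bilin_B_pure theta_lin theta_lin])
    also have "\<dots> = comul (group_hopf L N) (split (bc.pt \<one>\<^bsub>L\<^esub> h))"
      by (simp only: comul_theta[OF h] split_one[OF h])
    finally show "comul (group_hopf L N) (split (bc.pt \<one>\<^bsub>L\<^esub> h)) =
      tensor_lift L bc.V bc.V AA.T (\<lambda>a b. AA.pure (split a) (split b)) (comul bc.W (bc.pt \<one>\<^bsub>L\<^esub> h))" by simp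
  qed
qed

lemma split_counit:
  assumes "U \<in> carrier bc.V"
  shows "counit (group_hopf L N) (split U) = counit bc.W U"
proof -
  have g: "counit (group_hopf L N) \<in> lin_maps L GA L1"
  proof -
    have "(\<lambda>f. \<Oplus>\<^bsub>L1\<^esub>n\<in>carrier N. f n) \<in> lin_maps L GA L1"
      by (rule lin_maps_finsumf[OF module_GA module_L1 eval_lin])
    moreover have "counit (group_hopf L N) = (\<lambda>f. \<Oplus>\<^bsub>L1\<^esub>n\<in>carrier N. f n)"
      by (rule ext) (simp only: group_hopf_fields(7) finsum_algebra_via)
    ultimately show ?thesis by (simp only:)
  qed
  show ?thesis
  proof (rule bc.lin_maps_V_eqI[OF lin_maps_comp[OF split_lin g] bc.counit_W_lin assms])
    fix h assume h: "h \<in> carrier H"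
    have "counit H h \<in> carrier L" using lin_maps_closed[OF H.counit_lin h] K_mem by simp
    then show "counit (group_hopf L N) (split (bc.pt \<one>\<^bsub>L\<^esub> h)) = counit bc.W (bc.pt \<one>\<^bsub>L\<^esub> h)"
      using bc.counit_W_pure[OF L.one_closed h] hopf_isoD(5)[OF theta h] split_one[OF h]
      by (simp add: group_hopf_fields(7) fixed_hopf_fields(6))
  qed
qed

lemma split_antipode:
  assumes "U \<in> carrier bc.V"
  shows "antipode (group_hopf L N) (split U) = split (antipode bc.W U)"
  using assms
proof (induction rule: bc.V_induct)
  case (pure s h)
  have "antipode (group_hopf L N) (s \<odot>\<^bsub>GA\<^esub> \<theta> h) = s \<odot>\<^bsub>GA\<^esub> antipode B (\<theta> h)"
    by (auto simp: group_hopf_fields(8) fixed_hopf_fields(7))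
  also have "antipode B (\<theta> h) = \<theta> (antipode H h)" by (rule hopf_isoD(6)[OF theta pure(2)])
  finally show ?case
    using split_pure[OF pure] bc.antipode_W_pure[OF pure] split_pure[OF pure(1) lin_maps_closed[OF H.antipode_lin pure(2)]]
    by simp
next
  case (add U W)
  have c: "antipode bc.W U \<in> carrier bc.V" "antipode bc.W W \<in> carrier bc.V"
    using lin_maps_closed[OF bc.antipode_W_lin] add(1,2) by simp_all
  have "antipode bc.W (U \<oplus>\<^bsub>bc.V\<^esub> W) = antipode bc.W U \<oplus>\<^bsub>bc.V\<^esub> antipode bc.W W"
    using lin_maps_add[OF bc.antipode_W_lin] add(1,2) by simp
  then have "split (antipode bc.W (U \<oplus>\<^bsub>bc.V\<^esub> W)) =
      antipode (group_hopf L N) (split U) \<oplus>\<^bsub>GA\<^esub> antipode (group_hopf L N) (split W)"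
    by (simp only: lin_maps_add[OF split_lin c] add.IH)
  also have "\<dots> = antipode (group_hopf L N) (split U \<oplus>\<^bsub>GA\<^esub> split W)"
    by (auto simp: group_hopf_fields(8))
  finally show ?case by (simp only: lin_maps_add[OF split_lin add(1,2)])
qed

theorem split_hopf_iso: "split \<in> hopf_iso L (base_change K' L (\<lambda>x. x) H) (group_hopf L N)"
proof -
  have "split \<in> ring_hom bc.W (group_hopf L N)"
  proof (rule ring_hom_memI)
    show "split U \<in> carrier (group_hopf L N)" if "U \<in> carrier bc.W" for U
      using lin_maps_closed[OF split_lin] that by (simp only: group_hopf_fields base_change_fields)
    show "split \<one>\<^bsub>bc.W\<^esub> = \<one>\<^bsub>group_hopf L N\<^esub>"
      using split_one[OF H.one_closed] ring_hom_one[OF theta_hom]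
      by (simp only: base_change_fields bc.V_simps group_hopf_fields fixed_hopf_fields)
    fix U V assume "U \<in> carrier bc.W" "V \<in> carrier bc.W"
    then have U: "U \<in> carrier bc.V" "V \<in> carrier bc.V" by (simp_all only: base_change_fields)
    show "split (U \<otimes>\<^bsub>bc.W\<^esub> V) = split U \<otimes>\<^bsub>group_hopf L N\<^esub> split V"
      unfolding group_hopf_fields base_change_fields by (rule split_mult[OF U])
    show "split (U \<oplus>\<^bsub>bc.W\<^esub> V) = split U \<oplus>\<^bsub>group_hopf L N\<^esub> split V"
      unfolding group_hopf_fields base_change_fields by (rule lin_maps_add[OF split_lin U])
  qed
  moreover have "split \<in> lin_maps L bc.W (group_hopf L N)"
    using split_lin by (simp only: lin_maps_def base_change_fields group_hopf_fields)
  moreover have "bij_betw split (carrier bc.W) (carrier (group_hopf L N))"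
    using split_bij by (simp only: base_change_fields group_hopf_fields)
  moreover have "comul (group_hopf L N) (split U) =
      tensor_map L bc.W bc.W (group_hopf L N) (group_hopf L N) split split (comul bc.W U)"
    if "U \<in> carrier bc.W" for U
  proof -
    have A: "tensor_module L (group_hopf L N) (group_hopf L N) = AA.T"
      "pure_tensor L (group_hopf L N) (group_hopf L N) = AA.pure"
      by (rule tensor_cong; simp only: group_hopf_fields)+
    have "U \<in> carrier bc.V" using that by (simp only: base_change_fields)
    from split_comul[OF this] show ?thesis unfolding tensor_map_def A bc.tensor_W .
  qed
  ultimately show ?thesis
    using split_counit split_antipode
    by (simp add: hopf_iso_def alg_hom_def base_change_fields(1))
qed

end



section \<open>A common overfield\<close>

lemma (in cring) exists_maximalideal:
  assumes "\<one> \<noteq> \<zero>"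
  shows "\<exists>J. maximalideal J R"
proof -
  let ?A = "{I. ideal I R \<and> \<one> \<notin> I}"
  have "{\<zero>} \<in> ?A" using zeroideal assms by simp
  then have "?A \<noteq> {}" by blast
  moreover have "\<Union>C \<in> ?A" if C: "C \<noteq> {}" "subset.chain ?A C" for C
  proof -
    have "ideal (\<Union>C) R"
      by (rule chain_Union_is_ideal[of C, simplified C(1) if_False])
        (use C in \<open>auto simp: subset.chain_def\<close>)
    then show ?thesis using C by (auto simp: subset.chain_def)
  qed
  ultimately have "\<exists>J\<in>?A. \<forall>I\<in>?A. J \<subseteq> I \<longrightarrow> I = J" by (rule subset_Zorn_nonempty)
  then obtain J where J: "ideal J R" "\<one> \<notin> J" "\<And>I. ideal I R \<Longrightarrow> \<one> \<notin> I \<Longrightarrow> J \<subseteq> I \<Longrightarrow> I = J" by blast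
  have "maximalideal J R"
  proof (rule maximalidealI[OF J(1)])
    show "carrier R \<noteq> J" using J(2) by blast
    fix I assume I: "ideal I R" "J \<subseteq> I"
    show "I = J \<or> I = carrier R"
      using J(3)[OF I(1) _ I(2)] ideal.one_imp_carrier[OF I(1)] by blast
  qed
  then show ?thesis by blast
qed

text \<open>
  \<open>M\<close> is a residue field of \<open>L \<otimes>\<^sub>R L'\<close>. The linear form \<open>\<mu>\<close> ensures that this ring is not zero: the map
  \<open>l \<otimes> l' \<mapsto> \<phi> (\<mu> l) * l'\<close> takes \<open>1 \<otimes> 1\<close> to \<open>1\<close>.
\<close>

lemma exists_common_overfield:
  fixes R :: "('r, 'm) ring_scheme" and L :: "('s, 'n) ring_scheme" and L' :: "('l, 'p) ring_scheme"
  assumes "cring R" "cring L" "field L'" "i \<in> ring_hom R L" "\<phi> \<in> ring_hom R L'"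
    and "\<mu> \<in> lin_maps R (algebra_via i L) (algebra_via (\<lambda>x. x) R)" "\<mu> \<one>\<^bsub>L\<^esub> = \<one>\<^bsub>R\<^esub>"
  shows "\<exists>(M :: ('r, 's, 'l) tensor set ring) \<sigma> \<kappa>. field M \<and> \<sigma> \<in> ring_hom L M \<and> \<kappa> \<in> ring_hom L' M \<and>
    (\<forall>x\<in>carrier R. \<sigma> (i x) = \<kappa> (\<phi> x))"
proof -
  interpret R: cring R by fact
  interpret L: cring L by fact
  interpret L': field L' by fact
  let ?A = "algebra_via i L" and ?A' = "algebra_via \<phi> L'"
  interpret A: algebra R ?A by (rule algebra_algebra_via) fact+
  interpret A': algebra R ?A' by (rule algebra_algebra_via[OF assms(1) L'.is_cring assms(5)])
  interpret tensor_product_mult R ?A ?A'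
    by (intro tensor_product_mult.intro tensor_product.intro tensor_product_mult_axioms.intro
        A.module_axioms A'.module_axioms A.bilin_mult A'.bilin_mult)
  interpret C: cring TA by (rule cring_tensor_algebra[OF A.algebra_axioms A'.algebra_axioms])
  note h\<phi> = ring_hom_memE[OF assms(5)] and hi = ring_hom_memE[OF assms(4)]
  have "\<one>\<^bsub>TA\<^esub> \<noteq> \<zero>\<^bsub>TA\<^esub>"
  proof
    assume "\<one>\<^bsub>TA\<^esub> = \<zero>\<^bsub>TA\<^esub>"
    then have z: "pure \<one>\<^bsub>L\<^esub> \<one>\<^bsub>L'\<^esub> = \<zero>\<^bsub>T\<^esub>" by simp
    let ?\<beta> = "\<lambda>l l'. \<phi> (\<mu> l) \<otimes>\<^bsub>L'\<^esub> l'"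
    have b: "bilin R ?A ?A' ?A' ?\<beta>"
    proof (rule bilinI)
      note [simp] = h\<phi> lin_mapsD[OF assms(6), simplified]
      show "?\<beta> a (r \<odot>\<^bsub>?A'\<^esub> b) = r \<odot>\<^bsub>?A'\<^esub> ?\<beta> a b"
        if "r \<in> carrier R" "a \<in> carrier ?A" "b \<in> carrier ?A'" for r a b
        using that by (simp add: L'.m_lcomm)
    qed (use h\<phi> lin_mapsD[OF assms(6), simplified] in \<open>simp_all add: L'.l_distr L'.r_distr L'.m_assoc\<close>)
    have "tensor_lift R ?A ?A' ?A' ?\<beta> (pure \<one>\<^bsub>L\<^esub> \<one>\<^bsub>L'\<^esub>) = \<one>\<^bsub>L'\<^esub>"
      using lift_pure[OF A'.module_axioms b, of "\<one>\<^bsub>L\<^esub>" "\<one>\<^bsub>L'\<^esub>"] assms(7) h\<phi>(4) by simp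
    moreover have "tensor_lift R ?A ?A' ?A' ?\<beta> \<zero>\<^bsub>T\<^esub> = \<zero>\<^bsub>L'\<^esub>"
      using lin_maps_zero[OF module_T A'.module_axioms lift_lin[OF A'.module_axioms b]] by simp
    ultimately show False using z L'.one_not_zero by simp
  qed
  then obtain J where J: "maximalideal J TA" using C.exists_maximalideal by blast
  interpret J: maximalideal J TA by (rule J)
  let ?M = "TA Quot J"
  have M: "field ?M" by (rule J.quotient_is_field[OF C.is_cring])
  let ?\<sigma> = "\<lambda>l. J +>\<^bsub>TA\<^esub> pure l \<one>\<^bsub>L'\<^esub>" and ?\<kappa> = "\<lambda>l'. J +>\<^bsub>TA\<^esub> pure \<one>\<^bsub>L\<^esub> l'"
  have "(\<lambda>l. pure l \<one>\<^bsub>L'\<^esub>) \<in> ring_hom L TA"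
    by (rule ring_hom_memI)
      (use pure_add_left TA_mult_pure pure_closed in simp_all)
  from ring_hom_trans[OF this J.rcos_ring_hom] have \<sigma>: "?\<sigma> \<in> ring_hom L ?M"
    by (simp add: comp_def)
  have "(\<lambda>l'. pure \<one>\<^bsub>L\<^esub> l') \<in> ring_hom L' TA"
    by (rule ring_hom_memI)
      (use pure_add_right TA_mult_pure pure_closed in simp_all)
  from ring_hom_trans[OF this J.rcos_ring_hom] have \<kappa>: "?\<kappa> \<in> ring_hom L' ?M"
    by (simp add: comp_def)
  have "?\<sigma> (i x) = ?\<kappa> (\<phi> x)" if x: "x \<in> carrier R" for x
    using pure_smult_left[of "\<one>\<^bsub>L'\<^esub>" x "\<one>\<^bsub>L\<^esub>"] pure_smult_right[of "\<one>\<^bsub>L\<^esub>" x "\<one>\<^bsub>L'\<^esub>"] x h\<phi>(1) hi(1) by simp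
  with M \<sigma> \<kappa> show ?thesis
    by (intro exI[of _ ?M] exI[of _ ?\<sigma>] exI[of _ ?\<kappa>]) simp
qed


section \<open>Minimality of the splitting field\<close>

lemma (in finite_group_algebra) comul_el:
  assumes "n \<in> carrier N"
  shows "comul (group_hopf L N) (el n) = AA.pure (el n) (el n)"
proof (rule coord_eqI[OF comul_closed[OF el_closed] AA.pure_closed[OF el_closed el_closed]])
  fix p q assume pq: "p \<in> carrier N" "q \<in> carrier N"
  show "coord p q (comul (group_hopf L N) (el n)) = coord p q (AA.pure (el n) (el n))"
    unfolding coord_comul[OF el_closed pq] coord_pure[OF pq el_closed el_closed]
    using pq by (auto simp: el_apply)
qed

context descended_hopf
begin

text \<open>A linear form that takes \<open>1\<close> to \<open>tr w = 1\<close>, as \<open>exists_common_overfield\<close> requires.\<close>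

lemma functional_mu: "(\<lambda>x. tr (w \<otimes>\<^bsub>L\<^esub> x)) \<in> lin_maps K' L1 (algebra_via (\<lambda>x. x) K')"
proof (rule lin_mapsI)
  fix x assume "x \<in> carrier L1"
  then have x: "x \<in> carrier L" by simp
  then show "tr (w \<otimes>\<^bsub>L\<^esub> x) \<in> carrier (algebra_via (\<lambda>x. x) K')" using w_closed tr_K by simp
  show "tr (w \<otimes>\<^bsub>L\<^esub> (r \<odot>\<^bsub>L1\<^esub> x)) = r \<odot>\<^bsub>algebra_via (\<lambda>x. x) K'\<^esub> tr (w \<otimes>\<^bsub>L\<^esub> x)" if "r \<in> carrier K'" for r
    using tr_smult[of r "w \<otimes>\<^bsub>L\<^esub> x"] that K_mem w_closed x by (simp add: L.m_lcomm)
  fix y assume "y \<in> carrier L1"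
  then have y: "y \<in> carrier L" by simp
  have "tr (w \<otimes>\<^bsub>L\<^esub> (x \<oplus>\<^bsub>L\<^esub> y)) = (\<Oplus>\<^bsub>L\<^esub>g\<in>carrier \<Gamma>. \<rho> g (w \<otimes>\<^bsub>L\<^esub> x) \<oplus>\<^bsub>L\<^esub> \<rho> g (w \<otimes>\<^bsub>L\<^esub> y))"
    unfolding tr_def using w_closed x y
    by (intro L.finsum_cong') (auto simp: rho_closed rho_add L.r_distr)
  also have "\<dots> = tr (w \<otimes>\<^bsub>L\<^esub> x) \<oplus>\<^bsub>L\<^esub> tr (w \<otimes>\<^bsub>L\<^esub> y)"
    unfolding tr_def by (rule L.finsum_addf) (use w_closed x y rho_closed in auto)
  finally show "tr (w \<otimes>\<^bsub>L\<^esub> (x \<oplus>\<^bsub>L1\<^esub> y)) = tr (w \<otimes>\<^bsub>L\<^esub> x) \<oplus>\<^bsub>algebra_via (\<lambda>x. x) K'\<^esub> tr (w \<otimes>\<^bsub>L\<^esub> y)"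
    by simp
qed

text \<open>
  Otherwise all \<open>Tr (u k * el m)\<close> would have the same coefficients at \<open>m\<close> and \<open>n\<close>, and so would \<open>el m\<close> by
  \<open>Tr_dual_expand\<close>.
\<close>

lemma B_separates:
  assumes "m \<in> carrier N" "n \<in> carrier N" "m \<noteq> n"
  shows "\<exists>b\<in>carrier B. b m \<noteq> b n"
proof (rule ccontr)
  assume "\<not> ?thesis"
  then have eq: "b m = b n" if "b \<in> carrier B" for b using that by blast
  have "el m m = (\<Oplus>\<^bsub>L\<^esub>k\<in>{..<d}. e k \<otimes>\<^bsub>L\<^esub> Tr (u k \<odot>\<^bsub>GA\<^esub> el m) m)"
    by (rule Tr_dual_expand[OF el_closed assms(1), symmetric])
  also have "\<dots> = (\<Oplus>\<^bsub>L\<^esub>k\<in>{..<d}. e k \<otimes>\<^bsub>L\<^esub> Tr (u k \<odot>\<^bsub>GA\<^esub> el m) n)"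
  proof (rule L.finsum_cong', rule refl)
    have t: "Tr (u k \<odot>\<^bsub>GA\<^esub> el m) \<in> carrier B" if "k < d" for k
      by (rule Tr_B[OF smult_GA[OF u_closed[OF that] el_closed]])
    show "(\<lambda>k. e k \<otimes>\<^bsub>L\<^esub> Tr (u k \<odot>\<^bsub>GA\<^esub> el m) n) \<in> {..<d} \<rightarrow> carrier L"
      using e_closed GA_mem[OF B_mem[OF t] assms(2)] by auto
    show "e k \<otimes>\<^bsub>L\<^esub> Tr (u k \<odot>\<^bsub>GA\<^esub> el m) m = e k \<otimes>\<^bsub>L\<^esub> Tr (u k \<odot>\<^bsub>GA\<^esub> el m) n" if "k \<in> {..<d}" for k
      using eq[OF t] that by simp
  qed
  also have "\<dots> = el m n" by (rule Tr_dual_expand[OF el_closed assms(2)])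
  finally show False using assms fL.one_not_zero by (simp add: el_apply)
qed

context
  fixes L' :: "('l, 'y) ring_scheme" and \<phi> :: "'r \<Rightarrow> 'l" and \<Phi> :: "('r, 'l, 'h) tensor \<Rightarrow> 'n \<Rightarrow> 'l"
    and M :: "'t ring" and \<sigma> :: "'r \<Rightarrow> 't" and \<kappa> :: "'l \<Rightarrow> 't"
  assumes field_L': "field L'" and phi: "\<phi> \<in> ring_hom K' L'"
    and Phi: "\<Phi> \<in> hopf_iso L' (base_change K' L' \<phi> H) (group_hopf L' N)"
    and field_M: "field M" and sigma: "\<sigma> \<in> ring_hom L M" and kappa: "\<kappa> \<in> ring_hom L' M"
    and agree: "\<And>x. x \<in> K \<Longrightarrow> \<sigma> x = \<kappa> (\<phi> x)"
begin

interpretation L': field L' by (rule field_L')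
interpretation M: field M by (rule field_M)
interpretation G': finite_group_algebra L' N
  by (rule finite_group_algebra.intro[OF L'.is_cring group_N finite_N])
interpretation bc': base_changed_hopf K' L' \<phi> H
  by (intro base_changed_hopf.intro base_changed_module.intro base_changed_hopf_axioms.intro)
    (rule L'.is_cring phi H.module_H H.comul_lin H.counit_lin H.antipode_lin)+

abbreviation (input) "M1 \<equiv> algebra_via \<kappa> M"

lemma module_M1: "module L' M1" by (rule module_algebra_via[OF L'.is_cring M.is_cring kappa])

lemma module_M1_K: "module K' (restrict_scalars \<phi> M1)"
  by (rule module_restrict_scalars[OF K.is_cring module_M1 phi])

lemma sigma_lin: "\<sigma> \<in> lin_maps K' L1 (restrict_scalars \<phi> M1)"
  by (rule lin_mapsI) (use ring_hom_memE[OF sigma] K_mem agree in auto)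

lemma M1_algebra: "algebra L' M1" by (rule algebra_algebra_via[OF L'.is_cring M.is_cring kappa])

text \<open>
  The linear form \<open>h \<mapsto> \<sigma> (\<theta> h \<zeta>)\<close> on \<open>H\<close> extends to a linear form \<open>\<Psi>\<close> on \<open>L' \<otimes>\<^sub>K H\<close>, and \<open>\<Phi>\<close> carries \<open>\<Psi>\<close> to a
  linear form \<open>\<alpha>'\<close> on \<open>L'[N]\<close>. Every \<open>n \<in> N\<close> is grouplike, so \<open>\<alpha>'\<close> takes it to an idempotent of the field
  \<open>M\<close>, that is to \<open>0\<close> or \<open>1\<close>. Hence all values of \<open>\<alpha>'\<close> lie in the image of \<open>\<kappa>\<close>, and
  \<open>\<sigma> (\<theta> h \<zeta>) = \<alpha>' (\<Phi> (1 \<otimes> h))\<close> is one of them.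
\<close>

lemma coordinate_in_image:
  assumes z: "\<zeta> \<in> carrier N" and h: "h \<in> carrier H"
  shows "\<sigma> (\<theta> h \<zeta>) \<in> \<kappa> ` carrier L'"
proof -
  note s = ring_hom_memE[OF sigma] and k = ring_hom_memE[OF kappa]
  let ?g = "\<lambda>h. \<sigma> (\<theta> h \<zeta>)"
  have ev: "(\<lambda>h. \<theta> h \<zeta>) \<in> lin_maps K' H L1"
    by (rule lin_maps_comp[OF theta_lin lin_maps_comp[OF B_incl_lin lin_maps_subring[OF eval_lin[OF z] K_subset]]])
  have g: "?g \<in> lin_maps K' H (restrict_scalars \<phi> M1)"
    by (rule lin_maps_comp[OF ev sigma_lin])
  define \<Psi> where "\<Psi> = tensor_lift K' bc'.A H (restrict_scalars \<phi> M1) (\<lambda>s h. s \<odot>\<^bsub>M1\<^esub> ?g h)"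
  have \<Psi>_lin: "\<Psi> \<in> lin_maps L' bc'.V M1"
    unfolding \<Psi>_def by (rule bc'.extend_lin[OF module_M1 g])
  have \<Psi>_one: "\<Psi> (bc'.pt \<one>\<^bsub>L'\<^esub> h) = ?g h" if "h \<in> carrier H" for h
    using bc'.extend_pure[OF module_M1 g, of "\<one>\<^bsub>L'\<^esub>" h] that lin_maps_closed[OF g] k(4)
    unfolding \<Psi>_def by simp
  have mult: "bilin L' M1 M1 M1 (monoid.mult M1)" by (rule algebra.bilin_mult[OF M1_algebra])
  then have mult': "bilin L' M1 M1 M1 (\<lambda>a b. a \<otimes>\<^bsub>M\<^esub> b)" by simp
  have b\<Psi>: "bilin L' bc'.V bc'.V M1 (\<lambda>a b. \<Psi> a \<otimes>\<^bsub>M\<^esub> \<Psi> b)"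
    by (rule bilin_comp[OF mult' \<Psi>_lin \<Psi>_lin])
  \<comment> \<open>The coordinate of \<open>comul f\<close> at \<open>\<zeta> \<otimes> \<zeta>\<close> is \<open>f \<zeta>\<close>, so evaluation at \<open>\<zeta>\<close> turns the comultiplication
    into multiplication.\<close>
  have \<Psi>_comul: "tensor_lift L' bc'.V bc'.V M1 (\<lambda>a b. \<Psi> a \<otimes>\<^bsub>M\<^esub> \<Psi> b) (comul bc'.W U) = \<Psi> U"
    if U: "U \<in> carrier bc'.V" for U
  proof (rule bc'.lin_maps_V_eqI[OF lin_maps_comp[OF bc'.comul_W_lin bc'.VV.lift_lin[OF module_M1 b\<Psi>]] \<Psi>_lin U])
    fix h assume h: "h \<in> carrier H"
    have c: "comul H h \<in> carrier bc.HH.T" by (rule lin_maps_closed[OF H.comul_lin h])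
    have "bc'.comul_H h \<in> carrier bc'.VV.T" using lin_maps_closed[OF bc'.comul_H_lin h] by simp
    then have W: "comul bc'.W (bc'.pt \<one>\<^bsub>L'\<^esub> h) = bc'.comul_H h"
      using bc'.comul_W_pure[OF L'.one_closed h] by (simp add: bc'.VV.T.smult_one)
    have b1: "bilin K' H H L1 (\<lambda>a b. \<theta> a \<zeta> \<otimes>\<^bsub>L\<^esub> \<theta> b \<zeta>)"
      by (rule bilin_comp[OF bilin_coordB[OF z z] theta_lin theta_lin])
    have b2: "bilin K' H H (restrict_scalars \<phi> M1) (\<lambda>a b. \<sigma> (\<theta> a \<zeta> \<otimes>\<^bsub>L\<^esub> \<theta> b \<zeta>))"
      by (rule bilin_post[OF b1 sigma_lin])
    have b3: "bilin K' H H AA.T (\<lambda>a b. AA.pure (\<theta> a) (\<theta> b))"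
      by (rule bilin_comp[OF bilin_B_pure theta_lin theta_lin])
    have "tensor_lift L' bc'.V bc'.V M1 (\<lambda>a b. \<Psi> a \<otimes>\<^bsub>M\<^esub> \<Psi> b) (comul bc'.W (bc'.pt \<one>\<^bsub>L'\<^esub> h)) =
        tensor_lift K' H H (restrict_scalars \<phi> M1)
          (\<lambda>a b. \<Psi> (bc'.pt \<one>\<^bsub>L'\<^esub> a) \<otimes>\<^bsub>M\<^esub> \<Psi> (bc'.pt \<one>\<^bsub>L'\<^esub> b)) (comul H h)"
      unfolding W by (rule bc'.lift_comul_H[OF module_M1 b\<Psi> h])
    also have "\<dots> = tensor_lift K' H H (restrict_scalars \<phi> M1) (\<lambda>a b. \<sigma> (\<theta> a \<zeta> \<otimes>\<^bsub>L\<^esub> \<theta> b \<zeta>)) (comul H h)"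
    proof (rule bc.HH.tensor_lift_cong[OF c module_M1_K _ b2])
      fix a b assume "a \<in> carrier H" "b \<in> carrier H"
      then show "\<Psi> (bc'.pt \<one>\<^bsub>L'\<^esub> a) \<otimes>\<^bsub>M\<^esub> \<Psi> (bc'.pt \<one>\<^bsub>L'\<^esub> b) = \<sigma> (\<theta> a \<zeta> \<otimes>\<^bsub>L\<^esub> \<theta> b \<zeta>)"
        using \<Psi>_one s(2) GA_mem[OF theta_GA z] by simp
    qed
    also have "\<dots> = \<sigma> (tensor_lift K' H H L1 (\<lambda>a b. \<theta> a \<zeta> \<otimes>\<^bsub>L\<^esub> \<theta> b \<zeta>) (comul H h))"
      by (rule bc.HH.lift_post[OF module_K_L1 b1 module_M1_K sigma_lin c, symmetric])
    also have "tensor_lift K' H H L1 (\<lambda>a b. \<theta> a \<zeta> \<otimes>\<^bsub>L\<^esub> \<theta> b \<zeta>) (comul H h) =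
        tensor_lift K' H H L1 (\<lambda>a b. coord \<zeta> \<zeta> (AA.pure (\<theta> a) (\<theta> b))) (comul H h)"
      by (rule bc.HH.tensor_lift_cong[OF c module_K_L1 _ bilin_post[OF b3 lin_maps_subring[OF coord_lin[OF z z] K_subset]]])
        (simp only: coord_pure[OF z z theta_GA theta_GA])
    also have "\<dots> = coord \<zeta> \<zeta> (tensor_lift K' H H AA.T (\<lambda>a b. AA.pure (\<theta> a) (\<theta> b)) (comul H h))"
      by (rule bc.HH.lift_post[OF module_K_AA b3 module_K_L1 lin_maps_subring[OF coord_lin[OF z z] K_subset] c, symmetric])
    also have "\<dots> = \<theta> h \<zeta>"
      unfolding comul_theta[OF h] coord_comul[OF theta_GA[OF h] z z] by simp
    finally show "tensor_lift L' bc'.V bc'.V M1 (\<lambda>a b. \<Psi> a \<otimes>\<^bsub>M\<^esub> \<Psi> b) (comul bc'.W (bc'.pt \<one>\<^bsub>L'\<^esub> h)) =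
        \<Psi> (bc'.pt \<one>\<^bsub>L'\<^esub> h)" using \<Psi>_one[OF h] by simp
  qed
  note PhiD = hopf_isoD[OF Phi]
  have \<Phi>_lin: "\<Phi> \<in> lin_maps L' bc'.V G'.GA"
    using PhiD(2) by (simp only: lin_maps_def base_change_fields group_hopf_fields)
  have \<Phi>_bij: "bij_betw \<Phi> (carrier bc'.V) (carrier G'.GA)"
    using PhiD(3) by (simp only: base_change_fields group_hopf_fields)
  let ?\<chi> = "inv_into (carrier bc'.V) \<Phi>"
  have \<chi>: "\<And>y. y \<in> carrier G'.GA \<Longrightarrow> ?\<chi> y \<in> carrier bc'.V" "\<And>y. y \<in> carrier G'.GA \<Longrightarrow> \<Phi> (?\<chi> y) = y"
    "\<And>U. U \<in> carrier bc'.V \<Longrightarrow> ?\<chi> (\<Phi> U) = U"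
    using \<Phi>_bij by (auto simp only: bij_betw_def inv_into_into f_inv_into_f inv_into_f_f)
  define \<alpha>' where "\<alpha>' y = \<Psi> (?\<chi> y)" for y
  have \<alpha>'_lin: "\<alpha>' \<in> lin_maps L' G'.GA M1"
    unfolding \<alpha>'_def by (rule lin_maps_comp[OF lin_maps_inv_into[OF \<Phi>_lin \<Phi>_bij bc'.module_V] \<Psi>_lin])
  have idem: "\<alpha>' (G'.el n) \<otimes>\<^bsub>M\<^esub> \<alpha>' (G'.el n) = \<alpha>' (G'.el n)" if n: "n \<in> carrier N" for n
  proof -
    let ?U = "?\<chi> (G'.el n)"
    have U: "?U \<in> carrier bc'.V" "\<Phi> ?U = G'.el n" using \<chi> G'.el_closed by auto
    have b: "bilin L' G'.GA G'.GA M1 (\<lambda>a b. \<alpha>' a \<otimes>\<^bsub>M\<^esub> \<alpha>' b)"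
      by (rule bilin_comp[OF mult' \<alpha>'_lin \<alpha>'_lin])
    have A: "tensor_module L' (group_hopf L' N) (group_hopf L' N) = G'.AA.T"
      "pure_tensor L' (group_hopf L' N) (group_hopf L' N) = G'.AA.pure"
      by (rule tensor_cong; simp only: group_hopf_fields)+
    have "?U \<in> carrier bc'.W" using U(1) by (simp only: base_change_fields)
    from PhiD(4)[OF this] have cm: "tensor_map L' bc'.V bc'.V G'.GA G'.GA \<Phi> \<Phi> (comul bc'.W ?U) = G'.AA.pure (G'.el n) (G'.el n)"
      unfolding U(2) G'.comul_el[OF n] tensor_map_def A bc'.tensor_W by simp
    have "\<alpha>' (G'.el n) \<otimes>\<^bsub>M\<^esub> \<alpha>' (G'.el n) =
        tensor_lift L' G'.GA G'.GA M1 (\<lambda>a b. \<alpha>' a \<otimes>\<^bsub>M\<^esub> \<alpha>' b) (G'.AA.pure (G'.el n) (G'.el n))"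
      by (rule G'.AA.lift_pure[OF module_M1 b G'.el_closed G'.el_closed, symmetric])
    also have "\<dots> = tensor_lift L' bc'.V bc'.V M1 (\<lambda>a b. \<alpha>' (\<Phi> a) \<otimes>\<^bsub>M\<^esub> \<alpha>' (\<Phi> b)) (comul bc'.W ?U)"
      unfolding cm[symmetric]
      by (rule tensor_lift_map[OF bc'.VV.tensor_product_axioms G'.AA.tensor_product_axioms module_M1 \<Phi>_lin \<Phi>_lin b
            lin_maps_closed[OF bc'.comul_W_lin U(1)]])
    also have "\<dots> = tensor_lift L' bc'.V bc'.V M1 (\<lambda>a b. \<Psi> a \<otimes>\<^bsub>M\<^esub> \<Psi> b) (comul bc'.W ?U)"
      by (rule bc'.VV.tensor_lift_cong[OF lin_maps_closed[OF bc'.comul_W_lin U(1)] module_M1 _ b\<Psi>])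
        (simp only: \<alpha>'_def \<chi>(3))
    also have "\<dots> = \<alpha>' (G'.el n)" unfolding \<Psi>_comul[OF U(1)] \<alpha>'_def ..
    finally show ?thesis .
  qed
  have \<alpha>'_closed: "\<alpha>' (G'.el n) \<in> carrier M" for n
    using lin_maps_closed[OF \<alpha>'_lin G'.el_closed] by simp
  \<comment> \<open>A preimage of \<open>\<alpha>' n\<close> under \<open>\<kappa>\<close>.\<close>
  define c where "c n = (if \<alpha>' (G'.el n) = \<zero>\<^bsub>M\<^esub> then \<zero>\<^bsub>L'\<^esub> else \<one>\<^bsub>L'\<^esub>)" for n
  have c: "c n \<in> carrier L'" for n by (simp add: c_def)
  have kz: "\<kappa> \<zero>\<^bsub>L'\<^esub> = \<zero>\<^bsub>M\<^esub>" by (rule ring_hom_zero[OF kappa L'.ring_axioms M.ring_axioms])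
  have \<alpha>'c: "\<alpha>' (G'.el n) = \<kappa> (c n)" if n: "n \<in> carrier N" for n
  proof (cases "\<alpha>' (G'.el n) = \<zero>\<^bsub>M\<^esub>")
    case True
    then show ?thesis by (simp add: c_def kz)
  next
    case False
    have "\<alpha>' (G'.el n) \<otimes>\<^bsub>M\<^esub> \<alpha>' (G'.el n) = \<alpha>' (G'.el n) \<otimes>\<^bsub>M\<^esub> \<one>\<^bsub>M\<^esub>"
      using idem[OF n] \<alpha>'_closed by simp
    then have "\<alpha>' (G'.el n) = \<one>\<^bsub>M\<^esub>"
      using M.m_lcancel[OF False \<alpha>'_closed \<alpha>'_closed M.one_closed] by simp
    then show ?thesis using False by (simp add: c_def k(4))
  qed
  let ?f = "\<Phi> (bc'.pt \<one>\<^bsub>L'\<^esub> h)"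
  have pV: "bc'.pt \<one>\<^bsub>L'\<^esub> h \<in> carrier bc'.V" by (rule bc'.pure_closed[OF L'.one_closed h])
  have f: "?f \<in> carrier G'.GA" by (rule lin_maps_closed[OF \<Phi>_lin pV])
  note fm = G'.GA_mem[OF f]
  have "\<sigma> (\<theta> h \<zeta>) = \<alpha>' ?f" unfolding \<alpha>'_def \<chi>(3)[OF pV] \<Psi>_one[OF h] ..
  also have "\<dots> = \<alpha>' (\<Oplus>\<^bsub>G'.GA\<^esub>n\<in>carrier N. ?f n \<odot>\<^bsub>G'.GA\<^esub> G'.el n)"
    using G'.GA_expand[OF f] by simp
  also have "\<dots> = (\<Oplus>\<^bsub>M1\<^esub>n\<in>carrier N. \<alpha>' (?f n \<odot>\<^bsub>G'.GA\<^esub> G'.el n))"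
    by (rule lin_maps_finsum[OF G'.module_GA module_M1 \<alpha>'_lin])
      (use G'.GA.smult_closed[OF fm G'.el_closed] in blast)
  also have "\<dots> = (\<Oplus>\<^bsub>M\<^esub>n\<in>carrier N. \<alpha>' (?f n \<odot>\<^bsub>G'.GA\<^esub> G'.el n))" by (rule finsum_algebra_via)
  also have "\<dots> = (\<Oplus>\<^bsub>M\<^esub>n\<in>carrier N. \<kappa> (?f n \<otimes>\<^bsub>L'\<^esub> c n))"
  proof (rule M.finsum_cong', rule refl)
    show "(\<lambda>n. \<kappa> (?f n \<otimes>\<^bsub>L'\<^esub> c n)) \<in> carrier N \<rightarrow> carrier M" using fm c k(1) by auto
    fix n assume n: "n \<in> carrier N"
    show "\<alpha>' (?f n \<odot>\<^bsub>G'.GA\<^esub> G'.el n) = \<kappa> (?f n \<otimes>\<^bsub>L'\<^esub> c n)"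
      using lin_maps_smult[OF \<alpha>'_lin fm[OF n] G'.el_closed[of n]] \<alpha>'c[OF n] k(2)[OF fm[OF n] c]
      by (simp del: group_algebra_simps)
  qed
  also have "\<dots> = \<kappa> (\<Oplus>\<^bsub>L'\<^esub>n\<in>carrier N. ?f n \<otimes>\<^bsub>L'\<^esub> c n)"
  proof -
    have "\<kappa> \<in> lin_maps L' G'.L1 M1" by (rule lin_mapsI) (use k in auto)
    from lin_maps_finsum[OF G'.module_L1 module_M1 this, of "\<lambda>n. ?f n \<otimes>\<^bsub>L'\<^esub> c n" "carrier N"]
    show ?thesis using fm c by (simp add: finsum_algebra_via Pi_def)
  qed
  finally show ?thesis
    using fm c by (auto intro!: imageI L'.finsum_closed)
qed

lemma subfield_preimage: "subfield {l \<in> carrier L. \<sigma> l \<in> \<kappa> ` carrier L'} L"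
proof (rule fL.subfieldI')
  note s = ring_hom_memE[OF sigma] and k = ring_hom_memE[OF kappa]
  interpret S: ring_hom_ring L M \<sigma> by (rule ring_hom_ringI2[OF L.ring_axioms M.ring_axioms sigma])
  interpret Kp: ring_hom_ring L' M \<kappa> by (rule ring_hom_ringI2[OF L'.ring_axioms M.ring_axioms kappa])
  let ?S = "{l \<in> carrier L. \<sigma> l \<in> \<kappa> ` carrier L'}"
  show "subring ?S L"
  proof (rule L.subringI)
    show "\<one>\<^bsub>L\<^esub> \<in> ?S" using s(4) k(4) by (auto intro: image_eqI[of _ _ "\<one>\<^bsub>L'\<^esub>"])
  next
    fix x assume "x \<in> ?S"
    then obtain y where "x \<in> carrier L" "y \<in> carrier L'" "\<sigma> x = \<kappa> y" by blast
    then show "\<ominus>\<^bsub>L\<^esub> x \<in> ?S" by (auto intro!: image_eqI[of _ _ "\<ominus>\<^bsub>L'\<^esub> y"])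
  next
    fix x x' assume "x \<in> ?S" "x' \<in> ?S"
    then obtain y y' where "x \<in> carrier L" "y \<in> carrier L'" "\<sigma> x = \<kappa> y" "x' \<in> carrier L" "y' \<in> carrier L'" "\<sigma> x' = \<kappa> y'" by blast
    then show "x \<otimes>\<^bsub>L\<^esub> x' \<in> ?S" "x \<oplus>\<^bsub>L\<^esub> x' \<in> ?S"
      using image_eqI[of _ \<kappa> "y \<otimes>\<^bsub>L'\<^esub> y'"] image_eqI[of _ \<kappa> "y \<oplus>\<^bsub>L'\<^esub> y'"] by simp_all
  qed blast
  fix x assume "x \<in> ?S - {\<zero>\<^bsub>L\<^esub>}"
  then obtain y where xy: "x \<in> carrier L" "x \<noteq> \<zero>\<^bsub>L\<^esub>" "y \<in> carrier L'" "\<sigma> x = \<kappa> y" by blast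
  have ix: "inv\<^bsub>L\<^esub> x \<in> carrier L" "x \<otimes>\<^bsub>L\<^esub> inv\<^bsub>L\<^esub> x = \<one>\<^bsub>L\<^esub>"
    using xy fL.field_Units by auto
  then have sx: "\<sigma> x \<otimes>\<^bsub>M\<^esub> \<sigma> (inv\<^bsub>L\<^esub> x) = \<one>\<^bsub>M\<^esub>" using s(2)[OF xy(1) ix(1)] s(4) by simp
  have "y \<noteq> \<zero>\<^bsub>L'\<^esub>" using sx xy ix s(1) M.one_not_zero by auto
  then have iy: "inv\<^bsub>L'\<^esub> y \<in> carrier L'" "y \<otimes>\<^bsub>L'\<^esub> inv\<^bsub>L'\<^esub> y = \<one>\<^bsub>L'\<^esub>"
    using xy L'.field_Units by auto
  then have ky: "\<sigma> x \<otimes>\<^bsub>M\<^esub> \<kappa> (inv\<^bsub>L'\<^esub> y) = \<one>\<^bsub>M\<^esub>" using k(2)[OF xy(3) iy(1)] k(4) xy by simp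
  have "\<sigma> x \<noteq> \<zero>\<^bsub>M\<^esub>" using sx ix s(1) M.one_not_zero by auto
  then have "\<sigma> (inv\<^bsub>L\<^esub> x) = \<kappa> (inv\<^bsub>L'\<^esub> y)"
    using M.m_lcancel[of "\<sigma> x" "\<sigma> (inv\<^bsub>L\<^esub> x)" "\<kappa> (inv\<^bsub>L'\<^esub> y)"] sx ky s(1) k(1) xy ix iy by simp
  then show "inv\<^bsub>L\<^esub> x \<in> ?S" using ix iy by auto
qed

text \<open>
  The subfield of all \<open>l\<close> with \<open>\<sigma> l \<in> \<kappa> L'\<close> contains the coefficients \<open>b n\<close> of the elements of \<open>B\<close>. As
  \<open>g (b n) = b (\<alpha> g n)\<close>, and as \<open>B\<close> separates the points of \<open>N\<close>, every \<open>g \<noteq> 1\<close> moves one of them. So the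
  subfield contains a dual family, and with it the expansion of \<open>l\<close>.
\<close>

lemma image_subset:
  assumes alpha_faithful: "\<And>g. \<lbrakk>g \<in> carrier \<Gamma>; g \<noteq> \<one>\<^bsub>\<Gamma>\<^esub>\<rbrakk> \<Longrightarrow> \<exists>n\<in>carrier N. \<alpha> g n \<noteq> n"
    and l: "l \<in> carrier L"
  shows "\<sigma> l \<in> \<kappa> ` carrier L'"
proof -
  let ?S = "{l \<in> carrier L. \<sigma> l \<in> \<kappa> ` carrier L'}"
  have S: "subfield ?S L" by (rule subfield_preimage)
  have bS: "b n \<in> ?S" if "b \<in> carrier B" "n \<in> carrier N" for b n
    using coordinate_in_image[OF that(2) theta_inv(1)[OF that(1)]] theta_inv(2)[OF that(1)]
      GA_mem[OF B_mem[OF that(1)] that(2)] by simp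
  have "\<exists>x\<in>?S. \<rho> g x \<in> ?S \<and> \<rho> g x \<noteq> x" if g: "g \<in> carrier \<Gamma>" "g \<noteq> \<one>\<^bsub>\<Gamma>\<^esub>" for g
  proof -
    obtain n where n: "n \<in> carrier N" "\<alpha> g n \<noteq> n" using alpha_faithful[OF g] by blast
    obtain b where b: "b \<in> carrier B" "b (\<alpha> g n) \<noteq> b n"
      using B_separates[OF alpha_closed[OF g(1) n(1)] n] by blast
    have "\<rho> g (b n) = b (\<alpha> g n)" by (rule B_equivariant[OF b(1) g(1) n(1), symmetric])
    then show ?thesis
      using bS[OF b(1) n(1)] bS[OF b(1) alpha_closed[OF g(1) n(1)]] b(2) by (intro bexI[of _ "b n"]) auto
  qed
  from exists_dual[OF S this] obtain d' :: nat and e' u' where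
    eu: "e' \<in> {..<d'} \<rightarrow> ?S" "u' \<in> {..<d'} \<rightarrow> ?S"
      "\<And>g. g \<in> carrier \<Gamma> \<Longrightarrow> (\<Oplus>\<^bsub>L\<^esub>k\<in>{..<d'}. e' k \<otimes>\<^bsub>L\<^esub> \<rho> g (u' k)) = (if g = \<one>\<^bsub>\<Gamma>\<^esub> then \<one>\<^bsub>L\<^esub> else \<zero>\<^bsub>L\<^esub>)"
    by blast
  have df: "dual_family L N \<Gamma> K \<rho> \<alpha> d' e' u'"
    by (intro dual_family.intro dual_family_axioms.intro galois_descent_axioms)
      (use eu in auto)
  have "(\<Oplus>\<^bsub>L\<^esub>k\<in>{..<d'}. tr (u' k \<otimes>\<^bsub>L\<^esub> l) \<otimes>\<^bsub>L\<^esub> e' k) = l"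
    by (rule dual_family.tr_dual_expand[OF df l])
  moreover have "(\<Oplus>\<^bsub>L\<^esub>k\<in>I. tr (u' k \<otimes>\<^bsub>L\<^esub> l) \<otimes>\<^bsub>L\<^esub> e' k) \<in> ?S" if "I \<subseteq> {..<d'}" for I
  proof -
    note Sr = subringE[OF subfieldE(1)[OF S]]
    have "finite I" using that finite_subset by blast
    then show ?thesis using that
    proof (induction I rule: finite_induct)
      case empty
      then show ?case using Sr(2) by simp
    next
      case (insert k I)
      have k: "e' k \<in> ?S" "u' k \<in> ?S" using eu insert by auto
      then have "tr (u' k \<otimes>\<^bsub>L\<^esub> l) \<in> K" using tr_K l by auto
      then have t: "tr (u' k \<otimes>\<^bsub>L\<^esub> l) \<in> ?S"
        using agree K_mem ring_hom_memE(1)[OF phi] by auto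
      have "tr (u' j \<otimes>\<^bsub>L\<^esub> l) \<otimes>\<^bsub>L\<^esub> e' j \<in> carrier L" if "j \<in> insert k I" for j
        using that insert eu l by (auto intro!: L.m_closed tr_closed)
      then have "(\<Oplus>\<^bsub>L\<^esub>k\<in>insert k I. tr (u' k \<otimes>\<^bsub>L\<^esub> l) \<otimes>\<^bsub>L\<^esub> e' k) =
          tr (u' k \<otimes>\<^bsub>L\<^esub> l) \<otimes>\<^bsub>L\<^esub> e' k \<oplus>\<^bsub>L\<^esub> (\<Oplus>\<^bsub>L\<^esub>k\<in>I. tr (u' k \<otimes>\<^bsub>L\<^esub> l) \<otimes>\<^bsub>L\<^esub> e' k)"
        using insert by (intro L.finsum_insert) auto
      then show ?case using Sr(7)[OF Sr(6)[OF t k(1)]] insert by simp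
    qed
  qed
  ultimately show ?thesis by (metis (no_types, lifting) mem_Collect_eq subset_refl)
qed

end

theorem minimal_splitting_field:
  fixes L' :: "('l, 'y) ring_scheme" and \<phi> :: "'r \<Rightarrow> 'l"
  assumes alpha_faithful: "\<And>g. \<lbrakk>g \<in> carrier \<Gamma>; g \<noteq> \<one>\<^bsub>\<Gamma>\<^esub>\<rbrakk> \<Longrightarrow> \<exists>n\<in>carrier N. \<alpha> g n \<noteq> n"
    and L': "field L'" and phi: "\<phi> \<in> ring_hom K' L'"
    and iso: "hopf_isomorphic L' (base_change K' L' \<phi> H) (group_hopf L' N)"
  shows "\<exists>\<psi>\<in>ring_hom L L'. inj_on \<psi> (carrier L) \<and> (\<forall>x\<in>K. \<psi> x = \<phi> x)"
proof -
  interpret L': field L' by (rule L')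
  obtain \<Phi> where Phi: "\<Phi> \<in> hopf_iso L' (base_change K' L' \<phi> H) (group_hopf L' N)"
    using iso by (auto simp: hopf_isomorphic_def)
  have i: "(\<lambda>x. x) \<in> ring_hom K' L" using K_subset by (auto simp: ring_hom_def)
  have "tr (w \<otimes>\<^bsub>L\<^esub> \<one>\<^bsub>L\<^esub>) = \<one>\<^bsub>K'\<^esub>" using w_closed tr_w by simp
  from exists_common_overfield[OF K.is_cring cring_L L' i phi functional_mu this]
  obtain M :: "('r, 'r, 'l) tensor set ring" and \<sigma> \<kappa> where
    M: "field M" "\<sigma> \<in> ring_hom L M" "\<kappa> \<in> ring_hom L' M" "\<And>x. x \<in> K \<Longrightarrow> \<sigma> x = \<kappa> (\<phi> x)" by auto
  interpret M: field M by (rule M(1))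
  have img: "\<sigma> l \<in> \<kappa> ` carrier L'" if "l \<in> carrier L" for l
    by (rule image_subset[OF L' phi Phi M alpha_faithful that])
  have inj: "inj_on \<kappa> (carrier L')" by (rule non_trivial_field_hom_is_inj[OF M(3) L' M(1)])
  note s = ring_hom_memE[OF M(2)] and k = ring_hom_memE[OF M(3)]
  define \<psi> where "\<psi> l = inv_into (carrier L') \<kappa> (\<sigma> l)" for l
  have \<psi>: "\<psi> l \<in> carrier L'" "\<kappa> (\<psi> l) = \<sigma> l" if "l \<in> carrier L" for l
    using img[OF that] by (auto simp: \<psi>_def inv_into_into f_inv_into_f)
  have eqI: "a = b" if "a \<in> carrier L'" "b \<in> carrier L'" "\<kappa> a = \<kappa> b" for a b
    using inj that by (auto dest: inj_onD)
  have hom: "\<psi> \<in> ring_hom L L'"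
  proof (rule ring_hom_memI)
    show "\<psi> l \<in> carrier L'" if "l \<in> carrier L" for l by (rule \<psi>(1)[OF that])
    show "\<psi> \<one>\<^bsub>L\<^esub> = \<one>\<^bsub>L'\<^esub>" by (rule eqI) (use \<psi> s k in simp_all)
    fix x y assume "x \<in> carrier L" "y \<in> carrier L"
    then show "\<psi> (x \<otimes>\<^bsub>L\<^esub> y) = \<psi> x \<otimes>\<^bsub>L'\<^esub> \<psi> y" "\<psi> (x \<oplus>\<^bsub>L\<^esub> y) = \<psi> x \<oplus>\<^bsub>L'\<^esub> \<psi> y"
      by (auto intro!: eqI simp: \<psi> s k)
  qed
  moreover have "inj_on \<psi> (carrier L)" by (rule non_trivial_field_hom_is_inj[OF hom field_L L'])
  moreover have "\<psi> x = \<phi> x" if "x \<in> K" for x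
    by (rule eqI) (use that \<psi> M(4) K_mem ring_hom_memE(1)[OF phi] in simp_all)
  ultimately show ?thesis by blast
qed

end



text \<open>
  The dual family is eliminated here; it is an auxiliary choice on which the two theorems that follow
  do not depend.
\<close>

lemma (in galois_descent) exists_descended_hopf:
  assumes "hopf_algebra (L\<lparr>carrier := K\<rparr>) H" "\<theta> \<in> hopf_iso (L\<lparr>carrier := K\<rparr>) H B"
  shows "\<exists>d e u. descended_hopf L N \<Gamma> K \<rho> \<alpha> d e u H \<theta>"
proof -
  have sep: "\<exists>x\<in>carrier L. \<rho> g x \<in> carrier L \<and> \<rho> g x \<noteq> x" if g: "g \<in> carrier \<Gamma>" "g \<noteq> \<one>\<^bsub>\<Gamma>\<^esub>" for g
  proof -
    obtain x where x: "x \<in> carrier L" "\<rho> g x \<noteq> x" using faithful[OF g] by (elim bexE)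
    show ?thesis by (intro bexI[OF _ x(1)] conjI rho_closed g x)
  qed
  have "\<exists>(d::nat) e u. e \<in> {..<d} \<rightarrow> carrier L \<and> u \<in> {..<d} \<rightarrow> carrier L \<and>
      (\<forall>g\<in>carrier \<Gamma>. (\<Oplus>\<^bsub>L\<^esub>k\<in>{..<d}. e k \<otimes>\<^bsub>L\<^esub> \<rho> g (u k)) = (if g = \<one>\<^bsub>\<Gamma>\<^esub> then \<one>\<^bsub>L\<^esub> else \<zero>\<^bsub>L\<^esub>))"
    by (rule exists_dual[OF fL.carrier_is_subfield]) (rule sep)
  then obtain d :: nat and e u
    where eu: "e \<in> {..<d} \<rightarrow> carrier L" "u \<in> {..<d} \<rightarrow> carrier L"
      "\<forall>g\<in>carrier \<Gamma>. (\<Oplus>\<^bsub>L\<^esub>k\<in>{..<d}. e k \<otimes>\<^bsub>L\<^esub> \<rho> g (u k)) = (if g = \<one>\<^bsub>\<Gamma>\<^esub> then \<one>\<^bsub>L\<^esub> else \<zero>\<^bsub>L\<^esub>)"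
    by (elim exE conjE)
  have "dual_family L N \<Gamma> K \<rho> \<alpha> d e u"
  proof (rule dual_family.intro[OF galois_descent_axioms], rule dual_family_axioms.intro)
    show "e k \<in> carrier L" "u k \<in> carrier L" if "k < d" for k
      using eu(1,2) that by (auto dest: Pi_mem)
  qed (rule eu(3)[rule_format])
  then have "descended_hopf L N \<Gamma> K \<rho> \<alpha> d e u H \<theta>"
    by (rule descended_hopf.intro[OF _ descended_hopf_axioms.intro[OF assms]])
  then show ?thesis by (intro exI)
qed

theorem (in galois_descent) split_by_L:
  assumes "hopf_algebra (L\<lparr>carrier := K\<rparr>) H" "\<theta> \<in> hopf_iso (L\<lparr>carrier := K\<rparr>) H B"
  shows "hopf_isomorphic L (base_change (L\<lparr>carrier := K\<rparr>) L (\<lambda>x. x) H) (group_hopf L N)"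
proof -
  obtain d e u where "descended_hopf L N \<Gamma> K \<rho> \<alpha> d e u H \<theta>"
    using exists_descended_hopf[OF assms] by (elim exE)
  then interpret D: descended_hopf L N \<Gamma> K \<rho> \<alpha> d e u H \<theta> .
  show ?thesis unfolding hopf_isomorphic_def using D.split_hopf_iso by (rule ex_in_conv[THEN iffD1, OF exI])
qed

theorem (in galois_descent) L_embeds_in_splitting_field:
  fixes L' :: "('l, 'y) ring_scheme" and \<phi> :: "'r \<Rightarrow> 'l"
  assumes "hopf_algebra (L\<lparr>carrier := K\<rparr>) H" "\<theta> \<in> hopf_iso (L\<lparr>carrier := K\<rparr>) H B"
    and "\<And>g. \<lbrakk>g \<in> carrier \<Gamma>; g \<noteq> \<one>\<^bsub>\<Gamma>\<^esub>\<rbrakk> \<Longrightarrow> \<exists>n\<in>carrier N. \<alpha> g n \<noteq> n"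
    and "field L'" "\<phi> \<in> ring_hom (L\<lparr>carrier := K\<rparr>) L'"
    and "hopf_isomorphic L' (base_change (L\<lparr>carrier := K\<rparr>) L' \<phi> H) (group_hopf L' N)"
  shows "\<exists>\<psi>\<in>ring_hom L L'. inj_on \<psi> (carrier L) \<and> (\<forall>x\<in>K. \<psi> x = \<phi> x)"
proof -
  obtain d e u where "descended_hopf L N \<Gamma> K \<rho> \<alpha> d e u H \<theta>"
    using exists_descended_hopf[OF assms(1,2)] by (elim exE)
  then interpret D: descended_hopf L N \<Gamma> K \<rho> \<alpha> d e u H \<theta> .
  show ?thesis by (rule D.minimal_splitting_field[OF assms(3-6)])
qed


section \<open>Finite Galois groups\<close>

lemma galois_group_carrier: "\<sigma> \<in> carrier (galois_group E K) \<longleftrightarrow>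
    \<sigma> \<in> Bij (carrier E) \<and> \<sigma> \<in> ring_hom E E \<and> (\<forall>x\<in>K. \<sigma> x = x)"
  by (simp add: galois_group_def)

lemma galois_group_mult:
  "\<lbrakk>\<sigma> \<in> carrier (galois_group E K); \<tau> \<in> carrier (galois_group E K); x \<in> carrier E\<rbrakk> \<Longrightarrow>
    (\<sigma> \<otimes>\<^bsub>galois_group E K\<^esub> \<tau>) x = \<sigma> (\<tau> x)"
  by (simp add: galois_group_def BijGroup_def compose_def)

lemma galois_group_one: "x \<in> carrier E \<Longrightarrow> \<one>\<^bsub>galois_group E K\<^esub> x = x"
  by (simp add: galois_group_def BijGroup_def)

lemma group_galois_group:
  assumes "ring E" "K \<subseteq> carrier E"
  shows "group (galois_group E K)"
proof -
  interpret E: ring E by fact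
  interpret B: group "BijGroup (carrier E)" by (rule group_BijGroup)
  have "subgroup {\<sigma> \<in> Bij (carrier E). \<sigma> \<in> ring_hom E E \<and> (\<forall>x\<in>K. \<sigma> x = x)} (BijGroup (carrier E))"
    (is "subgroup ?S _")
  proof (rule subgroup.intro)
    show "?S \<subseteq> carrier (BijGroup (carrier E))" by (auto simp: BijGroup_def)
    show "\<one>\<^bsub>BijGroup (carrier E)\<^esub> \<in> ?S"
      using assms(2) by (auto simp: BijGroup_def id_Bij ring_hom_def)
    fix \<sigma> assume \<sigma>: "\<sigma> \<in> ?S"
    have sh: "\<sigma> \<in> ring_hom E E" "\<sigma> \<in> Bij (carrier E)" "\<And>x. x \<in> K \<Longrightarrow> \<sigma> x = x" using \<sigma> by auto
    note s = ring_hom_memE[OF sh(1)]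
    {
      fix \<tau> assume "\<tau> \<in> ?S"
      then have \<tau>: "\<tau> \<in> ring_hom E E" "\<tau> \<in> Bij (carrier E)" "\<And>x. x \<in> K \<Longrightarrow> \<tau> x = x" by auto
      have "compose (carrier E) \<sigma> \<tau> \<in> ring_hom E E"
        using s ring_hom_memE[OF \<tau>(1)] by (intro ring_hom_memI) (auto simp: compose_def)
      moreover have "compose (carrier E) \<sigma> \<tau> \<in> Bij (carrier E)" by (rule compose_Bij[OF sh(2) \<tau>(2)])
      moreover have "compose (carrier E) \<sigma> \<tau> x = x" if "x \<in> K" for x
        using that assms(2) \<tau>(3) sh(3) by (auto simp: compose_def)
      moreover have "\<sigma> \<otimes>\<^bsub>BijGroup (carrier E)\<^esub> \<tau> = compose (carrier E) \<sigma> \<tau>"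
        using sh(2) \<tau>(2) by (simp add: BijGroup_def)
      ultimately show "\<sigma> \<otimes>\<^bsub>BijGroup (carrier E)\<^esub> \<tau> \<in> ?S" by simp
    }
    define i where "i = (\<lambda>x\<in>carrier E. inv_into (carrier E) \<sigma> x)"
    have b: "bij_betw \<sigma> (carrier E) (carrier E)" using sh(2) by (simp add: Bij_def)
    have i: "i x \<in> carrier E" "\<sigma> (i x) = x" if "x \<in> carrier E" for x
      using b that by (auto simp: i_def bij_betw_def inv_into_into f_inv_into_f)
    have eq: "a = a'" if "a \<in> carrier E" "a' \<in> carrier E" "\<sigma> a = \<sigma> a'" for a a'
      using b that by (auto simp: bij_betw_def dest: inj_onD)
    have "i \<in> ring_hom E E"
    proof (rule ring_hom_memI)
      show "i \<one>\<^bsub>E\<^esub> = \<one>\<^bsub>E\<^esub>" by (rule eq) (simp_all add: i s(4))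
      fix x y assume "x \<in> carrier E" "y \<in> carrier E"
      then show "i (x \<otimes>\<^bsub>E\<^esub> y) = i x \<otimes>\<^bsub>E\<^esub> i y" "i (x \<oplus>\<^bsub>E\<^esub> y) = i x \<oplus>\<^bsub>E\<^esub> i y"
        by (rule_tac eq; simp add: i s)+
    qed (rule i(1))
    moreover have "i x = x" if "x \<in> K" for x
    proof -
      have "x \<in> carrier E" using that assms(2) by blast
      then show ?thesis by (rule_tac eq) (simp_all add: i sh(3)[OF that])
    qed
    moreover have "i \<in> Bij (carrier E)" unfolding i_def by (rule restrict_inv_into_Bij[OF sh(2)])
    moreover have "inv\<^bsub>BijGroup (carrier E)\<^esub> \<sigma> = i" unfolding i_def by (rule inv_BijGroup[OF sh(2)])
    ultimately show "inv\<^bsub>BijGroup (carrier E)\<^esub> \<sigma> \<in> ?S" by simp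
  qed
  from B.subgroup_imp_group[OF this] show ?thesis unfolding galois_group_def .
qed

lemma (in ring) ring_hom_combine:
  assumes "h \<in> ring_hom R R" "\<And>x. x \<in> K \<Longrightarrow> h x = x" "K \<subseteq> carrier R"
  shows "set Ks \<subseteq> K \<Longrightarrow> set Us \<subseteq> carrier R \<Longrightarrow> h (combine Ks Us) = combine Ks (map h Us)"
proof (induction Ks Us rule: combine.induct)
  case (1 k Ks u Us)
  have "combine Ks Us \<in> carrier R" using 1 assms(3) by (intro combine_in_carrier) auto
  then show ?case using 1 assms(2,3) ring_hom_memE[OF assms(1)] by auto
qed (use ring_hom_zero[OF assms(1) ring_axioms ring_axioms] in auto)

lemma (in ring) ring_hom_eval:
  assumes "h \<in> ring_hom R R" "\<And>x. x \<in> K \<Longrightarrow> h x = x" "K \<subseteq> carrier R" "x \<in> carrier R"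
  shows "set p \<subseteq> K \<Longrightarrow> h (eval p x) = eval p (h x)"
proof (induction p)
  case Nil
  then show ?case using ring_hom_zero[OF assms(1) ring_axioms ring_axioms] by simp
next
  case (Cons a p)
  have pw: "h (x [^] (n::nat)) = h x [^] n" for n
    by (induction n) (use ring_hom_memE[OF assms(1)] assms(4) in auto)
  have "eval p x \<in> carrier R" using Cons assms(3,4) by (intro eval_in_carrier) auto
  then show ?case using Cons assms ring_hom_memE[OF assms(1)] pw by auto
qed

text \<open>
  An automorphism over \<open>K\<close> is determined by its values on a finite spanning set, and each of these
  values is a root of a nonzero polynomial over \<open>K\<close>.
\<close>

lemma finite_galois_group:
  assumes "finite_galois E K"
  shows "finite (carrier (galois_group E K))"
proof -
  have "field E" and K: "subfield K E" and fd: "ring.finite_dimension E K (carrier E)"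
    using assms by (auto simp: finite_galois_def)
  interpret E: field E by fact
  let ?G = "carrier (galois_group E K)"
  have KE: "K \<subseteq> carrier E" by (rule subfieldE(3)[OF K])
  obtain Us where Us: "set Us \<subseteq> carrier E" "E.Span K Us = carrier E"
    using E.exists_base[OF K E.finite_dimensionE[OF K fd]] by blast
  have "\<exists>p. p \<in> carrier (poly_ring E) \<and> p \<noteq> [] \<and> set p \<subseteq> K \<and> E.eval p x = \<zero>\<^bsub>E\<^esub>" if x: "x \<in> carrier E" for x
  proof -
    have "(E.algebraic over K) x"
      by (rule E.finite_dimension_imp_algebraic[OF K E.carrier_is_subring fd x])
    from E.algebraicE[OF subfieldE(1)[OF K] x this] obtain p
      where p: "p \<in> carrier (K[X]\<^bsub>E\<^esub>)" "p \<noteq> []" "E.eval p x = \<zero>\<^bsub>E\<^esub>" by blast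
    have pol: "polynomial\<^bsub>E\<^esub> K p" using p(1) by (simp add: univ_poly_carrier)
    then have "set p \<subseteq> K" by (auto simp: polynomial_def)
    moreover have "p \<in> carrier (poly_ring E)"
      using pol KE by (auto simp: univ_poly_carrier[symmetric] polynomial_def)
    ultimately show ?thesis using p by blast
  qed
  then obtain P where P: "\<And>x. x \<in> carrier E \<Longrightarrow> P x \<in> carrier (poly_ring E) \<and> P x \<noteq> [] \<and> set (P x) \<subseteq> K \<and> E.eval (P x) x = \<zero>\<^bsub>E\<^esub>"
    by metis
  let ?R = "\<Union>u\<in>set Us. {y. E.is_root (P u) y}"
  have fin: "finite ?R"
    using E.finite_number_of_roots P Us(1) by auto
  have root: "\<sigma> u \<in> ?R" if "\<sigma> \<in> ?G" "u \<in> set Us" for \<sigma> u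
  proof -
    have u: "u \<in> carrier E" using that Us by blast
    have \<sigma>: "\<sigma> \<in> ring_hom E E" "\<And>x. x \<in> K \<Longrightarrow> \<sigma> x = x" using that by (auto simp: galois_group_carrier)
    have "E.eval (P u) (\<sigma> u) = \<sigma> (E.eval (P u) u)"
      by (rule E.ring_hom_eval[OF \<sigma> KE u, symmetric]) (use P[OF u] in blast)+
    also have "\<dots> = \<zero>\<^bsub>E\<^esub>" using P[OF u] ring_hom_zero[OF \<sigma>(1) E.ring_axioms E.ring_axioms] by simp
    finally show ?thesis using that P[OF u] ring_hom_memE(1)[OF \<sigma>(1) u] by (auto simp: E.is_root_def)
  qed
  have "inj_on (\<lambda>\<sigma>. map \<sigma> Us) ?G"
  proof (rule inj_onI)
    fix \<sigma> \<tau> assume \<sigma>: "\<sigma> \<in> ?G" and \<tau>: "\<tau> \<in> ?G" and eq: "map \<sigma> Us = map \<tau> Us"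
    have "\<sigma> x = \<tau> x" if x: "x \<in> carrier E" for x
    proof -
      obtain Ks where Ks: "set Ks \<subseteq> K" "x = E.combine Ks Us"
        using x[folded Us(2)] unfolding E.Span_eq_combine_set[OF K Us(1)] by blast
      have "\<sigma> x = E.combine Ks (map \<sigma> Us)" "\<tau> x = E.combine Ks (map \<tau> Us)"
        unfolding Ks(2) using \<sigma> \<tau> Ks(1) Us(1)
        by (auto intro!: E.ring_hom_combine[OF _ _ KE] simp: galois_group_carrier)
      then show ?thesis using eq by simp
    qed
    moreover have "\<sigma> \<in> extensional (carrier E)" "\<tau> \<in> extensional (carrier E)"
      using \<sigma> \<tau> by (auto simp: galois_group_carrier Bij_def)
    ultimately show "\<sigma> = \<tau>" by (auto intro: extensionalityI)
  qed
  moreover have "(\<lambda>\<sigma>. map \<sigma> Us) ` ?G \<subseteq> {ys. set ys \<subseteq> ?R \<and> length ys = length Us}"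
    using root by auto
  moreover have "finite {ys. set ys \<subseteq> ?R \<and> length ys = length Us}"
    by (rule finite_lists_length_eq[OF fin])
  ultimately show ?thesis by (meson finite_imageD finite_subset)
qed


section \<open>Conjugation by the left regular representation\<close>

locale greither_pareigis =
  fixes E :: "('e, 'm) ring_scheme" and K :: "'e set" and N :: "(('e \<Rightarrow> 'e) \<Rightarrow> 'e \<Rightarrow> 'e) set"
  assumes galois: "finite_galois E K"
    and regular: "regular_subgroup (galois_group E K) N"
    and normalized: "left_reg (galois_group E K) ` carrier (galois_group E K) \<subseteq>
      normalizer (Perm (galois_group E K)) N"
begin

abbreviation "G \<equiv> galois_group E K"
abbreviation "N' \<equiv> perm_subgroup G N"
text \<open>The kernel of conjugation, taken in \<open>G\<close>, whose elements act on \<open>E\<close>, instead of in \<open>\<lambda>(G)\<close>.\<close>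

definition "W = {g \<in> carrier G. left_reg G g \<in> conj_kernel G N}"
abbreviation "F \<equiv> fixed_field E W"
abbreviation "L \<equiv> E\<lparr>carrier := F\<rparr>"

sublocale E: field E using galois by (simp add: finite_galois_def)

lemma subfield_K: "subfield K E" using galois by (simp add: finite_galois_def)
lemma K_E: "K \<subseteq> carrier E" by (rule subfieldE(3)[OF subfield_K])

sublocale G: group G by (rule group_galois_group[OF E.ring_axioms K_E])

lemma finite_G: "finite (carrier G)" by (rule finite_galois_group[OF galois])

lemma G_hom: "g \<in> carrier G \<Longrightarrow> g \<in> ring_hom E E" by (simp add: galois_group_carrier)
lemma G_closed: "g \<in> carrier G \<Longrightarrow> x \<in> carrier E \<Longrightarrow> g x \<in> carrier E"
  by (rule ring_hom_memE(1)[OF G_hom])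

lemma G_cancel:
  assumes "g \<in> carrier G" "x \<in> carrier E"
  shows "(inv\<^bsub>G\<^esub> g) (g x) = x" "g ((inv\<^bsub>G\<^esub> g) x) = x"
  using galois_group_mult[of "inv\<^bsub>G\<^esub> g" E K g x] galois_group_mult[of g E K "inv\<^bsub>G\<^esub> g" x] assms
  by (simp_all add: galois_group_one)

lemma K_fixed: "K = {x \<in> carrier E. \<forall>g\<in>carrier G. g x = x}"
  using galois by (auto simp: finite_galois_def fixed_field_def)

sublocale P: group "Perm G" by (rule group_BijGroup)

lemma subgroup_N: "subgroup N (Perm G)" using regular by (simp add: regular_subgroup_def)
lemma group_N': "group N'" by (rule P.subgroup_imp_group[OF subgroup_N])

sublocale N': group N' by (rule group_N')

lemma N_P: "\<eta> \<in> N \<Longrightarrow> \<eta> \<in> carrier (Perm G)" by (rule subgroup.mem_carrier[OF subgroup_N])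

lemma finite_N: "finite N"
proof -
  have "card (carrier G) > 0" using finite_G G.one_closed by (auto simp: card_gt_0_iff)
  then show ?thesis using regular by (auto simp: regular_subgroup_def card_ge_0_finite)
qed

lemma left_reg_P: "g \<in> carrier G \<Longrightarrow> left_reg G g \<in> carrier (Perm G)"
proof -
  assume g: "g \<in> carrier G"
  have "bij_betw (left_reg G g) (carrier G) (carrier G)"
    by (rule bij_betw_byWitness[of _ "\<lambda>h. inv\<^bsub>G\<^esub> g \<otimes>\<^bsub>G\<^esub> h"])
      (use g in \<open>auto simp: left_reg_def G.m_assoc[symmetric]\<close>)
  then show ?thesis by (simp add: BijGroup_def Bij_def) (simp add: left_reg_def)
qed

lemma left_reg_mult: "\<lbrakk>g \<in> carrier G; h \<in> carrier G\<rbrakk> \<Longrightarrow>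
    left_reg G (g \<otimes>\<^bsub>G\<^esub> h) = left_reg G g \<otimes>\<^bsub>Perm G\<^esub> left_reg G h"
  using left_reg_P[of g] left_reg_P[of h]
  by (auto simp: BijGroup_def compose_def left_reg_def fun_eq_iff G.m_assoc)

lemma left_reg_one: "left_reg G \<one>\<^bsub>G\<^esub> = \<one>\<^bsub>Perm G\<^esub>"
  by (auto simp: BijGroup_def left_reg_def fun_eq_iff)

abbreviation "Lam \<equiv> left_reg G ` carrier G"

lemma subgroup_Lam: "subgroup Lam (Perm G)"
proof -
  have "left_reg G \<in> hom G (Perm G)"
    by (rule homI) (use left_reg_P left_reg_mult in auto)
  then interpret h: group_hom G "Perm G" "left_reg G"
    by (intro group_hom.intro group_hom_axioms.intro G.group_axioms P.group_axioms)
  show ?thesis by (rule h.img_is_subgroup)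
qed

abbreviation "cj \<equiv> conj_by (Perm G)"

lemma cj_N:
  assumes p: "p \<in> Lam" and \<eta>: "\<eta> \<in> N"
  shows "cj p \<eta> \<in> N"
proof -
  have "N \<subseteq> carrier (Perm G)" using N_P by blast
  moreover have "p \<in> normalizer (Perm G) N" using normalized p by blast
  ultimately have "p <#\<^bsub>Perm G\<^esub> N #>\<^bsub>Perm G\<^esub> inv\<^bsub>Perm G\<^esub> p = N"
    by (simp add: normalizer_def stabilizer_def)
  moreover have "cj p \<eta> \<in> p <#\<^bsub>Perm G\<^esub> N #>\<^bsub>Perm G\<^esub> inv\<^bsub>Perm G\<^esub> p"
    using \<eta> by (auto simp: conj_by_def l_coset_def r_coset_def)
  ultimately show ?thesis by simp
qed

lemma Lam_P: "p \<in> Lam \<Longrightarrow> p \<in> carrier (Perm G)" using left_reg_P by blast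

lemma cj_mult:
  assumes "p \<in> carrier (Perm G)" "q \<in> carrier (Perm G)" "\<eta> \<in> carrier (Perm G)"
  shows "cj (p \<otimes>\<^bsub>Perm G\<^esub> q) \<eta> = cj p (cj q \<eta>)"
  using assms by (simp add: conj_by_def P.inv_mult_group P.m_assoc)

lemma cj_one: "\<eta> \<in> carrier (Perm G) \<Longrightarrow> cj \<one>\<^bsub>Perm G\<^esub> \<eta> = \<eta>"
  by (simp add: conj_by_def)

lemma cj_distrib:
  assumes "p \<in> carrier (Perm G)" "\<xi> \<in> carrier (Perm G)" "\<eta> \<in> carrier (Perm G)"
  shows "cj p (\<xi> \<otimes>\<^bsub>Perm G\<^esub> \<eta>) = cj p \<xi> \<otimes>\<^bsub>Perm G\<^esub> cj p \<eta>"
proof -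
  have "inv\<^bsub>Perm G\<^esub> p \<otimes>\<^bsub>Perm G\<^esub> (p \<otimes>\<^bsub>Perm G\<^esub> (\<eta> \<otimes>\<^bsub>Perm G\<^esub> inv\<^bsub>Perm G\<^esub> p)) = \<eta> \<otimes>\<^bsub>Perm G\<^esub> inv\<^bsub>Perm G\<^esub> p"
    using assms by (simp add: P.m_assoc[symmetric])
  then show ?thesis using assms by (simp add: conj_by_def P.m_assoc)
qed

lemma cj_inv_cancel:
  assumes "p \<in> Lam" "\<eta> \<in> N"
  shows "cj (inv\<^bsub>Perm G\<^esub> p) (cj p \<eta>) = \<eta>" "cj p (cj (inv\<^bsub>Perm G\<^esub> p) \<eta>) = \<eta>"
  using cj_mult[of "inv\<^bsub>Perm G\<^esub> p" p \<eta>] cj_mult[of p "inv\<^bsub>Perm G\<^esub> p" \<eta>] cj_one Lam_P[OF assms(1)] N_P[OF assms(2)]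
  by simp_all

lemma Lam_inv: "p \<in> Lam \<Longrightarrow> inv\<^bsub>Perm G\<^esub> p \<in> Lam"
  by (rule subgroup.m_inv_closed[OF subgroup_Lam])

lemma cj_bij: "p \<in> Lam \<Longrightarrow> bij_betw (cj p) N N"
  by (rule bij_betw_byWitness[of _ "cj (inv\<^bsub>Perm G\<^esub> p)"])
    (use cj_inv_cancel cj_N Lam_inv in auto)

text \<open>Conjugation, restricted to \<open>N\<close>: the elements of \<open>AutoGroup\<close> are extensional functions.\<close>

definition cja :: "(('e \<Rightarrow> 'e) \<Rightarrow> 'e \<Rightarrow> 'e) \<Rightarrow> (('e \<Rightarrow> 'e) \<Rightarrow> 'e \<Rightarrow> 'e) \<Rightarrow> ('e \<Rightarrow> 'e) \<Rightarrow> 'e \<Rightarrow> 'e"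
  where "cja p = (\<lambda>\<eta>\<in>N. cj p \<eta>)"

lemma cja_auto:
  assumes p: "p \<in> Lam"
  shows "cja p \<in> auto N'"
proof -
  have "bij_betw (cja p) N N"
    using cj_bij[OF p] by (rule bij_betw_cong[THEN iffD1, rotated]) (simp add: cja_def)
  then have "cja p \<in> Bij N" by (simp add: Bij_def cja_def)
  moreover have "cja p \<in> hom N' N'"
    using cj_N[OF p] cj_distrib[OF Lam_P[OF p]] N_P subgroup.m_closed[OF subgroup_N]
    by (intro homI) (auto simp: cja_def)
  ultimately show ?thesis by (simp add: auto_def)
qed

lemma Aut_mult: "\<lbrakk>f \<in> auto N'; g \<in> auto N'; \<eta> \<in> N\<rbrakk> \<Longrightarrow> (f \<otimes>\<^bsub>AutoGroup N'\<^esub> g) \<eta> = f (g \<eta>)"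
  by (simp add: AutoGroup_def BijGroup_def auto_def compose_def)

lemma Aut_one: "\<eta> \<in> N \<Longrightarrow> \<one>\<^bsub>AutoGroup N'\<^esub> \<eta> = \<eta>"
  by (simp add: AutoGroup_def BijGroup_def)

lemma Aut_carrier: "carrier (AutoGroup N') = auto N'" by (simp add: AutoGroup_def)

lemma auto_closed: "f \<in> auto N' \<Longrightarrow> \<eta> \<in> N \<Longrightarrow> f \<eta> \<in> N"
  by (auto simp: auto_def hom_def)

lemma auto_eqI: "\<lbrakk>f \<in> auto N'; g \<in> auto N'; \<And>\<eta>. \<eta> \<in> N \<Longrightarrow> f \<eta> = g \<eta>\<rbrakk> \<Longrightarrow> f = g"
  by (auto simp: auto_def Bij_def intro: extensionalityI)

lemma finite_Aut: "finite (auto N')"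
proof (rule finite_subset)
  show "auto N' \<subseteq> N \<rightarrow>\<^sub>E N" by (auto simp: auto_def Bij_def bij_betw_def PiE_def)
  show "finite (N \<rightarrow>\<^sub>E N)" by (rule finite_PiE) (use finite_N in auto)
qed

sublocale Aut: group "AutoGroup N'" by (rule N'.AutoGroup)

lemma same_cja_coset:
  assumes p: "p \<in> Lam" and q: "q \<in> Lam" and eq: "cja p = cja q"
  shows "p \<otimes>\<^bsub>Perm G\<^esub> inv\<^bsub>Perm G\<^esub> q \<in> conj_kernel G N"
proof -
  have "cj (p \<otimes>\<^bsub>Perm G\<^esub> inv\<^bsub>Perm G\<^esub> q) \<eta> = \<eta>" if \<eta>: "\<eta> \<in> N" for \<eta>
  proof -
    have i: "cj (inv\<^bsub>Perm G\<^esub> q) \<eta> \<in> N" using cj_N[OF Lam_inv[OF q] \<eta>] .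
    have "cj (p \<otimes>\<^bsub>Perm G\<^esub> inv\<^bsub>Perm G\<^esub> q) \<eta> = cj p (cj (inv\<^bsub>Perm G\<^esub> q) \<eta>)"
      using Lam_P p q N_P \<eta> by (intro cj_mult) auto
    also have "\<dots> = cj q (cj (inv\<^bsub>Perm G\<^esub> q) \<eta>)" using fun_cong[OF eq, of "cj (inv\<^bsub>Perm G\<^esub> q) \<eta>"] i by (simp add: cja_def)
    also have "\<dots> = \<eta>" by (rule cj_inv_cancel(2)[OF q \<eta>])
    finally show ?thesis .
  qed
  moreover have "p \<otimes>\<^bsub>Perm G\<^esub> inv\<^bsub>Perm G\<^esub> q \<in> Lam"
    by (rule subgroup.m_closed[OF subgroup_Lam p Lam_inv[OF q]])
  ultimately show ?thesis by (simp add: conj_kernel_def)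
qed

lemma kernel_mult: "\<lbrakk>v \<in> conj_kernel G N; w \<in> conj_kernel G N\<rbrakk> \<Longrightarrow> v \<otimes>\<^bsub>Perm G\<^esub> w \<in> conj_kernel G N"
  unfolding conj_kernel_def
  using subgroup.m_closed[OF subgroup_Lam] cj_mult[OF Lam_P Lam_P N_P] by simp

lemma coset_eq:
  assumes p: "p \<in> Lam" and q: "q \<in> Lam" and eq: "cja p = cja q"
  shows "conj_kernel G N #>\<^bsub>perm_subgroup G Lam\<^esub> p = conj_kernel G N #>\<^bsub>perm_subgroup G Lam\<^esub> q"
proof -
  have "conj_kernel G N #>\<^bsub>perm_subgroup G Lam\<^esub> p \<subseteq> conj_kernel G N #>\<^bsub>perm_subgroup G Lam\<^esub> q"
    if p: "p \<in> Lam" and q: "q \<in> Lam" and eq: "cja p = cja q" for p q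
  proof
    fix x assume "x \<in> conj_kernel G N #>\<^bsub>perm_subgroup G Lam\<^esub> p"
    then obtain v where v: "v \<in> conj_kernel G N" "x = v \<otimes>\<^bsub>Perm G\<^esub> p" by (auto simp: r_coset_def)
    have vP: "v \<in> carrier (Perm G)" using v Lam_P by (auto simp: conj_kernel_def)
    have "x = (v \<otimes>\<^bsub>Perm G\<^esub> (p \<otimes>\<^bsub>Perm G\<^esub> inv\<^bsub>Perm G\<^esub> q)) \<otimes>\<^bsub>Perm G\<^esub> q"
      using v(2) vP Lam_P[OF p] Lam_P[OF q] by (simp add: P.m_assoc)
    moreover have "v \<otimes>\<^bsub>Perm G\<^esub> (p \<otimes>\<^bsub>Perm G\<^esub> inv\<^bsub>Perm G\<^esub> q) \<in> conj_kernel G N"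
      by (rule kernel_mult[OF v(1) same_cja_coset[OF p q eq]])
    ultimately show "x \<in> conj_kernel G N #>\<^bsub>perm_subgroup G Lam\<^esub> q" by (auto simp: r_coset_def)
  qed
  then show ?thesis using assms by (intro equalityI) auto
qed

text \<open>
  Any bijection between \<open>\<lambda>(G)/W\<close> and \<open>Aut(N)\<close> will do. It assigns a coset to every automorphism \<open>f\<close>;
  conjugation by a representative \<open>p f\<close> is an injective function of \<open>f\<close>, hence a bijection of the
  finite set \<open>Aut(N)\<close>.
\<close>

lemma cja_surj:
  assumes iso: "perm_subgroup G Lam Mod conj_kernel G N \<cong> AutoGroup N'" and f: "f \<in> auto N'"
  shows "\<exists>g\<in>carrier G. \<forall>\<eta>\<in>N. cj (left_reg G g) \<eta> = f \<eta>"
proof -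
  let ?Q = "perm_subgroup G Lam Mod conj_kernel G N"
  obtain \<iota> where \<iota>: "bij_betw \<iota> (carrier ?Q) (auto N')"
    using iso by (auto simp: is_iso_def iso_def AutoGroup_def)
  have Q: "\<exists>p. p \<in> Lam \<and> Y = conj_kernel G N #>\<^bsub>perm_subgroup G Lam\<^esub> p" if "Y \<in> carrier ?Q" for Y
    using that unfolding FactGroup_def RCOSETS_def by simp
  have "\<exists>p. p \<in> Lam \<and> inv_into (carrier ?Q) \<iota> f = conj_kernel G N #>\<^bsub>perm_subgroup G Lam\<^esub> p" if "f \<in> auto N'" for f
    using Q[of "inv_into (carrier ?Q) \<iota> f"] \<iota> that by (simp add: bij_betw_def inv_into_into)
  then obtain p where p: "\<And>f. f \<in> auto N' \<Longrightarrow> p f \<in> Lam"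
    "\<And>f. f \<in> auto N' \<Longrightarrow> inv_into (carrier ?Q) \<iota> f = conj_kernel G N #>\<^bsub>perm_subgroup G Lam\<^esub> p f"
    by metis
  have "inj_on (\<lambda>f. cja (p f)) (auto N')"
  proof (rule inj_onI)
    fix f f' assume f: "f \<in> auto N'" "f' \<in> auto N'" "cja (p f) = cja (p f')"
    have "inv_into (carrier ?Q) \<iota> f = inv_into (carrier ?Q) \<iota> f'"
      unfolding p(2)[OF f(1)] p(2)[OF f(2)] by (rule coset_eq[OF p(1)[OF f(1)] p(1)[OF f(2)] f(3)])
    then have "\<iota> (inv_into (carrier ?Q) \<iota> f) = \<iota> (inv_into (carrier ?Q) \<iota> f')" by (rule arg_cong)
    then show "f = f'" unfolding bij_betw_inv_into_right[OF \<iota> f(1)] bij_betw_inv_into_right[OF \<iota> f(2)] .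
  qed
  moreover have "(\<lambda>f. cja (p f)) ` auto N' \<subseteq> auto N'" using cja_auto p(1) by blast
  ultimately have "(\<lambda>f. cja (p f)) ` auto N' = auto N'" by (intro endo_inj_surj finite_Aut)
  with f have "f \<in> (\<lambda>f. cja (p f)) ` auto N'" by (simp only:)
  then obtain f' where f': "f = cja (p f')" "f' \<in> auto N'" by (rule imageE)
  obtain g where g: "p f' = left_reg G g" "g \<in> carrier G" by (rule imageE[OF p(1)[OF f'(2)]])
  have "cj (left_reg G g) \<eta> = f \<eta>" if "\<eta> \<in> N" for \<eta>
    using that by (simp only: f'(1) g(1) cja_def restrict_apply if_True)
  with g(2) show ?thesis by (intro bexI[of _ g]) simp_all
qed


section \<open>The fixed field of the conjugation kernel\<close>

abbreviation "cg g \<equiv> cj (left_reg G g)"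

lemma W_iff: "g \<in> W \<longleftrightarrow> g \<in> carrier G \<and> (\<forall>\<eta>\<in>N. cg g \<eta> = \<eta>)"
  by (auto simp: W_def conj_kernel_def)

lemma W_G: "g \<in> W \<Longrightarrow> g \<in> carrier G" by (simp add: W_def)

lemma cg_N: "g \<in> carrier G \<Longrightarrow> \<eta> \<in> N \<Longrightarrow> cg g \<eta> \<in> N" by (rule cj_N) auto

lemma cg_mult: "\<lbrakk>g \<in> carrier G; h \<in> carrier G; \<eta> \<in> N\<rbrakk> \<Longrightarrow> cg (g \<otimes>\<^bsub>G\<^esub> h) \<eta> = cg g (cg h \<eta>)"
  by (simp add: left_reg_mult cj_mult left_reg_P N_P)

lemma cg_one: "\<eta> \<in> N \<Longrightarrow> cg \<one>\<^bsub>G\<^esub> \<eta> = \<eta>" by (simp add: left_reg_one cj_one N_P)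

lemma cg_cancel: "g \<in> carrier G \<Longrightarrow> \<eta> \<in> N \<Longrightarrow> cg (inv\<^bsub>G\<^esub> g) (cg g \<eta>) = \<eta>"
  using cg_mult[of "inv\<^bsub>G\<^esub> g" g \<eta>] cg_one by simp

lemma W_one: "\<one>\<^bsub>G\<^esub> \<in> W" using cg_one by (simp only: W_iff) simp

lemma W_quotient:
  assumes "g \<in> carrier G" "h \<in> carrier G" "\<And>\<eta>. \<eta> \<in> N \<Longrightarrow> cg g \<eta> = cg h \<eta>"
  shows "inv\<^bsub>G\<^esub> h \<otimes>\<^bsub>G\<^esub> g \<in> W"
  unfolding W_iff using assms cg_mult[of "inv\<^bsub>G\<^esub> h" g] cg_cancel by simp

lemma W_conj:
  assumes g: "g \<in> carrier G" and v: "v \<in> W"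
  shows "inv\<^bsub>G\<^esub> g \<otimes>\<^bsub>G\<^esub> v \<otimes>\<^bsub>G\<^esub> g \<in> W"
proof -
  have vG: "v \<in> carrier G" by (rule W_G[OF v])
  have "cg (inv\<^bsub>G\<^esub> g \<otimes>\<^bsub>G\<^esub> v \<otimes>\<^bsub>G\<^esub> g) \<eta> = \<eta>" if "\<eta> \<in> N" for \<eta>
    using that g vG v cg_mult cg_N cg_cancel by (simp only: W_iff) simp
  then show ?thesis unfolding W_iff using g vG by simp
qed

lemma F_E: "x \<in> F \<Longrightarrow> x \<in> carrier E" by (simp add: fixed_field_def)
lemma F_fixed: "x \<in> F \<Longrightarrow> v \<in> W \<Longrightarrow> v x = x" unfolding fixed_field_def by blast
lemma FI: "\<lbrakk>x \<in> carrier E; \<And>v. v \<in> W \<Longrightarrow> v x = x\<rbrakk> \<Longrightarrow> x \<in> F" unfolding fixed_field_def by blast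

lemma G_F: "g \<in> carrier G \<Longrightarrow> x \<in> F \<Longrightarrow> g x \<in> F"
proof (rule FI)
  assume g: "g \<in> carrier G" and x: "x \<in> F"
  have xE: "x \<in> carrier E" by (rule F_E[OF x])
  show "g x \<in> carrier E" by (rule G_closed[OF g xE])
  fix v assume v: "v \<in> W"
  then have vG: "v \<in> carrier G" by (rule W_G)
  have "g x = g ((inv\<^bsub>G\<^esub> g \<otimes>\<^bsub>G\<^esub> v \<otimes>\<^bsub>G\<^esub> g) x)" using F_fixed[OF x W_conj[OF g v]] by simp
  also have "\<dots> = v (g x)" using g vG xE by (simp add: galois_group_mult G_closed G_cancel)
  finally show "v (g x) = g x" by simp
qed

text \<open>The two elements differ by an element of \<open>W\<close>.\<close>

lemma same_action:
  assumes "g \<in> carrier G" "h \<in> carrier G" "\<And>\<eta>. \<eta> \<in> N \<Longrightarrow> cg g \<eta> = cg h \<eta>" "x \<in> F"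
  shows "g x = h x"
proof -
  have xE: "x \<in> carrier E" by (rule F_E[OF assms(4)])
  have "h x = h ((inv\<^bsub>G\<^esub> h \<otimes>\<^bsub>G\<^esub> g) x)" using F_fixed[OF assms(4) W_quotient[OF assms(1-3)]] by simp
  also have "\<dots> = g x" using assms(1,2) xE by (simp add: galois_group_mult G_closed G_cancel)
  finally show ?thesis by simp
qed

lemma subfield_F: "subfield F E"
proof (rule E.subfieldI')
  have h: "v \<in> ring_hom E E" if "v \<in> W" for v by (rule G_hom[OF W_G[OF that]])
  have hr: "ring_hom_ring E E v" if "v \<in> W" for v by (rule ring_hom_ringI2[OF E.ring_axioms E.ring_axioms h[OF that]])
  show "subring F E"
  proof (rule E.subringI)
    show "F \<subseteq> carrier E" using F_E by blast
    show "\<one>\<^bsub>E\<^esub> \<in> F" by (rule FI) (use ring_hom_memE(4)[OF h] in auto)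
    fix x assume x: "x \<in> F"
    note xE = F_E[OF x]
    show "\<ominus>\<^bsub>E\<^esub> x \<in> F"
    proof (rule FI)
      show "\<ominus>\<^bsub>E\<^esub> x \<in> carrier E" using xE by simp
      fix v assume v: "v \<in> W"
      interpret v: ring_hom_ring E E v by (rule hr[OF v])
      show "v (\<ominus>\<^bsub>E\<^esub> x) = \<ominus>\<^bsub>E\<^esub> x" using F_fixed[OF x v] xE by simp
    qed
    fix y assume y: "y \<in> F"
    note yE = F_E[OF y]
    show "x \<otimes>\<^bsub>E\<^esub> y \<in> F" "x \<oplus>\<^bsub>E\<^esub> y \<in> F"
      by (rule FI; simp add: xE yE F_fixed[OF x] F_fixed[OF y] ring_hom_memE(2,3)[OF h])+
  qed
  fix x assume "x \<in> F - {\<zero>\<^bsub>E\<^esub>}"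
  then have x: "x \<in> F" "x \<in> carrier E" "x \<noteq> \<zero>\<^bsub>E\<^esub>" using F_E by auto
  then have i: "inv\<^bsub>E\<^esub> x \<in> carrier E" "x \<otimes>\<^bsub>E\<^esub> inv\<^bsub>E\<^esub> x = \<one>\<^bsub>E\<^esub>" using E.field_Units by auto
  show "inv\<^bsub>E\<^esub> x \<in> F"
  proof (rule FI[OF i(1)])
    fix v assume v: "v \<in> W"
    note hv = ring_hom_memE[OF h[OF v]]
    have "x \<otimes>\<^bsub>E\<^esub> v (inv\<^bsub>E\<^esub> x) = \<one>\<^bsub>E\<^esub>"
      using hv(2)[OF x(2) i(1)] hv(4) F_fixed[OF x(1) v] i by simp
    then show "v (inv\<^bsub>E\<^esub> x) = inv\<^bsub>E\<^esub> x"
      using E.m_lcancel[OF x(3,2) hv(1)[OF i(1)] i(1)] i by simp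
  qed
qed

text \<open>
  Artin's argument with a dual family of \<open>E\<close>. Let \<open>t k\<close> be the sum of the conjugates of \<open>u k\<close> under \<open>W\<close>,
  which is fixed by \<open>W\<close>. The sum \<open>\<Sum> e k * h (t k)\<close> is \<open>1\<close> for \<open>h = 1\<close> and \<open>0\<close> for \<open>h \<notin> W\<close>, so such an \<open>h\<close> cannot fix
  all \<open>t k\<close>.
\<close>

lemma moves_F:
  assumes g: "g \<in> carrier G" "g \<notin> W"
  shows "\<exists>x\<in>F. g x \<noteq> x"
proof (rule ccontr)
  assume "\<not> ?thesis"
  then have fix_F: "g x = x" if "x \<in> F" for x using that by blast
  let ?Y = "carrier G - {\<one>\<^bsub>G\<^esub>}"
  have sep: "\<exists>x\<in>carrier E. h x \<in> carrier E \<and> h x \<noteq> x" if "h \<in> ?Y" for h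
  proof (rule ccontr)
    assume "\<not> ?thesis"
    then have "h x = \<one>\<^bsub>G\<^esub> x" if "x \<in> carrier E" for x using that G_closed \<open>h \<in> ?Y\<close> galois_group_one by (metis DiffD1)
    moreover have "h \<in> extensional (carrier E)" "\<one>\<^bsub>G\<^esub> \<in> extensional (carrier E)"
      using that G.one_closed by (auto simp: galois_group_carrier Bij_def)
    ultimately have "h = \<one>\<^bsub>G\<^esub>" by (auto intro: extensionalityI)
    then show False using that by simp
  qed
  obtain n :: nat and e u where "e \<in> {..<n} \<rightarrow> carrier E" "u \<in> {..<n} \<rightarrow> carrier E"
    and eu1: "(\<Oplus>\<^bsub>E\<^esub>k\<in>{..<n}. e k \<otimes>\<^bsub>E\<^esub> u k) = \<one>\<^bsub>E\<^esub>"
    and eu0: "\<And>h. h \<in> ?Y \<Longrightarrow> (\<Oplus>\<^bsub>E\<^esub>k\<in>{..<n}. e k \<otimes>\<^bsub>E\<^esub> h (u k)) = \<zero>\<^bsub>E\<^esub>"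
    using exists_dual_family[OF E.field_axioms E.carrier_is_subfield, of ?Y] sep finite_G G_hom by blast
  then have e: "\<And>k. k < n \<Longrightarrow> e k \<in> carrier E" and u: "\<And>k. k < n \<Longrightarrow> u k \<in> carrier E" by auto
  have fW: "finite W" using finite_G by (simp add: W_def)
  \<comment> \<open>As elements of \<open>F\<close> (shown below), the \<open>t k\<close> are fixed by \<open>g\<close>.\<close>
  define t where "t k = (\<Oplus>\<^bsub>E\<^esub>v\<in>W. v (u k))" for k
  have vE: "v (u k) \<in> carrier E" if "v \<in> W" "k < n" for v k using that u G_closed W_G by auto
  have tE: "t k \<in> carrier E" if "k < n" for k
    unfolding t_def using vE that by (intro E.finsum_closed) auto
  have hom_sum: "h (t k) = (\<Oplus>\<^bsub>E\<^esub>v\<in>W. (h \<otimes>\<^bsub>G\<^esub> v) (u k))" if h: "h \<in> carrier G" and k: "k < n" for h k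
  proof -
    interpret h: ring_hom_cring E E h
      by (intro ring_hom_cring.intro ring_hom_cring_axioms.intro E.is_cring G_hom[OF h])
    have "h (t k) = (\<Oplus>\<^bsub>E\<^esub>v\<in>W. h (v (u k)))"
      unfolding t_def using vE[OF _ k] by (subst h.hom_finsum) (auto simp: comp_def)
    also have "\<dots> = (\<Oplus>\<^bsub>E\<^esub>v\<in>W. (h \<otimes>\<^bsub>G\<^esub> v) (u k))"
      using h u[OF k] G_closed W_G by (intro E.finsum_cong') (auto simp: galois_group_mult)
    finally show ?thesis .
  qed
  have tF: "t k \<in> F" if k: "k < n" for k
  proof (rule FI[OF tE[OF k]])
    fix h assume h: "h \<in> W"
    then have hG: "h \<in> carrier G" by (rule W_G)
    have Wc: "a \<otimes>\<^bsub>G\<^esub> b \<in> W" if "a \<in> W" "b \<in> W" for a b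
      using that cg_mult by (simp only: W_iff) simp
    have Wi: "inv\<^bsub>G\<^esub> a \<in> W" if "a \<in> W" for a
      using that cg_cancel[of a] by (simp only: W_iff) (metis G.inv_closed)
    have img: "(\<lambda>v. h \<otimes>\<^bsub>G\<^esub> v) ` W = W"
    proof
      show "(\<lambda>v. h \<otimes>\<^bsub>G\<^esub> v) ` W \<subseteq> W" using Wc[OF h] by blast
      show "W \<subseteq> (\<lambda>v. h \<otimes>\<^bsub>G\<^esub> v) ` W"
      proof
        fix v assume v: "v \<in> W"
        have "v = h \<otimes>\<^bsub>G\<^esub> (inv\<^bsub>G\<^esub> h \<otimes>\<^bsub>G\<^esub> v)" using W_G[OF v] hG by (simp add: G.m_assoc[symmetric])
        then show "v \<in> (\<lambda>v. h \<otimes>\<^bsub>G\<^esub> v) ` W" using Wc[OF Wi[OF h] v] by blast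
      qed
    qed
    have "(\<Oplus>\<^bsub>E\<^esub>v\<in>(\<lambda>v. h \<otimes>\<^bsub>G\<^esub> v) ` W. v (u k)) = (\<Oplus>\<^bsub>E\<^esub>v\<in>W. (h \<otimes>\<^bsub>G\<^esub> v) (u k))"
    proof (rule E.finsum_reindex)
      show "(\<lambda>v. v (u k)) \<in> (\<lambda>v. h \<otimes>\<^bsub>G\<^esub> v) ` W \<rightarrow> carrier E" unfolding img using vE[OF _ k] by blast
      show "inj_on (\<lambda>v. h \<otimes>\<^bsub>G\<^esub> v) W" using hG W_G by (auto simp: inj_on_def)
    qed
    then have "(\<Oplus>\<^bsub>E\<^esub>v\<in>W. (h \<otimes>\<^bsub>G\<^esub> v) (u k)) = t k" unfolding img t_def by (rule sym)
    then show "h (t k) = t k" by (simp only: hom_sum[OF hG k])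
  qed
  have val: "(\<Oplus>\<^bsub>E\<^esub>k\<in>{..<n}. e k \<otimes>\<^bsub>E\<^esub> h (t k)) = (\<Oplus>\<^bsub>E\<^esub>v\<in>W. \<Oplus>\<^bsub>E\<^esub>k\<in>{..<n}. e k \<otimes>\<^bsub>E\<^esub> (h \<otimes>\<^bsub>G\<^esub> v) (u k))"
    if h: "h \<in> carrier G" for h
  proof -
    have c: "(h \<otimes>\<^bsub>G\<^esub> v) (u k) \<in> carrier E" if "v \<in> W" "k < n" for v k
      using that h u G_closed W_G by simp
    have "(\<Oplus>\<^bsub>E\<^esub>k\<in>{..<n}. e k \<otimes>\<^bsub>E\<^esub> h (t k)) = (\<Oplus>\<^bsub>E\<^esub>k\<in>{..<n}. \<Oplus>\<^bsub>E\<^esub>v\<in>W. e k \<otimes>\<^bsub>E\<^esub> (h \<otimes>\<^bsub>G\<^esub> v) (u k))"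
    proof (rule E.finsum_cong', rule refl)
      show "(\<lambda>k. \<Oplus>\<^bsub>E\<^esub>v\<in>W. e k \<otimes>\<^bsub>E\<^esub> (h \<otimes>\<^bsub>G\<^esub> v) (u k)) \<in> {..<n} \<rightarrow> carrier E"
        using c e by (auto intro!: E.finsum_closed)
      fix k assume "k \<in> {..<n}"
      then show "e k \<otimes>\<^bsub>E\<^esub> h (t k) = (\<Oplus>\<^bsub>E\<^esub>v\<in>W. e k \<otimes>\<^bsub>E\<^esub> (h \<otimes>\<^bsub>G\<^esub> v) (u k))"
        using hom_sum[OF h] E.finsum_rdistr[OF fW, of "e k" "\<lambda>v. (h \<otimes>\<^bsub>G\<^esub> v) (u k)"] e c by auto
    qed
    also have "\<dots> = (\<Oplus>\<^bsub>E\<^esub>v\<in>W. \<Oplus>\<^bsub>E\<^esub>k\<in>{..<n}. e k \<otimes>\<^bsub>E\<^esub> (h \<otimes>\<^bsub>G\<^esub> v) (u k))"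
      by (rule E.finsum_swap[OF _ fW]) (use c e in auto)
    finally show ?thesis .
  qed
  have sum1: "(\<Oplus>\<^bsub>E\<^esub>k\<in>{..<n}. e k \<otimes>\<^bsub>E\<^esub> \<one>\<^bsub>G\<^esub> (u k)) = \<one>\<^bsub>E\<^esub>"
    using eu1 u e by (subst E.finsum_cong'[of _ _ "\<lambda>k. e k \<otimes>\<^bsub>E\<^esub> u k"]) (auto simp: galois_group_one)
  have "(\<Oplus>\<^bsub>E\<^esub>k\<in>{..<n}. e k \<otimes>\<^bsub>E\<^esub> \<one>\<^bsub>G\<^esub> (t k)) = (\<Oplus>\<^bsub>E\<^esub>v\<in>W. if v = \<one>\<^bsub>G\<^esub> then \<one>\<^bsub>E\<^esub> else \<zero>\<^bsub>E\<^esub>)"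
    unfolding val[OF G.one_closed]
    by (rule E.finsum_cong') (use sum1 eu0 W_G in auto)
  also have "\<dots> = \<one>\<^bsub>E\<^esub>" by (rule E.finsum_delta[OF fW W_one]) simp
  finally have one: "(\<Oplus>\<^bsub>E\<^esub>k\<in>{..<n}. e k \<otimes>\<^bsub>E\<^esub> \<one>\<^bsub>G\<^esub> (t k)) = \<one>\<^bsub>E\<^esub>" .
  have "(\<Oplus>\<^bsub>E\<^esub>k\<in>{..<n}. e k \<otimes>\<^bsub>E\<^esub> g (t k)) = (\<Oplus>\<^bsub>E\<^esub>v\<in>W. \<zero>\<^bsub>E\<^esub>)"
    unfolding val[OF g(1)]
  proof (rule E.finsum_cong', rule refl)
    fix v assume v: "v \<in> W"
    have "g \<otimes>\<^bsub>G\<^esub> v \<noteq> \<one>\<^bsub>G\<^esub>"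
    proof
      assume a: "g \<otimes>\<^bsub>G\<^esub> v = \<one>\<^bsub>G\<^esub>"
      have "cg g \<eta> = \<eta>" if "\<eta> \<in> N" for \<eta>
        using a that cg_mult[OF g(1) W_G[OF v] that] cg_one[OF that] v by (simp add: W_iff)
      then show False using g by (simp only: W_iff) simp
    qed
    then show "(\<Oplus>\<^bsub>E\<^esub>k\<in>{..<n}. e k \<otimes>\<^bsub>E\<^esub> (g \<otimes>\<^bsub>G\<^esub> v) (u k)) = \<zero>\<^bsub>E\<^esub>" using eu0 g(1) W_G[OF v] by simp
  qed auto
  also have "\<dots> = \<zero>\<^bsub>E\<^esub>" by (rule E.finsum_zero)
  finally have "(\<Oplus>\<^bsub>E\<^esub>k\<in>{..<n}. e k \<otimes>\<^bsub>E\<^esub> g (t k)) = \<zero>\<^bsub>E\<^esub>" .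
  moreover have "(\<Oplus>\<^bsub>E\<^esub>k\<in>{..<n}. e k \<otimes>\<^bsub>E\<^esub> g (t k)) = (\<Oplus>\<^bsub>E\<^esub>k\<in>{..<n}. e k \<otimes>\<^bsub>E\<^esub> \<one>\<^bsub>G\<^esub> (t k))"
    using fix_F[OF tF] tE e by (intro E.finsum_cong') (auto simp: galois_group_one)
  ultimately show False using one E.one_not_zero by simp
qed

lemma G_F_K: "x \<in> F \<Longrightarrow> (\<And>g. g \<in> carrier G \<Longrightarrow> g x = x) \<Longrightarrow> x \<in> K"
  using K_fixed F_E by blast

lemma K_F: "x \<in> K \<Longrightarrow> x \<in> F"
  using K_fixed by (intro FI) (auto dest: W_G)

end



section \<open>The two descriptions of the Hopf algebra\<close>

lemma finsum_subcarrier: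
  fixes E :: "('e, 'm) ring_scheme"
  assumes "abelian_monoid E" "abelian_monoid (E\<lparr>carrier := F\<rparr>)" "F \<subseteq> carrier E" "f \<in> I \<rightarrow> F"
  shows "finsum (E\<lparr>carrier := F\<rparr>) f I = finsum E f I"
proof -
  interpret E: abelian_monoid E by fact
  interpret L: abelian_monoid "E\<lparr>carrier := F\<rparr>" by fact
  show ?thesis using assms(4)
  proof (induction I rule: infinite_finite_induct)
    case (insert x I)
    have "f \<in> I \<rightarrow> F" "f x \<in> F" using insert by auto
    moreover have "f \<in> I \<rightarrow> carrier E" "f x \<in> carrier E" using insert assms(3) by auto
    ultimately show ?case using insert by simp
  qed (simp_all)
qed

locale full_greither_pareigis = greither_pareigis +
  assumes full: "perm_subgroup G Lam Mod conj_kernel G N \<cong> AutoGroup N'"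
begin

abbreviation "\<rho> \<equiv> conj_galois_action G N"

lemma rho:
  assumes "f \<in> auto N'"
  shows "\<rho> f \<in> carrier G" "\<eta> \<in> N \<Longrightarrow> cg (\<rho> f) \<eta> = f \<eta>"
proof -
  have "\<exists>g. g \<in> carrier G \<and> (\<forall>\<eta>\<in>N. cg g \<eta> = f \<eta>)" using cja_surj[OF full assms] by blast
  from someI_ex[OF this] show "\<rho> f \<in> carrier G" "\<eta> \<in> N \<Longrightarrow> cg (\<rho> f) \<eta> = f \<eta>"
    unfolding conj_galois_action_def by blast+
qed

text \<open>On \<open>F\<close>, the automorphism does not depend on the element of \<open>G\<close> that \<open>conj_galois_action\<close> chooses.\<close>

lemma rho_eq:
  assumes "f \<in> auto N'" "g \<in> carrier G" "\<And>\<eta>. \<eta> \<in> N \<Longrightarrow> cg g \<eta> = f \<eta>" "x \<in> F"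
  shows "\<rho> f x = g x"
  by (rule same_action[OF rho(1)[OF assms(1)] assms(2) _ assms(4)]) (simp add: rho(2)[OF assms(1)] assms(3))

lemma carrier_L: "carrier L = F" by simp
lemma carrier_N': "carrier N' = N" by simp

lemma field_L: "field L" by (rule E.subfield_iff(2)[OF subfield_F])

lemma cring_L: "cring L" by (rule domain.axioms(1)[OF field.axioms(1)[OF field_L]])

sublocale EA: finite_group_algebra E N'
  by (rule finite_group_algebra.intro[OF E.is_cring group_N']) (simp add: finite_N)

text \<open>
  The tautological action of automorphisms, as a constant: with \<open>\<lambda>f. f\<close> for the parameter \<open>\<alpha>\<close>, the left-hand
  side of an equation for \<open>\<alpha> g n\<close> would be the variable pattern \<open>g n\<close>.
\<close>

definition app :: "((('e \<Rightarrow> 'e) \<Rightarrow> 'e \<Rightarrow> 'e) \<Rightarrow> ('e \<Rightarrow> 'e) \<Rightarrow> 'e \<Rightarrow> 'e) \<Rightarrow>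
    (('e \<Rightarrow> 'e) \<Rightarrow> 'e \<Rightarrow> 'e) \<Rightarrow> ('e \<Rightarrow> 'e) \<Rightarrow> 'e \<Rightarrow> 'e"
  where "app = (\<lambda>f. f)"

lemma app: "app f \<eta> = f \<eta>" by (simp add: app_def)

sublocale gd: galois_descent L N' "AutoGroup N'" K \<rho> app
proof (intro galois_descent.intro galois_descent_axioms.intro finite_group_algebra.intro)
  show "cring L" by (rule cring_L)
  show "group N'" by (rule group_N')
  show "finite (carrier N')" by (simp add: finite_N)
  show "group (AutoGroup N')" by (rule Aut.group_axioms)
  show "field L" by (rule field_L)
  show "field (L\<lparr>carrier := K\<rparr>)" using E.subfield_iff(2)[OF subfield_K] by simp
  show "finite (carrier (AutoGroup N'))" by (simp add: Aut_carrier finite_Aut)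
next
  fix g assume g: "g \<in> carrier (AutoGroup N')"
  then have ga: "g \<in> auto N'" by (simp add: Aut_carrier)
  show "\<rho> g \<in> ring_hom L L"
  proof (rule ring_hom_memI)
    note h = ring_hom_memE[OF G_hom[OF rho(1)[OF ga]]]
    show "\<rho> g x \<in> carrier L" if "x \<in> carrier L" for x using G_F[OF rho(1)[OF ga]] that by simp
    show "\<rho> g \<one>\<^bsub>L\<^esub> = \<one>\<^bsub>L\<^esub>" using h(4) by simp
    fix x y assume "x \<in> carrier L" "y \<in> carrier L"
    then have xy: "x \<in> carrier E" "y \<in> carrier E" by (simp_all add: F_E)
    show "\<rho> g (x \<otimes>\<^bsub>L\<^esub> y) = \<rho> g x \<otimes>\<^bsub>L\<^esub> \<rho> g y" using h(2)[OF xy] by simp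
    show "\<rho> g (x \<oplus>\<^bsub>L\<^esub> y) = \<rho> g x \<oplus>\<^bsub>L\<^esub> \<rho> g y" using h(3)[OF xy] by simp
  qed
  show "\<exists>x\<in>carrier L. \<rho> g x \<noteq> x" if "g \<noteq> \<one>\<^bsub>AutoGroup N'\<^esub>"
  proof -
    have "\<rho> g \<notin> W"
    proof
      assume "\<rho> g \<in> W"
      then have "g \<eta> = \<one>\<^bsub>AutoGroup N'\<^esub> \<eta>" if "\<eta> \<in> N" for \<eta>
        using that rho(2)[OF ga that] by (simp add: W_iff Aut_one)
      then have "g = \<one>\<^bsub>AutoGroup N'\<^esub>"
        by (intro auto_eqI ga) (use Aut.one_closed in \<open>simp_all add: Aut_carrier\<close>)
      with that show False by simp
    qed
    from moves_F[OF rho(1)[OF ga] this] show ?thesis unfolding carrier_L .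
  qed
  show "app g n \<in> carrier N'" if "n \<in> carrier N'" for n
    using auto_closed[OF ga, of n] that unfolding carrier_N' app .
  fix h assume h: "h \<in> carrier (AutoGroup N')"
  then have ha: "h \<in> auto N'" by (simp add: Aut_carrier)
  show "app (g \<otimes>\<^bsub>AutoGroup N'\<^esub> h) n = app g (app h n)" if "n \<in> carrier N'" for n
    using Aut_mult[OF ga ha] that unfolding carrier_N' app .
  fix x assume "x \<in> carrier L"
  then have x: "x \<in> F" unfolding carrier_L .
  note xE = F_E[OF x]
  have "\<rho> (g \<otimes>\<^bsub>AutoGroup N'\<^esub> h) x = (\<rho> g \<otimes>\<^bsub>G\<^esub> \<rho> h) x"
  proof (rule rho_eq[OF _ _ _ x])
    show "g \<otimes>\<^bsub>AutoGroup N'\<^esub> h \<in> auto N'" using Aut.m_closed[OF g h] by (simp add: Aut_carrier)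
    show "\<rho> g \<otimes>\<^bsub>G\<^esub> \<rho> h \<in> carrier G" using rho(1) ga ha by simp
    show "cg (\<rho> g \<otimes>\<^bsub>G\<^esub> \<rho> h) \<eta> = (g \<otimes>\<^bsub>AutoGroup N'\<^esub> h) \<eta>" if "\<eta> \<in> N" for \<eta>
      unfolding cg_mult[OF rho(1)[OF ga] rho(1)[OF ha] that] rho(2)[OF ha that]
        rho(2)[OF ga auto_closed[OF ha that]] Aut_mult[OF ga ha that] ..
  qed
  then show "\<rho> (g \<otimes>\<^bsub>AutoGroup N'\<^esub> h) x = \<rho> g (\<rho> h x)"
    using galois_group_mult[OF rho(1)[OF ga] rho(1)[OF ha] xE] by simp
next
  fix x assume "x \<in> carrier L"
  then have x: "x \<in> F" unfolding carrier_L .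
  note xE = F_E[OF x]
  have "\<rho> \<one>\<^bsub>AutoGroup N'\<^esub> x = \<one>\<^bsub>G\<^esub> x"
    by (rule rho_eq[OF _ G.one_closed _ x])
      (use Aut.one_closed in \<open>simp_all add: Aut_carrier Aut_one cg_one\<close>)
  then show "\<rho> \<one>\<^bsub>AutoGroup N'\<^esub> x = x" using galois_group_one[OF xE] by simp
next
  show "app \<one>\<^bsub>AutoGroup N'\<^esub> n = n" if "n \<in> carrier N'" for n
    using Aut_one[of n] that unfolding carrier_N' app .
  show "K = {x \<in> carrier L. \<forall>g\<in>carrier (AutoGroup N'). \<rho> g x = x}"
  proof (intro equalityI subsetI)
    fix x assume "x \<in> K"
    then show "x \<in> {x \<in> carrier L. \<forall>g\<in>carrier (AutoGroup N'). \<rho> g x = x}"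
      using K_F K_fixed rho(1) by (auto simp: Aut_carrier)
  next
    fix x assume "x \<in> {x \<in> carrier L. \<forall>g\<in>carrier (AutoGroup N'). \<rho> g x = x}"
    then have x: "x \<in> F" "\<And>g. g \<in> auto N' \<Longrightarrow> \<rho> g x = x" by (auto simp: Aut_carrier)
    show "x \<in> K"
    proof (rule G_F_K[OF x(1)])
      fix g assume g: "g \<in> carrier G"
      have "cja (left_reg G g) \<in> auto N'" by (rule cja_auto) (use g in auto)
      from rho_eq[OF this g _ x(1)] x(2)[OF this] show "g x = x" by (simp add: cja_def)
    qed
  qed
qed

abbreviation "GP \<equiv> GP_hopf E K N"

lemma GP_fixed_hopf: "GP = fixed_hopf K E N' (carrier G) (\<lambda>g. g) cg"
  by (simp add: GP_hopf_def Let_def)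

lemma Theta_fixed_hopf: "Theta K L N' \<rho> = gd.B"
  by (simp add: Theta_def app_def)

lemma GA_L_E: "f \<in> carrier gd.GA \<Longrightarrow> f \<in> carrier EA.GA"
  using F_E by (simp add: PiE_iff)

lemma GA_L_F: "f \<in> carrier gd.GA \<Longrightarrow> n \<in> N \<Longrightarrow> f n \<in> F"
  by (simp add: PiE_iff)

lemma GA_L_I: "f \<in> carrier EA.GA \<Longrightarrow> (\<And>n. n \<in> N \<Longrightarrow> f n \<in> F) \<Longrightarrow> f \<in> carrier gd.GA"
  by (simp add: PiE_iff)

lemma GP_carrier_E: "carrier GP = {f \<in> carrier EA.GA. \<forall>g\<in>carrier G. \<forall>n\<in>N. f (cg g n) = g (f n)}"
proof -
  have "semilinear_map E N' g (cg g) f = f \<longleftrightarrow> (\<forall>n\<in>N. f (cg g n) = g (f n))"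
    if "f \<in> carrier EA.GA" "g \<in> carrier G" for f g
    using EA.semilinear_map_fixed_iff[OF that(1), of g "cg g"] cj_bij[of "left_reg G g"] G_closed[OF that(2)] that(2)
    by (auto simp del: group_algebra_simps)
  then show ?thesis unfolding GP_fixed_hopf fixed_hopf_fields by blast
qed

text \<open>
  Equivariance under \<open>W\<close> means that the values lie in \<open>F\<close>. On \<open>F\<close>, an element of \<open>G\<close> acts through the
  automorphism of \<open>N\<close> that it induces, and all automorphisms of \<open>N\<close> are induced.
\<close>

lemma GP_carrier: "carrier GP = carrier gd.B"
proof (intro equalityI subsetI)
  fix f assume "f \<in> carrier GP"
  then have f: "f \<in> carrier EA.GA" "\<And>g n. g \<in> carrier G \<Longrightarrow> n \<in> N \<Longrightarrow> f (cg g n) = g (f n)"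
    by (auto simp: GP_carrier_E simp del: group_algebra_simps)
  show "f \<in> carrier gd.B"
  proof (rule gd.BI)
    have "f n \<in> F" if n: "n \<in> N" for n
    proof (rule FI)
      show "f n \<in> carrier E" using EA.GA_mem[OF f(1)] n by simp
      show "v (f n) = f n" if "v \<in> W" for v
        using f(2)[OF W_G[OF that] n] that n by (simp add: W_iff)
    qed
    with f(1) show "f \<in> carrier gd.GA" by (rule GA_L_I)
    fix g n assume "g \<in> carrier (AutoGroup N')" "n \<in> carrier N'"
    then have g: "g \<in> auto N'" and n: "n \<in> N" by (simp_all add: Aut_carrier)
    show "f (app g n) = \<rho> g (f n)" unfolding app using f(2)[OF rho(1)[OF g] n] rho(2)[OF g n] by simp
  qed
next
  fix f assume f: "f \<in> carrier gd.B"
  note fL = GA_L_E[OF gd.B_GA[OF f]] GA_L_F[OF gd.B_GA[OF f]]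
  have "f (cg g n) = g (f n)" if g: "g \<in> carrier G" and n: "n \<in> N" for g n
  proof -
    have c: "cja (left_reg G g) \<in> auto N'" by (rule cja_auto) (use g in auto)
    have "f (app (cja (left_reg G g)) n) = \<rho> (cja (left_reg G g)) (f n)"
      by (rule gd.B_equivariant[OF f]) (use c n in \<open>simp_all add: Aut_carrier\<close>)
    also have "\<dots> = g (f n)"
      by (rule rho_eq[OF c g _ fL(2)[OF n]]) (simp add: cja_def)
    finally show ?thesis using n by (simp add: app cja_def)
  qed
  with fL(1) show "f \<in> carrier GP" by (simp add: GP_carrier_E del: group_algebra_simps)
qed

lemma GP_add: "add GP = add gd.B" and GP_smult: "module.smult GP = module.smult gd.B"
  unfolding GP_fixed_hopf fixed_hopf_fields by (simp_all add: group_algebra_def)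

lemma GP_one: "one GP = one gd.B"
proof -
  have "\<one>\<^bsub>L\<^esub> = \<one>\<^bsub>E\<^esub>" "\<zero>\<^bsub>L\<^esub> = \<zero>\<^bsub>E\<^esub>" by simp_all
  then show ?thesis unfolding GP_fixed_hopf fixed_hopf_fields group_algebra_simps by (simp only:)
qed

lemma finsum_L: "f \<in> I \<rightarrow> F \<Longrightarrow> finsum L f I = finsum E f I"
  by (rule finsum_subcarrier[OF E.abelian_monoid_axioms gd.L.abelian_monoid_axioms subsetI[OF F_E]])

lemma GP_mult:
  assumes "f \<in> carrier gd.B" "h \<in> carrier gd.B"
  shows "f \<otimes>\<^bsub>GP\<^esub> h = f \<otimes>\<^bsub>gd.B\<^esub> h"
proof -
  have m: "f n \<in> F" "h n \<in> F" if "n \<in> N" for n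
    by (rule GA_L_F[OF gd.B_GA[OF assms(1)] that], rule GA_L_F[OF gd.B_GA[OF assms(2)] that])
  have Fm: "x \<otimes>\<^bsub>E\<^esub> y \<in> F" if "x \<in> F" "y \<in> F" for x y
    using gd.L.m_closed[of x y] that by simp
  have c: "inv\<^bsub>N'\<^esub> a \<otimes>\<^bsub>N'\<^esub> n \<in> N" if "a \<in> N" "n \<in> N" for a n
    using N'.m_closed[OF N'.inv_closed, of a n] that unfolding carrier_N' .
  have "(\<Oplus>\<^bsub>E\<^esub>a\<in>N. f a \<otimes>\<^bsub>E\<^esub> h (inv\<^bsub>N'\<^esub> a \<otimes>\<^bsub>N'\<^esub> n)) = (\<Oplus>\<^bsub>L\<^esub>a\<in>N. f a \<otimes>\<^bsub>E\<^esub> h (inv\<^bsub>N'\<^esub> a \<otimes>\<^bsub>N'\<^esub> n))" if "n \<in> N" for n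
    by (rule finsum_L[symmetric]) (use m Fm c that in auto)
  then show ?thesis unfolding GP_fixed_hopf fixed_hopf_fields
    by (auto simp: fun_eq_iff)
qed

lemma GP_counit:
  assumes "f \<in> carrier gd.B"
  shows "counit GP f = counit gd.B f"
proof -
  have "f n \<in> F" if "n \<in> N" for n using GA_L_F[OF gd.B_GA[OF assms] that] .
  then have "finsum L f N = finsum E f N" by (intro finsum_L) auto
  then show ?thesis unfolding GP_fixed_hopf fixed_hopf_fields by simp
qed

lemma GP_antipode: "antipode GP f = antipode gd.B f"
  unfolding GP_fixed_hopf fixed_hopf_fields by simp

sublocale ER: rational_form E N' K gd.B
proof (rule rational_form.intro[OF EA.finite_group_algebra_axioms], rule rational_form_axioms.intro)
  show "cring (E\<lparr>carrier := K\<rparr>)" using gd.cring_K by simp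
  show "module (E\<lparr>carrier := K\<rparr>) gd.B" using gd.module_B by simp
  show "K \<subseteq> carrier E" by (rule K_E)
  show "carrier gd.B \<subseteq> carrier EA.GA" by (rule subsetI) (rule GA_L_E[OF gd.B_GA])
  show "add gd.B = add EA.GA" "module.smult gd.B = module.smult EA.GA"
    using GP_add GP_smult unfolding GP_fixed_hopf fixed_hopf_fields by simp_all
qed

lemma coord_E_L:
  assumes "m \<in> N" "n \<in> N" "U \<in> carrier gd.BB.T"
  shows "ER.coordB m n U = gd.coordB m n U"
proof -
  have l: "(\<lambda>x. x) \<in> lin_maps gd.K' gd.L1 EA.L1"
    by (rule lin_mapsI) (use F_E in auto)
  have m: "module gd.K' EA.L1" using ER.module_K_L1 by simp
  have N: "m \<in> carrier N'" "n \<in> carrier N'" using assms by auto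
  show ?thesis
    using gd.BB.lift_post[OF gd.module_K_L1 gd.bilin_coordB[OF N] m l assms(3)]
    by (simp add: ER.coordB_def gd.coordB_def)
qed

text \<open>
  The two comultiplications are defined by conditions in \<open>E[N] \<otimes>\<^sub>E E[N]\<close> and in \<open>L[N] \<otimes>\<^sub>L L[N]\<close>. By
  \<open>canonical_eq_comul_iff\<close> both say that the coordinates are those of a diagonal matrix.
\<close>

lemma GP_comul:
  assumes f: "f \<in> carrier gd.B"
  shows "comul GP f = comul gd.B f"
proof -
  let ?L = "\<lambda>U. U \<in> carrier gd.BB.T \<and> tensor_lift gd.K' gd.B gd.B gd.AA.T gd.AA.pure U = comul (group_hopf L N') f"
  let ?E = "\<lambda>U. U \<in> carrier ER.BB.T \<and> tensor_lift ER.K' gd.B gd.B EA.AA.T EA.AA.pure U = comul (group_hopf E N') f"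
  have "comul gd.B f = (THE U. ?L U)"
    by (rule fixed_hopf_comul) (simp_all only: fixed_hopf_fields)
  moreover have "comul GP f = (THE U. ?E U)"
    unfolding GP_fixed_hopf
    by (rule fixed_hopf_comul)
      (simp_all only: GP_carrier[unfolded GP_fixed_hopf] ER.B_add ER.B_smult)
  moreover have "?L U \<longleftrightarrow> ?E U" for U
  proof -
    note fL = gd.B_GA[OF f] and fE = GA_L_E[OF gd.B_GA[OF f]]
    have T: "carrier gd.BB.T = carrier ER.BB.T" by simp
    show ?thesis
    proof (cases "U \<in> carrier gd.BB.T")
      case True
      then have U: "U \<in> carrier ER.BB.T" unfolding T .
      show ?thesis
        using gd.canonical_eq_comul_iff[OF True fL] ER.canonical_eq_comul_iff[OF U fE] coord_E_L[OF _ _ True] True U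
        by simp
    next
      case False
      then show ?thesis unfolding T by simp
    qed
  qed
  ultimately show ?thesis by simp
qed

lemma hopf_iso_transfer:
  assumes \<theta>: "\<theta> \<in> hopf_iso (E\<lparr>carrier := K\<rparr>) H GP"
  shows "\<theta> \<in> hopf_iso (E\<lparr>carrier := K\<rparr>) H gd.B"
proof -
  note t = hopf_isoD[OF \<theta>]
  have c: "\<theta> x \<in> carrier gd.B" if "x \<in> carrier H" for x
    using lin_maps_closed[OF t(2) that] unfolding GP_carrier .
  note r = ring_hom_memE[OF t(1)]
  have "\<theta> \<in> ring_hom H gd.B"
  proof (rule ring_hom_memI)
    show "\<theta> \<one>\<^bsub>H\<^esub> = \<one>\<^bsub>gd.B\<^esub>" using r(4) unfolding GP_one .
    fix x y assume "x \<in> carrier H" "y \<in> carrier H"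
    then show "\<theta> (x \<otimes>\<^bsub>H\<^esub> y) = \<theta> x \<otimes>\<^bsub>gd.B\<^esub> \<theta> y" "\<theta> (x \<oplus>\<^bsub>H\<^esub> y) = \<theta> x \<oplus>\<^bsub>gd.B\<^esub> \<theta> y"
      using r(2,3) GP_mult c unfolding GP_add by auto
  qed (rule c)
  moreover have "\<theta> \<in> lin_maps (E\<lparr>carrier := K\<rparr>) H gd.B"
    using t(2) by (simp only: lin_maps_def GP_carrier GP_add GP_smult)
  moreover have "tensor_map (E\<lparr>carrier := K\<rparr>) H H GP GP \<theta> \<theta> = tensor_map (E\<lparr>carrier := K\<rparr>) H H gd.B gd.B \<theta> \<theta>"
    unfolding tensor_map_def
    by (simp only: tensor_cong(1,2)[OF GP_carrier GP_add GP_smult GP_carrier GP_add GP_smult])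
  ultimately show ?thesis
    using t(3-6) c GP_comul GP_counit GP_antipode by (simp add: hopf_iso_def alg_hom_def GP_carrier)
qed

end

theorem proposition5p3:
  fixes E :: "('e, 'm) ring_scheme" and K :: "'e set"
    and H :: "('e, 'h) hopf" and act :: "'h \<Rightarrow> 'e \<Rightarrow> 'e"
    and N :: "(('e \<Rightarrow> 'e) \<Rightarrow> 'e \<Rightarrow> 'e) set"
  defines "K' \<equiv> E\<lparr>carrier := K\<rparr>"
    and "G \<equiv> galois_group E K"
    and "N' \<equiv> perm_subgroup (galois_group E K) N"
    and "\<Lambda> \<equiv> left_reg (galois_group E K) ` carrier (galois_group E K)"
    and "W \<equiv> conj_kernel (galois_group E K) N"
    and "L \<equiv> E\<lparr>carrier := fixed_field E {g \<in> carrier (galois_group E K).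
               left_reg (galois_group E K) g \<in> conj_kernel (galois_group E K) N}\<rparr>"
  assumes "number_field K'"
    and "finite_galois E K"
    and "regular_subgroup G N"
    and "\<Lambda> \<subseteq> normalizer (Perm G) N"
    and "hopf_galois_structure E K H act"
    and "corresponds_to E K H act N"
    and "perm_subgroup G \<Lambda> Mod W \<cong> AutoGroup N'"
  shows "hopf_isomorphic K' (Theta K L N' (conj_galois_action G N)) H \<and>
    hopf_isomorphic L (base_change K' L (\<lambda>x. x) H) (group_hopf L N') \<and>
    (\<forall>(L' :: ('l, 'n) ring_scheme) \<phi>.
      field L' \<and> \<phi> \<in> ring_hom K' L' \<and>
      hopf_isomorphic L' (base_change K' L' \<phi> H) (group_hopf L' N') \<longrightarrow>
      (\<exists>\<psi> \<in> ring_hom L L'. inj_on \<psi> (carrier L) \<and> (\<forall>x\<in>K. \<psi> x = \<phi> x)))"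
proof -
  interpret S: full_greither_pareigis E K N
    by (intro full_greither_pareigis.intro greither_pareigis.intro full_greither_pareigis_axioms.intro)
      (use assms in auto)
  have L: "L = S.L" by (simp add: L_def S.W_def)
  have hH: "hopf_algebra K' H"
    using assms by (simp add: hopf_galois_structure_def Let_def)
  obtain \<theta> where "\<theta> \<in> hopf_iso K' H S.GP"
    using assms by (auto simp: corresponds_to_def)
  then have \<theta>: "\<theta> \<in> hopf_iso K' H S.gd.B" unfolding K'_def by (rule S.hopf_iso_transfer)
  have K': "K' = S.L\<lparr>carrier := K\<rparr>" by (simp add: K'_def)
  have N': "N' = S.N'" by (simp add: N'_def)
  note H\<theta> = hH[unfolded K'] \<theta>[unfolded K']
  have faithful: "\<exists>n\<in>carrier S.N'. S.app g n \<noteq> n"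
    if g: "g \<in> carrier (AutoGroup S.N')" "g \<noteq> \<one>\<^bsub>AutoGroup S.N'\<^esub>" for g
  proof (rule ccontr)
    assume "\<not> ?thesis"
    then have "g = \<one>\<^bsub>AutoGroup S.N'\<^esub>"
      by (intro S.auto_eqI) (use g S.Aut.one_closed in \<open>auto simp: S.Aut_carrier S.Aut_one S.app\<close>)
    with g show False by simp
  qed
  have 1: "hopf_isomorphic K' (Theta K L N' (conj_galois_action G N)) H"
  proof -
    have "module (S.L\<lparr>carrier := K\<rparr>) S.gd.B" by (rule S.gd.module_B)
    from hopf_iso_inv_into[OF H\<theta>(2,1) this] show ?thesis
      unfolding hopf_isomorphic_def L N' K' G_def S.Theta_fixed_hopf by (rule ex_in_conv[THEN iffD1, OF exI])
  qed
  have 2: "hopf_isomorphic L (base_change K' L (\<lambda>x. x) H) (group_hopf L N')"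
    unfolding K' L N' by (rule S.gd.split_by_L[OF H\<theta>])
  have 3: "\<exists>\<psi> \<in> ring_hom L L'. inj_on \<psi> (carrier L) \<and> (\<forall>x\<in>K. \<psi> x = \<phi> x)"
    if "field L'" "\<phi> \<in> ring_hom K' L'" "hopf_isomorphic L' (base_change K' L' \<phi> H) (group_hopf L' N')"
    for L' :: "('l, 'n) ring_scheme" and \<phi>
    using that unfolding K' L N' by - (rule S.gd.L_embeds_in_splitting_field[OF H\<theta>], rule faithful, assumption+)
  from 1 2 3 show ?thesis by blast
qed



end
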